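(* Let $C$ be a connected polytopal $(d-1)$-dimensional manifold or premanifold (possibly with boundary) in locally convex position in $\mathbb{R}^d$ or $S^d$, $d\ge 3$, and assume that for every connected component $B_i$ of the boundary $\partial C$ the fattened boundary $\mathrm{fat}(B_i,C)$ is (on its own) in convex position. Then $C$ is in convex position.
   Context: Let $K$ be an abstract polytopal complex and $f$ an immersion of $K$ into $\mathbb{R}^d$ (resp. $S^d$) that is an isometry on every face, such that for every face $\sigma$ the image $f(\mathrm{St}(\sigma,K))$ is a geometric polytopal complex combinatorially equivalent to $\mathrm{St}(\sigma,K)$; $f(K)$ is a precomplex. A polytopal complex is an $m$-manifold if the star of every vertex is PL-homeomorphic to an $m$-simplex; the image of a manifold under such an $f$ is a premanifold. For a polytopal $m$-(pre)manifold $C$ and a connected component $B$ of its boundary, $\mathrm{fat}(B,C)$ is the minimal subcomplex of $C$ containing all facets of $C$ meeting $B$ in an $(m-1)$-face. A pure (pre)complex $C$ is in convex position if for every facet $\sigma$ there is a closed halfspace (resp. closed hemisphere) containing $C$ whose boundary contains the vertices of $\sigma$ and no other vertices of $C$; it is in locally convex position if the star of every vertex is in convex position. *)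

theory Defs
  imports "HOL-Analysis.Analysis"
begin

text \<open>
  Both ambient geometries are treated uniformly: Euclidean space is the whole type,
  and a sphere is the unit sphere of a Euclidean space of one dimension more.
\<close>

datatype geometry = Euclidean | Spherical

fun ambient_dim :: "geometry \<Rightarrow> 'a::euclidean_space itself \<Rightarrow> nat" where
  "ambient_dim Euclidean _ = DIM('a)"
| "ambient_dim Spherical _ = DIM('a) - 1"

fun geo_dist :: "geometry \<Rightarrow> 'a::euclidean_space \<Rightarrow> 'a \<Rightarrow> real" where
  "geo_dist Euclidean x y = dist x y"
| "geo_dist Spherical x y = arccos (x \<bullet> y)"

text \<open>
  A spherical polytope is the spherical convex hull of finitely many points of an open
  hemisphere; \<^term>\<open>sgn\<close> is the radial projection to the unit sphere.
\<close>

fun geo_polytope :: "geometry \<Rightarrow> 'a::euclidean_space set \<Rightarrow> bool" where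
  "geo_polytope Euclidean P \<longleftrightarrow> polytope P"
| "geo_polytope Spherical P \<longleftrightarrow>
     (\<exists>V u. finite V \<and> V \<subseteq> sphere 0 1 \<and> (\<forall>v\<in>V. 0 < u \<bullet> v) \<and> P = sgn ` (convex hull V))"

text \<open>
  Faces of spherical polytopes are the intersections with great subspheres bounding a
  hemisphere that contains the polytope; \<open>u = 0\<close> yields the polytope itself.
\<close>

fun geo_face :: "geometry \<Rightarrow> 'a::euclidean_space set \<Rightarrow> 'a set \<Rightarrow> bool" where
  "geo_face Euclidean F P \<longleftrightarrow> F face_of P"
| "geo_face Spherical F P \<longleftrightarrow> (\<exists>u. (\<forall>x\<in>P. 0 \<le> u \<bullet> x) \<and> F = {x \<in> P. u \<bullet> x = 0})"

fun geo_dim :: "geometry \<Rightarrow> 'a::euclidean_space set \<Rightarrow> int" where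
  "geo_dim Euclidean P = aff_dim P"
| "geo_dim Spherical P = int (dim P) - 1"

text \<open>\<open>H\<close> is a closed halfspace (hemisphere) and \<open>D\<close> its boundary.\<close>

fun closed_half :: "geometry \<Rightarrow> 'a::euclidean_space set \<Rightarrow> 'a set \<Rightarrow> bool" where
  "closed_half Euclidean H D \<longleftrightarrow>
     (\<exists>a b. a \<noteq> 0 \<and> H = {x. a \<bullet> x \<le> b} \<and> D = {x. a \<bullet> x = b})"
| "closed_half Spherical H D \<longleftrightarrow>
     (\<exists>a. a \<noteq> 0 \<and> H = {x \<in> sphere 0 1. a \<bullet> x \<le> 0} \<and> D = {x \<in> sphere 0 1. a \<bullet> x = 0})"

text \<open>
  An abstract polytopal complex is a finite collection of polytopes glued along isometries
  of faces.  The cells are the (nonempty) faces, as subsets of the glued point set \<open>'p\<close>;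
  the chart of a cell identifies it with its polytope in the space \<open>'e\<close>, and the gluing
  maps are the changes of charts.
\<close>

record ('p, 'e) pcomplex =
  cells :: "'p set set"
  chart :: "'p set \<Rightarrow> 'p \<Rightarrow> 'e"

definition polyhedron_of :: "('p, 'e) pcomplex \<Rightarrow> 'p set" where
  "polyhedron_of K = \<Union>(cells K)"

definition cell_face ::
  "geometry \<Rightarrow> ('p, 'e::euclidean_space) pcomplex \<Rightarrow> 'p set \<Rightarrow> 'p set \<Rightarrow> bool" where
  "cell_face G K F c \<longleftrightarrow> F \<noteq> {} \<and> F \<subseteq> c \<and> geo_face G (chart K c ` F) (chart K c ` c)"

definition polytopal_complex :: "geometry \<Rightarrow> ('p, 'e::euclidean_space) pcomplex \<Rightarrow> bool" where
  "polytopal_complex G K \<longleftrightarrow>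
     finite (cells K) \<and>
     (\<forall>c\<in>cells K. c \<noteq> {} \<and> inj_on (chart K c) c \<and> geo_polytope G (chart K c ` c)) \<and>
     (\<forall>c\<in>cells K. \<forall>F. cell_face G K F c \<longrightarrow>
        F \<in> cells K \<and>
        (\<forall>x\<in>F. \<forall>y\<in>F. geo_dist G (chart K F x) (chart K F y) = geo_dist G (chart K c x) (chart K c y))) \<and>
     (\<forall>c\<in>cells K. \<forall>c'\<in>cells K. c \<inter> c' \<noteq> {} \<longrightarrow>
        cell_face G K (c \<inter> c') c \<and> cell_face G K (c \<inter> c') c')"

text \<open>A geometric complex is one whose cells are themselves polytopes of the ambient space.\<close>

definition geo_complex :: "'a set set \<Rightarrow> ('a, 'a) pcomplex" where
  "geo_complex \<C> = \<lparr>cells = \<C>, chart = (\<lambda>_ x. x)\<rparr>"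

definition geometric_polytopal_complex :: "geometry \<Rightarrow> 'a::euclidean_space set set \<Rightarrow> bool" where
  "geometric_polytopal_complex G \<C> \<longleftrightarrow> polytopal_complex G (geo_complex \<C>)"

definition cell_dim :: "geometry \<Rightarrow> ('p, 'e::euclidean_space) pcomplex \<Rightarrow> 'p set \<Rightarrow> int" where
  "cell_dim G K c = geo_dim G (chart K c ` c)"

definition vertices :: "('p, 'e) pcomplex \<Rightarrow> 'p set" where
  "vertices K = {v. {v} \<in> cells K}"

definition facets :: "('p, 'e) pcomplex \<Rightarrow> 'p set set" where
  "facets K = {c \<in> cells K. \<forall>c'\<in>cells K. c \<subseteq> c' \<longrightarrow> c' = c}"

definition pure :: "geometry \<Rightarrow> ('p, 'e::euclidean_space) pcomplex \<Rightarrow> bool" where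
  "pure G K \<longleftrightarrow> (\<exists>m. \<forall>c\<in>facets K. cell_dim G K c = m)"

text \<open>
  The minimal subcomplex containing all cells in \<open>A\<close>: in a polytopal complex, a cell
  contained in another one is a face of it.
\<close>

definition generated_subcomplex :: "('p, 'e) pcomplex \<Rightarrow> 'p set set \<Rightarrow> ('p, 'e) pcomplex" where
  "generated_subcomplex K A = K\<lparr>cells := {c \<in> cells K. \<exists>c'\<in>A. c \<subseteq> c'}\<rparr>"

definition star :: "('p, 'e) pcomplex \<Rightarrow> 'p set \<Rightarrow> ('p, 'e) pcomplex" where
  "star K \<sigma> = generated_subcomplex K {c \<in> cells K. \<sigma> \<subseteq> c}"

definition combinatorially_equivalent :: "'p set set \<Rightarrow> 'q set set \<Rightarrow> bool" where
  "combinatorially_equivalent \<A> \<B> \<longleftrightarrow>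
     (\<exists>g. bij_betw g \<A> \<B> \<and> (\<forall>c\<in>\<A>. \<forall>c'\<in>\<A>. c \<subseteq> c' \<longleftrightarrow> g c \<subseteq> g c'))"

definition subdivision ::
  "geometry \<Rightarrow> ('p, 'e::euclidean_space) pcomplex \<Rightarrow> ('p, 'e) pcomplex \<Rightarrow> bool" where
  "subdivision G K' K \<longleftrightarrow>
     polytopal_complex G K' \<and> polyhedron_of K' = polyhedron_of K \<and>
     (\<forall>c'\<in>cells K'. \<exists>c\<in>cells K. c' \<subseteq> c \<and>
        (\<forall>x\<in>c'. \<forall>y\<in>c'. geo_dist G (chart K' c' x) (chart K' c' y) = geo_dist G (chart K c x) (chart K c y)))"

text \<open>
  PL homeomorphy in terms of subdivisions, which makes sense across the two geometries
  (the simplex below is Euclidean also when the star is spherical).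
\<close>

definition PL_homeomorphic ::
  "geometry \<Rightarrow> ('p, 'e::euclidean_space) pcomplex \<Rightarrow>
   geometry \<Rightarrow> ('q, 'f::euclidean_space) pcomplex \<Rightarrow> bool" where
  "PL_homeomorphic G K G' L \<longleftrightarrow>
     (\<exists>K' L'. subdivision G K' K \<and> subdivision G' L' L \<and>
        combinatorially_equivalent (cells K') (cells L'))"

definition polytopal_manifold ::
  "geometry \<Rightarrow> nat \<Rightarrow> ('p, 'e::euclidean_space) pcomplex \<Rightarrow> bool" where
  "polytopal_manifold G m K \<longleftrightarrow>
     polytopal_complex G K \<and>
     (\<forall>v\<in>vertices K. \<exists>S::'e set. (int m) simplex S \<and>
        PL_homeomorphic G (star K {v}) Euclidean (geo_complex {F. F face_of S \<and> F \<noteq> {}}))"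

text \<open>The weak topology: a set is open iff its trace on every cell is relatively open.\<close>

definition complex_topology :: "('p, 'e::topological_space) pcomplex \<Rightarrow> 'p topology" where
  "complex_topology K = topology (\<lambda>U. U \<subseteq> polyhedron_of K \<and>
     (\<forall>c\<in>cells K. \<exists>W. open W \<and> U \<inter> c = {x \<in> c. chart K c x \<in> W}))"

lemma openin_complex_topology:
  "openin (complex_topology K) U \<longleftrightarrow> U \<subseteq> polyhedron_of K \<and>
     (\<forall>c\<in>cells K. \<exists>W. open W \<and> U \<inter> c = {x \<in> c. chart K c x \<in> W})"
proof -
  let ?P = "\<lambda>U. U \<subseteq> polyhedron_of K \<and>
     (\<forall>c\<in>cells K. \<exists>W. open W \<and> U \<inter> c = {x \<in> c. chart K c x \<in> W})"
  have "istopology ?P"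
    unfolding istopology_def
  proof (intro conjI allI impI)
    fix S T assume S: "?P S" and T: "?P T"
    show "S \<inter> T \<subseteq> polyhedron_of K"
      using S[THEN conjunct1] by blast
    show "\<forall>c\<in>cells K. \<exists>W. open W \<and> (S \<inter> T) \<inter> c = {x \<in> c. chart K c x \<in> W}"
    proof
      fix c assume c: "c \<in> cells K"
      obtain V where V: "open V" "S \<inter> c = {x \<in> c. chart K c x \<in> V}" using S c by blast
      obtain W where W: "open W" "T \<inter> c = {x \<in> c. chart K c x \<in> W}" using T c by blast
      have "(S \<inter> T) \<inter> c = {x \<in> c. chart K c x \<in> V \<inter> W}" 
        using V(2) W(2) by (simp add: set_eq_iff) metis
      with V(1) W(1) show "\<exists>W. open W \<and> (S \<inter> T) \<inter> c = {x \<in> c. chart K c x \<in> W}"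
        by (intro exI[of _ "V \<inter> W"] conjI open_Int)
    qed
  next
    fix \<K> assume *: "\<forall>U\<in>\<K>. ?P U"
    show "\<Union>\<K> \<subseteq> polyhedron_of K"
      by (rule Union_least) (rule *[rule_format, THEN conjunct1])
    show "\<forall>c\<in>cells K. \<exists>W. open W \<and> \<Union>\<K> \<inter> c = {x \<in> c. chart K c x \<in> W}"
    proof
      fix c assume c: "c \<in> cells K"
      have "\<forall>U\<in>\<K>. \<exists>W. open W \<and> U \<inter> c = {x \<in> c. chart K c x \<in> W}"
        using *[rule_format, THEN conjunct2, rule_format, OF _ c] by (intro ballI)
      then obtain w where w: "\<forall>U\<in>\<K>. open (w U) \<and> U \<inter> c = {x \<in> c. chart K c x \<in> w U}"
        by (rule bchoice[THEN exE])
      have "\<Union>\<K> \<inter> c = (\<Union>U\<in>\<K>. U \<inter> c)" by blast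
      also have "\<dots> = (\<Union>U\<in>\<K>. {x \<in> c. chart K c x \<in> w U})" using w by simp
      also have "\<dots> = {x \<in> c. chart K c x \<in> (\<Union>U\<in>\<K>. w U)}" by blast
      finally have "\<Union>\<K> \<inter> c = {x \<in> c. chart K c x \<in> (\<Union>U\<in>\<K>. w U)}" .
      moreover have "open (\<Union>U\<in>\<K>. w U)" using w by (intro open_UN ballI) simp
      ultimately show "\<exists>W. open W \<and> \<Union>\<K> \<inter> c = {x \<in> c. chart K c x \<in> W}"
        by (intro exI[of _ "\<Union>U\<in>\<K>. w U"] conjI)
    qed
  qed
  then show ?thesis unfolding complex_topology_def by (simp only: topology_inverse')
qed

definition immersion ::
  "('p, 'e::euclidean_space) pcomplex \<Rightarrow> ('p \<Rightarrow> 'a::euclidean_space) \<Rightarrow> bool" where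
  "immersion K f \<longleftrightarrow>
     continuous_map (complex_topology K) euclidean f \<and>
     (\<forall>x\<in>polyhedron_of K. \<exists>U. openin (complex_topology K) U \<and> x \<in> U \<and> inj_on f U)"

text \<open>
  A precomplex \<open>f(K)\<close> is represented by the pair of \<open>K\<close> and \<open>f\<close>; its faces and vertices
  are those of \<open>K\<close>, so that distinct faces of \<open>K\<close> with overlapping images stay distinct.
\<close>

definition precomplex ::
  "geometry \<Rightarrow> ('p, 'e::euclidean_space) pcomplex \<Rightarrow> ('p \<Rightarrow> 'a::euclidean_space) \<Rightarrow> bool" where
  "precomplex G K f \<longleftrightarrow>
     polytopal_complex G K \<and> immersion K f \<and>
     (\<forall>c\<in>cells K. \<forall>x\<in>c. \<forall>y\<in>c. geo_dist G (f x) (f y) = geo_dist G (chart K c x) (chart K c y)) \<and>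
     (\<forall>\<sigma>\<in>cells K.
        geometric_polytopal_complex G ((`) f ` cells (star K \<sigma>)) \<and>
        combinatorially_equivalent (cells (star K \<sigma>)) ((`) f ` cells (star K \<sigma>)))"

definition premanifold ::
  "geometry \<Rightarrow> nat \<Rightarrow> ('p, 'e::euclidean_space) pcomplex \<Rightarrow> ('p \<Rightarrow> 'a::euclidean_space) \<Rightarrow> bool" where
  "premanifold G m K f \<longleftrightarrow> polytopal_manifold G m K \<and> precomplex G K f"

definition boundary_complex ::
  "geometry \<Rightarrow> nat \<Rightarrow> ('p, 'e::euclidean_space) pcomplex \<Rightarrow> ('p, 'e) pcomplex" where
  "boundary_complex G m K = generated_subcomplex K
     {e \<in> cells K. cell_dim G K e = int m - 1 \<and> (\<exists>!c. c \<in> facets K \<and> e \<subseteq> c)}"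

definition boundary_components ::
  "geometry \<Rightarrow> nat \<Rightarrow> ('p, 'e::euclidean_space) pcomplex \<Rightarrow> ('p, 'e) pcomplex set" where
  "boundary_components G m K =
     {K\<lparr>cells := {c \<in> cells (boundary_complex G m K). c \<subseteq> S}\<rparr> | S.
        S \<in> connected_components_of (complex_topology (boundary_complex G m K))}"

definition fat ::
  "geometry \<Rightarrow> nat \<Rightarrow> ('p, 'e::euclidean_space) pcomplex \<Rightarrow> ('p, 'e) pcomplex \<Rightarrow> ('p, 'e) pcomplex" where
  "fat G m B K = generated_subcomplex K
     {c \<in> facets K. \<exists>e\<in>cells B. cell_dim G K e = int m - 1 \<and> e \<subseteq> c}"

definition convex_position ::
  "geometry \<Rightarrow> ('p, 'e::euclidean_space) pcomplex \<Rightarrow> ('p \<Rightarrow> 'a::euclidean_space) \<Rightarrow> bool" where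
  "convex_position G K f \<longleftrightarrow>
     pure G K \<and>
     (\<forall>\<sigma>\<in>facets K. \<exists>H D. closed_half G H D \<and> f ` polyhedron_of K \<subseteq> H \<and>
        (\<forall>v\<in>vertices K. f v \<in> D \<longleftrightarrow> v \<in> \<sigma>))"

definition locally_convex_position ::
  "geometry \<Rightarrow> ('p, 'e::euclidean_space) pcomplex \<Rightarrow> ('p \<Rightarrow> 'a::euclidean_space) \<Rightarrow> bool" where
  "locally_convex_position G K f \<longleftrightarrow> (\<forall>v\<in>vertices K. convex_position G (star K {v}) f)"

text \<open>Geometric complexes (and manifolds) are the precomplexes (premanifolds) with \<open>f\<close> the inclusion.\<close>

lemma geometric_complex_star:
  assumes "polytopal_complex G (geo_complex \<C>)"
  shows "polytopal_complex G (star (geo_complex \<C>) \<sigma>)"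
proof -
  let ?K = "geo_complex \<C>" and ?S = "star (geo_complex \<C>) \<sigma>"
  have face: "cell_face G ?S F c \<longleftrightarrow> cell_face G ?K F c" for F c
    by (simp add: cell_face_def star_def generated_subcomplex_def geo_complex_def)
  have chart: "chart ?S = (\<lambda>_ x. x)" "chart ?K = (\<lambda>_ x. x)"
    by (simp_all add: star_def generated_subcomplex_def geo_complex_def)
  have sub: "cells ?S \<subseteq> cells ?K"
    by (auto simp: star_def generated_subcomplex_def)
  have down: "F \<in> cells ?S" if F: "F \<in> cells ?K" "F \<subseteq> c" "c \<in> cells ?S" for F c
  proof -
    obtain c' where "c' \<in> cells ?K" "\<sigma> \<subseteq> c'" "c \<subseteq> c'"
      using F(3) by (auto simp: star_def generated_subcomplex_def)
    moreover from this(3) F(2) have "F \<subseteq> c'" by (rule order_trans[rotated])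
    ultimately show ?thesis
      using F(1) by (auto simp: star_def generated_subcomplex_def)
  qed
  note P = assms[unfolded polytopal_complex_def chart]
  note K = P[THEN conjunct1]
    P[THEN conjunct2, THEN conjunct1, rule_format]
    P[THEN conjunct2, THEN conjunct2, THEN conjunct1, rule_format, THEN conjunct1]
    P[THEN conjunct2, THEN conjunct2, THEN conjunct2, rule_format]
  show ?thesis
    unfolding polytopal_complex_def face chart
  proof (intro conjI ballI allI impI)
    show "finite (cells ?S)" using K(1) sub finite_subset by blast
  next
    fix c F assume c: "c \<in> cells ?S" and F: "cell_face G ?K F c"
    have "F \<in> cells ?K" using c sub by (intro K(3)[OF _ F]) blast
    moreover have "F \<subseteq> c" using F by (simp add: cell_face_def)
    ultimately show "F \<in> cells ?S" using c by (rule down)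
  next
    fix c assume "c \<in> cells ?S"
    then have c: "c \<in> cells ?K" using sub by blast
    show "c \<noteq> {}" "inj_on (\<lambda>x. x) c" "geo_polytope G ((\<lambda>x. x) ` c)"
      using K(2)[OF c] by simp_all
  next
    fix c c' assume "c \<in> cells ?S" "c' \<in> cells ?S" and ne: "c \<inter> c' \<noteq> {}"
    then have "c \<in> cells ?K" "c' \<in> cells ?K" using sub by blast+
    from K(4)[OF this ne]
    show "cell_face G ?K (c \<inter> c') c" "cell_face G ?K (c \<inter> c') c'" by blast+
  qed simp
qed

lemma geometric_precomplex:
  assumes "geometric_polytopal_complex G \<C>"
  shows "precomplex G (geo_complex \<C>) (\<lambda>x. x)"
proof -
  let ?K = "geo_complex \<C>"
  have K: "polytopal_complex G ?K"
    using assms by (simp add: geometric_polytopal_complex_def)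
  have chart: "chart ?K = (\<lambda>_ x. x)"
    by (simp add: geo_complex_def)
  have open_K: "openin (complex_topology ?K) (polyhedron_of ?K)"
    unfolding openin_complex_topology
  proof (intro conjI ballI)
    fix c assume "c \<in> cells ?K"
    then have "polyhedron_of ?K \<inter> c = {x \<in> c. chart ?K c x \<in> UNIV}"
      by (auto simp: polyhedron_of_def)
    then show "\<exists>W. open W \<and> polyhedron_of ?K \<inter> c = {x \<in> c. chart ?K c x \<in> W}"
      by (intro exI[of _ UNIV] conjI open_UNIV)
  qed simp
  have top: "topspace (complex_topology ?K) = polyhedron_of ?K"
  proof
    show "topspace (complex_topology ?K) \<subseteq> polyhedron_of ?K"
      using openin_topspace[of "complex_topology ?K"] unfolding openin_complex_topology by blast
    show "polyhedron_of ?K \<subseteq> topspace (complex_topology ?K)"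
      using open_K by (rule openin_subset)
  qed
  have "continuous_map (complex_topology ?K) euclidean (\<lambda>x. x)"
    unfolding continuous_map_def top
  proof (intro conjI allI impI)
    fix U :: "'a set" assume "openin euclidean U"
    then have U: "open U" by simp
    show "openin (complex_topology ?K) {x \<in> polyhedron_of ?K. x \<in> U}"
      unfolding openin_complex_topology
    proof (intro conjI ballI)
      fix c assume "c \<in> cells ?K"
      then have "{x \<in> polyhedron_of ?K. x \<in> U} \<inter> c = {x \<in> c. chart ?K c x \<in> U}"
        by (auto simp: polyhedron_of_def chart)
      with U show "\<exists>W. open W \<and> {x \<in> polyhedron_of ?K. x \<in> U} \<inter> c = {x \<in> c. chart ?K c x \<in> W}"
        by (intro exI[of _ U] conjI)
    qed blast
  qed simp
  with open_K have "immersion ?K (\<lambda>x. x)"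
    unfolding immersion_def by (intro conjI ballI exI[of _ "polyhedron_of ?K"]) simp_all
  moreover have "geometric_polytopal_complex G (cells (star ?K \<sigma>))" for \<sigma>
  proof -
    have "geo_complex (cells (star ?K \<sigma>)) = star ?K \<sigma>"
      by (simp add: geo_complex_def star_def generated_subcomplex_def)
    then show ?thesis
      using geometric_complex_star[OF K] by (simp add: geometric_polytopal_complex_def)
  qed
  moreover have "combinatorially_equivalent A A" for A :: "'a set set"
    unfolding combinatorially_equivalent_def by (rule exI[of _ id]) auto
  ultimately show ?thesis
    using K unfolding precomplex_def chart by simp
qed

lemma geometric_premanifold:
  assumes "polytopal_manifold G m (geo_complex \<C>)"
  shows "premanifold G m (geo_complex \<C>) (\<lambda>x. x)"
  using assms geometric_precomplex
  by (auto simp: premanifold_def polytopal_manifold_def geometric_polytopal_complex_def)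

end

theory Submission
  imports Defs
begin

text \<open>
  In both geometries, cells become pointed polyhedral cones in a Euclidean space of dimension
  \<open>d + 1\<close>, and supporting halfspaces become linear functionals, the outer normals of the facets.

  For a closed complex, consider the graph whose nodes are the facets and whose edges are the
  ridges.  For a direction \<open>u\<close>, local convexity implies that moving \<open>u\<close> through a hyperplane
  orthogonal to a normal does not change how the nodes whose normals are positive on \<open>u\<close> are connected.
  A facet all of whose neighbours are negative on \<open>u\<close> is therefore the only positive one: taking for
  \<open>u\<close> a point just beyond that facet shows that every local supporting hyperplane is a global one.

  A boundary component is capped off by the boundary of the convex hull of its fattening.  Instead
  of cutting that boundary along the component and keeping one side, which would need a separation
  theorem, infinitely many copies of it are stacked: crossing the component outwards leads one level
  up.  The nodes are then infinite in number, but there are only finitely many normals, which is all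
  the graph argument uses.  That the facets around a face are connected through ridges is read off
  a subdivision of the simplex, by joining points in general position by segments.
\<close>

section \<open>Graphs of normal vectors\<close>

text \<open>The difficulty is that \<open>f\<close> is only an immersion: cells that are far apart
  may a priori have overlapping images, so a vertex must be tracked as a point of the complex and
  not through its image. Two further obstacles shape the proof. First, a facet may be alone in the
  star of a vertex, and then both signs of its normal pass the local test; one sign has to be
  carried consistently over the whole facet and to the boundary components that it touches. Second,
  even with levels something remains of separation, but it is local: around a single boundary face
  of codimension two the facets of the cap form an inner and an outer arc, and these are told apart
  by the plane through the two boundary ridges there. The bound on \<open>d\<close> enters through
  the faces of codimension two of the manifold: their cones have positive dimension, so each of them
  contains a vertex, and convexity of the star of that vertex controls the turn around the
  face.\<close>

lemma avoid_hyperplanes: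
  fixes Z :: "'w::euclidean_space set"
  assumes "finite Z" "0 \<notin> Z" "open O'" "O' \<noteq> {}"
  shows "\<exists>u\<in>O'. \<forall>z\<in>Z. u \<bullet> z \<noteq> 0"
  using assms
proof (induction Z arbitrary: O' rule: finite_induct)
  case (insert z Z)
  obtain x where x: "x \<in> O'" using insert.prems by blast
  obtain r where r: "r > 0" "ball x r \<subseteq> O'" using insert.prems(2) x open_contains_ball by blast
  have z0: "z \<noteq> 0" using insert.prems by auto
  have "\<exists>y\<in>O'. y \<bullet> z \<noteq> 0"
  proof (cases "x \<bullet> z = 0")
    case True
    define y where "y = x + (r / (2 * norm z)) *\<^sub>R z"
    have "dist x y = r/2" using z0 r by (simp add: y_def dist_norm)
    then have "y \<in> O'" using r by auto
    moreover have "y \<bullet> z \<noteq> 0" using True z0 r by (simp add: y_def inner_add_left)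
    ultimately show ?thesis by blast
  qed (use x in blast)
  then have "O' \<inter> {u. u \<bullet> z \<noteq> 0} \<noteq> {}" by blast
  moreover have "open (O' \<inter> {u. u \<bullet> z \<noteq> 0})"
  proof -
    have "open {u. u \<bullet> z \<noteq> 0}" by (intro open_Collect_neq continuous_intros)
    then show ?thesis using insert.prems(2) by (rule open_Int[rotated])
  qed
  ultimately obtain u where "u \<in> O' \<inter> {u. u \<bullet> z \<noteq> 0}" "\<forall>z\<in>Z. u \<bullet> z \<noteq> 0"
    using insert.IH[of "O' \<inter> {u. u \<bullet> z \<noteq> 0}"] insert.prems by blast
  then show ?case by blast
qed auto

definition pos_nodes :: "'s set \<Rightarrow> ('s \<Rightarrow> 'w::euclidean_space) \<Rightarrow> 'w \<Rightarrow> 's set" where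
  "pos_nodes S n u = {x \<in> S. 0 < u \<bullet> n x}"

text \<open>The closure is reflexive: \<open>pos_conn S E n u a a\<close> holds also when
  \<open>a\<close> is not positive on \<open>u\<close>, so positivity of the end points is stated
  separately wherever it matters.\<close>

definition pos_conn ::
  "'s set \<Rightarrow> ('s \<Rightarrow> 's \<Rightarrow> bool) \<Rightarrow> ('s \<Rightarrow> 'w::euclidean_space) \<Rightarrow> 'w \<Rightarrow> 's \<Rightarrow> 's \<Rightarrow> bool" where
  "pos_conn S E n u a b \<longleftrightarrow>
     (a, b) \<in> {(x, y). x \<in> pos_nodes S n u \<and> y \<in> pos_nodes S n u \<and> E x y}\<^sup>*"

lemma pos_conn_mono:
  assumes "pos_nodes S n u \<subseteq> pos_nodes S n u'" "pos_conn S E n u a b"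
  shows "pos_conn S E n u' a b"
  using assms(2) unfolding pos_conn_def
  by (rule rtrancl_mono[THEN subsetD, rotated]) (use assms(1) in blast)

lemma pos_conn_trans:
  "pos_conn S E n u a b \<Longrightarrow> pos_conn S E n u b c \<Longrightarrow> pos_conn S E n u a c"
  unfolding pos_conn_def by (rule rtrancl_trans)

text \<open>\<open>upper\<close> is local convexity in the form used here: when \<open>u\<close>
  lies on the hyperplane of \<open>x\<close>, the neighbours of \<open>x\<close> that are positive
  on \<open>u\<close> are connected without \<open>x\<close>. With \<open>adj_indep\<close> it lets
  a path be rerouted around any node that is lost as \<open>u\<close> reaches a hyperplane.\<close>

locale normal_graph =
  fixes S :: "'s set" and E :: "'s \<Rightarrow> 's \<Rightarrow> bool" and n :: "'s \<Rightarrow> 'w::euclidean_space"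
  assumes fin: "finite (n ` S)"
    and adj_in: "E x y \<Longrightarrow> x \<in> S \<and> y \<in> S"
    and adj_sym: "E x y \<Longrightarrow> E y x"
    and adj_indep: "E x y \<Longrightarrow> n y \<notin> span {n x}"
    and upper: "\<lbrakk>E x y; E x z; u \<bullet> n x = 0; 0 < u \<bullet> n y; 0 < u \<bullet> n z\<rbrakk> \<Longrightarrow> pos_conn S E n u y z"
    and nonzero: "x \<in> S \<Longrightarrow> n x \<noteq> 0"
begin

abbreviation "P \<equiv> pos_nodes S n"
abbreviation "conn \<equiv> pos_conn S E n"

lemma conn_sym: "conn u a b \<Longrightarrow> conn u b a"
proof -
  assume "conn u a b"
  moreover have "sym {(x, y). x \<in> P u \<and> y \<in> P u \<and> E x y}"
    by (auto intro: symI adj_sym)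
  ultimately show ?thesis unfolding pos_conn_def by (rule symD[OF sym_rtrancl, rotated])
qed

text \<open>A path may use nodes that are positive on \<open>u\<close> but orthogonal to
  \<open>u'\<close>. Their normals are parallel, so no two of them are adjacent: the path enters and
  leaves each one through nodes that survive, and \<open>upper\<close> joins these two.\<close>

lemma conn_drop:
  assumes sub: "P u' \<subseteq> P u" and drop: "\<And>x. x \<in> P u - P u' \<Longrightarrow> u' \<bullet> n x = 0"
    and line: "\<And>x y. x \<in> P u - P u' \<Longrightarrow> y \<in> P u - P u' \<Longrightarrow> n y \<in> span {n x}"
    and a: "a \<in> P u'" and c: "c \<in> P u'" and conn: "conn u a c"
  shows "conn u' a c"
proof -
  \<comment> \<open>At a lost node the invariant speaks of all its surviving neighbours, since one
    of them is the next node of the path.\<close>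
  have "(c \<in> P u' \<longrightarrow> conn u' a c) \<and> (c \<in> P u - P u' \<longrightarrow> (\<forall>d. E c d \<and> d \<in> P u' \<longrightarrow> conn u' a d))"
    using conn unfolding pos_conn_def[of S E n u]
  proof (induction rule: rtrancl_induct)
    case base
    then show ?case using a by (auto simp: pos_conn_def)
  next
    case (step y z)
    have yz: "y \<in> P u" "z \<in> P u" "E y z" using step.hyps by auto
    have single: "conn u' x x'" if "x \<in> P u'" "x' \<in> P u'" "E x x'" for x x'
      using that unfolding pos_conn_def by (intro r_into_rtrancl) simp
    show ?case
    proof (cases "y \<in> P u'")
      case True
      then have ay: "conn u' a y" using step.IH by simp
      show ?thesis
      proof (cases "z \<in> P u'")
        case True
        then show ?thesis using pos_conn_trans[OF ay single[OF \<open>y \<in> P u'\<close> True yz(3)]] by simp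
      next
        case False
        have "conn u' a d" if d: "E z d" "d \<in> P u'" for d
        proof -
          have "conn u' y d"
          proof (rule upper[of z])
            show "E z y" using yz(3) adj_sym by blast
            show "u' \<bullet> n z = 0" using drop False yz by blast
            show "0 < u' \<bullet> n y" "0 < u' \<bullet> n d" using True d by (auto simp: pos_nodes_def)
          qed (fact d)
          then show ?thesis by (rule pos_conn_trans[OF ay])
        qed
        then show ?thesis using False by simp
      qed
    next
      case False
      then have "z \<in> P u'" using line[of y z] adj_indep[OF yz(3)] yz by blast
      then show ?thesis using step.IH False yz by simp
    qed
  qed
  then show ?thesis using c by simp
qed

lemma independent_functional:
  assumes "(p::'w) \<notin> span {y, z}" "z \<notin> span {y}" "y \<noteq> 0"
  shows "\<exists>u. u \<bullet> p > 0 \<and> u \<bullet> y > 0 \<and> u \<bullet> z > 0"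
proof -
  have "independent {y}" using assms(3) by simp
  from independent_insertI[OF assms(2) this] have "independent {y, z}" by (subst insert_commute)
  from independent_insertI[OF assms(1) this] have ind: "independent {p, y, z}" .
  from linear_independent_extend[OF ind, of "\<lambda>_. 1::real"]
  obtain g :: "'w \<Rightarrow> real" where g: "linear g" "\<forall>x\<in>{p,y,z}. g x = 1" by blast
  define u where "u = adjoint g 1"
  have "u \<bullet> x = g x" for x
    using adjoint_works[OF g(1), of x 1] by (simp add: u_def inner_commute)
  then show ?thesis using g(2) by (intro exI[of _ u]) simp
qed

definition "generic u \<longleftrightarrow> (\<forall>x\<in>S. u \<bullet> n x \<noteq> 0)"

lemma perturb:
  assumes "finite Z" "0 \<notin> Z" "finite Y"
  obtains u' where "generic u'" "\<And>z. z \<in> Z \<Longrightarrow> u' \<bullet> z \<noteq> 0" "\<And>z. z \<in> Y \<Longrightarrow> 0 < u \<bullet> z \<Longrightarrow> 0 < u' \<bullet> z"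
    "\<And>x. x \<in> S \<Longrightarrow> 0 < u \<bullet> n x \<Longrightarrow> 0 < u' \<bullet> n x" "\<And>x. x \<in> S \<Longrightarrow> 0 > u \<bullet> n x \<Longrightarrow> 0 > u' \<bullet> n x"
proof -
  define A B where "A = {z\<in>Y \<union> n ` S. 0 < u \<bullet> z}" and "B = {z\<in>n ` S. 0 > u \<bullet> z}"
  have AB: "finite A" "finite B" using assms(3) fin by (auto simp: A_def B_def)
  define Q where "Q = (\<Inter>z\<in>A. {v. 0 < v \<bullet> z}) \<inter> (\<Inter>z\<in>B. {v. 0 > v \<bullet> z})"
  have "open {v. 0 < v \<bullet> z}" "open {v. 0 > v \<bullet> z}" for z :: 'w
    by (intro open_Collect_less continuous_intros)+
  then have "open Q" unfolding Q_def using AB by (intro open_Int open_INT) auto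
  moreover have "u \<in> Q" by (auto simp: Q_def A_def B_def)
  moreover have "0 \<notin> Z \<union> n ` S" using assms(2) nonzero by force
  ultimately obtain u' where u': "u' \<in> Q" "\<forall>z\<in>Z \<union> n ` S. u' \<bullet> z \<noteq> 0"
    using avoid_hyperplanes[of "Z \<union> n ` S" Q] assms(1) fin by (metis emptyE finite_UnI)
  show ?thesis
  proof (rule that[of u'])
    show "generic u'" using u'(2) by (simp add: generic_def)
    show "u' \<bullet> z \<noteq> 0" if "z \<in> Z" for z using that u'(2) by simp
    show "0 < u' \<bullet> z" if "z \<in> Y" "0 < u \<bullet> z" for z using that u'(1) by (simp add: Q_def A_def)
    show "0 < u' \<bullet> n x" if "x \<in> S" "0 < u \<bullet> n x" for x using that u'(1) by (simp add: Q_def A_def)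
    show "0 > u' \<bullet> n x" if "x \<in> S" "0 > u \<bullet> n x" for x using that u'(1) by (simp add: Q_def B_def)
  qed
qed

text \<open>The pair \<open>p\<close>, \<open>T\<close> is a virtual node: whenever \<open>u\<close>
  is positive on \<open>p\<close>, some node of \<open>T\<close> is positive, and for generic
  \<open>u\<close> the positive nodes of \<open>T\<close> are connected to each other. Whether
  \<open>z\<close> can be reached from the virtual node does not change along a segment of
  directions positive on \<open>p\<close> and \<open>n z\<close>, because it is locally constant in
  time, even at the times where a normal vanishes.\<close>

lemma conn_transport:
  assumes T: "\<And>u. u \<bullet> p > 0 \<Longrightarrow> \<exists>t\<in>T. 0 < u \<bullet> n t" "T \<subseteq> S"
    and Tc: "\<And>u t t'. generic u \<Longrightarrow> t \<in> T \<Longrightarrow> t' \<in> T \<Longrightarrow> 0 < u \<bullet> n t \<Longrightarrow> 0 < u \<bullet> n t' \<Longrightarrow> conn u t t'"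
    and z: "z \<in> S" and u0: "generic u0" "u0 \<bullet> p > 0" "u0 \<bullet> n z > 0"
    and u1: "generic u1" "u1 \<bullet> p > 0" "u1 \<bullet> n z > 0"
    and ex: "\<exists>t\<in>T. 0 < u0 \<bullet> n t \<and> conn u0 t z"
  shows "\<exists>t\<in>T. 0 < u1 \<bullet> n t \<and> conn u1 t z"
proof -
  \<comment> \<open>If the segment from \<open>u0\<close> to \<open>u2\<close> meets the hyperplanes
    of two non-parallel normals at the same time, then \<open>u2\<close> is orthogonal to one of
    these vectors.\<close>
  define Z where "Z = {(u0 \<bullet> x) *\<^sub>R y - (u0 \<bullet> y) *\<^sub>R x | x y. x \<in> n ` S \<and> y \<in> n ` S \<and> y \<notin> span {x}}"
  have "Z \<subseteq> (\<lambda>(x,y). (u0 \<bullet> x) *\<^sub>R y - (u0 \<bullet> y) *\<^sub>R x) ` (n ` S \<times> n ` S)" by (auto simp: Z_def)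
  then have "finite Z" using fin by (meson finite_SigmaI finite_imageI finite_subset)
  have "0 \<notin> Z"
  proof
    assume "0 \<in> Z"
    then obtain x y where xy: "x \<in> n ` S" "y \<in> n ` S" "y \<notin> span {x}" "(u0 \<bullet> x) *\<^sub>R y = (u0 \<bullet> y) *\<^sub>R x"
      unfolding Z_def by auto
    have "u0 \<bullet> x \<noteq> 0" using u0(1) xy by (auto simp: generic_def)
    then have "y = ((u0 \<bullet> y) / (u0 \<bullet> x)) *\<^sub>R x"
      using xy(4) by (simp add: eq_vector_fraction_iff)
    then have "y \<in> span {x}" by (metis span_base span_scale singletonI)
    then show False using xy by blast
  qed
  obtain u2 where u2: "generic u2" "\<And>z. z \<in> Z \<Longrightarrow> u2 \<bullet> z \<noteq> 0" "u2 \<bullet> p > 0"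
    "\<And>x. x \<in> S \<Longrightarrow> 0 < u1 \<bullet> n x \<Longrightarrow> 0 < u2 \<bullet> n x" "\<And>x. x \<in> S \<Longrightarrow> 0 > u1 \<bullet> n x \<Longrightarrow> 0 > u2 \<bullet> n x"
    using perturb[OF \<open>finite Z\<close> \<open>0 \<notin> Z\<close>, of "{p}" u1] u1(2) by (metis finite.emptyI finite.insertI singletonI)
  have P12: "P u2 = P u1"
  proof -
    have "0 < u2 \<bullet> n x \<longleftrightarrow> 0 < u1 \<bullet> n x" if "x \<in> S" for x
      using u1(1) u2(4,5)[OF that] that unfolding generic_def by (meson not_less_iff_gr_or_eq)
    then show ?thesis unfolding pos_nodes_def by blast
  qed
  define U where "U s = (1 - s) *\<^sub>R u0 + s *\<^sub>R u2" for s :: real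
  have Uin: "U s \<bullet> x = (1 - s) * (u0 \<bullet> x) + s * (u2 \<bullet> x)" for s x
    by (simp add: U_def inner_add_left)
  have comb: "(1 - s) * a + s * b > 0" if "s \<in> {0..1}" "a > 0" "b > 0" for a b s :: real
    using that by (cases "s = 0") (auto intro!: add_nonneg_pos mult_nonneg_nonneg mult_pos_pos)
  have Up: "U s \<bullet> p > 0" if "s \<in> {0..1}" for s using that comb u0 u2 by (simp add: Uin)
  have Uz: "U s \<bullet> n z > 0" if "s \<in> {0..1}" for s
    using that comb u0(3) u2(4)[OF z u1(3)] by (simp add: Uin)
  define Q where "Q s \<longleftrightarrow> (\<exists>t\<in>T. 0 < U s \<bullet> n t \<and> conn (U s) t z)" for s
  have zeros: "n y \<in> span {n x}" if "x \<in> S" "y \<in> S" "U s \<bullet> n x = 0" "U s \<bullet> n y = 0" for s x y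
  proof (rule ccontr)
    assume "n y \<notin> span {n x}"
    then have "(u0 \<bullet> n x) *\<^sub>R n y - (u0 \<bullet> n y) *\<^sub>R n x \<in> Z"
      unfolding Z_def using that by blast
    then have "(u0 \<bullet> n x) * (u2 \<bullet> n y) - (u0 \<bullet> n y) * (u2 \<bullet> n x) \<noteq> 0"
      using u2(2) by (fastforce simp: inner_diff_right)
    moreover have "(1 - s) * (u0 \<bullet> n x) + s * (u2 \<bullet> n x) = 0" "(1 - s) * (u0 \<bullet> n y) + s * (u2 \<bullet> n y) = 0"
      using that by (simp_all add: Uin)
    ultimately show False by algebra
  qed
  have "Q 0 = Q 1"
  proof (rule connected_local_const[of "{0..1}"])
    show "\<forall>a\<in>{0..1}. \<forall>\<^sub>F b in at a within {0..1}. Q a = Q b"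
    proof
      fix a :: real assume a: "a \<in> {0..1}"
      have "\<forall>\<^sub>F b in at a within {0..1}. \<forall>x\<in>n ` S. (U a \<bullet> x > 0 \<longrightarrow> U b \<bullet> x > 0) \<and> (U a \<bullet> x < 0 \<longrightarrow> U b \<bullet> x < 0)
          \<and> U b \<bullet> x \<noteq> 0"
      proof (rule eventually_ball_finite[OF fin], rule ballI)
        fix x assume x: "x \<in> n ` S"
        have t: "((\<lambda>b. U b \<bullet> x) \<longlongrightarrow> U a \<bullet> x) (at a within {0..1})"
          unfolding U_def by (intro tendsto_intros)
        have 1: "\<forall>\<^sub>F b in at a within {0..1}. U a \<bullet> x > 0 \<longrightarrow> U b \<bullet> x > 0"
          using order_tendstoD(1)[OF t, of 0] by (cases "U a \<bullet> x > 0") auto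
        have 2: "\<forall>\<^sub>F b in at a within {0..1}. U a \<bullet> x < 0 \<longrightarrow> U b \<bullet> x < 0"
          using order_tendstoD(2)[OF t, of 0] by (cases "U a \<bullet> x < 0") auto
        have 3: "\<forall>\<^sub>F b in at a within {0..1}. U b \<bullet> x \<noteq> 0"
        proof (cases "U a \<bullet> x = 0")
          case True
          \<comment> \<open>An affine function of time with two zeros also vanishes at time 0,
            against the genericity of \<open>u0\<close>.\<close>
          have "U b \<bullet> x \<noteq> 0" if "b \<noteq> a" for b
          proof
            assume "U b \<bullet> x = 0"
            then have "(1 - a) * (u0 \<bullet> x) + a * (u2 \<bullet> x) = 0" "(1 - b) * (u0 \<bullet> x) + b * (u2 \<bullet> x) = 0"
              using True by (simp_all add: Uin)
            then have "(a - b) * (u0 \<bullet> x) = 0" by algebra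
            then show False using that u0(1) x by (auto simp: generic_def)
          qed
          then show ?thesis by (simp add: eventually_at_filter)
        next
          case False
          then show ?thesis using 1 2 by (auto elim!: eventually_mono simp: neq_iff)
        qed
        show "\<forall>\<^sub>F b in at a within {0..1}. (U a \<bullet> x > 0 \<longrightarrow> U b \<bullet> x > 0) \<and> (U a \<bullet> x < 0 \<longrightarrow> U b \<bullet> x < 0)
          \<and> U b \<bullet> x \<noteq> 0"
          using 1 2 3 by eventually_elim auto
      qed
      moreover have "\<forall>\<^sub>F b in at a within {0..1}. b \<in> {0..1}"
        by (simp add: eventually_at_filter)
      ultimately show "\<forall>\<^sub>F b in at a within {0..1}. Q a = Q b"
      proof eventually_elim
        case (elim b)
        have sub: "P (U a) \<subseteq> P (U b)" using elim(1) by (auto simp: pos_nodes_def)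
        have drop: "U a \<bullet> n x = 0" if "x \<in> P (U b) - P (U a)" for x
        proof -
          have x: "n x \<in> n ` S" "0 < U b \<bullet> n x" "\<not> 0 < U a \<bullet> n x" using that by (auto simp: pos_nodes_def)
          then have "\<not> U a \<bullet> n x < 0" using elim(1) by (meson not_less_iff_gr_or_eq)
          then show ?thesis using x by linarith
        qed
        have gb: "generic (U b)" using elim(1) by (auto simp: generic_def)
        show "Q a = Q b"
        proof
          assume "Q a"
          then obtain t where "t \<in> T" "0 < U a \<bullet> n t" "conn (U a) t z" by (auto simp: Q_def)
          then show "Q b" unfolding Q_def
            using pos_conn_mono[OF sub] sub T(2) by (intro bexI[of _ t]) (auto simp: pos_nodes_def)
        next
          assume "Q b"
          then obtain t where t: "t \<in> T" "0 < U b \<bullet> n t" "conn (U b) t z" by (auto simp: Q_def)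
          \<comment> \<open>The node \<open>t\<close> found at time \<open>b\<close> may be lost at
            time \<open>a\<close>; \<open>t'\<close> is positive at both times, and
            \<open>Tc\<close> joins it to \<open>t\<close> at the generic time
            \<open>b\<close>.\<close>
          obtain t' where t': "t' \<in> T" "0 < U a \<bullet> n t'" using T(1) Up[OF a] by blast
          have "t' \<in> P (U a)" using t' T(2) by (auto simp: pos_nodes_def)
          then have "0 < U b \<bullet> n t'" using sub by (auto simp: pos_nodes_def)
          then have "conn (U b) t' z" by (rule pos_conn_trans[OF Tc[OF gb t'(1) t(1) _ t(2)] t(3)])
          then have "conn (U a) t' z"
          proof (rule conn_drop[OF sub _ _ \<open>t' \<in> P (U a)\<close>, rotated 3])
            show "z \<in> P (U a)" using z Uz[OF a] by (simp add: pos_nodes_def)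
            show "n y \<in> span {n x}" if "x \<in> P (U b) - P (U a)" "y \<in> P (U b) - P (U a)" for x y
              using zeros[OF _ _ drop[OF that(1)] drop[OF that(2)]] that by (auto simp: pos_nodes_def)
          qed (use drop in auto)
          then show "Q a" using t' by (auto simp: Q_def)
        qed
      qed
    qed
  qed auto
  moreover have "Q 0" using ex by (simp add: Q_def U_def)
  ultimately obtain t where t: "t \<in> T" "0 < u2 \<bullet> n t" "conn u2 t z" by (auto simp: Q_def U_def)
  then have "t \<in> P u1" using P12 T(2) by (auto simp: pos_nodes_def)
  then show ?thesis using t pos_conn_mono[of S n u2 u1] P12 by (auto simp: pos_nodes_def)
qed

lemma conn_transport_pair:
  assumes "a \<in> S" "b \<in> S" "generic u0" "generic u1" "conn u0 a b"
    "0 < u0 \<bullet> n a" "0 < u0 \<bullet> n b" "0 < u1 \<bullet> n a" "0 < u1 \<bullet> n b"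
  shows "conn u1 a b"
  using conn_transport[of "n a" "{a}" b u0 u1] assms by (auto simp: pos_conn_def)

text \<open>
  The node \<open>t\<close> is replaced by a point \<open>p\<close> in general position of the cone spanned by the normals
  of \<open>t\<close> and two of its neighbours: then \<open>p\<close> and the normals of any two adjacent nodes lie in an
  open half-space, so the connectedness relation to \<open>p\<close> propagates along edges.
\<close>

lemma isolated_node_unique:
  assumes t: "E t t1" "E t t2" "dim {n t1, n t, n t2} = 3"
    and u: "0 < u \<bullet> n t" "\<And>y. E t y \<Longrightarrow> u \<bullet> n y < 0"
    and x: "(t, x) \<in> {(a, b). E a b}\<^sup>*" "x \<noteq> t"
  shows "u \<bullet> n x \<le> 0"
proof (rule ccontr)
  assume "\<not> u \<bullet> n x \<le> 0"
  then have ux: "0 < u \<bullet> n x" by simp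
  have tS: "t \<in> S" "t1 \<in> S" "t2 \<in> S" using t adj_in by blast+
  have xS: "x \<in> S" using x tS(1) adj_in by (induction rule: rtrancl_induct) auto
  obtain u' where gu': "generic u'"
    and pos: "\<And>x. x \<in> S \<Longrightarrow> 0 < u \<bullet> n x \<Longrightarrow> 0 < u' \<bullet> n x"
    and neg: "\<And>x. x \<in> S \<Longrightarrow> 0 > u \<bullet> n x \<Longrightarrow> 0 > u' \<bullet> n x"
    using perturb[of "{}" "{}" u] by auto
  have u'x: "0 < u' \<bullet> n x" using pos xS ux by blast
  have u't: "0 < u' \<bullet> n t" using pos tS u by blast
  have u'y: "u' \<bullet> n y < 0" if "E t y" for y using neg u(2)[OF that] adj_in[OF that] by blast
  \<comment> \<open>Points of a moment curve: a plane contains them for at most two values of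
    \<open>e\<close> unless it contains all three normals.\<close>
  define p where "p e = n t + e *\<^sub>R n t1 + (e\<^sup>2) *\<^sub>R n t2" for e :: real
  have bad: "finite {e. p e \<in> span {y, z}}" for y z
  proof -
    have "\<not> {n t1, n t, n t2} \<subseteq> span {y, z}"
    proof
      assume "{n t1, n t, n t2} \<subseteq> span {y, z}"
      then have "dim {n t1, n t, n t2} \<le> dim (span {y, z})" by (rule dim_subset)
      also have "\<dots> \<le> card {y, z}" by (simp add: dim_le_card')
      also have "\<dots> \<le> 2" by (simp add: card_insert_if)
      finally show False using t(3) by simp
    qed
    then obtain a where a: "a \<in> {n t1, n t, n t2}" "a \<notin> span {y, z}" by blast
    obtain l w where lw: "l \<in> span {y, z}" "\<And>v. v \<in> span {y, z} \<Longrightarrow> orthogonal w v" "a = l + w"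
      using orthogonal_subspace_decomp_exists[of "{y, z}" a] by metis
    have "w \<noteq> 0" using lw a by auto
    moreover have "w \<bullet> l = 0" using lw by (auto simp: orthogonal_def)
    ultimately have wa: "w \<bullet> a \<noteq> 0" using lw(3) by (simp add: inner_add_right)
    have "finite {e. poly [:w \<bullet> n t, w \<bullet> n t1, w \<bullet> n t2:] e = 0}"
      by (rule poly_roots_finite) (use a wa in auto)
    moreover have "{e. p e \<in> span {y, z}} \<subseteq> {e. poly [:w \<bullet> n t, w \<bullet> n t1, w \<bullet> n t2:] e = 0}"
    proof clarify
      fix e assume "p e \<in> span {y, z}"
      then have "w \<bullet> p e = 0" using lw(2) by (auto simp: orthogonal_def)
      then show "poly [:w \<bullet> n t, w \<bullet> n t1, w \<bullet> n t2:] e = 0"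
        by (simp add: p_def inner_add_right power2_eq_square algebra_simps)
    qed
    ultimately show ?thesis by (rule finite_subset[rotated])
  qed
  define Bad where "Bad = (\<Union>(y,z)\<in>n ` S \<times> n ` S. {e. p e \<in> span {y, z}})"
  have "finite Bad" unfolding Bad_def using fin bad by auto
  have "((\<lambda>e. u' \<bullet> p e) \<longlongrightarrow> u' \<bullet> p 0) (at_right 0)"
    unfolding p_def by (intro tendsto_intros)
  then have "\<forall>\<^sub>F e in at_right 0. u' \<bullet> p e > 0"
    using u't by (intro order_tendstoD) (auto simp: p_def)
  then obtain d where d: "d > 0" "\<And>e. 0 < e \<Longrightarrow> e < d \<Longrightarrow> u' \<bullet> p e > 0"
    unfolding eventually_at_right_field by auto
  have "infinite {0<..<d}" using d(1) by simp
  then obtain e where e: "0 < e" "e < d" "e \<notin> Bad"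
    using \<open>finite Bad\<close> by (metis finite_subset greaterThanLessThan_iff subsetI)
  define q where "q = p e"
  have q: "q \<notin> span {n y, n z}" if "y \<in> S" "z \<in> S" for y z
    using e(3) that by (auto simp: Bad_def q_def)
  define T where "T = {t1, t, t2}"
  have TS: "T \<subseteq> S" using tS by (auto simp: T_def)
  have T1: "\<exists>t\<in>T. 0 < v \<bullet> n t" if "0 < v \<bullet> q" for v
  proof (rule ccontr)
    assume "\<not> ?thesis"
    then have "v \<bullet> n t \<le> 0" "e * (v \<bullet> n t1) \<le> 0" "e\<^sup>2 * (v \<bullet> n t2) \<le> 0"
      using e by (auto simp: T_def not_less mult_le_0_iff)
    then show False using that by (simp add: q_def p_def inner_add_right)
  qed
  \<comment> \<open>The three normals are independent, so some generic direction \<open>v1\<close>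
    is positive on all of \<open>T\<close>, where \<open>t1\<close> and \<open>t2\<close> are joined
    through \<open>t\<close>; \<open>conn_transport_pair\<close> carries this to
    \<open>v\<close>.\<close>
  have T2: "conn v a b" if v: "generic v" and ab: "a \<in> T" "b \<in> T" "0 < v \<bullet> n a" "0 < v \<bullet> n b" for v a b
  proof -
    have "n t1 \<notin> span {n t, n t2}"
    proof
      assume "n t1 \<in> span {n t, n t2}"
      then have "span {n t1, n t, n t2} = span {n t, n t2}" by (rule span_redundant)
      then have "dim {n t1, n t, n t2} = dim {n t, n t2}" by (metis dim_span)
      also have "\<dots> \<le> card {n t, n t2}" by (simp add: dim_le_card')
      also have "\<dots> \<le> 2" by (simp add: card_insert_if)
      finally show False using t(3) by simp
    qed
    then obtain v0 where "v0 \<bullet> n t1 > 0" "v0 \<bullet> n t > 0" "v0 \<bullet> n t2 > 0"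
      using independent_functional[of "n t1" "n t" "n t2"] adj_indep[OF t(2)] nonzero tS by blast
    then obtain v1 where v1: "generic v1" "v1 \<bullet> n t1 > 0" "v1 \<bullet> n t > 0" "v1 \<bullet> n t2 > 0"
      using perturb[of "{}" "{}" v0] tS by (metis emptyE finite.emptyI)
    have step: "conn v1 a b" if "E a b" "0 < v1 \<bullet> n a" "0 < v1 \<bullet> n b" for a b
      using that adj_in[OF that(1)] unfolding pos_conn_def
      by (intro r_into_rtrancl) (simp add: pos_nodes_def)
    have ct: "conn v1 t c" if "c \<in> T" for c
      using that v1 t step by (auto simp: T_def pos_conn_def)
    have "conn v1 a b" using pos_conn_trans[OF conn_sym[OF ct[OF ab(1)]] ct[OF ab(2)]] .
    then show ?thesis
      using conn_transport_pair[OF _ _ v1(1) v] ab TS v1 unfolding T_def by auto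
  qed
  \<comment> \<open>Quantifying over all generic \<open>v\<close> makes the induction work: for an
    edge from \<open>y\<close> to \<open>z\<close> one passes to a direction positive on
    \<open>q\<close>, \<open>n y\<close> and \<open>n z\<close> at once, uses the edge there and
    returns by \<open>conn_transport\<close>.\<close>
  have "\<forall>v. generic v \<and> 0 < v \<bullet> q \<and> 0 < v \<bullet> n x \<longrightarrow> (\<exists>s\<in>T. 0 < v \<bullet> n s \<and> conn v s x)"
    using x(1)
  proof (induction rule: rtrancl_induct)
    case base
    show ?case by (auto simp: T_def pos_conn_def)
  next
    case (step y z)
    have yz: "E y z" "y \<in> S" "z \<in> S" using step.hyps adj_in by auto
    show ?case
    proof (intro allI impI)
      fix v assume v: "generic v \<and> 0 < v \<bullet> q \<and> 0 < v \<bullet> n z"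
      obtain v0 where v0: "v0 \<bullet> q > 0" "v0 \<bullet> n y > 0" "v0 \<bullet> n z > 0"
        using independent_functional[OF q[OF yz(2,3)] adj_indep[OF yz(1)] nonzero[OF yz(2)]] by blast
      then obtain v1 where v1: "generic v1" "v1 \<bullet> q > 0" "v1 \<bullet> n y > 0" "v1 \<bullet> n z > 0"
        using perturb[of "{}" "{q}" v0] yz by (metis emptyE finite.emptyI finite.insertI singletonI)
      then obtain s where s: "s \<in> T" "0 < v1 \<bullet> n s" "conn v1 s y" using step.IH by auto
      have "conn v1 y z" using yz v1 unfolding pos_conn_def
        by (intro r_into_rtrancl) (simp add: pos_nodes_def)
      then have ex: "\<exists>s\<in>T. 0 < v1 \<bullet> n s \<and> conn v1 s z" using s pos_conn_trans[OF s(3)] by auto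
      show "\<exists>s\<in>T. 0 < v \<bullet> n s \<and> conn v s z"
        by (rule conn_transport[OF T1 TS T2 yz(3) v1(1,2,4) _ _ _ ex]) (use v in auto)
    qed
  qed
  then obtain s where s: "s \<in> T" "0 < u' \<bullet> n s" "conn u' s x"
    using gu' d(2)[OF e(1,2)] u'x by (auto simp: q_def)
  \<comment> \<open>In direction \<open>u'\<close> the nodes \<open>t1\<close> and \<open>t2\<close>
    are negative, so the virtual node reduces to \<open>t\<close>, and a path from \<open>t\<close>
    would have to start with a positive neighbour of \<open>t\<close>.\<close>
  have "s = t" using s(1,2) u'y[OF t(1)] u'y[OF t(2)] by (auto simp: T_def)
  with s(3) have "(t, x) \<in> {(x, y). x \<in> P u' \<and> y \<in> P u' \<and> E x y}\<^sup>*" by (simp add: pos_conn_def)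
  then show False
  proof (cases rule: converse_rtranclE)
    case (step y)
    then have "E t y" "0 < u' \<bullet> n y" by (auto simp: pos_nodes_def)
    then show ?thesis using u'y by force
  qed (use x in simp)
qed

end

section \<open>Polyhedral cones\<close>

lemma convex_not_covered:
  fixes T :: "'w::euclidean_space set"
  assumes "finite \<M>" "convex T" "T \<noteq> {}" "\<And>M. M \<in> \<M> \<Longrightarrow> affine M \<and> \<not> T \<subseteq> M"
  shows "\<exists>y\<in>T. \<forall>M\<in>\<M>. y \<notin> M"
  using assms(1,4)
proof (induction \<M> rule: finite_induct)
  case (insert M \<M>)
  have "\<And>M. M \<in> \<M> \<Longrightarrow> affine M \<and> \<not> T \<subseteq> M" using insert.prems by simp
  from insert.IH[OF this] obtain y1 where y1: "y1 \<in> T" "\<forall>M\<in>\<M>. y1 \<notin> M" by blast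
  obtain y2 where y2: "y2 \<in> T" "y2 \<notin> M" using insert.prems[of M] by auto
  \<comment> \<open>The line through \<open>y1\<close> and \<open>y2\<close> meets each of the
    affine sets at most once, since none of them contains both points; so all but finitely many
    points of the segment avoid them all.\<close>
  define g where "g t = (1 - t) *\<^sub>R y1 + t *\<^sub>R y2" for t :: real
  have line: "g t \<in> N \<Longrightarrow> g s \<in> N \<Longrightarrow> s \<noteq> t \<Longrightarrow> y1 \<in> N \<and> y2 \<in> N" if "affine N" for N s t
  proof -
    assume a: "g t \<in> N" "g s \<in> N" "s \<noteq> t"
    have "(1 - c) *\<^sub>R g t + c *\<^sub>R g s \<in> N" for c using that a unfolding affine_def by simp
    moreover have "(1 - c) *\<^sub>R g t + c *\<^sub>R g s = g (t + c * (s - t))" for c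
      unfolding g_def by (simp add: algebra_simps)
    ultimately have *: "g (t + c * (s - t)) \<in> N" for c by simp
    have "y1 = g (t + (- t / (s - t)) * (s - t))" "y2 = g (t + ((1 - t) / (s - t)) * (s - t))"
      using a(3) by (simp_all add: g_def)
    then show ?thesis using * by metis
  qed
  have "finite (\<Union>N\<in>insert M \<M>. {t. g t \<in> N})"
  proof (intro finite_UN_I)
    fix N assume N: "N \<in> insert M \<M>"
    then have aff: "affine N" and "\<not> (y1 \<in> N \<and> y2 \<in> N)" using insert.prems[of N] y1 y2 by auto
    then have "s = t" if "g t \<in> N" "g s \<in> N" for s t using line[OF aff] that by blast
    then have "{t. g t \<in> N} \<subseteq> {SOME t. g t \<in> N}" using someI[of "\<lambda>t. g t \<in> N"] by auto
    then show "finite {t. g t \<in> N}" by (rule finite_subset) simp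
  qed (use insert.hyps in simp)
  moreover have "infinite {0..1::real}" by simp
  ultimately obtain t where t: "t \<in> {0..1}" "t \<notin> (\<Union>N\<in>insert M \<M>. {t. g t \<in> N})"
    by (meson finite_subset subsetI)
  have "g t \<in> T" using assms(2) y1 y2 t(1) unfolding g_def by (simp add: convexD_alt)
  then show ?case using t(2) by (intro bexI[of _ "g t"]) auto
qed (use assms(3) in auto)

lemma convex_not_covered_dim:
  fixes T :: "'w::euclidean_space set"
  assumes "finite \<M>" "convex T" "T \<noteq> {}" "\<And>M. M \<in> \<M> \<Longrightarrow> aff_dim M < aff_dim T"
  shows "\<exists>y\<in>T. \<forall>M\<in>\<M>. y \<notin> affine hull M"
proof -
  have "\<exists>y\<in>T. \<forall>M\<in>(hull) affine ` \<M>. y \<notin> M"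
  proof (rule convex_not_covered)
    fix M assume "M \<in> (hull) affine ` \<M>"
    then obtain M' where M': "M = affine hull M'" "M' \<in> \<M>" by auto
    have "\<not> T \<subseteq> affine hull M'"
    proof
      assume "T \<subseteq> affine hull M'"
      then have "aff_dim T \<le> aff_dim (affine hull M')" by (rule aff_dim_subset)
      then show False using assms(4)[OF M'(2)] by (simp add: aff_dim_affine_hull)
    qed
    then show "affine M \<and> \<not> T \<subseteq> M" using M' by simp
  qed (use assms in auto)
  then show ?thesis by simp
qed

text \<open>A segment in general position between two pieces avoids all intersections of codimension two.\<close>

lemma convex_cover_connected:
  fixes S :: "'w::euclidean_space set"
  assumes fin: "finite I" and S: "convex S" and cl: "\<And>i. i \<in> I \<Longrightarrow> closed (T i)"
    and cov: "S \<subseteq> (\<Union>i\<in>I. T i)" and conv: "\<And>i. i \<in> I \<Longrightarrow> convex (T i)"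
    and full: "\<And>i. i \<in> I \<Longrightarrow> aff_dim (T i \<inter> S) = aff_dim S"
    and ij: "i \<in> I" "j \<in> I"
  shows "(i, j) \<in> {(a, b). a \<in> I \<and> b \<in> I \<and> aff_dim S - 1 \<le> aff_dim (T a \<inter> T b \<inter> S)}\<^sup>*"
proof (rule ccontr)
  define r where "r = {(a, b). a \<in> I \<and> b \<in> I \<and> aff_dim S - 1 \<le> aff_dim (T a \<inter> T b \<inter> S)}"
  assume "\<not> ?thesis"
  then have nij: "(i, j) \<notin> r\<^sup>*" by (simp add: r_def)
  have ne: "T l \<inter> S \<noteq> {}" if "l \<in> I" for l
  proof
    assume "T l \<inter> S = {}"
    then have "S = {}" using full[OF that] by (metis aff_dim_empty)
    then have "aff_dim S - 1 \<le> aff_dim (T i \<inter> T j \<inter> S)" by simp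
    then have "(i,j) \<in> r" using ij by (auto simp: r_def)
    then show False using nij by blast
  qed
  define A where "A = {l \<in> I. (i, l) \<in> r\<^sup>*}"
  define B where "B = I - A"
  have iA: "i \<in> A" and jB: "j \<in> B" using ij nij by (auto simp: A_def B_def)
  \<comment> \<open>As \<open>A\<close> is closed under the relation, each of these intersections
    has codimension at least two in \<open>S\<close>.\<close>
  define \<M> where "\<M> = (\<lambda>(a,b). T a \<inter> T b \<inter> S) ` (A \<times> B)"
  have fA: "finite A" "finite B" using fin by (auto simp: A_def B_def)
  have M: "aff_dim M < aff_dim S - 1" if MM: "M \<in> \<M>" for M
  proof (rule ccontr)
    assume *: "\<not> ?thesis"
    obtain a b where ab: "a \<in> A" "b \<in> B" "M = T a \<inter> T b \<inter> S" using MM by (auto simp: \<M>_def)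
    then have "(a,b) \<in> r" using * by (auto simp: r_def A_def B_def)
    then have "(i,b) \<in> r\<^sup>*" using ab(1) by (auto simp: A_def)
    then show False using ab by (auto simp: A_def B_def)
  qed
  have conv': "convex (T l \<inter> S)" if "l \<in> I" for l using conv[OF that] S by (rule convex_Int)
  obtain x where x: "x \<in> T i \<inter> S" "\<forall>M\<in>\<M>. x \<notin> affine hull M"
  proof -
    have "\<exists>x\<in>T i \<inter> S. \<forall>M\<in>\<M>. x \<notin> affine hull M"
    proof (rule convex_not_covered_dim)
      show "aff_dim M < aff_dim (T i \<inter> S)" if "M \<in> \<M>" for M using M[OF that] full[OF ij(1)] by simp
    qed (use fA conv'[OF ij(1)] ne[OF ij(1)] in \<open>auto simp: \<M>_def\<close>)
    then show ?thesis using that by blast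
  qed
  \<comment> \<open>Joining \<open>x\<close> to such an intersection raises the dimension by at most
    one, so \<open>y\<close> can still avoid the affine hulls. The segment from \<open>x\<close> to
    \<open>y\<close> then misses all the intersections, although it is connected and covered by the
    closed unions over \<open>A\<close> and \<open>B\<close>.\<close>
  have "\<exists>y\<in>T j \<inter> S. \<forall>M\<in>insert x ` \<M>. y \<notin> affine hull M"
  proof (rule convex_not_covered_dim)
    fix M assume "M \<in> insert x ` \<M>"
    then obtain M' where M': "M = insert x M'" "M' \<in> \<M>" by blast
    then show "aff_dim M < aff_dim (T j \<inter> S)"
      using M[OF M'(2)] full[OF ij(2)] by (simp add: aff_dim_insert)
  qed (use fA conv'[OF ij(2)] ne[OF ij(2)] in \<open>auto simp: \<M>_def\<close>)
  then obtain y where y: "y \<in> T j \<inter> S" "\<And>M. M \<in> \<M> \<Longrightarrow> y \<notin> affine hull (insert x M)" by auto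
  have seg: "closed_segment x y \<subseteq> S" using x y S by (simp add: closed_segment_subset)
  have "closed_segment x y \<inter> (\<Union>a\<in>A. T a) \<inter> (\<Union>b\<in>B. T b) \<noteq> {}"
  proof
    assume emp: "closed_segment x y \<inter> (\<Union>a\<in>A. T a) \<inter> (\<Union>b\<in>B. T b) = {}"
    have "closed (\<Union>a\<in>A. T a)" "closed (\<Union>b\<in>B. T b)"
      using fA cl by (auto intro!: closed_UN simp: A_def B_def)
    moreover have "(\<Union>a\<in>A. T a) \<inter> (\<Union>b\<in>B. T b) \<inter> closed_segment x y = {}" using emp by blast
    moreover have "closed_segment x y \<subseteq> (\<Union>a\<in>A. T a) \<union> (\<Union>b\<in>B. T b)"
    proof
      fix z assume "z \<in> closed_segment x y"
      then obtain l where "l \<in> I" "z \<in> T l" using seg cov by blast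
      then show "z \<in> (\<Union>a\<in>A. T a) \<union> (\<Union>b\<in>B. T b)" by (cases "l \<in> A") (auto simp: B_def)
    qed
    moreover have "x \<in> (\<Union>a\<in>A. T a)" "y \<in> (\<Union>b\<in>B. T b)" using iA jB x(1) y(1) by auto
    moreover have "connected (closed_segment x y)" by simp
    ultimately show False unfolding connected_closed
      by (metis (no_types, lifting) disjoint_iff ends_in_segment(1) ends_in_segment(2))
  qed
  then obtain z a b where z: "z \<in> closed_segment x y" "a \<in> A" "b \<in> B" "z \<in> T a" "z \<in> T b" by blast
  then have "z \<in> T a \<inter> T b \<inter> S" using seg by auto
  moreover have M': "T a \<inter> T b \<inter> S \<in> \<M>" using z by (auto simp: \<M>_def)
  ultimately have zM: "z \<in> affine hull (T a \<inter> T b \<inter> S)" by (simp add: hull_inc)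
  have xM: "x \<notin> affine hull (T a \<inter> T b \<inter> S)" using x(2) M' by blast
  then have "z \<noteq> x" using zM by blast
  then have "y \<in> affine hull {x, z}"
  proof -
    obtain t where t: "0 \<le> t" "t \<le> 1" "z = (1 - t) *\<^sub>R x + t *\<^sub>R y"
      using z(1) by (auto simp: closed_segment_def)
    have "t \<noteq> 0" using t \<open>z \<noteq> x\<close> by auto
    then have "y = (1 - 1/t) *\<^sub>R x + (1/t) *\<^sub>R z" unfolding t(3) by (simp add: algebra_simps)
    then show ?thesis unfolding affine_hull_2 by (intro CollectI exI[of _ "1 - 1/t"] exI[of _ "1/t"]) simp
  qed
  moreover have "affine hull {x, z} \<subseteq> affine hull (insert x (T a \<inter> T b \<inter> S))"
    by (rule hull_minimal)
      (use hull_mono[of "T a \<inter> T b \<inter> S" "insert x (T a \<inter> T b \<inter> S)" affine] zM in \<open>auto simp: hull_inc\<close>)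
  ultimately show False using y(2)[OF M'] by blast
qed

section \<open>Polyhedral cones and the normals of their facets\<close>

definition pcone :: "'w::euclidean_space set \<Rightarrow> bool" where
  "pcone X \<longleftrightarrow> polyhedron X \<and> conic X \<and> X \<noteq> {}"

lemma pcone_0: "pcone X \<Longrightarrow> 0 \<in> X"
  unfolding pcone_def conic_def by (metis all_not_in_conv order_refl scaleR_zero_left)

lemma pcone_convex: "pcone X \<Longrightarrow> convex X"
  by (simp add: pcone_def polyhedron_imp_convex)

lemma pcone_closed: "pcone X \<Longrightarrow> closed X"
  by (simp add: pcone_def polyhedron_imp_closed)

lemma pcone_scale: "pcone X \<Longrightarrow> x \<in> X \<Longrightarrow> 0 \<le> c \<Longrightarrow> c *\<^sub>R x \<in> X"
  by (simp add: pcone_def conicD)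

lemma pcone_add: "pcone X \<Longrightarrow> x \<in> X \<Longrightarrow> y \<in> X \<Longrightarrow> x + y \<in> X"
proof -
  assume X: "pcone X" "x \<in> X" "y \<in> X"
  then have "(1/2) *\<^sub>R x + (1/2) *\<^sub>R y \<in> X" using convexD[OF pcone_convex] by fastforce
  from pcone_scale[OF X(1) this, of 2] show ?thesis by (simp add: algebra_simps)
qed

lemma pcone_affine_hull: "pcone X \<Longrightarrow> affine hull X = span X"
  by (rule affine_hull_span_0) (simp add: hull_inc pcone_0)

lemma pcone_aff_dim: "pcone X \<Longrightarrow> aff_dim X = int (dim X)"
  by (simp add: aff_dim_zero hull_inc pcone_0)

lemma pcone_face: "pcone X \<Longrightarrow> F face_of X \<Longrightarrow> F \<noteq> {} \<Longrightarrow> pcone F"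
  unfolding pcone_def using face_of_polyhedron_polyhedron face_of_conic by blast

lemma pcone_facet: "pcone X \<Longrightarrow> e facet_of X \<Longrightarrow> pcone e"
  using pcone_face facet_of_def by blast

text \<open>A face of a cone contains 0, so its supporting hyperplane passes through 0; projecting
  the normal to the span of \<open>X\<close> does not change its values on \<open>X\<close>.\<close>

lemma pcone_face_normal:
  assumes "pcone X" "F face_of X" "F \<noteq> {}"
  obtains m where "m \<in> span X" "\<And>x. x \<in> X \<Longrightarrow> m \<bullet> x \<le> 0" "F = {x \<in> X. m \<bullet> x = 0}"
proof -
  have "F exposed_face_of X" using assms exposed_face_of_polyhedron by (auto simp: pcone_def)
  then obtain a b where ab: "X \<subseteq> {x. a \<bullet> x \<le> b}" "F = X \<inter> {x. a \<bullet> x = b}"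
    unfolding exposed_face_of_def by blast
  have "0 \<in> F" using pcone_0[OF pcone_face[OF assms]] .
  then have b: "b = 0" using ab by auto
  obtain m w where mw: "m \<in> span X" "\<And>v. v \<in> span X \<Longrightarrow> orthogonal w v" "a = m + w"
    using orthogonal_subspace_decomp_exists[of X a] by metis
  have "a \<bullet> x = m \<bullet> x" if "x \<in> X" for x
    using mw(2)[OF span_base[OF that]] mw(3) by (simp add: inner_add_left orthogonal_def)
  moreover have "a \<bullet> x \<le> 0" if "x \<in> X" for x using ab(1) b that by auto
  moreover have "F = {x \<in> X. a \<bullet> x = 0}" using ab(2) b by auto
  ultimately show ?thesis using that[of m] mw(1) by (metis (mono_tags, lifting) Collect_cong)
qed

text \<open>The length is left arbitrary; by \<open>facet_normal_cone\<close> the normal of a facet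
  inside the span of \<open>X\<close> is determined up to a positive factor.\<close>

definition fnormal :: "'w::euclidean_space set \<Rightarrow> 'w set \<Rightarrow> 'w" where
  "fnormal X e = (SOME m. m \<in> span X \<and> (\<forall>x\<in>X. m \<bullet> x \<le> 0) \<and> e = {x \<in> X. m \<bullet> x = 0})"

lemma fnormal:
  assumes "pcone X" "e facet_of X"
  shows "fnormal X e \<in> span X" "x \<in> X \<Longrightarrow> fnormal X e \<bullet> x \<le> 0" "e = {x \<in> X. fnormal X e \<bullet> x = 0}"
    "fnormal X e \<noteq> 0"
proof -
  obtain m where "m \<in> span X" "\<And>x. x \<in> X \<Longrightarrow> m \<bullet> x \<le> 0" "e = {x \<in> X. m \<bullet> x = 0}"
    using pcone_face_normal[of X e] assms by (auto simp: facet_of_def)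
  then have "\<exists>m. m \<in> span X \<and> (\<forall>x\<in>X. m \<bullet> x \<le> 0) \<and> e = {x \<in> X. m \<bullet> x = 0}" by blast
  from someI_ex[OF this] have *: "fnormal X e \<in> span X \<and> (\<forall>x\<in>X. fnormal X e \<bullet> x \<le> 0) \<and> e = {x \<in> X. fnormal X e \<bullet> x = 0}"
    unfolding fnormal_def .
  then show "fnormal X e \<in> span X" "x \<in> X \<Longrightarrow> fnormal X e \<bullet> x \<le> 0" "e = {x \<in> X. fnormal X e \<bullet> x = 0}"
    by blast+
  have "e \<noteq> X" using assms(2) by auto
  then show "fnormal X e \<noteq> 0" using * by auto
qed

lemma fnormal_less:
  assumes "pcone X" "e facet_of X" "x \<in> X" "x \<notin> e"
  shows "fnormal X e \<bullet> x < 0"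
  using fnormal(2,3)[OF assms(1,2)] assms(3,4) by (metis (mono_tags, lifting) less_eq_real_def mem_Collect_eq)

lemma facet_disjoint_rel_interior:
  "e facet_of X \<Longrightarrow> p \<in> rel_interior X \<Longrightarrow> p \<notin> e"
  using face_of_disjoint_rel_interior[of e X] facet_of_imp_face_of[of e X] facet_of_irrefl[of X] by blast

lemma fnormal_rel_interior:
  assumes "pcone X" "e facet_of X" "p \<in> rel_interior X"
  shows "fnormal X e \<bullet> p < 0"
  using fnormal_less[OF assms(1,2)] facet_disjoint_rel_interior[OF assms(2,3)] assms(3) rel_interior_subset
  by blast

lemma pcone_rel_interior: "pcone X \<Longrightarrow> rel_interior X \<noteq> {}"
  using rel_interior_eq_empty pcone_convex pcone_0 by blast

text \<open>For \<open>x\<close> outside \<open>X\<close>, the last point of \<open>X\<close> on the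
  segment from an interior point \<open>p\<close> to \<open>x\<close> lies on a facet. The normal of
  that facet is negative at \<open>p\<close> and zero at this point, hence positive at
  \<open>x\<close>.\<close>

lemma pcone_memI:
  assumes X: "pcone X" and x: "x \<in> span X" and le: "\<And>e. e facet_of X \<Longrightarrow> fnormal X e \<bullet> x \<le> 0"
  shows "x \<in> X"
proof (rule ccontr)
  assume nx: "x \<notin> X"
  obtain p where p: "p \<in> rel_interior X" using pcone_rel_interior[OF X] by blast
  then have pX: "p \<in> X" using rel_interior_subset by blast
  define g where "g t = p + t *\<^sub>R (x - p)" for t :: real
  define A where "A = {t\<in>{0..1}. g t \<in> X}"
  have gspan: "g t \<in> affine hull X" for t
    unfolding pcone_affine_hull[OF X] g_def using x span_base[OF pX]
    by (intro span_add span_scale span_diff)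
  have "A = {0..1} \<inter> g -` X" by (auto simp: A_def)
  moreover have "continuous_on UNIV g" unfolding g_def by (intro continuous_intros)
  ultimately have "closed A" using pcone_closed[OF X] by (metis closed_Int closed_atLeastAtMost closed_vimage)
  then have "compact A" unfolding A_def by (metis (mono_tags, lifting) bounded_closed_interval bounded_subset compact_eq_bounded_closed mem_Collect_eq subsetI box_real(2) bounded_cbox)
  moreover have "0 \<in> A" using pX by (simp add: A_def g_def)
  ultimately obtain t where t: "t \<in> A" "\<And>s. s \<in> A \<Longrightarrow> s \<le> t" using compact_attains_sup[of A] by blast
  have t1: "t < 1" using t(1) nx by (cases "t = 1") (auto simp: A_def g_def)
  have "g t \<notin> rel_interior X"
  proof
    assume "g t \<in> rel_interior X"
    then obtain r where r: "r > 0" "ball (g t) r \<inter> affine hull X \<subseteq> X" by (auto simp: mem_rel_interior_ball)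
    define s where "s = min 1 (t + r / (2 * (norm (x - p) + 1)))"
    have pos: "norm (x - p) + 1 > 0" by (simp add: add_nonneg_pos)
    then have s: "s > t" "s \<le> 1" using t1 r(1) by (auto simp: s_def)
    have "dist (g t) (g s) = norm ((t - s) *\<^sub>R (x - p))" by (simp add: g_def dist_norm algebra_simps)
    also have "\<dots> = (s - t) * norm (x - p)" using s by simp
    also have "\<dots> \<le> (r / (2 * (norm (x - p) + 1))) * (norm (x - p) + 1)"
      using s r pos by (intro mult_mono) (auto simp: s_def)
    also have "\<dots> = r / 2" using pos by (simp add: field_simps)
    also have "\<dots> < r" using r by simp
    finally have "g s \<in> X" using r(2) gspan by auto
    then have "s \<in> A" using s t(1) by (auto simp: A_def)
    then show False using t(2) s by force
  qed
  then have "g t \<in> rel_frontier X" using t(1) closure_subset by (auto simp: rel_frontier_def A_def)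
  then obtain e where e: "e facet_of X" "g t \<in> e"
    using rel_frontier_of_polyhedron[of X] X by (auto simp: pcone_def)
  let ?m = "fnormal X e"
  have "?m \<bullet> g t = 0" using fnormal(3)[OF X e(1)] e(2) by blast
  then have eq: "(1 - t) * (?m \<bullet> p) + t * (?m \<bullet> x) = 0" by (simp add: g_def inner_add_right inner_diff_right algebra_simps)
  have "(1 - t) * (?m \<bullet> p) < 0" using fnormal_rel_interior[OF X e(1) p] t1 by (simp add: mult_pos_neg)
  moreover have "t * (?m \<bullet> x) \<le> 0" using le[OF e(1)] t(1) by (simp add: A_def mult_nonneg_nonpos)
  ultimately show False using eq by linarith
qed

section \<open>Pairs of facets and faces of codimension two\<close>

lemma facet_not_subset:
  assumes "convex X" "e1 facet_of X" "e2 facet_of X" "e1 \<noteq> e2"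
  obtains r where "r \<in> e1" "r \<notin> e2"
proof -
  have "\<not> e1 \<subseteq> e2"
  proof
    assume "e1 \<subseteq> e2"
    then have "e1 face_of e2" using assms face_of_subset facet_of_imp_face_of facet_of_imp_subset by blast
    then have "aff_dim e1 < aff_dim e2"
      using face_of_aff_dim_lt[of e2 e1] assms face_of_imp_convex facet_of_imp_face_of by blast
    then show False using assms by (simp add: facet_of_def)
  qed
  then show ?thesis using that by blast
qed

lemma fnormal_indep:
  assumes "pcone X" "e1 facet_of X" "e2 facet_of X" "e1 \<noteq> e2"
  shows "fnormal X e2 \<notin> span {fnormal X e1}"
proof
  assume "fnormal X e2 \<in> span {fnormal X e1}"
  then obtain c where c: "fnormal X e2 = c *\<^sub>R fnormal X e1" by (auto simp: span_singleton)
  obtain r where r: "r \<in> e1" "r \<notin> e2" using facet_not_subset[OF pcone_convex] assms by metis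
  have "r \<in> X" using r assms facet_of_imp_subset by blast
  then have "fnormal X e2 \<bullet> r < 0" using fnormal_less assms r by blast
  moreover have "fnormal X e1 \<bullet> r = 0" using fnormal(3)[OF assms(1,2)] r by blast
  ultimately show False using c by simp
qed

text \<open>The vectors of \<open>span X\<close> orthogonal to a face of codimension two form a
  plane, and the normals of two different facets through that face are a basis of it.\<close>

lemma codim2_normal_span:
  assumes X: "pcone X" and e: "e1 facet_of X" "e2 facet_of X" "e1 \<noteq> e2"
    and G: "G \<subseteq> e1" "G \<subseteq> e2" "aff_dim G = aff_dim X - 2" "0 \<in> G"
    and n: "\<And>x. x \<in> G \<Longrightarrow> n \<bullet> x = 0"
  obtains a b where
    "\<And>x. x \<in> span X \<Longrightarrow> n \<bullet> x = a * (fnormal X e1 \<bullet> x) + b * (fnormal X e2 \<bullet> x)"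
proof -
  let ?m1 = "fnormal X e1" and ?m2 = "fnormal X e2"
  define V where "V = {y \<in> span X. \<forall>x\<in>span G. orthogonal x y}"
  have GX: "G \<subseteq> X" using G(1) e(1) facet_of_imp_subset by blast
  have dG: "aff_dim G = int (dim G)" using G(4) by (simp add: aff_dim_zero hull_inc)
  have "dim V + dim (span G) = dim (span X)"
    unfolding V_def by (rule dim_subspace_orthogonal_to_vectors) (use span_mono[OF GX] in auto)
  then have dV: "dim V = 2" using G(3) dG pcone_aff_dim[OF X] by (simp add: dim_span)
  have inV: "v \<in> V" if "v \<in> span X" "\<And>x. x \<in> G \<Longrightarrow> v \<bullet> x = 0" for v
  proof -
    have "orthogonal v x" if "x \<in> span G" for x
      using orthogonal_to_span[OF that, of v] \<open>\<And>x. x \<in> G \<Longrightarrow> v \<bullet> x = 0\<close> by (simp add: orthogonal_def)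
    then show ?thesis using that(1) by (simp add: V_def orthogonal_commute)
  qed
  have m0: "?m1 \<bullet> x = 0" "?m2 \<bullet> x = 0" if "x \<in> G" for x
    using that G(1,2) fnormal(3)[OF X e(1)] fnormal(3)[OF X e(2)] by blast+
  have m1V: "?m1 \<in> V" and m2V: "?m2 \<in> V" using inV fnormal(1)[OF X] e m0 by blast+
  obtain n' w where nw: "n' \<in> span X" "\<And>v. v \<in> span X \<Longrightarrow> orthogonal w v" "n = n' + w"
    using orthogonal_subspace_decomp_exists[of X n] by metis
  have nn': "n \<bullet> x = n' \<bullet> x" if "x \<in> span X" for x
    using nw(2)[OF that] nw(3) by (simp add: inner_add_left orthogonal_def)
  have n'V: "n' \<in> V" by (rule inV[OF nw(1)]) (metis nn' n GX span_base subsetD)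
  have ind: "independent {?m2, ?m1}"
    using independent_insertI[OF fnormal_indep[OF X e]] fnormal(4)[OF X e(1)] by simp
  have "?m2 \<noteq> ?m1" using fnormal_indep[OF X e] span_base[of ?m1 "{?m1}"] by auto
  then have "card {?m2, ?m1} = 2" by simp
  have "V \<subseteq> span {?m2, ?m1}"
    by (rule card_ge_dim_independent[OF _ ind]) (use m1V m2V dV \<open>card {?m2, ?m1} = 2\<close> in auto)
  then have "n' \<in> span {?m2, ?m1}" using n'V by blast
  then obtain b where "n' - b *\<^sub>R ?m2 \<in> span {?m1}" using span_breakdown_eq by metis
  then obtain a where "n' - b *\<^sub>R ?m2 = a *\<^sub>R ?m1" by (auto simp: span_singleton)
  then have n'eq: "n' = a *\<^sub>R ?m1 + b *\<^sub>R ?m2" by (simp add: algebra_simps)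
  have eq: "n \<bullet> x = a * (?m1 \<bullet> x) + b * (?m2 \<bullet> x)" if "x \<in> span X" for x
    using nn'[OF that] by (simp add: n'eq inner_add_left)
  then show ?thesis using that by blast
qed

text \<open>The signs of the two coefficients are read off at a point of \<open>e1\<close> outside
  \<open>e2\<close> and at a point of \<open>e2\<close> outside \<open>e1\<close>.\<close>

lemma codim2_normal_cone:
  assumes X: "pcone X" and e: "e1 facet_of X" "e2 facet_of X" "e1 \<noteq> e2"
    and G: "G \<subseteq> e1" "G \<subseteq> e2" "aff_dim G = aff_dim X - 2" "0 \<in> G"
    and n: "\<And>x. x \<in> X \<Longrightarrow> n \<bullet> x \<le> 0" "\<And>x. x \<in> G \<Longrightarrow> n \<bullet> x = 0"
  obtains a b where "a \<ge> 0" "b \<ge> 0"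
    "\<And>x. x \<in> span X \<Longrightarrow> n \<bullet> x = a * (fnormal X e1 \<bullet> x) + b * (fnormal X e2 \<bullet> x)"
proof -
  let ?m1 = "fnormal X e1" and ?m2 = "fnormal X e2"
  obtain a b where eq: "\<And>x. x \<in> span X \<Longrightarrow> n \<bullet> x = a * (?m1 \<bullet> x) + b * (?m2 \<bullet> x)"
    using codim2_normal_span[OF X e G, of n] n(2) by metis
  obtain r1 where r1: "r1 \<in> e1" "r1 \<notin> e2" using facet_not_subset[OF pcone_convex[OF X]] e by metis
  obtain r2 where r2: "r2 \<in> e2" "r2 \<notin> e1" using facet_not_subset[OF pcone_convex[OF X] e(2,1)] e by metis
  have rX: "r1 \<in> X" "r2 \<in> X" using r1 r2 e facet_of_imp_subset by blast+
  have "?m1 \<bullet> r1 = 0" "?m2 \<bullet> r2 = 0" using r1 r2 fnormal(3)[OF X] e by blast+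
  then have "b * (?m2 \<bullet> r1) \<le> 0" "a * (?m1 \<bullet> r2) \<le> 0"
    using eq[OF span_base[OF rX(1)]] eq[OF span_base[OF rX(2)]] n(1)[OF rX(1)] n(1)[OF rX(2)] by auto
  moreover have "?m2 \<bullet> r1 < 0" "?m1 \<bullet> r2 < 0" using fnormal_less[OF X] e r1 r2 rX by blast+
  ultimately have "a \<ge> 0" "b \<ge> 0" by (auto simp: mult_le_0_iff)
  then show ?thesis using that eq by blast
qed

text \<open>The normal of a third facet would be a nonnegative combination of the other two. At a
  point of \<open>e3\<close> outside \<open>e1\<close> both terms vanish, which kills the first
  coefficient; likewise the second one dies, and the normal would be 0.\<close>

lemma codim2_at_most_two_facets:
  assumes X: "pcone X" and e: "e1 facet_of X" "e2 facet_of X" "e3 facet_of X" "e1 \<noteq> e2"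
    and G: "G \<subseteq> e1" "G \<subseteq> e2" "G \<subseteq> e3" "aff_dim G = aff_dim X - 2" "0 \<in> G"
  shows "e3 = e1 \<or> e3 = e2"
proof (rule ccontr)
  assume ne: "\<not> ?thesis"
  have "fnormal X e3 \<bullet> x = 0" if "x \<in> G" for x using that G(3) fnormal(3)[OF X e(3)] by blast
  then obtain a b where ab: "a \<ge> 0" "b \<ge> 0"
    "\<And>x. x \<in> span X \<Longrightarrow> fnormal X e3 \<bullet> x = a * (fnormal X e1 \<bullet> x) + b * (fnormal X e2 \<bullet> x)"
    using codim2_normal_cone[OF X e(1,2,4) G(1,2,4,5), of "fnormal X e3"] fnormal(2)[OF X e(3)] by metis
  obtain r1 where r1: "r1 \<in> e3" "r1 \<notin> e1" using facet_not_subset[OF pcone_convex[OF X] e(3,1)] ne by metis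
  obtain r2 where r2: "r2 \<in> e3" "r2 \<notin> e2" using facet_not_subset[OF pcone_convex[OF X] e(3,2)] ne by metis
  have rX: "r1 \<in> X" "r2 \<in> X" using r1 r2 e facet_of_imp_subset by blast+
  have "fnormal X e3 \<bullet> r1 = 0" "fnormal X e3 \<bullet> r2 = 0" using r1 r2 fnormal(3)[OF X e(3)] by blast+
  then have z: "a * (fnormal X e1 \<bullet> r1) + b * (fnormal X e2 \<bullet> r1) = 0"
    "a * (fnormal X e1 \<bullet> r2) + b * (fnormal X e2 \<bullet> r2) = 0"
    using ab(3)[OF span_base[OF rX(1)]] ab(3)[OF span_base[OF rX(2)]] by auto
  have le: "a * (fnormal X e1 \<bullet> r) \<le> 0" "b * (fnormal X e2 \<bullet> r) \<le> 0" if "r \<in> X" for r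
    using fnormal(2)[OF X e(1) that] fnormal(2)[OF X e(2) that] ab by (simp_all add: mult_nonneg_nonpos)
  have "a = 0" using z(1) le[OF rX(1)] fnormal_less[OF X e(1) rX(1) r1(2)] by (smt (verit) mult_eq_0_iff)
  moreover have "b = 0" using z(2) le[OF rX(2)] fnormal_less[OF X e(2) rX(2) r2(2)] by (smt (verit) mult_eq_0_iff)
  ultimately have "fnormal X e3 \<bullet> fnormal X e3 = 0" using ab(3)[OF fnormal(1)[OF X e(3)]] by simp
  then show False using fnormal(4)[OF X e(3)] by simp
qed

lemma facet_facet_codim2:
  assumes "e facet_of X" "G facet_of e"
  shows "G face_of X" "aff_dim G = aff_dim X - 2" "G \<noteq> {}"
  using assms face_of_trans by (auto simp: facet_of_def)

lemma codim2_face_facet: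
  assumes "pcone X" "e facet_of X" "G face_of X" "G \<subseteq> e" "aff_dim G = aff_dim X - 2" "G \<noteq> {}"
  shows "G facet_of e"
  using assms face_of_subset[of G X e] facet_of_imp_subset[of e X] by (simp add: facet_of_def)

text \<open>A proper face is the intersection of the facets containing it, so one facet alone cannot
  cut out a face of codimension two.\<close>

lemma codim2_other_facet:
  assumes X: "pcone X" and e: "e facet_of X" and G: "G facet_of e"
  obtains e' where "e' facet_of X" "e' \<noteq> e" "G facet_of e'" "G = e \<inter> e'"
proof -
  note G' = facet_facet_codim2[OF e G]
  have "G \<noteq> X" using G'(2) by auto
  then have eq: "G = \<Inter>{F. F facet_of X \<and> G \<subseteq> F}"
    using face_of_polyhedron[of X G] X G' by (auto simp: pcone_def)
  have "G \<noteq> e" using G by auto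
  have "\<exists>e'. e' facet_of X \<and> G \<subseteq> e' \<and> e' \<noteq> e"
  proof (rule ccontr)
    assume "\<not> ?thesis"
    then have "{F. F facet_of X \<and> G \<subseteq> F} = {e}" using e G facet_of_imp_subset by blast
    then show False using eq \<open>G \<noteq> e\<close> by simp
  qed
  then obtain e' where e': "e' facet_of X" "G \<subseteq> e'" "e' \<noteq> e" by blast
  have Gf: "G facet_of e'" using codim2_face_facet[OF X e'(1) G'(1) e'(2) G'(2,3)] .
  have "{F. F facet_of X \<and> G \<subseteq> F} = {e, e'}"
    using codim2_at_most_two_facets[OF X e e'(1) _ e'(3)[symmetric] facet_of_imp_subset[OF G] e'(2) _ G'(2)]
      pcone_0[OF pcone_facet[OF pcone_facet[OF X e] G]] e e' facet_of_imp_subset[OF G] by blast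
  then have "G = e \<inter> e'" using eq by simp
  then show ?thesis using that e' Gf by blast
qed

text \<open>Orthogonality to \<open>e\<close> leaves a line inside \<open>span X\<close>, and an
  interior point of \<open>X\<close> fixes the direction on it.\<close>

lemma facet_normal_cone:
  assumes X: "pcone X" and e: "e facet_of X"
    and n: "\<And>x. x \<in> X \<Longrightarrow> n \<bullet> x \<le> 0" "\<And>x. x \<in> e \<Longrightarrow> n \<bullet> x = 0"
  obtains a where "a \<ge> 0" "\<And>x. x \<in> span X \<Longrightarrow> n \<bullet> x = a * (fnormal X e \<bullet> x)"
proof -
  let ?m = "fnormal X e"
  define V where "V = {y \<in> span X. \<forall>x\<in>span e. orthogonal x y}"
  have eX: "e \<subseteq> X" using e facet_of_imp_subset by blast
  have "dim V + dim (span e) = dim (span X)"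
    unfolding V_def by (rule dim_subspace_orthogonal_to_vectors) (use span_mono[OF eX] in auto)
  then have dV: "dim V = 1" using e pcone_aff_dim[OF X] pcone_aff_dim[OF pcone_facet[OF X e]] by (simp add: facet_of_def)
  have inV: "v \<in> V" if v: "v \<in> span X" "\<And>x. x \<in> e \<Longrightarrow> v \<bullet> x = 0" for v
  proof -
    have "orthogonal v x" if "x \<in> span e" for x
      using orthogonal_to_span[OF that, of v] v(2) by (simp add: orthogonal_def)
    then show ?thesis using v(1) by (simp add: V_def orthogonal_commute)
  qed
  have "?m \<bullet> x = 0" if "x \<in> e" for x using that fnormal(3)[OF X e] by blast
  then have mV: "?m \<in> V" using inV[OF fnormal(1)[OF X e]] by blast
  obtain n' w where nw: "n' \<in> span X" "\<And>v. v \<in> span X \<Longrightarrow> orthogonal w v" "n = n' + w"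
    using orthogonal_subspace_decomp_exists[of X n] by metis
  have nn': "n \<bullet> x = n' \<bullet> x" if "x \<in> span X" for x
    using nw(2)[OF that] nw(3) by (simp add: inner_add_left orthogonal_def)
  have n'V: "n' \<in> V" by (rule inV[OF nw(1)]) (metis nn' n(2) eX span_base subsetD)
  have "V \<subseteq> span {?m}"
    by (rule card_ge_dim_independent) (use mV dV fnormal(4)[OF X e] in auto)
  then obtain a where a: "n' = a *\<^sub>R ?m" using n'V by (auto simp: span_singleton)
  have eq: "n \<bullet> x = a * (?m \<bullet> x)" if "x \<in> span X" for x using nn'[OF that] a by simp
  obtain p where p: "p \<in> rel_interior X" using pcone_rel_interior[OF X] by blast
  have pX: "p \<in> X" using p rel_interior_subset by blast
  have "a * (?m \<bullet> p) \<le> 0" using eq[OF span_base[OF pX]] n(1)[OF pX] by simp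
  then have "a \<ge> 0" using fnormal_rel_interior[OF X e p] by (simp add: mult_le_0_iff)
  then show ?thesis using that eq by blast
qed

section \<open>Facets seen from a direction\<close>

lemma exit_facet:
  assumes X: "pcone X" and x: "x \<in> X" and u: "u \<in> span X" and e: "e facet_of X" "0 < fnormal X e \<bullet> u"
  obtains f t where "f facet_of X" "0 < fnormal X f \<bullet> u" "t \<ge> 0" "x + t *\<^sub>R u \<in> f"
proof -
  let ?m = "fnormal X"
  define I where "I = {f. f facet_of X \<and> 0 < fnormal X f \<bullet> u}"
  have finI: "finite I" using finite_polyhedron_facets[of X] X by (auto simp: I_def pcone_def)
  \<comment> \<open>The ratio test: \<open>t f\<close> is the time at which the ray from
    \<open>x\<close> in direction \<open>u\<close> reaches the hyperplane of \<open>f\<close>, and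
    the smallest such time decides.\<close>
  define t where "t f = - (?m f \<bullet> x) / (?m f \<bullet> u)" for f
  have "I \<noteq> {}" using e by (auto simp: I_def)
  then obtain f where f: "f \<in> I" "\<And>g. g \<in> I \<Longrightarrow> t f \<le> t g"
    using finI by (metis (no_types, lifting) ex_is_arg_min_if_finite is_arg_min_linorder)
  have tf: "t f \<ge> 0" using fnormal(2)[OF X _ x, of f] f(1) by (simp add: t_def I_def divide_nonpos_pos)
  have "x + t f *\<^sub>R u \<in> X"
  proof (rule pcone_memI[OF X])
    show "x + t f *\<^sub>R u \<in> span X" using span_base[OF x] u by (intro span_add span_scale)
    fix g assume g: "g facet_of X"
    show "?m g \<bullet> (x + t f *\<^sub>R u) \<le> 0"
    proof (cases "g \<in> I")
      case True
      then have "?m g \<bullet> u > 0" by (simp add: I_def)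
      then have "t f * (?m g \<bullet> u) \<le> t g * (?m g \<bullet> u)" using f(2)[OF True] by simp
      also have "\<dots> = - (?m g \<bullet> x)" using \<open>?m g \<bullet> u > 0\<close> by (simp add: t_def)
      finally show ?thesis by (simp add: inner_add_right)
    next
      case False
      then have "?m g \<bullet> u \<le> 0" using g by (auto simp: I_def)
      then have "t f * (?m g \<bullet> u) \<le> 0" using tf by (simp add: mult_nonneg_nonpos)
      then show ?thesis using fnormal(2)[OF X g x] by (simp add: inner_add_right)
    qed
  qed
  moreover have "?m f \<bullet> (x + t f *\<^sub>R u) = 0"
  proof -
    have "?m f \<bullet> u \<noteq> 0" using f(1) by (simp add: I_def)
    then show ?thesis unfolding t_def inner_add_right by simp
  qed
  ultimately have "x + t f *\<^sub>R u \<in> f" using fnormal(3)[OF X, of f] f(1) by (auto simp: I_def)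
  then show ?thesis using that[of f "t f"] f(1) tf by (auto simp: I_def)
qed

text \<open>
  The facets visible from \<open>u\<close>, extended by the line through \<open>u\<close>, tile a convex set.
\<close>

definition visible_adj :: "'w::euclidean_space set \<Rightarrow> 'w \<Rightarrow> ('w set \<times> 'w set) set" where
  "visible_adj X u = {(f, g). f facet_of X \<and> g facet_of X \<and> 0 < fnormal X f \<bullet> u \<and> 0 < fnormal X g \<bullet> u \<and>
     f \<noteq> g \<and> (f \<inter> g) facet_of f \<and> (f \<inter> g) facet_of g}"

lemma visible_facets_connected:
  assumes X: "pcone X" and u: "u \<in> span X"
    and e: "e facet_of X" "0 < fnormal X e \<bullet> u" and e': "e' facet_of X" "0 < fnormal X e' \<bullet> u"
  shows "(e, e') \<in> (visible_adj X u)\<^sup>*"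
proof -
  define I where "I = {f. f facet_of X \<and> 0 < fnormal X f \<bullet> u}"
  let ?m = "fnormal X"
  \<comment> \<open>\<open>L f\<close> projects along \<open>u\<close> to the hyperplane of
    \<open>f\<close>, so \<open>T f\<close> is \<open>f\<close> plus the line spanned by
    \<open>u\<close>, and \<open>S\<close> is \<open>X\<close> plus that line.\<close>
  define L where "L f z = z - ((?m f \<bullet> z) / (?m f \<bullet> u)) *\<^sub>R u" for f z
  define T where "T f = {z. L f z \<in> f}" for f
  define S where "S = {x + s *\<^sub>R u | x s. x \<in> X}"
  have finI: "finite I" using finite_polyhedron_facets[of X] X by (auto simp: I_def pcone_def)
  have lin: "linear (L f)" for f
    unfolding L_def by (rule linearI) (simp_all add: inner_add_right add_divide_distrib algebra_simps)
  have closedf: "closed f" "convex f" if "f \<in> I" for f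
    using that pcone_facet[OF X] pcone_closed pcone_convex by (auto simp: I_def)
  have T_alt: "z \<in> T f \<longleftrightarrow> (\<exists>x\<in>f. \<exists>s. z = x + s *\<^sub>R u)" if f: "f \<in> I" for f z
  proof
    assume "z \<in> T f"
    then have "L f z \<in> f" by (simp add: T_def)
    moreover have "z = L f z + ((?m f \<bullet> z) / (?m f \<bullet> u)) *\<^sub>R u" by (simp add: L_def)
    ultimately show "\<exists>x\<in>f. \<exists>s. z = x + s *\<^sub>R u" by blast
  next
    assume "\<exists>x\<in>f. \<exists>s. z = x + s *\<^sub>R u"
    then obtain x s where xs: "x \<in> f" "z = x + s *\<^sub>R u" by blast
    have "?m f \<bullet> x = 0" using fnormal(3)[OF X] f xs by (auto simp: I_def)
    then have "L f z = x" using f xs(2) by (simp add: L_def I_def inner_add_right)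
    then show "z \<in> T f" using xs by (simp add: T_def)
  qed
  have fX: "f \<subseteq> X" if "f \<in> I" for f using that facet_of_imp_subset by (auto simp: I_def)
  have TS: "T f \<subseteq> S" if "f \<in> I" for f using T_alt[OF that] fX[OF that] by (fastforce simp: S_def)
  have convS: "convex S"
  proof -
    have "S = (\<Union>x\<in>X. \<Union>y\<in>range (\<lambda>s. s *\<^sub>R u). {x + y})" by (auto simp: S_def)
    moreover have "convex (range (\<lambda>s::real. s *\<^sub>R u))"
      by (rule convex_linear_image) (auto simp: linear_iff algebra_simps)
    ultimately show ?thesis using convex_sums[OF pcone_convex[OF X]] by (metis (no_types))
  qed
  have Sspan: "S \<subseteq> span X" using u by (auto simp: S_def intro: span_add span_scale span_base)
  have XS: "X \<subseteq> S" by (force simp: S_def intro: exI[of _ 0])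
  have dimS: "aff_dim S = aff_dim X"
  proof (rule antisym)
    have "aff_dim S \<le> aff_dim (affine hull X)" using Sspan pcone_affine_hull[OF X] by (intro aff_dim_subset) auto
    then show "aff_dim S \<le> aff_dim X" by (simp add: aff_dim_affine_hull)
  qed (use XS in \<open>simp add: aff_dim_subset\<close>)
  have uf: "u \<notin> affine hull f" if f: "f \<in> I" for f
  proof
    assume "u \<in> affine hull f"
    moreover have "f \<subseteq> {x. ?m f \<bullet> x = 0}" using fnormal(3)[OF X] f by (auto simp: I_def)
    then have "affine hull f \<subseteq> {x. ?m f \<bullet> x = 0}" by (rule hull_minimal) (rule affine_hyperplane)
    ultimately show False using f by (auto simp: I_def)
  qed
  have "(e, e') \<in> {(a, b). a \<in> I \<and> b \<in> I \<and> aff_dim S - 1 \<le> aff_dim (T a \<inter> T b \<inter> S)}\<^sup>*"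
  proof (rule convex_cover_connected[OF finI convS])
    fix f assume f: "f \<in> I"
    have Tv: "T f = L f -` f" by (auto simp: T_def)
    show "closed (T f)" unfolding Tv using closedf[OF f] lin linear_continuous_on[of "L f" UNIV]
      by (intro closed_vimage) (auto simp: linear_conv_bounded_linear)
    show "convex (T f)" unfolding Tv using closedf(2)[OF f] lin by (intro convex_linear_vimage)
    have "insert u f \<subseteq> T f"
    proof -
      have "0 \<in> f" using pcone_0 pcone_facet[OF X] f by (auto simp: I_def)
      then have "u \<in> T f" using T_alt[OF f, of u] by (metis add_0 scaleR_one)
      moreover have "f \<subseteq> T f" using T_alt[OF f] by (metis add.right_neutral scaleR_zero_left subsetI)
      ultimately show ?thesis by simp
    qed
    then have "aff_dim (insert u f) \<le> aff_dim (T f \<inter> S)" using TS[OF f] by (intro aff_dim_subset) blast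
    moreover have "aff_dim (insert u f) = aff_dim X" using uf[OF f] f by (simp add: aff_dim_insert I_def facet_of_def)
    moreover have "aff_dim (T f \<inter> S) \<le> aff_dim S" by (simp add: aff_dim_subset)
    ultimately show "aff_dim (T f \<inter> S) = aff_dim S" using dimS by linarith
  next
    show "S \<subseteq> (\<Union>i\<in>I. T i)"
    proof
      fix z assume "z \<in> S"
      then obtain x s where xs: "x \<in> X" "z = x + s *\<^sub>R u" by (auto simp: S_def)
      obtain f t where f: "f \<in> I" and "x + t *\<^sub>R u \<in> f"
        using exit_facet[OF X xs(1) u e] unfolding I_def by blast
      moreover have "z = (x + t *\<^sub>R u) + (s - t) *\<^sub>R u" using xs by (simp add: algebra_simps)
      ultimately show "z \<in> (\<Union>i\<in>I. T i)" using T_alt[OF f] f by blast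
    qed
  qed (use e e' in \<open>auto simp: I_def\<close>)
  moreover have "{(a, b). a \<in> I \<and> b \<in> I \<and> aff_dim S - 1 \<le> aff_dim (T a \<inter> T b \<inter> S)} \<subseteq> visible_adj X u \<union> Id"
  proof
    fix q assume "q \<in> {(a, b). a \<in> I \<and> b \<in> I \<and> aff_dim S - 1 \<le> aff_dim (T a \<inter> T b \<inter> S)}"
    then obtain f g where q: "q = (f, g)" and fg: "f \<in> I" "g \<in> I" "aff_dim S - 1 \<le> aff_dim (T f \<inter> T g \<inter> S)"
      by blast
    have "(f, g) \<in> visible_adj X u" if ne: "f \<noteq> g"
    proof -
      have "T f \<inter> T g \<inter> S \<subseteq> affine hull (insert u (f \<inter> g))"
      proof
        fix z assume z: "z \<in> T f \<inter> T g \<inter> S"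
        obtain x s where x: "x \<in> f" "z = x + s *\<^sub>R u" using z T_alt[OF fg(1)] by blast
        obtain y t where y: "y \<in> g" "z = y + t *\<^sub>R u" using z T_alt[OF fg(2)] by blast
        \<comment> \<open>Both \<open>x\<close> and \<open>y\<close> lie in \<open>X\<close> on one
          line in direction \<open>u\<close>, and each is the last point of \<open>X\<close> there;
          the two supporting inequalities force them to coincide.\<close>
        have xy: "y = x + (s - t) *\<^sub>R u" using x y by (simp add: algebra_simps)
        have "?m f \<bullet> x = 0" "?m g \<bullet> y = 0" using x y fg fnormal(3)[OF X] by (auto simp: I_def)
        moreover have "?m f \<bullet> y \<le> 0" "?m g \<bullet> x \<le> 0"
          using x y fg fnormal(2)[OF X] fX by (auto simp: I_def)
        ultimately have "(s - t) * (?m f \<bullet> u) \<le> 0" "(s - t) * (?m g \<bullet> u) \<ge> 0"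
          unfolding xy by (simp_all add: inner_add_right)
        then have "s = t" using fg by (auto simp: I_def mult_le_0_iff zero_le_mult_iff)
        then have xfg: "x \<in> f \<inter> g" using x y by simp
        have "0 \<in> f \<inter> g" using pcone_0 pcone_facet[OF X] fg by (auto simp: I_def)
        then have "affine hull (insert u (f \<inter> g)) = span (insert u (f \<inter> g))"
          by (simp add: affine_hull_span_0 hull_inc)
        then show "z \<in> affine hull (insert u (f \<inter> g))"
          using x(2) span_add[OF span_base[of x "insert u (f \<inter> g)"] span_scale[OF span_base[of u "insert u (f \<inter> g)"], of s]] xfg
          by simp
      qed
      then have "aff_dim (T f \<inter> T g \<inter> S) \<le> aff_dim (insert u (f \<inter> g))"
        by (metis aff_dim_affine_hull aff_dim_subset)
      then have ge: "aff_dim (f \<inter> g) \<ge> aff_dim X - 2"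
        using fg(3) dimS by (simp add: aff_dim_insert split: if_splits)
      have fgf: "f face_of X" "g face_of X" "pcone f" "pcone g" using fg pcone_facet[OF X] by (auto simp: I_def facet_of_def)
      have face: "(f \<inter> g) face_of X" using fgf by (simp add: face_of_Int)
      have "f \<inter> g \<noteq> {}" using pcone_0 fgf by blast
      have "\<not> f \<subseteq> g" using facet_not_subset[OF pcone_convex[OF X], of f g] fg ne by (auto simp: I_def)
      then have "f \<inter> g \<noteq> f" by blast
      moreover have "(f \<inter> g) face_of f" using face fgf face_of_subset[OF face] face_of_imp_subset by blast
      ultimately have "aff_dim (f \<inter> g) < aff_dim f" using face_of_aff_dim_lt pcone_convex fgf by blast
      then have eq: "aff_dim (f \<inter> g) = aff_dim X - 2" using ge fg by (auto simp: I_def facet_of_def)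
      have "(f \<inter> g) facet_of f" "(f \<inter> g) facet_of g"
        using codim2_face_facet[OF X _ face _ eq \<open>f \<inter> g \<noteq> {}\<close>] fg by (auto simp: I_def)
      then show ?thesis using fg ne by (auto simp: visible_adj_def I_def)
    qed
    then show "q \<in> visible_adj X u \<union> Id" using q by blast
  qed
  ultimately show ?thesis by (metis (no_types, lifting) rtrancl_mono rtrancl_reflcl subset_iff Un_commute)
qed

section \<open>Closed complexes of cones\<close>

lemma even_card_involution:
  assumes "finite A" "\<And>x. x \<in> A \<Longrightarrow> f x \<in> A" "\<And>x. x \<in> A \<Longrightarrow> f (f x) = x" "\<And>x. x \<in> A \<Longrightarrow> f x \<noteq> x"
  shows "even (card A)"
  using assms
proof (induction "card A" arbitrary: A rule: less_induct)
  case less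
  show ?case
  proof (cases "A = {}")
    case False
    then obtain x where x: "x \<in> A" by blast
    define B where "B = A - {x, f x}"
    have two: "{x, f x} \<subseteq> A" "card {x, f x} = 2" using x less.prems(2,4)[OF x] by auto
    have c: "card A = card B + 2" unfolding B_def
      using card_Diff_subset[OF _ two(1)] card_mono[OF less.prems(1) two(1)] two(2) by simp
    have "even (card B)"
    proof (rule less.hyps)
      show "f y \<in> B" if "y \<in> B" for y
      proof -
        have y: "y \<in> A" "y \<noteq> x" "y \<noteq> f x" using that by (auto simp: B_def)
        have "f y \<noteq> x" using less.prems(3)[OF y(1)] y(3) by auto
        moreover have "f y \<noteq> f x" using less.prems(3)[OF y(1)] less.prems(3)[OF x] y(2) by auto
        ultimately show ?thesis using less.prems(2)[OF y(1)] by (simp add: B_def)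
      qed
      show "f (f y) = y" "f y \<noteq> y" if "y \<in> B" for y using that less.prems(3,4)[of y] by (simp_all add: B_def)
    qed (use c less.prems(1) in \<open>simp_all add: B_def\<close>)
    then show ?thesis using c by simp
  qed simp
qed

lemma perp_perp_singleton:
  fixes a v :: "'w::euclidean_space"
  assumes "\<And>x. a \<bullet> x = 0 \<Longrightarrow> v \<bullet> x = 0"
  shows "v \<in> span {a}"
proof -
  obtain c w where cw: "c \<in> span {a}" "\<And>y. y \<in> span {a} \<Longrightarrow> orthogonal w y" "v = c + w"
    using orthogonal_subspace_decomp_exists[of "{a}" v] by metis
  have "a \<bullet> w = 0" using cw(2)[of a] by (simp add: span_base orthogonal_def inner_commute)
  then have "v \<bullet> w = 0" by (rule assms)
  moreover have "c \<bullet> w = 0" using cw(2)[OF cw(1)] by (simp add: orthogonal_def inner_commute)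
  ultimately have "w = 0" using cw(3) by (simp add: inner_add_left)
  then show ?thesis using cw by simp
qed

lemma span_hyperplane_eq:
  fixes X :: "'w::euclidean_space set"
  assumes "pcone X" "aff_dim X = int DIM('w) - 1" "a \<noteq> 0" "\<And>x. x \<in> X \<Longrightarrow> a \<bullet> x = 0"
  shows "span X = {x. a \<bullet> x = 0}"
proof (rule subspace_dim_equal)
  show "span X \<subseteq> {x. a \<bullet> x = 0}"
    by (rule span_minimal) (use assms(4) in \<open>auto simp: subspace_hyperplane\<close>)
  show "dim {x. a \<bullet> x = 0} \<le> dim (span X)"
    using assms(2,3) pcone_aff_dim[OF assms(1)] by (simp add: dim_hyperplane)
qed (auto simp: subspace_hyperplane)

section \<open>Closed complexes and turns around a face of codimension two\<close>

inductive_set orbit :: "('s \<Rightarrow> 'w::euclidean_space set) \<Rightarrow> ('s \<Rightarrow> 'w set \<Rightarrow> 's) \<Rightarrow> 's \<Rightarrow> 'w set \<Rightarrow> 's set"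
  for X nb s G where
  start: "s \<in> orbit X nb s G"
| step: "t \<in> orbit X nb s G \<Longrightarrow> f facet_of X t \<Longrightarrow> G \<subseteq> f \<Longrightarrow> nb t f \<in> orbit X nb s G"

lemma orbit_trans: "t \<in> orbit X nb s G \<Longrightarrow> r \<in> orbit X nb t G \<Longrightarrow> r \<in> orbit X nb s G"
  by (rotate_tac 1, induction rule: orbit.induct) (auto intro: orbit.step)

text \<open>Different nodes may carry the same cone, which is why \<open>X\<close> is indexed.
  \<open>orb\<close> is convexity around a face \<open>G\<close> of codimension two: every other
  node met when crossing ridges through \<open>G\<close> has a normal that supports
  \<open>X s\<close> and is not parallel to that of \<open>s\<close>.\<close>

locale closed_complex =
  fixes S :: "'s set" and X :: "'s \<Rightarrow> 'w::euclidean_space set" and n :: "'s \<Rightarrow> 'w"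
    and nb :: "'s \<Rightarrow> 'w set \<Rightarrow> 's"
  assumes fin: "finite (n ` S)"
    and X_pcone: "s \<in> S \<Longrightarrow> pcone (X s)"
    and X_dim: "s \<in> S \<Longrightarrow> aff_dim (X s) = int DIM('w) - 1"
    and n_nz: "s \<in> S \<Longrightarrow> n s \<noteq> 0"
    and n_perp: "s \<in> S \<Longrightarrow> x \<in> X s \<Longrightarrow> n s \<bullet> x = 0"
    and nb_in: "s \<in> S \<Longrightarrow> e facet_of X s \<Longrightarrow> nb s e \<in> S"
    and nb_facet: "s \<in> S \<Longrightarrow> e facet_of X s \<Longrightarrow> e facet_of X (nb s e)"
    and nb_nb: "s \<in> S \<Longrightarrow> e facet_of X s \<Longrightarrow> nb (nb s e) e = s"
    and nb_indep: "s \<in> S \<Longrightarrow> e facet_of X s \<Longrightarrow> n (nb s e) \<notin> span {n s}"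
    and nb_le: "s \<in> S \<Longrightarrow> e facet_of X s \<Longrightarrow> x \<in> X s \<Longrightarrow> n (nb s e) \<bullet> x \<le> 0"
    and orb: "\<lbrakk>s \<in> S; e facet_of X s; G facet_of e; t \<in> orbit X nb s G; t \<noteq> s\<rbrakk>
       \<Longrightarrow> n t \<notin> span {n s} \<and> (\<forall>x\<in>X s. n t \<bullet> x \<le> 0)"
begin

definition "E s t \<longleftrightarrow> s \<in> S \<and> (\<exists>e. e facet_of X s \<and> t = nb s e)"

lemma span_X: "s \<in> S \<Longrightarrow> span (X s) = {x. n s \<bullet> x = 0}"
  by (rule span_hyperplane_eq) (simp_all add: X_pcone X_dim n_nz n_perp)

text \<open>The translation between the graph and the cone: for a direction in the hyperplane of
  \<open>s\<close>, positivity of the neighbour across \<open>e\<close> becomes visibility of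
  \<open>e\<close>.\<close>

lemma nb_normal:
  assumes "s \<in> S" "e facet_of X s"
  obtains a where "a > 0" "\<And>x. n s \<bullet> x = 0 \<Longrightarrow> n (nb s e) \<bullet> x = a * (fnormal (X s) e \<bullet> x)"
proof -
  have "n (nb s e) \<bullet> x = 0" if "x \<in> e" for x
    using n_perp[OF nb_in[OF assms]] facet_of_imp_subset[OF nb_facet[OF assms]] that by blast
  then obtain a where a: "a \<ge> 0" "\<And>x. x \<in> span (X s) \<Longrightarrow> n (nb s e) \<bullet> x = a * (fnormal (X s) e \<bullet> x)"
    using facet_normal_cone[OF X_pcone[OF assms(1)] assms(2), of "n (nb s e)"] nb_le[OF assms] by metis
  have "a \<noteq> 0"
  proof
    assume "a = 0"
    then have "n (nb s e) \<in> span {n s}" using a(2) span_X[OF assms(1)] by (intro perp_perp_singleton) auto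
    then show False using nb_indep[OF assms] by blast
  qed
  then show ?thesis using that[of a] a span_X[OF assms(1)] by auto
qed

lemma orbit_props:
  assumes "s \<in> S" "e facet_of X s" "G facet_of e" "t \<in> orbit X nb s G"
  shows "t \<in> S" "\<exists>f. f facet_of X t \<and> G facet_of f" "s \<in> orbit X nb t G"
proof -
  have "t \<in> S \<and> (\<exists>f. f facet_of X t \<and> G facet_of f) \<and> s \<in> orbit X nb t G"
    using assms(4)
  proof (induction rule: orbit.induct)
    case start
    then show ?case using assms by (auto intro: orbit.start)
  next
    case (step t f)
    then obtain f' where f': "f' facet_of X t" "G facet_of f'" and t: "t \<in> S" "s \<in> orbit X nb t G" by blast
    note G = facet_facet_codim2[OF f']
    have Gf: "G facet_of f" by (rule codim2_face_facet[OF X_pcone[OF t(1)] step.hyps(2) G(1) step.hyps(3) G(2,3)])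
    have "t \<in> orbit X nb (nb t f) G"
      using orbit.step[of "nb t f" X nb "nb t f" G, OF orbit.start nb_facet[OF t(1) step.hyps(2)] step.hyps(3)]
      by (simp add: nb_nb[OF t(1) step.hyps(2)])
    then have "s \<in> orbit X nb (nb t f) G" using t(2) by (rule orbit_trans)
    then show ?case using nb_in[OF t(1) step.hyps(2)] nb_facet[OF t(1) step.hyps(2)] Gf by blast
  qed
  then show "t \<in> S" "\<exists>f. f facet_of X t \<and> G facet_of f" "s \<in> orbit X nb t G" by blast+
qed

text \<open>Two nodes of the orbit lie in each other's orbit, so by \<open>orb\<close> their normals
  are not parallel. Hence \<open>n\<close> is injective on the orbit, and the finite set of normals
  bounds it.\<close>

lemma orbit_finite:
  assumes "s \<in> S" "e facet_of X s" "G facet_of e"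
  shows "finite (orbit X nb s G)"
proof (rule finite_imageD)
  show "finite (n ` orbit X nb s G)"
    by (rule finite_subset[OF _ fin]) (use orbit_props(1)[OF assms] in blast)
  show "inj_on n (orbit X nb s G)"
  proof (rule inj_onI, rule ccontr)
    fix t r assume tr: "t \<in> orbit X nb s G" "r \<in> orbit X nb s G" "n t = n r" "t \<noteq> r"
    obtain f where f: "f facet_of X t" "G facet_of f" using orbit_props(2)[OF assms tr(1)] by blast
    have "r \<in> orbit X nb t G" using orbit_trans[OF orbit_props(3)[OF assms tr(1)] tr(2)] .
    then have "n r \<notin> span {n t}" using orb[OF orbit_props(1)[OF assms tr(1)] f] tr(4) by blast
    then show False using tr(3) span_base[of "n t" "{n t}"] by simp
  qed
qed

lemma two_facets:
  assumes "s \<in> S" "e facet_of X s" "G facet_of e" "t \<in> orbit X nb s G"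
  shows "card {f. f facet_of X t \<and> G \<subseteq> f} = 2"
proof -
  obtain f where f: "f facet_of X t" "G facet_of f" using orbit_props(2)[OF assms] by blast
  have t: "t \<in> S" by (rule orbit_props(1)[OF assms])
  obtain f' where f': "f' facet_of X t" "f' \<noteq> f" "G facet_of f'"
    using codim2_other_facet[OF X_pcone[OF t] f] by metis
  have "{f. f facet_of X t \<and> G \<subseteq> f} = {f, f'}"
    using codim2_at_most_two_facets[OF X_pcone[OF t] f(1) f'(1) _ f'(2)[symmetric] facet_of_imp_subset[OF f(2)] facet_of_imp_subset[OF f'(3)] _ facet_facet_codim2(2)[OF f]]
      pcone_0[OF pcone_facet[OF pcone_facet[OF X_pcone[OF t] f(1)] f(2)]] f f' facet_of_imp_subset by blast
  then show ?thesis using f'(2) by simp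
qed

text \<open>All nodes around \<open>G\<close> other than \<open>s\<close> are positive on
  \<open>u\<close>, since on the hyperplane of \<open>s\<close> their normals are nonzero
  nonnegative combinations of those of \<open>e\<close> and \<open>e'\<close>. It remains to see
  that removing \<open>s\<close> does not separate its two neighbours around \<open>G\<close>, and
  this is a parity count.\<close>

lemma around_codim2:
  assumes s: "s \<in> S" and e: "e facet_of X s" "e' facet_of X s" "e \<noteq> e'"
    and G: "G facet_of e" "G facet_of e'"
    and u: "n s \<bullet> u = 0" "0 < fnormal (X s) e \<bullet> u" "0 < fnormal (X s) e' \<bullet> u"
  shows "pos_conn S E n u (nb s e) (nb s e')"
proof -
  define A where "A = orbit X nb s G - {s}"
  have Gsub: "G \<subseteq> e" "G \<subseteq> e'" using G facet_of_imp_subset by blast+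
  note props = orbit_props[OF s e(1) G(1)]
  have pos: "0 < u \<bullet> n t" if t: "t \<in> A" for t
  proof -
    have t': "t \<in> orbit X nb s G" "t \<noteq> s" using t by (auto simp: A_def)
    have nt: "n t \<notin> span {n s}" "\<And>x. x \<in> X s \<Longrightarrow> n t \<bullet> x \<le> 0" using orb[OF s e(1) G(1) t'] by auto
    obtain f where f: "f facet_of X t" "G facet_of f" using props(2)[OF t'(1)] by blast
    have "n t \<bullet> x = 0" if "x \<in> G" for x
      using n_perp[OF props(1)[OF t'(1)]] that f facet_of_imp_subset by blast
    then obtain a b where ab: "a \<ge> 0" "b \<ge> 0"
      "\<And>x. x \<in> span (X s) \<Longrightarrow> n t \<bullet> x = a * (fnormal (X s) e \<bullet> x) + b * (fnormal (X s) e' \<bullet> x)"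
      using codim2_normal_cone[OF X_pcone[OF s] e Gsub facet_facet_codim2(2)[OF e(1) G(1)], of "n t"]
        pcone_0[OF pcone_facet[OF pcone_facet[OF X_pcone[OF s] e(1)] G(1)]] nt(2) by metis
    have "\<not> (a = 0 \<and> b = 0)"
    proof
      assume "a = 0 \<and> b = 0"
      then have "n t \<in> span {n s}" using ab(3) span_X[OF s] by (intro perp_perp_singleton) auto
      then show False using nt(1) by blast
    qed
    then have "a > 0 \<or> b > 0" using ab by linarith
    moreover have "n t \<bullet> u = a * (fnormal (X s) e \<bullet> u) + b * (fnormal (X s) e' \<bullet> u)"
      using ab(3) u(1) span_X[OF s] by simp
    ultimately have "n t \<bullet> u > 0" using ab(1,2) u(2,3)
      by (metis add_nonneg_pos add_pos_nonneg less_eq_real_def mult_nonneg_nonneg mult_pos_pos)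
    then show ?thesis by (simp add: inner_commute)
  qed
  have nbs: "nb s e \<noteq> s" "nb s e' \<noteq> s"
    using nb_indep[OF s e(1)] nb_indep[OF s e(2)] span_base[of "n s" "{n s}"] by auto
  have eA: "nb s e \<in> A" "nb s e' \<in> A"
    using orbit.step[of s X nb s G, OF orbit.start e(1) Gsub(1)] orbit.step[of s X nb s G, OF orbit.start e(2) Gsub(2)] nbs by (auto simp: A_def)
  define R where "R = {(a, b). a \<in> A \<and> b \<in> A \<and> (\<exists>f. f facet_of X a \<and> G \<subseteq> f \<and> b = nb a f)}"
  have R_conn: "pos_conn S E n u a b" if "(a, b) \<in> R\<^sup>*" for a b
    using that unfolding pos_conn_def
    by (rule rtrancl_mono[THEN subsetD, rotated]) (use pos props(1) in \<open>auto simp: R_def pos_nodes_def E_def A_def\<close>)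
  \<comment> \<open>\<open>C\<close> is the component of \<open>nb s e\<close>. Each of its nodes
    has two ridges through \<open>G\<close>, so the number of pairs in \<open>H\<close> below is
    even, and crossing pairs up all of them except those leading to \<open>s\<close>. If
    \<open>nb s e'\<close> were missing, exactly one pair would lead to \<open>s\<close>.\<close>
  define C where "C = {t \<in> A. (nb s e, t) \<in> R\<^sup>*}"
  have "nb s e' \<in> C"
  proof (rule ccontr)
    assume nC: "nb s e' \<notin> C"
    have finC: "finite C" using orbit_finite[OF s e(1) G(1)] by (simp add: C_def A_def)
    define H where "H = Sigma C (\<lambda>t. {f. f facet_of X t \<and> G \<subseteq> f})"
    have cardf: "card {f. f facet_of X t \<and> G \<subseteq> f} = 2" if "t \<in> C" for t
      using two_facets[OF s e(1) G(1), of t] that by (auto simp: C_def A_def)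
    have finf: "finite {f. f facet_of X t \<and> G \<subseteq> f}" if "t \<in> C" for t
      by (rule card_ge_0_finite) (simp add: cardf[OF that])
    have cardH: "card H = 2 * card C" unfolding H_def using finC finf cardf by (simp add: card_SigmaI)
    have finH: "finite H" unfolding H_def using finC finf by blast
    define H0 where "H0 = {h \<in> H. nb (fst h) (snd h) \<noteq> s}"
    have CS: "t \<in> S" "t \<in> orbit X nb s G" if "t \<in> C" for t using that props(1) by (auto simp: C_def A_def)
    have "even (card H0)"
    proof (rule even_card_involution[of _ "\<lambda>(t,f). (nb t f, f)"])
      show "finite H0" using finH by (simp add: H0_def)
      fix h assume "h \<in> H0"
      then obtain t f where h: "h = (t,f)" "t \<in> C" "f facet_of X t" "G \<subseteq> f" "nb t f \<noteq> s"
        by (auto simp: H0_def H_def)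
      have tA: "nb t f \<in> A" using orbit.step[OF CS(2)[OF h(2)] h(3,4)] h(5) by (simp add: A_def)
      moreover have "t \<in> A" using h(2) by (simp add: C_def)
      ultimately have "(t, nb t f) \<in> R" using h by (auto simp: R_def)
      then have "nb t f \<in> C" using h(2) tA by (auto simp: C_def)
      then show "(case h of (t, f) \<Rightarrow> (nb t f, f)) \<in> H0"
        using h nb_facet[OF CS(1)[OF h(2)] h(3)] nb_nb[OF CS(1)[OF h(2)] h(3)] \<open>t \<in> A\<close>
        by (auto simp: H0_def H_def A_def)
      show "(case (case h of (t, f) \<Rightarrow> (nb t f, f)) of (t, f) \<Rightarrow> (nb t f, f)) = h"
        using h nb_nb[OF CS(1)[OF h(2)] h(3)] by simp
      show "(case h of (t, f) \<Rightarrow> (nb t f, f)) \<noteq> h"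
        using h nb_indep[OF CS(1)[OF h(2)] h(3)] span_base[of "n t" "{n t}"] by auto
    qed
    moreover have "H - H0 = {(nb s e, e)}"
    proof
      show "{(nb s e, e)} \<subseteq> H - H0"
        using eA(1) nb_facet[OF s e(1)] Gsub(1) nb_nb[OF s e(1)] by (auto simp: H_def H0_def C_def)
      show "H - H0 \<subseteq> {(nb s e, e)}"
      proof
        fix h assume "h \<in> H - H0"
        then obtain t f where h: "h = (t,f)" "t \<in> C" "f facet_of X t" "G \<subseteq> f" "nb t f = s"
          by (auto simp: H0_def H_def)
        have fs: "f facet_of X s" "nb s f = t" using nb_facet[OF CS(1)[OF h(2)] h(3)] nb_nb[OF CS(1)[OF h(2)] h(3)] h(5) by auto
        have "f = e \<or> f = e'"
          using codim2_at_most_two_facets[OF X_pcone[OF s] e(1,2) fs(1) e(3) Gsub h(4) facet_facet_codim2(2)[OF e(1) G(1)]]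
            pcone_0[OF pcone_facet[OF pcone_facet[OF X_pcone[OF s] e(1)] G(1)]] by blast
        then show "h \<in> {(nb s e, e)}" using h fs(2) nC by auto
      qed
    qed
    moreover have "card H = card H0 + card (H - H0)"
      using finH card_Diff_subset[of H0 H] card_mono[of H H0] by (simp add: H0_def finite_subset)
    ultimately show False using cardH by simp presburger
  qed
  then show ?thesis using R_conn by (simp add: C_def)
qed

lemma E_sym: "E s t \<Longrightarrow> E t s"
  unfolding E_def by (metis nb_in nb_facet nb_nb)

sublocale normal_graph S E n
proof
  show "finite (n ` S)" by (rule fin)
  show "E x y \<Longrightarrow> x \<in> S \<and> y \<in> S" for x y using nb_in by (auto simp: E_def)
  show "E x y \<Longrightarrow> E y x" for x y by (rule E_sym)
  show "E x y \<Longrightarrow> n y \<notin> span {n x}" for x y using nb_indep by (auto simp: E_def)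
  show "x \<in> S \<Longrightarrow> n x \<noteq> 0" for x by (rule n_nz)
  show "pos_conn S E n u y z" if xyz: "E x y" "E x z" and u: "u \<bullet> n x = 0" "0 < u \<bullet> n y" "0 < u \<bullet> n z" for x y z u
  proof -
    obtain e e' where e: "x \<in> S" "e facet_of X x" "y = nb x e" "e' facet_of X x" "z = nb x e'"
      using xyz by (auto simp: E_def)
    have u0: "n x \<bullet> u = 0" using u(1) by (simp add: inner_commute)
    have vis: "0 < fnormal (X x) f \<bullet> u" if f: "f facet_of X x" "0 < u \<bullet> n (nb x f)" for f
    proof -
      obtain a where a: "a > 0" "\<And>y. n x \<bullet> y = 0 \<Longrightarrow> n (nb x f) \<bullet> y = a * (fnormal (X x) f \<bullet> y)"
        using nb_normal[OF e(1) f(1)] by blast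
      have "0 < a * (fnormal (X x) f \<bullet> u)" using f(2) a(2)[OF u0] by (simp add: inner_commute)
      then show ?thesis using a(1) by (simp add: zero_less_mult_iff)
    qed
    have uspan: "u \<in> span (X x)" using span_X[OF e(1)] u0 by simp
    \<comment> \<open>Consecutive facets in such a chain share a cone of codimension two, where
      \<open>around_codim2\<close> applies.\<close>
    have "(e, e') \<in> (visible_adj (X x) u)\<^sup>*"
      using visible_facets_connected[OF X_pcone[OF e(1)] uspan e(2) _ e(4)] vis e u by blast
    then have "pos_conn S E n u (nb x e) (nb x e')"
    proof (induction rule: rtrancl_induct)
      case base
      then show ?case by (simp add: pos_conn_def)
    next
      case (step f g)
      have "pos_conn S E n u (nb x f) (nb x g)"
        using step.hyps(2) around_codim2[OF e(1) _ _ _ _ _ u0, of f g "f \<inter> g"] by (auto simp: visible_adj_def)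
      then show ?case using step.IH pos_conn_trans[of S E n u] by metis
    qed
    then show ?thesis using e by simp
  qed
qed

text \<open>Push an interior point \<open>p\<close> of the cone of \<open>s\<close> slightly along
  the outer normal \<open>n s\<close>: there \<open>s\<close> is positive and all its neighbours are
  negative, so no other reachable node is positive. Letting the push tend to 0 gives the inequality
  at \<open>p\<close>, and before the limit it excludes a normal in the direction of
  \<open>n s\<close>.\<close>

lemma support:
  assumes s: "s \<in> S" and f: "f1 facet_of X s" "f2 facet_of X s" "f1 \<noteq> f2"
    and t: "(s, t) \<in> {(a, b). E a b}\<^sup>*" "t \<noteq> s"
  shows "x \<in> X s \<Longrightarrow> n t \<bullet> x \<le> 0" "c > 0 \<Longrightarrow> n t \<noteq> c *\<^sub>R n s"
proof -
  have dim3: "dim {n (nb s f1), n s, n (nb s f2)} = 3"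
  proof -
    obtain a1 where a1: "a1 > 0" "\<And>x. n s \<bullet> x = 0 \<Longrightarrow> n (nb s f1) \<bullet> x = a1 * (fnormal (X s) f1 \<bullet> x)"
      using nb_normal[OF s f(1)] by blast
    obtain a2 where a2: "a2 > 0" "\<And>x. n s \<bullet> x = 0 \<Longrightarrow> n (nb s f2) \<bullet> x = a2 * (fnormal (X s) f2 \<bullet> x)"
      using nb_normal[OF s f(2)] by blast
    have n1: "n (nb s f1) \<notin> span {n s, n (nb s f2)}"
    proof
      assume "n (nb s f1) \<in> span {n s, n (nb s f2)}"
      then obtain k l where "n (nb s f1) - k *\<^sub>R n s = l *\<^sub>R n (nb s f2)"
        using span_breakdown_eq[of "n (nb s f1)" "n s" "{n (nb s f2)}"] by (auto simp: span_singleton)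
      then have kl: "n (nb s f1) = k *\<^sub>R n s + l *\<^sub>R n (nb s f2)" by (simp add: algebra_simps)
      have "a1 * (fnormal (X s) f1 \<bullet> x) = l * (a2 * (fnormal (X s) f2 \<bullet> x))" if "n s \<bullet> x = 0" for x
        using a1(2)[OF that] a2(2)[OF that] that by (simp add: kl inner_add_left)
      then have *: "fnormal (X s) f1 \<bullet> x = (l * a2 / a1) * (fnormal (X s) f2 \<bullet> x)" if "x \<in> span (X s)" for x
        using that span_X[OF s] a1(1) by (simp add: field_simps)
      obtain r where r: "r \<in> f2" "r \<notin> f1" using facet_not_subset[OF pcone_convex[OF X_pcone[OF s]] f(2,1)] f(3) by metis
      have rX: "r \<in> X s" using r f facet_of_imp_subset by blast
      have "fnormal (X s) f2 \<bullet> r = 0" using r fnormal(3)[OF X_pcone[OF s] f(2)] by blast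
      then show False using *[OF span_base[OF rX]] fnormal_less[OF X_pcone[OF s] f(1) rX r(2)] by simp
    qed
    have n2: "n s \<notin> span {n (nb s f2)}"
    proof
      assume "n s \<in> span {n (nb s f2)}"
      then obtain k where k: "n s = k *\<^sub>R n (nb s f2)" by (auto simp: span_singleton)
      then have "k \<noteq> 0" using n_nz[OF s] by auto
      then have "n (nb s f2) = (1/k) *\<^sub>R n s" using k by simp
      then show False using nb_indep[OF s f(2)] by (metis span_base span_scale singletonI)
    qed
    have "independent {n (nb s f2)}" using n_nz nb_in s f by simp
    from independent_insertI[OF n2 this] have i2: "independent {n s, n (nb s f2)}" .
    from independent_insertI[OF n1 this] have i3: "independent {n (nb s f1), n s, n (nb s f2)}" .
    have "n s \<noteq> n (nb s f2)" "n (nb s f1) \<noteq> n s" "n (nb s f1) \<noteq> n (nb s f2)"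
      using n1 n2 span_base[of "n s" "{n s, n (nb s f2)}"] span_base[of "n (nb s f2)" "{n s, n (nb s f2)}"]
        span_base[of "n (nb s f2)" "{n (nb s f2)}"] by auto
    then show ?thesis using dim_eq_card_independent[OF i3] by simp
  qed
  define u where "u p \<epsilon> = p + \<epsilon> *\<^sub>R n s" for p and \<epsilon> :: real
  have ev: "\<forall>\<^sub>F \<epsilon> in at_right 0. u p \<epsilon> \<bullet> n t \<le> 0 \<and> 0 < u p \<epsilon> \<bullet> n s" if p: "p \<in> rel_interior (X s)" for p
  proof -
    have pX: "p \<in> X s" using p rel_interior_subset by blast
    have finf: "finite {f. f facet_of X s}" using finite_polyhedron_facets X_pcone[OF s] by (auto simp: pcone_def)
    have "\<forall>\<^sub>F \<epsilon> in at_right 0. \<forall>f\<in>{f. f facet_of X s}. u p \<epsilon> \<bullet> n (nb s f) < 0"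
    proof (rule eventually_ball_finite[OF finf], rule ballI)
      fix f assume "f \<in> {f. f facet_of X s}"
      then have f: "f facet_of X s" by simp
      obtain a where a: "a > 0" "\<And>x. n s \<bullet> x = 0 \<Longrightarrow> n (nb s f) \<bullet> x = a * (fnormal (X s) f \<bullet> x)"
        using nb_normal[OF s f] by blast
      have "a * (fnormal (X s) f \<bullet> p) < 0"
        using fnormal_rel_interior[OF X_pcone[OF s] f p] a(1) by (simp add: mult_pos_neg)
      then have "u p 0 \<bullet> n (nb s f) < 0" using a(2)[OF n_perp[OF s pX]] by (simp add: u_def inner_commute)
      moreover have "((\<lambda>\<epsilon>. u p \<epsilon> \<bullet> n (nb s f)) \<longlongrightarrow> u p 0 \<bullet> n (nb s f)) (at_right 0)"
        unfolding u_def by (intro tendsto_intros)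
      ultimately show "\<forall>\<^sub>F \<epsilon> in at_right 0. u p \<epsilon> \<bullet> n (nb s f) < 0" by (rule order_tendstoD(2)[rotated])
    qed
    moreover have "\<forall>\<^sub>F \<epsilon> in at_right (0::real). 0 < \<epsilon>" by (simp add: eventually_at_right_less)
    ultimately show ?thesis
    proof eventually_elim
      case (elim \<epsilon>)
      have us: "0 < u p \<epsilon> \<bullet> n s" using elim(2) n_nz[OF s] n_perp[OF s pX]
        by (simp add: u_def inner_add_left inner_commute[of p])
      have "u p \<epsilon> \<bullet> n t \<le> 0"
      proof (rule isolated_node_unique[of s "nb s f1" "nb s f2"])
        show "E s (nb s f1)" "E s (nb s f2)" using s f by (auto simp: E_def)
        show "u p \<epsilon> \<bullet> n y < 0" if "E s y" for y using that elim(1) by (auto simp: E_def)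
      qed (use dim3 us t in auto)
      then show ?case using us by blast
    qed
  qed
  have ri: "n t \<bullet> p \<le> 0" if p: "p \<in> rel_interior (X s)" for p
  proof -
    have "((\<lambda>\<epsilon>. u p \<epsilon> \<bullet> n t) \<longlongrightarrow> u p 0 \<bullet> n t) (at_right 0)"
      unfolding u_def by (intro tendsto_intros)
    moreover have "\<forall>\<^sub>F \<epsilon> in at_right 0. u p \<epsilon> \<bullet> n t \<le> 0" using ev[OF p] by (rule eventually_mono) simp
    ultimately have "u p 0 \<bullet> n t \<le> 0" using tendsto_upperbound trivial_limit_at_right_real by blast
    then show ?thesis by (simp add: u_def inner_commute)
  qed
  show "n t \<bullet> x \<le> 0" if "x \<in> X s"
  proof -
    have "closure (rel_interior (X s)) \<subseteq> {y. n t \<bullet> y \<le> 0}"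
      using ri by (intro closure_minimal) (auto simp: closed_halfspace_le)
    moreover have "X s \<subseteq> closure (rel_interior (X s))"
      using convex_closure_rel_interior[OF pcone_convex[OF X_pcone[OF s]]] closure_subset by blast
    ultimately show ?thesis using that by blast
  qed
  show "n t \<noteq> c *\<^sub>R n s" if "c > 0"
  proof
    assume eq: "n t = c *\<^sub>R n s"
    obtain p where "p \<in> rel_interior (X s)" using pcone_rel_interior[OF X_pcone[OF s]] by blast
    from eventually_happens[OF ev[OF this]] obtain \<epsilon> where "u p \<epsilon> \<bullet> n t \<le> 0" "0 < u p \<epsilon> \<bullet> n s"
      by (auto simp: trivial_limit_at_right_real)
    then show False using eq that by (simp add: mult_le_0_iff)
  qed
qed

end

section \<open>Complexes of pointed cones\<close>

text \<open>With at most one facet, a nonzero vector of the span orthogonal to its normal would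
  satisfy all facet inequalities together with its negative, and \<open>X\<close> would contain a
  line.\<close>

lemma pointed_two_facets:
  fixes X :: "'w::euclidean_space set"
  assumes X: "pcone X" and u: "\<And>x. x \<in> X \<Longrightarrow> x \<noteq> 0 \<Longrightarrow> 0 < u \<bullet> x" and d: "aff_dim X \<ge> 2"
  obtains e1 e2 where "e1 facet_of X" "e2 facet_of X" "e1 \<noteq> e2"
proof -
  have noline: "z = 0" if "z \<in> X" "- z \<in> X" for z
    using u[of z] u[of "-z"] that by (cases "z = 0") auto
  have "\<exists>e1 e2. e1 facet_of X \<and> e2 facet_of X \<and> e1 \<noteq> e2"
  proof (rule ccontr)
    assume no: "\<not> ?thesis"
    then obtain m where m: "\<And>e. e facet_of X \<Longrightarrow> fnormal X e = m" by metis
    define V where "V = {y \<in> span X. \<forall>x\<in>span ({m} \<inter> span X). orthogonal x y}"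
    have "dim V + dim (span ({m} \<inter> span X)) = dim (span X)"
      unfolding V_def by (rule dim_subspace_orthogonal_to_vectors) (auto simp: span_minimal)
    moreover have "dim ({m} \<inter> span X) \<le> 1" using dim_le_card'[of "{m} \<inter> span X"] card_mono[of "{m}" "{m} \<inter> span X"] by simp
    ultimately have "dim V \<ge> 1" using d pcone_aff_dim[OF X] by simp
    then have "V \<noteq> {0}" "V \<noteq> {}" by auto
    moreover have "0 \<in> V" unfolding V_def using span_0 orthogonal_clauses(1) by blast
    ultimately obtain z where z: "z \<in> V" "z \<noteq> 0" by blast
    have mz: "fnormal X e \<bullet> z = 0" if "e facet_of X" for e
    proof -
      have "m \<in> {m} \<inter> span X" using m[OF that] fnormal(1)[OF X that] by simp
      then have "orthogonal m z" using z(1) span_base unfolding V_def by blast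
      then show ?thesis using m[OF that] by (simp add: orthogonal_def)
    qed
    have zs: "z \<in> span X" using z(1) by (simp add: V_def)
    have "z \<in> X" "- z \<in> X" using mz zs span_neg by (auto intro!: pcone_memI[OF X])
    then show False using noline z(2) by blast
  qed
  then show ?thesis using that by blast
qed

text \<open>From the negative of an interior point every facet is visible.\<close>

lemma facets_strongly_connected:
  assumes X: "pcone X" and e: "e facet_of X" "e' facet_of X"
  obtains u where "(e, e') \<in> (visible_adj X u)\<^sup>*"
proof -
  obtain p where p: "p \<in> rel_interior X" using pcone_rel_interior[OF X] by blast
  have "- p \<in> span X" using p rel_interior_subset span_base span_neg by blast
  then show ?thesis
    using visible_facets_connected[OF X, of "-p" e e'] fnormal_rel_interior[OF X _ p] e that by force
qed

section \<open>Cells and the cones over them\<close>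

definition cn :: "('p \<Rightarrow> 'w::euclidean_space) \<Rightarrow> 'p set \<Rightarrow> 'w set" where
  "cn h c = conic hull (h ` c)"

lemma cn_iff: "y \<in> cn h c \<longleftrightarrow> (\<exists>t x. 0 \<le> t \<and> x \<in> c \<and> y = t *\<^sub>R h x)"
  unfolding cn_def conic_hull_explicit by auto

lemma cn_base: "x \<in> c \<Longrightarrow> h x \<in> cn h c"
  unfolding cn_iff by (metis scaleR_one zero_le_one)

lemma cn_mono: "c \<subseteq> c' \<Longrightarrow> cn h c \<subseteq> cn h c'"
  unfolding cn_def by (intro hull_mono image_mono)

lemma convex_cone_hull_le:
  assumes "\<And>x. x \<in> A \<Longrightarrow> n \<bullet> x \<le> 0" "y \<in> convex_cone hull A"
  shows "n \<bullet> y \<le> 0"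
proof -
  have "convex_cone {y. n \<bullet> y \<le> 0}"
    by (auto simp: convex_cone_def conic_def convex_halfspace_le mult_nonneg_nonpos intro: exI[of _ 0])
  then have "convex_cone hull A \<subseteq> {y. n \<bullet> y \<le> 0}" using assms(1) by (intro hull_minimal) auto
  then show ?thesis using assms(2) by blast
qed

text \<open>What the two geometries have in common: \<open>h\<close> sends points to vectors and
  cells to pointed cones. It is injective on rays only within one cell, so a cell can be recovered
  from its cone only inside a larger cell; \<open>mem_cell\<close> and \<open>pre_C\<close>
  therefore carry a common cell \<open>c\<close>.\<close>

locale cell_cones =
  fixes K :: "'p set set" and h :: "'p \<Rightarrow> 'w::euclidean_space"
  assumes finK: "finite K"
    and ne: "c \<in> K \<Longrightarrow> c \<noteq> {}"
    and pc: "c \<in> K \<Longrightarrow> pcone (cn h c)"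
    and pointed: "c \<in> K \<Longrightarrow> \<exists>u. \<forall>x\<in>c. 0 < u \<bullet> h x"
    and rays: "\<lbrakk>c \<in> K; x \<in> c; y \<in> c; 0 < t; h x = t *\<^sub>R h y\<rbrakk> \<Longrightarrow> x = y"
    and faceK: "\<lbrakk>c \<in> K; \<forall>x\<in>c. m \<bullet> h x \<le> 0; \<exists>x\<in>c. m \<bullet> h x = 0\<rbrakk> \<Longrightarrow> {x \<in> c. m \<bullet> h x = 0} \<in> K"
    and subK: "\<lbrakk>c \<in> K; b \<in> K; b \<subseteq> c\<rbrakk> \<Longrightarrow> \<exists>m. (\<forall>x\<in>c. m \<bullet> h x \<le> 0) \<and> b = {x \<in> c. m \<bullet> h x = 0}"
    and intK: "\<lbrakk>c \<in> K; c' \<in> K; c \<inter> c' \<noteq> {}\<rbrakk> \<Longrightarrow> c \<inter> c' \<in> K"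
begin

abbreviation "C \<equiv> cn h"
definition "V = {v. {v} \<in> K}"
definition "pre c e = {x \<in> c. h x \<in> e}"
definition "Fac = {c \<in> K. \<forall>c'\<in>K. c \<subseteq> c' \<longrightarrow> c' = c}"

lemma FacK: "s \<in> Fac \<Longrightarrow> s \<in> K" by (simp add: Fac_def)

lemma h_nz: "c \<in> K \<Longrightarrow> x \<in> c \<Longrightarrow> h x \<noteq> 0"
  using pointed by fastforce

lemma C_nz: "c \<in> K \<Longrightarrow> C c \<noteq> {0}"
  using ne cn_base[of _ c h] h_nz by fastforce

lemma C_pointed:
  assumes "c \<in> K" obtains u where "\<And>x. x \<in> C c \<Longrightarrow> x \<noteq> 0 \<Longrightarrow> 0 < u \<bullet> x"
proof -
  obtain u where "\<forall>x\<in>c. 0 < u \<bullet> h x" using pointed[OF assms] by blast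
  then show ?thesis using that[of u] unfolding cn_iff by (force simp: zero_less_mult_iff)
qed

lemma C_dim_pos: "c \<in> K \<Longrightarrow> aff_dim (C c) \<ge> 1"
proof -
  assume c: "c \<in> K"
  have "dim (C c) \<noteq> 0" using C_nz[OF c] pcone_0[OF pc[OF c]] unfolding dim_eq_0 by blast
  then show ?thesis using pcone_aff_dim[OF pc[OF c]] by linarith
qed

lemma C_le: "(\<And>x. x \<in> c \<Longrightarrow> m \<bullet> h x \<le> 0) \<Longrightarrow> y \<in> C c \<Longrightarrow> m \<bullet> y \<le> 0"
  unfolding cn_iff by (auto simp: mult_nonneg_nonpos)

lemma C_eq0: "(\<And>x. x \<in> c \<Longrightarrow> m \<bullet> h x = 0) \<Longrightarrow> y \<in> C c \<Longrightarrow> m \<bullet> y = 0"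
  unfolding cn_iff by auto

lemma C_face:
  assumes c: "c \<in> K" and b: "b \<in> K" "b \<subseteq> c"
  shows "C b face_of C c"
proof -
  obtain m where m: "\<forall>x\<in>c. m \<bullet> h x \<le> 0" "b = {x \<in> c. m \<bullet> h x = 0}" using subK[OF c b] by blast
  have "C b = C c \<inter> {y. m \<bullet> y = 0}"
  proof
    show "C b \<subseteq> C c \<inter> {y. m \<bullet> y = 0}" using cn_mono[OF b(2)] C_eq0[of b m] m(2) by blast
    show "C c \<inter> {y. m \<bullet> y = 0} \<subseteq> C b"
    proof
      fix y assume y: "y \<in> C c \<inter> {y. m \<bullet> y = 0}"
      then obtain t x where t: "0 \<le> t" "x \<in> c" "y = t *\<^sub>R h x" by (auto simp: cn_iff)
      show "y \<in> C b"
      proof (cases "t = 0")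
        case True
        then show ?thesis using t pcone_0[OF pc[OF b(1)]] by simp
      next
        case False
        then have "x \<in> b" using y t m(2) by auto
        then show ?thesis using t by (auto simp: cn_iff)
      qed
    qed
  qed
  then show ?thesis using face_of_Int_supporting_hyperplane_le[OF pcone_convex[OF pc[OF c]], of m 0] C_le[of c m] m(1) by simp
qed

lemma pre_cell:
  assumes c: "c \<in> K" and e: "e face_of C c" "e \<noteq> {}" "e \<noteq> {0}"
  shows "pre c e \<in> K" "pre c e \<subseteq> c" "C (pre c e) = e"
proof -
  obtain m where m: "\<And>x. x \<in> C c \<Longrightarrow> m \<bullet> x \<le> 0" "e = {x \<in> C c. m \<bullet> x = 0}"
    using pcone_face_normal[OF pc[OF c] e(1,2)] by metis
  have pe: "pre c e = {x \<in> c. m \<bullet> h x = 0}" unfolding pre_def m(2) using cn_base[of _ c h] by blast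
  obtain y where y: "y \<in> e" "y \<noteq> 0" using e(2,3) by blast
  then obtain t x where t: "0 \<le> t" "x \<in> c" "y = t *\<^sub>R h x" using m(2) by (auto simp: cn_iff)
  then have "m \<bullet> h x = 0" using y m(2) by auto
  then show "pre c e \<in> K" unfolding pe using faceK[OF c, of m] m(1) cn_base[of _ c h] t(2) by blast
  show "pre c e \<subseteq> c" by (auto simp: pre_def)
  have pce: "pcone e" by (rule pcone_face[OF pc[OF c] e(1,2)])
  show "C (pre c e) = e"
  proof
    show "C (pre c e) \<subseteq> e" using pcone_scale[OF pce] by (auto simp: cn_iff pre_def)
    show "e \<subseteq> C (pre c e)"
    proof
      fix y assume y: "y \<in> e"
      then obtain t x where t: "0 \<le> t" "x \<in> c" "y = t *\<^sub>R h x" using m(2) by (auto simp: cn_iff)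
      show "y \<in> C (pre c e)"
      proof (cases "t = 0")
        case True
        then show ?thesis using t pcone_0[OF pc[OF \<open>pre c e \<in> K\<close>]] by simp
      next
        case False
        then have "x \<in> pre c e" unfolding pe using y t m(2) by auto
        then show ?thesis using t by (auto simp: cn_iff)
      qed
    qed
  qed
qed

lemma mem_cell:
  assumes "c \<in> K" "b \<in> K" "b \<subseteq> c" "x \<in> c" "h x \<in> C b"
  shows "x \<in> b"
proof -
  obtain t y where t: "0 \<le> t" "y \<in> b" "h x = t *\<^sub>R h y" using assms(5) by (auto simp: cn_iff)
  moreover have "t \<noteq> 0" using t h_nz[OF assms(1,4)] by auto
  ultimately have "x = y" using rays[OF assms(1,4), of y t] assms(3) by auto
  then show ?thesis using t by simp
qed

lemma pre_C:
  assumes "c \<in> K" "b \<in> K" "b \<subseteq> c" shows "pre c (C b) = b"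
  using mem_cell[OF assms] assms(3) cn_base[of _ b h] by (auto simp: pre_def)

lemma C_dim_less:
  assumes "c \<in> K" "b \<in> K" "b \<subseteq> c" "b \<noteq> c" shows "aff_dim (C b) < aff_dim (C c)"
proof -
  have "C b \<noteq> C c" using pre_C[OF assms(1-3)] pre_C[OF assms(1,1) order_refl] assms(4) by metis
  then show ?thesis using face_of_aff_dim_lt[OF pcone_convex[OF pc[OF assms(1)]] C_face[OF assms(1-3)]] by blast
qed

lemma facet_cell:
  assumes c: "c \<in> K" and e: "e facet_of C c" and d: "aff_dim (C c) \<ge> 2"
  shows "pre c e \<in> K" "pre c e \<subseteq> c" "C (pre c e) = e" "pre c e \<noteq> c"
proof -
  have "e \<noteq> {0}" using e d by (auto simp: facet_of_def)
  then show "pre c e \<in> K" "pre c e \<subseteq> c" "C (pre c e) = e"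
    using pre_cell[OF c, of e] e by (auto simp: facet_of_def)
  then show "pre c e \<noteq> c" using e by auto
qed

lemma ray_cell:
  assumes c: "c \<in> K" and d: "aff_dim (C c) < 2"
  obtains v where "c = {v}" "v \<in> V"
proof -
  obtain v where v: "v \<in> c" using ne[OF c] by blast
  have "dim (C c) \<le> 1" using d pcone_aff_dim[OF pc[OF c]] by simp
  have hv: "h v \<in> C c" "h v \<noteq> 0" using v cn_base h_nz[OF c] by auto
  have "C c \<subseteq> span {h v}"
    by (rule card_ge_dim_independent) (use hv \<open>dim (C c) \<le> 1\<close> in auto)
  have "x = v" if x: "x \<in> c" for x
  proof -
    have "h x \<in> span {h v}" using \<open>C c \<subseteq> span {h v}\<close> cn_base[OF x] by blast
    then obtain t where t: "h x = t *\<^sub>R h v" by (auto simp: span_singleton)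
    obtain u where u: "\<forall>x\<in>c. 0 < u \<bullet> h x" using pointed[OF c] by blast
    have "0 < t * (u \<bullet> h v)" using u x t by (metis inner_scaleR_right)
    then have "0 < t" using u v by (metis less_asym zero_less_mult_iff)
    then show ?thesis using rays[OF c x v] t by blast
  qed
  then have "c = {v}" using v by blast
  then show ?thesis using that c by (simp add: V_def)
qed

text \<open>Induction on the dimension: from a point of the cone go against some \<open>y\<close> in
  one facet until the cone is left through a facet \<open>f\<close>. The point is then a point of
  \<open>f\<close> plus a multiple of \<open>y\<close>, and both facets are generated by their
  vertices.\<close>

lemma C_generated:
  "c \<in> K \<Longrightarrow> C c = convex_cone hull (h ` (c \<inter> V))"
proof (induction "nat (aff_dim (C c))" arbitrary: c rule: less_induct)
  case less
  note c = less.prems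
  have sup: "convex_cone hull (h ` (c \<inter> V)) \<subseteq> C c"
  proof (rule hull_minimal)
    show "h ` (c \<inter> V) \<subseteq> C c" using cn_base[of _ c h] by (auto simp: image_subset_iff)
    show "convex_cone (C c)" using pc[OF c] pcone_convex by (auto simp: convex_cone_def pcone_def)
  qed
  have conv: "x + y \<in> convex_cone hull (h ` (c \<inter> V))"
    if "x \<in> convex_cone hull (h ` (c \<inter> V))" "y \<in> convex_cone hull (h ` (c \<inter> V))" for x y
    using that by (rule convex_cone_hull_add)
  have sub: "C c \<subseteq> convex_cone hull (h ` (c \<inter> V))"
  proof (cases "aff_dim (C c) < 2")
    case True
    then obtain v where v: "c = {v}" "v \<in> V" using ray_cell[OF c] by blast
    show ?thesis
    proof
      fix y assume "y \<in> C c"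
      then obtain t where "0 \<le> t" "y = t *\<^sub>R h v" using v by (auto simp: cn_iff)
      then show "y \<in> convex_cone hull (h ` (c \<inter> V))"
        using v convex_cone_hull_mul[OF hull_inc[of "h v" "h ` (c \<inter> V)" convex_cone]] by auto
    qed
  next
    case False
    then have d: "aff_dim (C c) \<ge> 2" by simp
    have fac: "e \<subseteq> convex_cone hull (h ` (c \<inter> V))" if e: "e facet_of C c" for e
    proof -
      note p = facet_cell[OF c e d]
      have "C (pre c e) = convex_cone hull (h ` (pre c e \<inter> V))"
      proof (rule less.hyps)
        show "nat (aff_dim (C (pre c e))) < nat (aff_dim (C c))"
          using C_dim_less[OF c p(1,2,4)] d by simp
      qed (rule p(1))
      also have "\<dots> \<subseteq> convex_cone hull (h ` (c \<inter> V))" using p(2) by (intro hull_mono) blast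
      finally show ?thesis using p(3) by simp
    qed
    obtain u where u: "\<And>x. x \<in> C c \<Longrightarrow> x \<noteq> 0 \<Longrightarrow> 0 < u \<bullet> x" using C_pointed[OF c] by blast
    obtain e1 e2 where e: "e1 facet_of C c" "e2 facet_of C c" "e1 \<noteq> e2"
      using pointed_two_facets[OF pc[OF c] u d] by blast
    \<comment> \<open>Since \<open>y\<close> is not in \<open>e2\<close>, the facet
      \<open>e2\<close> is visible from \<open>- y\<close>, so the ray does leave the cone.\<close>
    obtain y where y: "y \<in> e1" "y \<notin> e2" using facet_not_subset[OF pcone_convex[OF pc[OF c]] e] by metis
    have yC: "y \<in> C c" using y e facet_of_imp_subset by blast
    have vis: "0 < fnormal (C c) e2 \<bullet> (- y)" using fnormal_less[OF pc[OF c] e(2) yC y(2)] by simp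
    have ys: "- y \<in> span (C c)" using span_neg[OF span_base[OF yC]] .
    show ?thesis
    proof
      fix x assume x: "x \<in> C c"
      obtain f t where f: "f facet_of C c" "t \<ge> 0" "x + t *\<^sub>R (- y) \<in> f"
        using exit_facet[OF pc[OF c] x ys e(2) vis] by metis
      have "(x + t *\<^sub>R (- y)) + t *\<^sub>R y \<in> convex_cone hull (h ` (c \<inter> V))"
        by (rule conv[OF subsetD[OF fac[OF f(1)] f(3)] convex_cone_hull_mul[OF subsetD[OF fac[OF e(1)] y(1)] f(2)]])
      then show "x \<in> convex_cone hull (h ` (c \<inter> V))" by simp
    qed
  qed
  show ?case using sub sup by blast
qed

lemma vertices_zero:
  assumes c: "c \<in> K" and z: "\<And>w. w \<in> c \<Longrightarrow> w \<in> V \<Longrightarrow> m \<bullet> h w = 0" and x: "x \<in> C c"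
  shows "m \<bullet> x = 0"
proof -
  have "x \<in> convex_cone hull (h ` (c \<inter> V))" using x C_generated[OF c] by blast
  moreover have "m \<bullet> y \<le> 0" "(- m) \<bullet> y \<le> 0" if "y \<in> h ` (c \<inter> V)" for y using that z by auto
  ultimately have "m \<bullet> x \<le> 0" "(- m) \<bullet> x \<le> 0"
    by (blast intro: convex_cone_hull_le)+
  then show ?thesis by simp
qed

lemma ex_vertex:
  assumes c: "c \<in> K" obtains v where "v \<in> c" "v \<in> V"
proof -
  have "c \<inter> V \<noteq> {}"
  proof
    assume "c \<inter> V = {}"
    then have "C c = {0}" using C_generated[OF c] by simp
    then show False using C_nz[OF c] by blast
  qed
  then show ?thesis using that by blast
qed

text \<open>The functional that cuts \<open>c \<inter> b\<close> out of \<open>c\<close> vanishes at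
  all vertices of \<open>c\<close>, hence on all of \<open>c\<close>.\<close>

lemma subset_by_vertices:
  assumes c: "c \<in> K" "b \<in> K" and v: "\<And>w. w \<in> c \<Longrightarrow> w \<in> V \<Longrightarrow> w \<in> b"
  shows "c \<subseteq> b"
proof -
  obtain w where "w \<in> c" "w \<in> V" using ex_vertex[OF c(1)] by blast
  then have i: "c \<inter> b \<in> K" using v intK[OF c] by blast
  obtain m where m: "\<forall>x\<in>c. m \<bullet> h x \<le> 0" "c \<inter> b = {x \<in> c. m \<bullet> h x = 0}" using subK[OF c(1) i] by blast
  have "m \<bullet> h w = 0" if "w \<in> c" "w \<in> V" for w using that v m(2) by blast
  then have "m \<bullet> h x = 0" if "x \<in> c" for x using vertices_zero[OF c(1), of m] cn_base[OF that] by blast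
  then show ?thesis using m(2) by blast
qed

lemma Fac_sub: "c \<in> Fac \<Longrightarrow> c' \<in> Fac \<Longrightarrow> c \<subseteq> c' \<Longrightarrow> c = c'"
  by (auto simp: Fac_def)

lemma Fac_exists:
  assumes "c \<in> K" obtains s where "s \<in> Fac" "c \<subseteq> s"
proof -
  obtain s where s: "s \<in> {s \<in> K. c \<subseteq> s}" "\<forall>b\<in>{s \<in> K. c \<subseteq> s}. s \<subseteq> b \<longrightarrow> s = b"
    using finite_has_maximal[of "{s \<in> K. c \<subseteq> s}"] finK assms by auto
  then have "s \<in> Fac" unfolding Fac_def by auto
  then show ?thesis using that s by blast
qed

text \<open>Convex position, tested on one cell \<open>t\<close> at a time. The test asks for
  membership of the vertex itself and not of its image, because \<open>h\<close> is not known to be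
  injective across cells.\<close>

definition "supp m s t \<longleftrightarrow> (\<forall>x\<in>t. m \<bullet> h x \<le> 0) \<and> (\<forall>w\<in>t \<inter> V. m \<bullet> h w = 0 \<longleftrightarrow> w \<in> s)"

lemma supp_perp: "s \<in> K \<Longrightarrow> supp m s s \<Longrightarrow> x \<in> C s \<Longrightarrow> m \<bullet> x = 0"
  using vertices_zero[of s m x] by (auto simp: supp_def)

lemma supp_le: "supp m s t \<Longrightarrow> x \<in> C t \<Longrightarrow> m \<bullet> x \<le> 0"
  using C_le[of t m x] by (auto simp: supp_def)

lemma supp_sub:
  assumes "supp m s t" "s \<in> K" "t \<in> K" "e \<in> K" "e \<subseteq> t" "\<And>x. x \<in> e \<Longrightarrow> m \<bullet> h x = 0"
  shows "e \<subseteq> s"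
  by (rule subset_by_vertices[OF assms(4,2)]) (use assms(1,5,6) in \<open>auto simp: supp_def\<close>)

lemma supp_strict:
  assumes "supp m s t" "s \<in> Fac" "t \<in> Fac" "s \<noteq> t"
  obtains w where "w \<in> t" "w \<in> V" "m \<bullet> h w < 0"
proof -
  have "\<not> t \<subseteq> s" using assms Fac_sub by blast
  then obtain w where "w \<in> t" "w \<in> V" "w \<notin> s" using subset_by_vertices[of t s] assms FacK by blast
  then show ?thesis using that assms(1) unfolding supp_def by force
qed

end

text \<open>Facets that mutually support each other are facets of their common conic hull.\<close>

locale facet_family = cell_cones K h for K :: "'p set set" and h :: "'p \<Rightarrow> 'w::euclidean_space" +
  fixes T :: "'p set set" and \<nu> :: "'p set \<Rightarrow> 'w"
  assumes TF: "T \<subseteq> Fac" and T2: "\<exists>s\<in>T. \<exists>t\<in>T. s \<noteq> t"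
    and Tsupp: "s \<in> T \<Longrightarrow> t \<in> T \<Longrightarrow> supp (\<nu> s) s t" and Tnz: "s \<in> T \<Longrightarrow> \<nu> s \<noteq> 0"
    and Tdim: "s \<in> T \<Longrightarrow> aff_dim (cn h s) = int DIM('w) - 1"
begin

definition "P = convex_cone hull (h ` (\<Union>T \<inter> V))"

lemma TK: "s \<in> T \<Longrightarrow> s \<in> K" using TF FacK by blast

lemma P_pcone: "pcone P"
proof -
  have "(\<lambda>v. {v}) ` V \<subseteq> K" by (auto simp: V_def)
  then have "finite V" using finK by (metis finite_imageD finite_subset inj_on_def the_elem_eq)
  then have "polyhedron P" unfolding P_def by (intro polyhedron_convex_cone_hull) simp
  then show ?thesis unfolding pcone_def P_def
    using conic_convex_cone_hull convex_cone_hull_nonempty by blast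
qed

lemma sub_P: "s \<in> T \<Longrightarrow> C s \<subseteq> P"
  unfolding P_def C_generated[OF TK] by (rule hull_mono) blast

lemma P_le: "s \<in> T \<Longrightarrow> x \<in> P \<Longrightarrow> \<nu> s \<bullet> x \<le> 0"
  unfolding P_def by (rule convex_cone_hull_le) (use Tsupp in \<open>auto simp: supp_def\<close>)

lemma P_zero:
  assumes s: "s \<in> T" and x: "x \<in> P" "\<nu> s \<bullet> x = 0"
  shows "x \<in> C s"
proof -
  \<comment> \<open>\<open>Q\<close> is a convex cone because a sum of two nonpositive values is 0
    only if both are; it contains the generators of \<open>P\<close> by mutual support.\<close>
  define Q where "Q = {y. \<nu> s \<bullet> y \<le> 0 \<and> (\<nu> s \<bullet> y = 0 \<longrightarrow> y \<in> C s)}"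
  note Cs = pc[OF TK[OF s]]
  have "convex_cone Q" unfolding convex_cone_iff
  proof (intro conjI allI ballI impI)
    show "0 \<in> Q" using pcone_0[OF Cs] by (simp add: Q_def)
    show "x + y \<in> Q" if "x \<in> Q" "y \<in> Q" for x y
    proof -
      have "\<nu> s \<bullet> x = 0 \<and> \<nu> s \<bullet> y = 0" if "\<nu> s \<bullet> (x + y) = 0"
        using that \<open>x \<in> Q\<close> \<open>y \<in> Q\<close> by (auto simp: Q_def inner_add_right)
      then show ?thesis using that pcone_add[OF Cs] by (auto simp: Q_def inner_add_right)
    qed
    show "c *\<^sub>R x \<in> Q" if "x \<in> Q" "0 \<le> c" for x c
      using that pcone_scale[OF Cs] pcone_0[OF Cs] by (cases "c = 0") (auto simp: Q_def mult_nonneg_nonpos)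
  qed
  moreover have "h ` (\<Union>T \<inter> V) \<subseteq> Q"
  proof clarify
    fix w t assume w: "w \<in> V" "t \<in> T" "w \<in> t"
    then show "h w \<in> Q" using Tsupp[OF s w(2)] cn_base[of w s h] by (auto simp: Q_def supp_def)
  qed
  ultimately have "P \<subseteq> Q" unfolding P_def by (intro hull_minimal)
  then show ?thesis using x by (auto simp: Q_def)
qed

lemma P_eq: "s \<in> T \<Longrightarrow> C s = {x \<in> P. \<nu> s \<bullet> x = 0}"
  using sub_P P_zero supp_perp[OF TK Tsupp] by blast

lemma P_dim: "aff_dim P = int DIM('w)"
proof -
  obtain s t where st: "s \<in> T" "t \<in> T" "s \<noteq> t" using T2 by blast
  obtain w where w: "w \<in> t" "w \<in> V" "\<nu> s \<bullet> h w < 0"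
    using supp_strict[OF Tsupp[OF st(1,2)]] st TF by blast
  have "h w \<notin> affine hull (C s)"
  proof
    assume "h w \<in> affine hull (C s)"
    moreover have "affine hull (C s) \<subseteq> {x. \<nu> s \<bullet> x = 0}"
      by (rule hull_minimal) (use P_eq[OF st(1)] in \<open>auto simp: affine_hyperplane\<close>)
    ultimately show False using w(3) by auto
  qed
  then have "aff_dim (insert (h w) (C s)) = int DIM('w)" using Tdim[OF st(1)] by (simp add: aff_dim_insert)
  moreover have "insert (h w) (C s) \<subseteq> P" using sub_P[OF st(1)] sub_P[OF st(2)] cn_base[OF w(1)] by blast
  ultimately have "int DIM('w) \<le> aff_dim P" by (metis aff_dim_subset)
  then show ?thesis using aff_dim_le_DIM[of P] by linarith
qed

lemma P_facet: "s \<in> T \<Longrightarrow> C s facet_of P"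
proof -
  assume s: "s \<in> T"
  have "C s = P \<inter> {x. \<nu> s \<bullet> x = 0}" using P_eq[OF s] by blast
  then have "C s face_of P"
    using face_of_Int_supporting_hyperplane_le[OF pcone_convex[OF P_pcone], of "\<nu> s" 0] P_le[OF s] by simp
  then show ?thesis using Tdim[OF s] P_dim pcone_0[OF pc[OF TK[OF s]]] by (auto simp: facet_of_def)
qed

lemma P_span: "span P = UNIV"
proof -
  have "dim P = DIM('w)" using P_dim pcone_aff_dim[OF P_pcone] by simp
  then show ?thesis by (simp add: dim_eq_full)
qed

lemma fnormal_\<nu>:
  assumes s: "s \<in> T"
  obtains a where "a > 0" "\<nu> s = a *\<^sub>R fnormal P (C s)"
proof -
  obtain a where a: "a \<ge> 0" "\<And>x. x \<in> span P \<Longrightarrow> \<nu> s \<bullet> x = a * (fnormal P (C s) \<bullet> x)"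
    using facet_normal_cone[OF P_pcone P_facet[OF s], of "\<nu> s"] P_le[OF s] P_eq[OF s] by blast
  then have "\<forall>x. \<nu> s \<bullet> x = (a *\<^sub>R fnormal P (C s)) \<bullet> x" unfolding P_span by simp
  then have "\<nu> s = a *\<^sub>R fnormal P (C s)" by (simp only: vector_eq_rdot)
  moreover have "a \<noteq> 0" using calculation Tnz[OF s] by auto
  ultimately show ?thesis using that[of a] a(1) by auto
qed

end

section \<open>Boundary ridges\<close>

lemma rtrancl_first_step: "(s, t) \<in> r\<^sup>* \<Longrightarrow> s \<noteq> t \<Longrightarrow> \<exists>b. (s, b) \<in> r \<and> b \<noteq> s"
  by (induction rule: rtrancl_induct) blast+

context cell_cones
begin

text \<open>Cones have one dimension more than their cells, and the ambient dimension is
  \<open>DIM('w) - 1\<close>. So the facets of the manifold have cones of dimension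
  \<open>DIM('w) - 1\<close>, its ridges \<open>DIM('w) - 2\<close>, and the cells in
  \<open>pk\<close>, of codimension two in the manifold, \<open>DIM('w) - 3\<close>.\<close>

definition "rdg = {e \<in> K. aff_dim (C e) = int DIM('w) - 2}"
definition "bd = {e \<in> rdg. \<exists>!s. s \<in> Fac \<and> e \<subseteq> s}"
definition "pk = {g \<in> K. aff_dim (C g) = int DIM('w) - 3}"
definition "collar cl i = {s \<in> Fac. \<exists>b\<in>bd. cl b = i \<and> b \<subseteq> s}"
definition "own b = (THE s. s \<in> Fac \<and> b \<subseteq> s)"

lemma own:
  assumes "b \<in> bd" shows "own b \<in> Fac" "b \<subseteq> own b" "s \<in> Fac \<Longrightarrow> b \<subseteq> s \<Longrightarrow> s = own b"
proof -
  have ex: "\<exists>!s. s \<in> Fac \<and> b \<subseteq> s" using assms by (simp add: bd_def)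
  then have "own b \<in> Fac \<and> b \<subseteq> own b" unfolding own_def by (rule theI')
  then show "own b \<in> Fac" "b \<subseteq> own b" "s \<in> Fac \<Longrightarrow> b \<subseteq> s \<Longrightarrow> s = own b" using ex by blast+
qed

lemma bdK: "b \<in> bd \<Longrightarrow> b \<in> rdg" "b \<in> bd \<Longrightarrow> b \<in> K" "b \<in> rdg \<Longrightarrow> b \<in> K"
  by (auto simp: bd_def rdg_def)

end

text \<open>\<open>cl\<close> labels a boundary ridge with its boundary component, and
  \<open>collar cl i\<close> consists of the facets of the fattened component. \<open>strong\<close>
  and \<open>connF\<close> are the traces of the manifold condition and of connectedness;
  \<open>dim4\<close> gives the cones of \<open>pk\<close> positive dimension, so that faces of
  codimension two correspond to cells with vertices.\<close>

locale convex_manifold = cell_cones K h for K :: "'p set set" and h :: "'p \<Rightarrow> 'w::euclidean_space" +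
  fixes cl :: "'p set \<Rightarrow> 'i"
  assumes dim4: "DIM('w) \<ge> 4"
    and Fdim: "s \<in> Fac \<Longrightarrow> aff_dim (cn h s) = int DIM('w) - 1"
    and star: "\<lbrakk>v \<in> V; s \<in> Fac; v \<in> s\<rbrakk> \<Longrightarrow> \<exists>m. m \<noteq> 0 \<and> (\<forall>t\<in>Fac. v \<in> t \<longrightarrow> supp m s t)"
    and strong: "\<lbrakk>g \<in> K; s \<in> Fac; t \<in> Fac; g \<subseteq> s; g \<subseteq> t\<rbrakk> \<Longrightarrow>
       (s, t) \<in> {(a, b). a \<in> Fac \<and> b \<in> Fac \<and> g \<subseteq> a \<and> g \<subseteq> b \<and> aff_dim (cn h (a \<inter> b)) = int DIM('w) - 2}\<^sup>*"
    and connF: "\<lbrakk>s \<in> Fac; t \<in> Fac\<rbrakk> \<Longrightarrow> (s, t) \<in> {(a, b). a \<in> Fac \<and> b \<in> Fac \<and> a \<inter> b \<noteq> {}}\<^sup>*"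
    and clb: "\<lbrakk>b \<in> bd; b' \<in> bd; b \<inter> b' \<noteq> {}\<rbrakk> \<Longrightarrow> cl b = cl b'"
    and fatc: "s \<in> collar cl i \<Longrightarrow> \<exists>m. m \<noteq> 0 \<and> (\<forall>t\<in>collar cl i. supp m s t)"
begin

lemma ridge_facet:
  assumes "s \<in> Fac" "e \<in> rdg" "e \<subseteq> s" shows "C e facet_of C s"
  using C_face[OF FacK[OF assms(1)] bdK(3)[OF assms(2)] assms(3)] Fdim[OF assms(1)] assms(2)
    pcone_0[OF pc[OF bdK(3)[OF assms(2)]]] by (auto simp: facet_of_def rdg_def)

lemma facet_ridge:
  assumes "s \<in> Fac" "f facet_of C s"
  shows "pre s f \<in> rdg" "pre s f \<subseteq> s" "C (pre s f) = f"
proof -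
  have "aff_dim (C s) \<ge> 2" using Fdim[OF assms(1)] dim4 by simp
  note p = facet_cell[OF FacK[OF assms(1)] assms(2) this]
  show "pre s f \<in> rdg" using p assms(2) Fdim[OF assms(1)] by (simp add: rdg_def facet_of_def)
  show "pre s f \<subseteq> s" "C (pre s f) = f" using p by auto
qed

lemma inter_cell:
  assumes "a \<in> Fac" "b \<in> Fac" "aff_dim (C (a \<inter> b)) = int DIM('w) - 2"
  shows "a \<inter> b \<in> rdg"
proof -
  have "a \<inter> b \<noteq> {}"
  proof
    assume "a \<inter> b = {}"
    then have "C (a \<inter> b) = {}" by (simp add: cn_def)
    then show False using assms(3) dim4 by simp
  qed
  then show ?thesis using intK[OF FacK[OF assms(1)] FacK[OF assms(2)]] assms(3) by (simp add: rdg_def)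
qed

text \<open>That ridges do not branch follows from convexity at one of their vertices: three facets
  through a ridge would be three facets of their common conic hull through one face of codimension
  two.\<close>

lemma ridge_two:
  assumes e: "e \<in> rdg" and F: "a \<in> Fac" "b \<in> Fac" "c \<in> Fac" "a \<noteq> b" and s: "e \<subseteq> a" "e \<subseteq> b" "e \<subseteq> c"
  shows "c = a \<or> c = b"
proof -
  obtain v where v: "v \<in> e" "v \<in> V" using ex_vertex[OF bdK(3)[OF e]] by blast
  define \<nu> where "\<nu> s = (SOME m. m \<noteq> 0 \<and> (\<forall>t\<in>Fac. v \<in> t \<longrightarrow> supp m s t))" for s
  have \<nu>: "\<nu> s \<noteq> 0 \<and> (\<forall>t\<in>Fac. v \<in> t \<longrightarrow> supp (\<nu> s) s t)" if "s \<in> Fac" "v \<in> s" for s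
    unfolding \<nu>_def by (rule someI_ex) (rule star[OF v(2) that])
  have vT: "v \<in> s \<and> s \<in> Fac" if "s \<in> {a,b,c}" for s using that v s F by auto
  interpret facet_family K h "{a,b,c}" \<nu>
  proof unfold_locales
    show "{a, b, c} \<subseteq> Fac" using F by simp
    show "\<exists>s\<in>{a, b, c}. \<exists>t\<in>{a, b, c}. s \<noteq> t" using F(4) by blast
    show "supp (\<nu> s) s t" if "s \<in> {a, b, c}" "t \<in> {a, b, c}" for s t
      using \<nu>[of s] vT[OF that(1)] vT[OF that(2)] by blast
    show "\<nu> s \<noteq> 0" "aff_dim (C s) = int DIM('w) - 1" if "s \<in> {a, b, c}" for s
      using \<nu>[of s] vT[OF that] Fdim by blast+
  qed
  have "C c = C a \<or> C c = C b"
  proof (rule codim2_at_most_two_facets[OF P_pcone, of "C a" "C b" "C c" "C e"])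
    show "C a \<noteq> C b"
    proof
      assume *: "C a = C b"
      obtain w where w: "w \<in> b" "\<nu> a \<bullet> h w < 0" by (rule supp_strict[OF Tsupp[of a b] F(1,2,4)]) auto
      have "h w \<in> C a" using * cn_base[OF w(1)] by blast
      then show False using supp_perp[OF FacK[OF F(1)] Tsupp[of a a]] w(2) by force
    qed
    show "aff_dim (C e) = aff_dim P - 2" using e P_dim by (simp add: rdg_def)
    show "0 \<in> C e" using pcone_0 pc bdK(3)[OF e] by blast
    show "C a facet_of P" "C b facet_of P" "C c facet_of P" by (rule P_facet; simp)+
    show "C e \<subseteq> C a" "C e \<subseteq> C b" "C e \<subseteq> C c" using s by (simp_all add: cn_mono)
  qed
  moreover have "c = x" if "C c = C x" "x \<in> {a,b}" for x
  proof (rule ccontr)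
    assume "c \<noteq> x"
    have xab: "x \<in> {a, b}" by (rule that(2))
    then have xF: "x \<in> Fac" using F by blast
    obtain w where w: "w \<in> x" "\<nu> c \<bullet> h w < 0"
      by (rule supp_strict[OF Tsupp[of c x] F(3) xF \<open>c \<noteq> x\<close>]) (use xab in auto)
    have "h w \<in> C c" using that cn_base[OF w(1)] by blast
    then show False using supp_perp[OF FacK[OF F(3)] Tsupp[of c c]] w(2) by force
  qed
  ultimately show ?thesis by blast
qed

definition "oth s e = (THE t. t \<in> Fac \<and> t \<noteq> s \<and> e \<subseteq> t)"

lemma oth:
  assumes s: "s \<in> Fac" "e \<in> rdg" "e \<subseteq> s" "e \<notin> bd"
  shows "oth s e \<in> Fac" "oth s e \<noteq> s" "e \<subseteq> oth s e" "t \<in> Fac \<Longrightarrow> t \<noteq> s \<Longrightarrow> e \<subseteq> t \<Longrightarrow> t = oth s e"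
proof -
  have "\<exists>t. t \<in> Fac \<and> t \<noteq> s \<and> e \<subseteq> t"
  proof (rule ccontr)
    assume "\<not> ?thesis"
    then have "\<exists>!t. t \<in> Fac \<and> e \<subseteq> t" using s(1,3) by blast
    then show False using s(2,4) by (simp add: bd_def)
  qed
  then have ex: "\<exists>!t. t \<in> Fac \<and> t \<noteq> s \<and> e \<subseteq> t" using ridge_two[OF s(2)] s by blast
  then have "oth s e \<in> Fac \<and> oth s e \<noteq> s \<and> e \<subseteq> oth s e" unfolding oth_def by (rule theI')
  then show "oth s e \<in> Fac" "oth s e \<noteq> s" "e \<subseteq> oth s e" "t \<in> Fac \<Longrightarrow> t \<noteq> s \<Longrightarrow> e \<subseteq> t \<Longrightarrow> t = oth s e"
    using ex by blast+
qed

lemma oth_oth: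
  assumes s: "s \<in> Fac" "e \<in> rdg" "e \<subseteq> s" "e \<notin> bd"
  shows "oth (oth s e) e = s"
  using oth(4)[OF oth(1)[OF s] s(2) oth(3)[OF s] s(4), of s] oth(2)[OF s] s by metis

definition "Rg s g = {e \<in> rdg. g \<subseteq> e \<and> e \<subseteq> s}"

lemma pkK: "g \<in> pk \<Longrightarrow> g \<in> K" by (simp add: pk_def)

lemma pk_facet:
  assumes "g \<in> pk" "e \<in> rdg" "g \<subseteq> e" shows "C g facet_of C e"
  using C_face[OF bdK(3)[OF assms(2)] pkK[OF assms(1)] assms(3)] assms pcone_0[OF pc[OF pkK[OF assms(1)]]]
  by (auto simp: facet_of_def rdg_def pk_def)

lemma pre_sub:
  assumes "s \<in> Fac" "g \<in> K" "g \<subseteq> s" "C g \<subseteq> f" shows "g \<subseteq> pre s f"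
  using assms cn_base[of _ g h] by (auto simp: pre_def)

lemma Rg_two:
  assumes s: "s \<in> Fac" and g: "g \<in> pk" "g \<subseteq> s"
  obtains e e' where "e \<noteq> e'" "Rg s g = {e, e'}"
proof -
  note gK = pkK[OF g(1)] and sK = FacK[OF s]
  have face: "C g face_of C s" by (rule C_face[OF sK gK g(2)])
  have dg: "aff_dim (C g) = aff_dim (C s) - 2" using g(1) Fdim[OF s] by (simp add: pk_def)
  have gne: "C g \<noteq> {}" using pcone_0[OF pc[OF gK]] by blast
  have "C g \<noteq> C s" using dg by auto
  then obtain f where f: "f facet_of C s" "C g \<subseteq> f"
    using face_of_polyhedron_subset_facet[of "C s" "C g"] pc[OF sK] face gne by (auto simp: pcone_def)
  have gf: "C g facet_of f" by (rule codim2_face_facet[OF pc[OF sK] f(1) face f(2) dg gne])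
  obtain f' where f': "f' facet_of C s" "f' \<noteq> f" "C g facet_of f'" using codim2_other_facet[OF pc[OF sK] f(1) gf] by metis
  have sub': "C g \<subseteq> f'" using f'(3) facet_of_imp_subset by blast
  note p = facet_ridge[OF s f(1)] and p' = facet_ridge[OF s f'(1)]
  show ?thesis
  proof (rule that[of "pre s f" "pre s f'"])
    show "pre s f \<noteq> pre s f'" using p(3) p'(3) f'(2) by metis
    show "Rg s g = {pre s f, pre s f'}"
    proof
      show "{pre s f, pre s f'} \<subseteq> Rg s g" using p p' pre_sub[OF s gK g(2)] f(2) sub' by (auto simp: Rg_def)
      show "Rg s g \<subseteq> {pre s f, pre s f'}"
      proof
        fix e assume "e \<in> Rg s g"
        then have e: "e \<in> rdg" "g \<subseteq> e" "e \<subseteq> s" by (auto simp: Rg_def)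
        have "C e = f \<or> C e = f'"
          using codim2_at_most_two_facets[OF pc[OF sK] f(1) f'(1) ridge_facet[OF s e(1,3)] f'(2)[symmetric] f(2) sub' cn_mono[OF e(2)] dg pcone_0[OF pc[OF gK]]] .
        then show "e \<in> {pre s f, pre s f'}" using pre_C[OF sK bdK(3)[OF e(1)] e(3)] by auto
      qed
    qed
  qed
qed

lemma Rg_card: "s \<in> Fac \<Longrightarrow> g \<in> pk \<Longrightarrow> g \<subseteq> s \<Longrightarrow> card (Rg s g) = 2 \<and> finite (Rg s g)"
  by (metis Rg_two card_2_iff finite.emptyI finite.insertI)

text \<open>
  The facets around a cell of codimension two of the manifold form a path or a cycle: the number of
  boundary ridges is even by double counting, and at most two because the facets are connected.
\<close>

lemma boundary_arc:
  assumes b: "b \<in> bd" and g: "g \<in> pk" "g \<subseteq> b"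
  obtains b' where "b' \<in> bd" "b' \<noteq> b" "g \<subseteq> b'" "\<And>b''. b'' \<in> bd \<Longrightarrow> g \<subseteq> b'' \<Longrightarrow> b'' = b \<or> b'' = b'"
proof -
  define St where "St = {s \<in> Fac. g \<subseteq> s}"
  have finSt: "finite St" using finK by (simp add: St_def Fac_def)
  have Rc: "card (Rg s g) = 2" "finite (Rg s g)" if "s \<in> St" for s
    using Rg_card[OF _ g(1)] that by (auto simp: St_def)
  \<comment> \<open>Incidences of a facet around \<open>g\<close> with one of its two ridges through
    \<open>g\<close>. Crossing an inner ridge pairs them up, so the number of incidences with
    boundary ridges is even.\<close>
  define H where "H = Sigma St (\<lambda>s. Rg s g)"
  define Hb where "Hb = {p \<in> H. snd p \<in> bd}"
  have finH: "finite H" unfolding H_def using finSt Rc by blast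
  have cardH: "card H = 2 * card St" unfolding H_def using finSt Rc by (simp add: card_SigmaI)
  have "even (card (H - Hb))"
  proof (rule even_card_involution[of _ "\<lambda>(s, e). (oth s e, e)"])
    fix p assume "p \<in> H - Hb"
    then obtain s e where p: "p = (s, e)" and s: "s \<in> Fac" "e \<in> rdg" "e \<subseteq> s" "e \<notin> bd" "g \<subseteq> e"
      by (auto simp: H_def Hb_def Rg_def St_def)
    show "(case p of (s, e) \<Rightarrow> (oth s e, e)) \<in> H - Hb"
      using oth(1,3)[OF s(1-4)] s(2,4,5) p order_trans[OF s(5) oth(3)[OF s(1-4)]]
      by (simp add: H_def Hb_def Rg_def St_def)
    show "(case case p of (s, e) \<Rightarrow> (oth s e, e) of (s, e) \<Rightarrow> (oth s e, e)) = p"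
      using oth_oth[OF s(1-4)] p by simp
    show "(case p of (s, e) \<Rightarrow> (oth s e, e)) \<noteq> p" using oth(2)[OF s(1-4)] p by simp
  qed (use finH in simp)
  moreover have "card H = card Hb + card (H - Hb)"
    using finH card_Diff_subset[of Hb H] card_mono[of H Hb] by (simp add: Hb_def finite_subset)
  ultimately have evenHb: "even (card Hb)" using cardH by presburger
  have bSt: "own b \<in> St" using own(1)[OF b] order_trans[OF g(2) own(2)[OF b]] by (simp add: St_def)
  \<comment> \<open>The exits of a set \<open>A\<close> of facets. Adding the facet across an exit
    that is not a boundary ridge removes this exit and creates at most one new one, so a set grown
    from \<open>own b\<close> keeps at most two; for all of \<open>St\<close> the exits are exactly
    \<open>Hb\<close>.\<close>
  define out where "out A = {p \<in> H. fst p \<in> A \<and> (snd p \<in> bd \<or> oth (fst p) (snd p) \<notin> A)}" for A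
  have fo: "finite (out A)" for A using finH by (simp add: out_def)
  define \<A> where "\<A> = {A. A \<subseteq> St \<and> own b \<in> A \<and> card (out A) \<le> 2}"
  have "out {own b} \<subseteq> {own b} \<times> Rg (own b) g" unfolding out_def H_def by force
  moreover have "card ({own b} \<times> Rg (own b) g) = 2" using Rc(1)[OF bSt] by (simp add: card_cartesian_product)
  ultimately have "card (out {own b}) \<le> 2" using card_mono[of "{own b} \<times> Rg (own b) g"] Rc(2)[OF bSt] by fastforce
  then have "{own b} \<in> \<A>" using bSt by (simp add: \<A>_def)
  moreover have "finite \<A>" by (rule finite_subset[of _ "Pow St"]) (auto simp: \<A>_def finSt)
  ultimately obtain A where A: "A \<in> \<A>" "\<forall>B\<in>\<A>. A \<subseteq> B \<longrightarrow> A = B" using finite_has_maximal[of \<A>] by blast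
  have "A = St"
  proof (rule ccontr)
    assume "A \<noteq> St"
    then obtain t where t: "t \<in> St" "t \<notin> A" using A(1) by (auto simp: \<A>_def)
    have oA: "own b \<in> A" "A \<subseteq> St" "card (out A) \<le> 2" using A(1) by (auto simp: \<A>_def)
    define r where "r = {(a, b). a \<in> Fac \<and> b \<in> Fac \<and> g \<subseteq> a \<and> g \<subseteq> b \<and> aff_dim (cn h (a \<inter> b)) = int DIM('w) - 2}"
    have "(own b, t) \<in> r\<^sup>*" unfolding r_def
      using strong[OF pkK[OF g(1)]] bSt t(1) by (auto simp: St_def)
    then have "\<exists>x y. (x, y) \<in> r \<and> x \<in> A \<and> y \<notin> A"
      using oA(1) t(2) by (induction rule: rtrancl_induct) blast+
    then obtain x y where xy: "(x, y) \<in> r" "x \<in> A" "y \<notin> A" by blast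
    then have xyF: "x \<in> Fac" "y \<in> Fac" "g \<subseteq> x" "g \<subseteq> y" "x \<inter> y \<in> rdg" "x \<noteq> y"
      using inter_cell[of x y] by (auto simp: r_def)
    define e where "e = x \<inter> y"
    have e: "e \<in> rdg" "e \<subseteq> x" "e \<subseteq> y" "g \<subseteq> e" using xyF by (auto simp: e_def)
    have nbd: "e \<notin> bd" using own(3)[of e x] own(3)[of e y] xyF e by blast
    have ox: "oth x e = y" "oth y e = x" using oth(4)[OF xyF(1) e(1,2) nbd xyF(2)] oth(4)[OF xyF(2) e(1,3) nbd xyF(1)] xyF e by auto
    have sub: "out (insert y A) \<subseteq> (out A - {(x, e)}) \<union> ({y} \<times> (Rg y g - {e}))"
    proof
      fix p assume "p \<in> out (insert y A)"
      then obtain s f where p: "p = (s, f)" "s \<in> St" "f \<in> Rg s g" "s \<in> insert y A" "f \<in> bd \<or> oth s f \<notin> insert y A"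
        unfolding out_def H_def by force
      show "p \<in> (out A - {(x, e)}) \<union> ({y} \<times> (Rg y g - {e}))"
      proof (cases "s = y")
        case True
        then have "f \<noteq> e" using p(5) nbd ox(2) xy(2) by (metis insertCI)
        then show ?thesis using p True by simp
      next
        case False
        then have "(s, f) \<in> out A" using p by (auto simp: out_def H_def)
        moreover have "(s, f) \<noteq> (x, e)" using p(5) nbd ox(1) by (metis insertI1 prod.inject)
        ultimately show ?thesis using p by simp
      qed
    qed
    have ySt: "y \<in> St" using xyF by (simp add: St_def)
    have "(x, e) \<in> out A" using xy e ox xyF by (auto simp: out_def H_def Rg_def St_def)
    then have "card (out A - {(x, e)}) \<le> 1" using oA(3) fo by (simp add: card_Diff_singleton)
    moreover have "card ({y} \<times> (Rg y g - {e})) = 1"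
      using Rc[OF ySt] e by (simp add: card_cartesian_product Rg_def card_Diff_singleton)
    moreover have "card (out (insert y A)) \<le> card ((out A - {(x, e)}) \<union> ({y} \<times> (Rg y g - {e})))"
      by (rule card_mono[OF _ sub]) (use fo Rc[OF ySt] in auto)
    ultimately have "card (out (insert y A)) \<le> 2"
      using card_Un_le[of "out A - {(x, e)}" "{y} \<times> (Rg y g - {e})"] by linarith
    then have "insert y A \<in> \<A>" using oA ySt by (simp add: \<A>_def)
    then show False using A(2) xy(3) by blast
  qed
  moreover have "out St = Hb"
  proof
    show "Hb \<subseteq> out St" unfolding out_def Hb_def H_def by force
    show "out St \<subseteq> Hb"
    proof
      fix p assume p: "p \<in> out St"
      then obtain s e where se: "p = (s, e)" "s \<in> St" "e \<in> Rg s g" "e \<in> bd \<or> oth s e \<notin> St" "p \<in> H"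
        unfolding out_def H_def by force
      have "e \<in> bd"
      proof (rule ccontr)
        assume nb: "e \<notin> bd"
        have e: "s \<in> Fac" "e \<in> rdg" "e \<subseteq> s" "g \<subseteq> e" using se(2,3) by (auto simp only: St_def Rg_def)
        have "oth s e \<in> St"
          using oth(1)[OF e(1-3) nb] order_trans[OF e(4) oth(3)[OF e(1-3) nb]] by (simp add: St_def)
        then show False using se(4) nb by blast
      qed
      then show "p \<in> Hb" using se by (simp add: Hb_def)
    qed
  qed
  ultimately have "card Hb \<le> 2" using A(1) by (simp add: \<A>_def)
  have inHb: "(own x, x) \<in> Hb" if "x \<in> bd" "g \<subseteq> x" for x
    using own(1,2)[OF that(1)] order_trans[OF that(2) own(2)[OF that(1)]] that bdK(1) by (simp add: Hb_def H_def St_def Rg_def)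
  have finHb: "finite Hb" using finH by (simp add: Hb_def)
  have "card Hb \<noteq> 0" using inHb[OF b g(2)] finHb by auto
  then have "card Hb = 2" using \<open>card Hb \<le> 2\<close> evenHb by presburger
  then have "\<exists>q. q \<noteq> (own b, b) \<and> Hb = {(own b, b), q}"
  proof -
    obtain p q where pq: "Hb = {p, q}" "p \<noteq> q" using \<open>card Hb = 2\<close> by (auto simp: card_2_iff)
    then consider "p = (own b, b)" | "q = (own b, b)" using inHb[OF b g(2)] by blast
    then show ?thesis
    proof cases
      case 1
      then show ?thesis using pq by (intro exI[of _ q]) simp
    next
      case 2
      then show ?thesis using pq by (intro exI[of _ p]) (simp add: insert_commute)
    qed
  qed
  then obtain s b' where q: "(s, b') \<noteq> (own b, b)" "Hb = {(own b, b), (s, b')}" by auto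
  have "(s, b') \<in> Hb" using q by simp
  then have b': "b' \<in> bd" "g \<subseteq> b'" "s \<in> Fac" "b' \<subseteq> s" by (auto simp: Hb_def H_def St_def Rg_def)
  show ?thesis
  proof (rule that[OF b'(1) _ b'(2)])
    show "b' \<noteq> b" using q(1) own(3)[OF b'(1,3,4)] by auto
    show "b'' = b \<or> b'' = b'" if "b'' \<in> bd" "g \<subseteq> b''" for b'' using inHb[OF that] q(2) by auto
  qed
qed

text \<open>The facets of the cone of \<open>s\<close> are connected through faces of codimension
  two, so a property that passes between the two ridges at each such face reaches every ridge of
  \<open>s\<close>.\<close>

lemma ridge_propagate:
  assumes s: "s \<in> Fac" and e0: "e0 \<in> rdg" "e0 \<subseteq> s" "Q e0"
    and step: "\<And>e e' g. \<lbrakk>g \<in> pk; g \<subseteq> s; Rg s g = {e, e'}; e \<noteq> e'; Q e\<rbrakk> \<Longrightarrow> Q e'"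
    and e: "e \<in> rdg" "e \<subseteq> s"
  shows "Q e"
proof -
  note sK = FacK[OF s]
  obtain u where "(C e0, C e) \<in> (visible_adj (C s) u)\<^sup>*"
    using facets_strongly_connected[OF pc[OF sK] ridge_facet[OF s e0(1,2)] ridge_facet[OF s e]] by blast
  then have "Q (pre s (C e))"
  proof (induction rule: rtrancl_induct)
    case base
    show ?case using e0(3) pre_C[OF sK bdK(3)[OF e0(1)] e0(2)] by simp
  next
    case (step f f')
    then have f: "f facet_of C s" "f' facet_of C s" "f \<noteq> f'" "(f \<inter> f') facet_of f" "(f \<inter> f') facet_of f'"
      by (auto simp: visible_adj_def)
    note p = facet_ridge[OF s f(1)] and p' = facet_ridge[OF s f(2)]
    note cd = facet_facet_codim2[OF f(1,4)]
    have "f \<inter> f' \<noteq> {0}"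
    proof
      assume "f \<inter> f' = {0}"
      then have "aff_dim (f \<inter> f') = 0" by simp
      then show False using cd(2) Fdim[OF s] dim4 by linarith
    qed
    note q = pre_cell[OF sK cd(1,3) this]
    have g: "pre s (f \<inter> f') \<in> pk" using q cd(2) Fdim[OF s] by (simp add: pk_def)
    obtain a b where ab: "a \<noteq> b" "Rg s (pre s (f \<inter> f')) = {a, b}" using Rg_two[OF s g q(2)] by blast
    have "pre s f \<in> Rg s (pre s (f \<inter> f'))" "pre s f' \<in> Rg s (pre s (f \<inter> f'))" "pre s f \<noteq> pre s f'"
    proof -
      have "pre s (f \<inter> f') \<subseteq> pre s f" "pre s (f \<inter> f') \<subseteq> pre s f'" by (auto simp: pre_def)
      then show "pre s f \<in> Rg s (pre s (f \<inter> f'))" "pre s f' \<in> Rg s (pre s (f \<inter> f'))" using p p' by (simp_all add: Rg_def)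
      show "pre s f \<noteq> pre s f'" using p(3) p'(3) f(3) by metis
    qed
    then have "Rg s (pre s (f \<inter> f')) = {pre s f, pre s f'}" "pre s f \<noteq> pre s f'" using ab by auto
    then show ?case using assms(5)[OF g q(2)] step.IH by blast
  qed
  then show ?thesis using pre_C[OF sK bdK(3)[OF e(1)] e(2)] by simp
qed

lemma nb_at:
  assumes "g \<in> K" "s \<in> Fac" "t \<in> Fac" "g \<subseteq> s" "g \<subseteq> t" "s \<noteq> t"
  obtains b where "b \<in> Fac" "b \<noteq> s" "g \<subseteq> b" "s \<inter> b \<in> rdg" "s \<inter> b \<notin> bd"
proof -
  obtain b where b: "b \<in> Fac" "b \<noteq> s" "g \<subseteq> b" "aff_dim (C (s \<inter> b)) = int DIM('w) - 2"
    using rtrancl_first_step[OF strong[OF assms(1-5)] assms(6)] by blast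
  have "s \<inter> b \<notin> bd" using own(3)[of "s \<inter> b" s] own(3)[of "s \<inter> b" b] b assms by auto
  then show ?thesis using that b inter_cell[OF assms(2) b(1,4)] by blast
qed

text \<open>Both functionals vanish on the hyperplane of \<open>s\<close>; the facet
  \<open>t\<close> has a vertex off that hyperplane, which fixes the sign.\<close>

lemma supp_proportional:
  assumes "s \<in> Fac" "t \<in> Fac" "s \<noteq> t" "m \<noteq> 0" "m' \<noteq> 0" "supp m s s" "supp m' s s" "supp m s t" "supp m' s t"
  obtains a where "a > 0" "m' = a *\<^sub>R m"
proof -
  have sp: "span (C s) = {x. m \<bullet> x = 0}"
    by (rule span_hyperplane_eq[OF pc[OF FacK[OF assms(1)]] Fdim[OF assms(1)] assms(4)])
      (rule supp_perp[OF FacK[OF assms(1)] assms(6)])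
  have sp': "span (C s) = {x. m' \<bullet> x = 0}"
    by (rule span_hyperplane_eq[OF pc[OF FacK[OF assms(1)]] Fdim[OF assms(1)] assms(5)])
      (rule supp_perp[OF FacK[OF assms(1)] assms(7)])
  have "m' \<in> span {m}" by (rule perp_perp_singleton) (use sp sp' in blast)
  then obtain a where a: "m' = a *\<^sub>R m" by (auto simp: span_singleton)
  obtain w where w: "w \<in> t" "w \<in> V" "m \<bullet> h w < 0" using supp_strict[OF assms(8,1,2,3)] by blast
  have "m' \<bullet> h w \<le> 0" using assms(9) w by (auto simp: supp_def)
  then have "a \<ge> 0" using a w(3) by (simp add: mult_le_0_iff)
  moreover have "a \<noteq> 0" using a assms(5) by auto
  ultimately have "a > 0" by simp
  then show ?thesis using that a by blast
qed

lemma supp_scale: "a > 0 \<Longrightarrow> supp (a *\<^sub>R m) s t \<longleftrightarrow> supp m s t"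
  by (simp add: supp_def mult_le_0_iff)

end

section \<open>One outer normal for each facet\<close>

locale nontrivial_manifold = convex_manifold K h cl
  for K :: "'p set set" and h :: "'p \<Rightarrow> 'w::euclidean_space" and cl :: "'p set \<Rightarrow> 'i" +
  assumes nontriv: "\<exists>s\<in>Fac. \<exists>t\<in>Fac. s \<noteq> t"
begin

lemma has_nb:
  assumes s: "s \<in> Fac"
  obtains b where "b \<in> Fac" "b \<noteq> s" "s \<inter> b \<in> rdg" "s \<inter> b \<notin> bd"
proof -
  obtain t where t: "t \<in> Fac" "t \<noteq> s" using nontriv by metis
  obtain b where b: "b \<in> Fac" "b \<noteq> s" "s \<inter> b \<noteq> {}"
    using rtrancl_first_step[OF connF[OF s t(1)] t(2)[symmetric]] by blast
  have "s \<inter> b \<in> K" using intK[OF FacK[OF s] FacK[OF b(1)] b(3)] .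
  from nb_at[OF this s b(1) _ _ b(2)[symmetric]] show ?thesis using that by blast
qed

text \<open>If \<open>s\<close> were alone in its collar, the second boundary ridge at each face of
  codimension two would again belong to \<open>s\<close>, so being a boundary ridge with label
  \<open>i\<close> would spread to all ridges of \<open>s\<close>; but \<open>s\<close> has a
  neighbour.\<close>

lemma fat_two:
  assumes s: "s \<in> collar cl i"
  obtains t where "t \<in> collar cl i" "t \<noteq> s"
proof (rule ccontr)
  assume no: "\<not> thesis"
  then have only: "t = s" if "t \<in> collar cl i" for t using that \<open>\<And>t. t \<in> collar cl i \<Longrightarrow> t \<noteq> s \<Longrightarrow> thesis\<close> by blast
  have sF: "s \<in> Fac" using s by (simp add: collar_def)
  obtain b0 where b0: "b0 \<in> bd" "cl b0 = i" "b0 \<subseteq> s" using s by (auto simp: collar_def)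
  have all: "e \<in> bd \<and> cl e = i" if e: "e \<in> rdg" "e \<subseteq> s" for e
  proof (rule ridge_propagate[OF sF bdK(1)[OF b0(1)] b0(3) _ _ e, of "\<lambda>e. e \<in> bd \<and> cl e = i"])
    show "b0 \<in> bd \<and> cl b0 = i" using b0 by blast
    fix e e' g assume g: "g \<in> pk" "g \<subseteq> s" "Rg s g = {e, e'}" "e \<noteq> e'" and e: "e \<in> bd \<and> cl e = i"
    have ge: "g \<subseteq> e" using g(3) by (auto simp: Rg_def)
    obtain b' where b': "b' \<in> bd" "b' \<noteq> e" "g \<subseteq> b'" using boundary_arc[OF conjunct1[OF e] g(1) ge] by metis
    have "cl b' = i" using clb[OF b'(1) conjunct1[OF e]] e b'(3) ge ne[OF pkK[OF g(1)]] by blast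
    moreover have "own b' \<in> collar cl i" using own(1,2)[OF b'(1)] calculation b'(1) by (auto simp only: collar_def)
    then have "own b' = s" by (rule only)
    then have "b' \<in> Rg s g" using own(2)[OF b'(1)] b' bdK(1) by (simp add: Rg_def)
    then have "b' = e'" using g(3) b'(2) by auto
    ultimately show "e' \<in> bd \<and> cl e' = i" using b'(1) by blast
  qed
  obtain b where "s \<inter> b \<in> rdg" "s \<inter> b \<notin> bd" using has_nb[OF sF] by blast
  then show False using all[of "s \<inter> b"] by blast
qed

text \<open>Each star and each fattened component supplies a normal of \<open>s\<close>, all on one
  line; the point is that one sign fits all of them. A vertex whose only facet is \<open>s\<close>
  does not determine the sign, so the choice is carried from ridge to ridge over
  \<open>s\<close>.\<close>

lemma normal_exists:
  assumes s: "s \<in> Fac"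
  shows "\<exists>m. m \<noteq> 0 \<and> (\<forall>v\<in>V \<inter> s. \<forall>t\<in>Fac. v \<in> t \<longrightarrow> supp m s t) \<and>
    (\<forall>b\<in>bd. b \<subseteq> s \<longrightarrow> (\<forall>t\<in>collar cl (cl b). supp m s t))"
proof -
  define N where "N e m \<longleftrightarrow> m \<noteq> 0 \<and> (e \<in> bd \<longrightarrow> (\<forall>t\<in>collar cl (cl e). supp m s t)) \<and>
    (e \<notin> bd \<longrightarrow> (\<forall>t\<in>Fac. e \<subseteq> t \<longrightarrow> supp m s t))" for e m
  have fat_self: "s \<in> collar cl (cl e)" if "e \<in> bd" "e \<subseteq> s" for e using that s by (auto simp: collar_def)
  have exN: "\<exists>m. N e m" if e: "e \<in> rdg" "e \<subseteq> s" for e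
  proof (cases "e \<in> bd")
    case True
    then show ?thesis using fatc[OF fat_self[OF True e(2)]] by (auto simp: N_def)
  next
    case False
    obtain v where v: "v \<in> e" "v \<in> V" using ex_vertex[OF bdK(3)[OF e(1)]] by blast
    obtain m where "m \<noteq> 0" "\<forall>t\<in>Fac. v \<in> t \<longrightarrow> supp m s t" using star[OF v(2) s] v e by blast
    then show ?thesis using False v(1) unfolding N_def by blast
  qed
  have Nss: "supp m s s" if "N e m" "e \<in> rdg" "e \<subseteq> s" for e m
    using that s fat_self by (cases "e \<in> bd") (auto simp: N_def)
  have Nscale: "N e (a *\<^sub>R m)" if "N e m" "a > 0" for e m a
    using that by (auto simp: N_def supp_scale)
  obtain b0 where b0: "s \<inter> b0 \<in> rdg" using has_nb[OF s] by blast
  obtain m0 where m0: "N (s \<inter> b0) m0" using exN[OF b0] by blast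
  have all: "N e m0" if e: "e \<in> rdg" "e \<subseteq> s" for e
  proof (rule ridge_propagate[OF s b0 _ _ _ e, of "\<lambda>e. N e m0"])
    show "N (s \<inter> b0) m0" by (rule m0)
    fix e e' g assume g: "g \<in> pk" "g \<subseteq> s" "Rg s g = {e, e'}" "e \<noteq> e'" and Ne: "N e m0"
    have R: "e \<in> rdg" "e' \<in> rdg" "e \<subseteq> s" "e' \<subseteq> s" "g \<subseteq> e" "g \<subseteq> e'" using g(3) by (auto simp: Rg_def)
    obtain v where v: "v \<in> g" "v \<in> V" using ex_vertex[OF pkK[OF g(1)]] by blast
    obtain mv where mv: "mv \<noteq> 0" "\<forall>t\<in>Fac. v \<in> t \<longrightarrow> supp mv s t" using star[OF v(2) s] v g by blast
    \<comment> \<open>A functional that fits one of two ridges at \<open>g\<close>, not both on the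
      boundary, supports a facet other than \<open>s\<close> through the vertex \<open>v\<close>,
      and hence has the sign of \<open>mv\<close>.\<close>
    have propor: "\<exists>a>0. m = a *\<^sub>R mv" if f: "N f m" "Rg s g = {f, f'}" "f \<noteq> f'" "\<not> (f \<in> bd \<and> f' \<in> bd)" for f f' m
    proof -
      have Rf: "f \<in> rdg" "f \<subseteq> s" "g \<subseteq> f" using f(2) by (auto simp: Rg_def)
      have "\<exists>t\<in>Fac. t \<noteq> s \<and> v \<in> t \<and> supp m s t"
      proof (cases "f \<in> bd")
        case False
        note o = oth[OF s Rf(1,2) False]
        have "supp m s (oth s f)" using f(1) False o(1,3) by (simp add: N_def)
        moreover have "v \<in> oth s f" using o(3) Rf(3) v(1) by (meson subsetD)
        ultimately show ?thesis using o(1,2) by (intro bexI[of _ "oth s f"] conjI)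
      next
        case True
        then have "f' \<notin> bd" using f(4) by blast
        \<comment> \<open>The second boundary ridge through \<open>g\<close> is not
          \<open>f'\<close>, so its facet is a member of the same collar different from
          \<open>s\<close>.\<close>
        obtain b' where b': "b' \<in> bd" "b' \<noteq> f" "g \<subseteq> b'" using boundary_arc[OF True g(1) Rf(3)] by metis
        have cl': "cl b' = cl f" using clb[OF b'(1) True] b'(3) Rf(3) ne[OF pkK[OF g(1)]] by blast
        have "own b' \<noteq> s"
        proof
          assume "own b' = s"
          then have "b' \<in> Rg s g" using own(2)[OF b'(1)] b' bdK(1) by (simp add: Rg_def)
          then show False using f(2) b' \<open>f' \<notin> bd\<close> by auto
        qed
        moreover have "own b' \<in> collar cl (cl f)" using own(1,2)[OF b'(1)] b'(1) cl' by (auto simp only: collar_def)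
        ultimately show ?thesis using f(1) True own[OF b'(1)] b'(3) v(1) unfolding N_def by blast
      qed
      then obtain t where t: "t \<in> Fac" "t \<noteq> s" "v \<in> t" "supp m s t" by blast
      have "supp mv s s" "supp mv s t" using mv(2) s t v g by blast+
      moreover have "m \<noteq> 0" using f(1) by (simp add: N_def)
      ultimately show ?thesis
        using supp_proportional[OF s t(1) t(2)[symmetric] mv(1) _ _ Nss[OF f(1) Rf(1,2)] _ t(4)] by metis
    qed
    show "N e' m0"
    proof (cases "e \<in> bd \<and> e' \<in> bd")
      case True
      have "e \<inter> e' \<noteq> {}" using R(5,6) ne[OF pkK[OF g(1)]] by blast
      then have "cl e = cl e'" using clb[of e e'] True by blast
      then show ?thesis using Ne True by (simp add: N_def)
    next
      case False
      obtain m' where m': "N e' m'" using exN[OF R(2,4)] by blast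
      have "Rg s g = {e', e}" using g(3) by auto
      then obtain a a' where a: "a > 0" "m0 = a *\<^sub>R mv" "a' > 0" "m' = a' *\<^sub>R mv"
        using propor[OF Ne g(3,4) False] propor[OF m' _ g(4)[symmetric]] False by blast
      then have "m0 = (a / a') *\<^sub>R m'" by simp
      then show ?thesis using Nscale[OF m', of "a / a'"] a by simp
    qed
  qed (rule Int_lower1)
  \<comment> \<open>Another facet through \<open>v\<close> yields an inner ridge of \<open>s\<close>
    through \<open>v\<close>, and the neighbour across it compares the sign of \<open>m0\<close>
    with that of \<open>mv\<close>.\<close>
  have S1: "supp m0 s t" if v: "v \<in> V" "v \<in> s" "t \<in> Fac" "v \<in> t" for v t
  proof (cases "t = s")
    case True
    then show ?thesis using Nss[OF m0 b0] by blast
  next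
    case False
    have vK: "{v} \<in> K" using v by (simp add: V_def)
    obtain b where b: "b \<in> Fac" "b \<noteq> s" "{v} \<subseteq> b" "s \<inter> b \<in> rdg" "s \<inter> b \<notin> bd"
      using nb_at[OF vK s v(3)] v False by blast
    obtain mv where mv: "mv \<noteq> 0" "\<forall>t\<in>Fac. v \<in> t \<longrightarrow> supp mv s t" using star[OF v(1) s v(2)] by blast
    have "N (s \<inter> b) m0" using all b by blast
    then have "supp m0 s b" "m0 \<noteq> 0" using b by (auto simp: N_def)
    moreover have "supp mv s s" "supp mv s b" using mv(2) s b v by blast+
    ultimately obtain a where "a > 0" "m0 = a *\<^sub>R mv"
      using supp_proportional[OF s b(1) b(2)[symmetric] mv(1) _ _ Nss[OF m0 b0]] by blast
    moreover have "supp mv s t" using mv(2) v by blast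
    ultimately show ?thesis by (simp add: supp_scale)
  qed
  have S2: "supp m0 s t" if "b \<in> bd" "b \<subseteq> s" "t \<in> collar cl (cl b)" for b t
    using all[OF bdK(1)[OF that(1)] that(2)] that by (simp add: N_def)
  have "m0 \<noteq> 0" using m0 by (simp add: N_def)
  show ?thesis
  proof (intro exI[of _ m0] conjI ballI impI)
    show "supp m0 s t" if "v \<in> V \<inter> s" "t \<in> Fac" "v \<in> t" for v t using S1[of v t] that by blast
    show "supp m0 s t" if "b \<in> bd" "b \<subseteq> s" "t \<in> collar cl (cl b)" for b t using that by (rule S2)
  qed fact
qed

definition "nrm s = (SOME m. m \<noteq> 0 \<and> (\<forall>v\<in>V \<inter> s. \<forall>t\<in>Fac. v \<in> t \<longrightarrow> supp m s t) \<and>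
    (\<forall>b\<in>bd. b \<subseteq> s \<longrightarrow> (\<forall>t\<in>collar cl (cl b). supp m s t)))"

lemma nrm:
  assumes "s \<in> Fac"
  shows "nrm s \<noteq> 0" "v \<in> V \<Longrightarrow> v \<in> s \<Longrightarrow> t \<in> Fac \<Longrightarrow> v \<in> t \<Longrightarrow> supp (nrm s) s t"
    "b \<in> bd \<Longrightarrow> b \<subseteq> s \<Longrightarrow> t \<in> collar cl (cl b) \<Longrightarrow> supp (nrm s) s t"
proof -
  note * = someI_ex[OF normal_exists[OF assms], folded nrm_def]
  show "nrm s \<noteq> 0" using * by (rule conjunct1)
  show "supp (nrm s) s t" if "v \<in> V" "v \<in> s" "t \<in> Fac" "v \<in> t" using *[THEN conjunct2, THEN conjunct1] that by blast
  show "supp (nrm s) s t" if "b \<in> bd" "b \<subseteq> s" "t \<in> collar cl (cl b)" using *[THEN conjunct2, THEN conjunct2] that by blast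
qed

end

section \<open>Chords of the boundary\<close>

lemma rel_interior_zero:
  assumes "convex X" "p \<in> rel_interior X" "\<And>x. x \<in> X \<Longrightarrow> m \<bullet> x \<le> 0" "m \<bullet> p = 0" "x \<in> X"
  shows "m \<bullet> x = 0"
proof -
  have face: "(X \<inter> {x. m \<bullet> x = 0}) face_of X"
    using face_of_Int_supporting_hyperplane_le[OF assms(1), of m 0] assms(3) by blast
  have pX: "p \<in> X" using assms(2) rel_interior_subset by blast
  have "X \<subseteq> X \<inter> {x. m \<bullet> x = 0}"
    by (rule subset_of_face_of[OF face order_refl]) (use assms(2,4) pX in blast)
  then show ?thesis using assms(5) by blast
qed

text \<open>
  In the three-dimensional quotient by the span of \<open>G\<close>, the functional \<open>c\<close> vanishes on the plane
  spanned by the two rays \<open>r0\<close> and \<open>r1\<close>.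
\<close>

lemma chord_functional:
  fixes G :: "'w::euclidean_space set"
  assumes dG: "int (dim G) = int DIM('w) - 3"
    and z: "\<And>x. x \<in> G \<Longrightarrow> s0 \<bullet> x = 0" "\<And>x. x \<in> G \<Longrightarrow> s1 \<bullet> x = 0"
    and r: "s0 \<bullet> r0 = 0" "s0 \<bullet> r1 < 0" "s1 \<bullet> r1 = 0" "s1 \<bullet> r0 < 0"
  obtains c where "c \<noteq> 0" "\<And>x. x \<in> G \<Longrightarrow> c \<bullet> x = 0" "c \<bullet> r0 = 0" "c \<bullet> r1 = 0"
    "\<And>x. c \<bullet> x = 0 \<Longrightarrow> \<exists>z\<in>span G. \<exists>a b. x = z + a *\<^sub>R r0 + b *\<^sub>R r1"
proof -
  define A where "A = insert r0 (insert r1 G)"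
  have "span G \<subseteq> {x. s0 \<bullet> x = 0}" by (rule span_minimal) (use z in \<open>auto simp: subspace_hyperplane\<close>)
  then have 1: "r1 \<notin> span G" using r by auto
  have "span (insert r1 G) \<subseteq> {x. s1 \<bullet> x = 0}" by (rule span_minimal) (use z r in \<open>auto simp: subspace_hyperplane\<close>)
  then have 2: "r0 \<notin> span (insert r1 G)" using r by auto
  have dA: "int (dim A) = int DIM('w) - 1" unfolding A_def using 1 2 dG by (simp add: dim_insert)
  then have "dim A < DIM('w)" by linarith
  then obtain c where c: "c \<noteq> 0" "\<And>y. y \<in> span A \<Longrightarrow> orthogonal c y"
    using orthogonal_to_subspace_exists by metis
  have cA: "c \<bullet> y = 0" if "y \<in> A" for y using c(2)[OF span_base[OF that]] by (simp add: orthogonal_def)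
  have "span A = {x. c \<bullet> x = 0}"
  proof (rule subspace_dim_equal)
    show "span A \<subseteq> {x. c \<bullet> x = 0}" using c(2) by (auto simp: orthogonal_def)
    have "int (dim {x. c \<bullet> x = 0}) = int DIM('w) - 1" using dim_hyperplane[OF c(1)] by simp
    then show "dim {x. c \<bullet> x = 0} \<le> dim (span A)" using dA by simp
  qed (auto simp: subspace_hyperplane)
  then have sp: "x \<in> span A" if "c \<bullet> x = 0" for x using that by blast
  have "\<exists>z\<in>span G. \<exists>a b. x = z + a *\<^sub>R r0 + b *\<^sub>R r1" if x: "c \<bullet> x = 0" for x
  proof -
    obtain a where "x - a *\<^sub>R r0 \<in> span (insert r1 G)" using sp[OF x] span_breakdown_eq unfolding A_def by blast
    then obtain b where "x - a *\<^sub>R r0 - b *\<^sub>R r1 \<in> span G" using span_breakdown_eq by blast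
    moreover have "x = (x - a *\<^sub>R r0 - b *\<^sub>R r1) + a *\<^sub>R r0 + b *\<^sub>R r1" by simp
    ultimately show ?thesis by blast
  qed
  then show ?thesis using that[of c] c(1) cA by (simp add: A_def)
qed

text \<open>A convex \<open>Y\<close> with points strictly on both sides of the plane where
  \<open>c\<close> vanishes would contain a point \<open>z\<close> of that plane. The functionals
  \<open>s0\<close> and \<open>s1\<close> place \<open>z\<close> in the angle of \<open>r0\<close>
  and \<open>r1\<close> modulo \<open>span G\<close>, and \<open>m\<close> then forces it into
  \<open>G\<close>, \<open>B0\<close> or \<open>B1\<close>, unless \<open>m\<close> is parallel to
  \<open>c\<close>. A face containing \<open>z\<close> contains the whole crossing segment, yet
  \<open>c\<close> vanishes on it.\<close>

lemma one_sided:
  fixes c :: "'w::euclidean_space"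
  assumes c: "\<And>x. c \<bullet> x = 0 \<Longrightarrow> \<exists>z\<in>span G. \<exists>a b. x = z + a *\<^sub>R r0 + b *\<^sub>R r1"
    and s: "\<And>x. x \<in> G \<Longrightarrow> s0 \<bullet> x = 0" "\<And>x. x \<in> G \<Longrightarrow> s1 \<bullet> x = 0"
      "s0 \<bullet> r0 = 0" "s0 \<bullet> r1 < 0" "s1 \<bullet> r1 = 0" "s1 \<bullet> r0 < 0"
    and B: "pcone B0" "pcone B1" "pcone G" "r0 \<in> B0" "r1 \<in> B1" "G \<subseteq> B0" "G \<subseteq> B1"
      "\<And>x. x \<in> B0 \<Longrightarrow> c \<bullet> x = 0" "\<And>x. x \<in> B1 \<Longrightarrow> c \<bullet> x = 0"
    and Y: "convex Y" "\<And>x. x \<in> Y \<Longrightarrow> m \<bullet> x = 0" "m \<bullet> r0 \<le> 0" "m \<bullet> r1 \<le> 0" "\<And>x. x \<in> G \<Longrightarrow> m \<bullet> x = 0" "m \<noteq> 0"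
      "\<And>x. x \<in> Y \<Longrightarrow> s0 \<bullet> x \<le> 0" "\<And>x. x \<in> Y \<Longrightarrow> s1 \<bullet> x \<le> 0"
      "G face_of Y" "m \<bullet> r0 = 0 \<Longrightarrow> B0 face_of Y" "m \<bullet> r1 = 0 \<Longrightarrow> B1 face_of Y"
    and x: "x \<in> Y" "0 < c \<bullet> x"
  shows "y \<in> Y \<Longrightarrow> 0 \<le> c \<bullet> y"
proof (rule ccontr)
  assume yY: "y \<in> Y" and "\<not> 0 \<le> c \<bullet> y"
  then have cy: "c \<bullet> y < 0" by simp
  define t where "t = (c \<bullet> x) / (c \<bullet> x - c \<bullet> y)"
  have t: "0 < t" "t < 1" using x(2) cy by (auto simp: t_def field_simps)
  define z where "z = (1 - t) *\<^sub>R x + t *\<^sub>R y"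
  have "c \<bullet> z = c \<bullet> x - t * (c \<bullet> x - c \<bullet> y)" by (simp add: z_def inner_add_right algebra_simps)
  then have "c \<bullet> z = 0" using x(2) cy by (simp add: t_def)
  then obtain w a b where w: "w \<in> span G" "z = w + a *\<^sub>R r0 + b *\<^sub>R r1" using c by blast
  have zY: "z \<in> Y" unfolding z_def using Y(1) x(1) yY t by (simp add: convexD_alt)
  have zero: "k \<bullet> w = 0" if "\<And>x. x \<in> G \<Longrightarrow> k \<bullet> x = 0" for k
  proof -
    have "span G \<subseteq> {x. k \<bullet> x = 0}" by (rule span_minimal) (use that in \<open>auto simp: subspace_hyperplane\<close>)
    then show ?thesis using w(1) by blast
  qed
  have "b * (s0 \<bullet> r1) \<le> 0" "a * (s1 \<bullet> r0) \<le> 0"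
    using Y(7)[OF zY] Y(8)[OF zY] zero[of s0] zero[of s1] s by (simp_all add: w(2) inner_add_right)
  then have ab: "a \<ge> 0" "b \<ge> 0" using s by (simp_all add: mult_le_0_iff)
  have "a * (m \<bullet> r0) + b * (m \<bullet> r1) = 0"
    using Y(2)[OF zY] zero[of m] Y(5) by (simp add: w(2) inner_add_right)
  moreover have "a * (m \<bullet> r0) \<le> 0" "b * (m \<bullet> r1) \<le> 0" using ab Y(3,4) by (simp_all add: mult_nonneg_nonpos)
  ultimately have m0: "a = 0 \<or> m \<bullet> r0 = 0" "b = 0 \<or> m \<bullet> r1 = 0" by (smt (verit) mult_eq_0_iff)+
  have "x \<noteq> y" using x(2) cy by auto
  then have zseg: "z \<in> open_segment x y" unfolding in_segment z_def using t by blast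
  have face: False if F: "F face_of Y" "pcone F" "z \<in> span F" "\<And>x. x \<in> F \<Longrightarrow> c \<bullet> x = 0" for F
  proof -
    have "F = affine hull F \<inter> Y" using face_of_imp_eq_affine_Int[OF Y(1) F(1)] .
    then have "z \<in> F" using F(3) zY pcone_affine_hull[OF F(2)] by blast
    then have "x \<in> F" using face_ofD[OF F(1) zseg] x(1) yY by blast
    then show False using F(4) x(2) by fastforce
  qed
  have wB: "w \<in> span B0" "w \<in> span B1" using w(1) span_mono[OF B(6)] span_mono[OF B(7)] by blast+
  consider "a = 0" "b = 0" | "m \<bullet> r0 = 0" "b = 0" | "a = 0" "m \<bullet> r1 = 0" | "m \<bullet> r0 = 0" "m \<bullet> r1 = 0" using m0 by blast
  then show False
  proof cases
    case 1
    then show False using face[OF Y(9) B(3)] w B(6,8) by auto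
  next
    case 2
    then have "z \<in> span B0" using w(2) wB(1) span_base[OF B(4)] by (auto intro: span_add span_scale)
    then show False using face[OF Y(10)[OF 2(1)] B(1)] B(8) by blast
  next
    case 3
    then have "z \<in> span B1" using w(2) wB(2) span_base[OF B(5)] by (auto intro: span_add span_scale)
    then show False using face[OF Y(11)[OF 3(2)] B(2)] B(9) by blast
  next
    case 4
    have "m \<bullet> v = 0" if v: "c \<bullet> v = 0" for v
    proof -
      obtain w' a' b' where w': "w' \<in> span G" "v = w' + a' *\<^sub>R r0 + b' *\<^sub>R r1" using c[OF v] by blast
      have "span G \<subseteq> {x. m \<bullet> x = 0}" by (rule span_minimal) (use Y(5) in \<open>auto simp: subspace_hyperplane\<close>)
      then have "m \<bullet> w' = 0" using w'(1) by blast
      then show ?thesis using 4 by (simp add: w'(2) inner_add_right)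
    qed
    then have "m \<in> span {c}" by (rule perp_perp_singleton)
    then obtain k where "m = k *\<^sub>R c" by (auto simp: span_singleton)
    then show False using Y(2)[OF x(1)] Y(6) x(2) by auto
  qed
qed

context nontrivial_manifold
begin

abbreviation "PP i \<equiv> facet_family.P K h (collar cl i)"
abbreviation "\<nu> i \<equiv> fnormal (PP i)"

lemma collar_Fac: "s \<in> collar cl i \<Longrightarrow> s \<in> Fac" by (simp add: collar_def)

lemma own_collar: "b \<in> bd \<Longrightarrow> own b \<in> collar cl (cl b)"
  using own by (auto simp only: collar_def)

lemma collar_supp: "s \<in> collar cl i \<Longrightarrow> t \<in> collar cl i \<Longrightarrow> supp (nrm s) s t"
proof -
  assume st: "s \<in> collar cl i" "t \<in> collar cl i"
  then obtain b where "b \<in> bd" "cl b = i" "b \<subseteq> s" by (auto simp only: collar_def)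
  then show ?thesis using nrm(3)[OF collar_Fac[OF st(1)], of b t] st by blast
qed

lemma ff: "b \<in> bd \<Longrightarrow> facet_family K h (collar cl (cl b)) nrm"
proof -
  assume b: "b \<in> bd"
  show ?thesis
  proof unfold_locales
    show "collar cl (cl b) \<subseteq> Fac" using collar_Fac by blast
    show "\<exists>s\<in>collar cl (cl b). \<exists>t\<in>collar cl (cl b). s \<noteq> t" using fat_two[OF own_collar[OF b]] own_collar[OF b] by metis
    show "supp (nrm s) s t" if "s \<in> collar cl (cl b)" "t \<in> collar cl (cl b)" for s t using collar_supp that by blast
    show "nrm s \<noteq> 0" "aff_dim (cn h s) = int DIM('w) - 1" if "s \<in> collar cl (cl b)" for s
      using nrm(1) Fdim collar_Fac[OF that] by blast+
  qed
qed

lemma supp_self: "s \<in> Fac \<Longrightarrow> supp (nrm s) s s"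
  using nrm(2)[of s _ s] ex_vertex[OF FacK] by metis

lemma nrm_perp: "s \<in> Fac \<Longrightarrow> x \<in> C s \<Longrightarrow> nrm s \<bullet> x = 0"
  using supp_perp[OF FacK supp_self] by blast

end

section \<open>The boundary near a face of codimension two\<close>

locale chord = nontrivial_manifold K h cl for K :: "'p set set" and h :: "'p \<Rightarrow> 'w::euclidean_space" and cl :: "'p set \<Rightarrow> 'i" +
  fixes b b' g
  assumes b: "b \<in> bd" "b' \<in> bd" "b \<noteq> b'" and g: "g \<in> pk" "g \<subseteq> b" "g \<subseteq> b'"
    and only: "x \<in> bd \<Longrightarrow> g \<subseteq> x \<Longrightarrow> x = b \<or> x = b'"
begin

abbreviation "i \<equiv> cl b"
abbreviation "Q \<equiv> PP i"
abbreviation "s0 \<equiv> own b"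
abbreviation "s1 \<equiv> own b'"
definition "St = {s \<in> Fac. g \<subseteq> s}"

interpretation ff: facet_family K h "collar cl i" nrm by (rule ff[OF b(1)])

lemma cl_eq: "cl b' = cl b"
  using clb[OF b(2,1)] g ne[OF pkK[OF g(1)]] by blast

lemma s_collar: "s0 \<in> collar cl i" "s1 \<in> collar cl i"
  using own_collar[OF b(1)] own_collar[OF b(2)] cl_eq by auto

lemma sSt: "s0 \<in> St" "s1 \<in> St"
  using own(1,2)[OF b(1)] own(1,2)[OF b(2)] g unfolding St_def by blast+

lemma StF: "t \<in> St \<Longrightarrow> t \<in> Fac" by (simp add: St_def)

lemma St_supp: "t \<in> St \<Longrightarrow> t' \<in> St \<Longrightarrow> supp (nrm t) t t'"
proof -
  assume t: "t \<in> St" "t' \<in> St"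
  obtain v where v: "v \<in> g" "v \<in> V" using ex_vertex[OF pkK[OF g(1)]] by blast
  then have "v \<in> t" "v \<in> t'" using t by (auto simp: St_def)
  then show ?thesis using nrm(2)[OF StF[OF t(1)] v(2) _ StF[OF t(2)]] by blast
qed

lemma dimG: "aff_dim (C g) = int DIM('w) - 3" "aff_dim (C g) = aff_dim Q - 3" "pcone (C g)"
  using g(1) ff.P_dim pc[OF pkK[OF g(1)]] by (auto simp: pk_def)

lemma Gsub: "C g \<subseteq> C b" "C g \<subseteq> C b'" "t \<in> St \<Longrightarrow> C g \<subseteq> C t"
  using g by (auto simp: St_def intro!: cn_mono)

lemma bsub: "C b \<subseteq> C s0" "C b' \<subseteq> C s1"
  using own(2)[OF b(1)] own(2)[OF b(2)] by (auto intro!: cn_mono)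

lemma bQ: "C b \<subseteq> Q" "C b' \<subseteq> Q"
  using bsub ff.sub_P[OF s_collar(1)] ff.sub_P[OF s_collar(2)] by blast+

lemma other_facet_unique:
  assumes F: "F facet_of Q" "F' facet_of Q" "F'' facet_of Q" "F \<noteq> F'"
    and f: "f facet_of F" "f \<subseteq> F'" "f \<subseteq> F''"
  shows "F'' = F \<or> F'' = F'"
  using codim2_at_most_two_facets[OF ff.P_pcone F facet_of_imp_subset[OF f(1)] f(2,3) facet_facet_codim2(2)[OF F(1) f(1)]]
    pcone_0[OF pcone_facet[OF pcone_facet[OF ff.P_pcone F(1)] f(1)]] by blast

lemma nrm_multiple:
  assumes "t \<in> collar cl i" obtains a where "a > 0" "nrm t = a *\<^sub>R \<nu> i (C t)"
  using ff.fnormal_\<nu>[OF assms] by blast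

text \<open>If both boundary ridges at \<open>g\<close> lie on one facet, they use up its two ridges
  through \<open>g\<close>, so no neighbour can be attached there.\<close>

lemma sides_single:
  assumes eq: "s0 = s1"
  shows "St = {s0}"
    and "\<lbrakk>f facet_of C s0; C g \<subseteq> f\<rbrakk> \<Longrightarrow> f = C b \<or> f = C b'"
proof -
  have gs: "g \<subseteq> s0" using sSt by (simp add: St_def)
  obtain e e' where e: "e \<noteq> e'" "Rg s0 g = {e, e'}" using Rg_two[OF own(1)[OF b(1)] g(1) gs] by blast
  have "b \<in> Rg s0 g" "b' \<in> Rg s0 g"
    using own(2)[OF b(1)] own(2)[OF b(2)] b g bdK(1) eq unfolding Rg_def by auto
  then have R: "Rg s0 g = {b, b'}" using e b(3) by auto
  show "St = {s0}"
  proof (rule ccontr)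
    assume "St \<noteq> {s0}"
    then obtain t where t: "t \<in> Fac" "g \<subseteq> t" "t \<noteq> s0" using sSt(1) by (auto simp: St_def)
    obtain y where y: "y \<in> Fac" "y \<noteq> s0" "g \<subseteq> y" "s0 \<inter> y \<in> rdg" "s0 \<inter> y \<notin> bd"
      using nb_at[OF pkK[OF g(1)] own(1)[OF b(1)] t(1) gs t(2)] t(3) by blast
    then have "s0 \<inter> y \<in> Rg s0 g" using gs by (simp add: Rg_def)
    then show False using R y(5) b by auto
  qed
  show "f = C b \<or> f = C b'" if f: "f facet_of C s0" "C g \<subseteq> f"
  proof -
    note p = facet_ridge[OF own(1)[OF b(1)] f(1)]
    have "pre s0 f \<in> Rg s0 g" using p pre_sub[OF own(1)[OF b(1)] pkK[OF g(1)] gs f(2)] by (simp add: Rg_def)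
    then show ?thesis using R p(3) by auto
  qed
qed

text \<open>The facets of \<open>Q\<close> around \<open>g\<close> form a turn that the ridges
  \<open>b\<close> and \<open>b'\<close> cut into two arcs; \<open>inn\<close> marks the arc of the
  collar. When \<open>s0\<close> and \<open>s1\<close> differ, the plane through both ridges tells
  the arcs apart, and the facets of the complex at \<open>g\<close> lie on the side of the inner
  arc. Hence they and the outer facets support each other, as it must be if they are to take the
  place of the inner arc.\<close>

lemma sides:
  obtains inn where "inn (C s0)" "inn (C s1)"
    "\<And>F F' f. \<lbrakk>F facet_of Q; F' facet_of Q; F \<noteq> F'; f facet_of F; f \<subseteq> F'; C g \<subseteq> f; f \<noteq> C b; f \<noteq> C b'\<rbrakk> \<Longrightarrow> inn F \<longleftrightarrow> inn F'"
    "\<And>F. \<lbrakk>F facet_of Q; C b \<subseteq> F; F \<noteq> C s0\<rbrakk> \<Longrightarrow> \<not> inn F"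
    "\<And>F. \<lbrakk>F facet_of Q; C b' \<subseteq> F; F \<noteq> C s1\<rbrakk> \<Longrightarrow> \<not> inn F"
    "\<And>F t x. \<lbrakk>F facet_of Q; C g \<subseteq> F; \<not> inn F; t \<in> St; x \<in> C t\<rbrakk> \<Longrightarrow> \<nu> i F \<bullet> x \<le> 0"
    "\<And>F t x. \<lbrakk>F facet_of Q; C g \<subseteq> F; \<not> inn F; t \<in> St; x \<in> F\<rbrakk> \<Longrightarrow> nrm t \<bullet> x \<le> 0"
    "\<And>F t. \<lbrakk>F facet_of Q; C g \<subseteq> F; \<not> inn F; t \<in> St\<rbrakk> \<Longrightarrow> nrm t \<notin> span {\<nu> i F}"
proof (cases "s0 = s1")
  case True
  note S = sides_single[OF True]
  show ?thesis
  proof (rule that[of "\<lambda>F. F = C s0"])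
    fix F F' f assume F: "F facet_of Q" "F' facet_of Q" "F \<noteq> F'" "f facet_of F" "f \<subseteq> F'" "C g \<subseteq> f" "f \<noteq> C b" "f \<noteq> C b'"
    note cd = facet_facet_codim2[OF F(1,4)]
    have "f facet_of F'" by (rule codim2_face_facet[OF ff.P_pcone F(2) cd(1) F(5) cd(2,3)])
    then show "F = C s0 \<longleftrightarrow> F' = C s0" using S(2)[of f] F by metis
  next
    fix F t x assume F: "F facet_of Q" "F \<noteq> C s0" "t \<in> St"
    then have t: "t = s0" using S(1) by blast
    show "\<nu> i F \<bullet> x \<le> 0" if "x \<in> C t" using fnormal(2)[OF ff.P_pcone F(1)] ff.sub_P[OF s_collar(1)] that t by blast
    show "nrm t \<bullet> x \<le> 0" if "x \<in> F" using ff.P_le[OF s_collar(1)] facet_of_imp_subset[OF F(1)] that t by blast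
    obtain a where a: "a > 0" "nrm s0 = a *\<^sub>R \<nu> i (C s0)" using nrm_multiple[OF s_collar(1)] by blast
    show "nrm t \<notin> span {\<nu> i F}"
    proof
      assume "nrm t \<in> span {\<nu> i F}"
      then have "(1/a) *\<^sub>R nrm t \<in> span {\<nu> i F}" by (rule span_scale)
      then show False using fnormal_indep[OF ff.P_pcone F(1) ff.P_facet[OF s_collar(1)] F(2)] a t by simp
    qed
  qed (use True in auto)
next
  case False
  obtain r0 where r0: "r0 \<in> rel_interior (C b)" using pcone_rel_interior[OF pc[OF bdK(2)[OF b(1)]]] by blast
  obtain r1 where r1: "r1 \<in> rel_interior (C b')" using pcone_rel_interior[OF pc[OF bdK(2)[OF b(2)]]] by blast
  have rin: "r0 \<in> C b" "r1 \<in> C b'" using r0 r1 rel_interior_subset by blast+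
  note pcb = pc[OF bdK(2)[OF b(1)]] pc[OF bdK(2)[OF b(2)]]
  have bt: "t = s0" if t: "t \<in> St" "nrm t \<bullet> r0 = 0" for t
  proof -
    have le: "nrm t \<bullet> x \<le> 0" if "x \<in> C b" for x using supp_le[OF St_supp[OF t(1) sSt(1)]] that bsub(1) by blast
    have "nrm t \<bullet> x = 0" if "x \<in> C b" for x
      by (rule rel_interior_zero[OF pcone_convex[OF pcb(1)] r0 le t(2) that])
    then have "nrm t \<bullet> h x = 0" if "x \<in> b" for x using cn_base[OF that] by blast
    then have "b \<subseteq> t"
      by (rule supp_sub[OF St_supp[OF t(1) sSt(1)] FacK[OF StF[OF t(1)]] FacK[OF own(1)[OF b(1)]] bdK(2)[OF b(1)] own(2)[OF b(1)]])
    then show ?thesis using own(3)[OF b(1) StF[OF t(1)]] by blast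
  qed
  have bt': "t = s1" if t: "t \<in> St" "nrm t \<bullet> r1 = 0" for t
  proof -
    have le: "nrm t \<bullet> x \<le> 0" if "x \<in> C b'" for x using supp_le[OF St_supp[OF t(1) sSt(2)]] that bsub(2) by blast
    have "nrm t \<bullet> x = 0" if "x \<in> C b'" for x
      by (rule rel_interior_zero[OF pcone_convex[OF pcb(2)] r1 le t(2) that])
    then have "nrm t \<bullet> h x = 0" if "x \<in> b'" for x using cn_base[OF that] by blast
    then have "b' \<subseteq> t"
      by (rule supp_sub[OF St_supp[OF t(1) sSt(2)] FacK[OF StF[OF t(1)]] FacK[OF own(1)[OF b(2)]] bdK(2)[OF b(2)] own(2)[OF b(2)]])
    then show ?thesis using own(3)[OF b(2) StF[OF t(1)]] by blast
  qed
  have tr: "nrm t \<bullet> r0 \<le> 0" "nrm t \<bullet> r1 \<le> 0" if t: "t \<in> St" for t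
    using supp_le[OF St_supp[OF t sSt(1)]] supp_le[OF St_supp[OF t sSt(2)]] bsub rin by blast+
  let ?n0 = "nrm s0" and ?n1 = "nrm s1"
  have n0: "?n0 \<bullet> r0 = 0" "?n0 \<bullet> r1 < 0" "?n1 \<bullet> r1 = 0" "?n1 \<bullet> r0 < 0"
  proof -
    show "?n0 \<bullet> r0 = 0" "?n1 \<bullet> r1 = 0" using nrm_perp StF sSt bsub rin by blast+
    show "?n0 \<bullet> r1 < 0" using bt'[OF sSt(1)] tr(2)[OF sSt(1)] False by fastforce
    show "?n1 \<bullet> r0 < 0" using bt[OF sSt(2)] tr(1)[OF sSt(2)] False by fastforce
  qed
  have nG: "nrm t \<bullet> x = 0" if "t \<in> St" "x \<in> C g" for t x using nrm_perp[OF StF[OF that(1)]] Gsub(3)[OF that(1)] that(2) by blast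
  have dG: "int (dim (C g)) = int DIM('w) - 3" using dimG pcone_aff_dim by metis
  obtain c0 where c0: "c0 \<noteq> 0" "\<And>x. x \<in> C g \<Longrightarrow> c0 \<bullet> x = 0" "c0 \<bullet> r0 = 0" "c0 \<bullet> r1 = 0"
    "\<And>x. c0 \<bullet> x = 0 \<Longrightarrow> \<exists>z\<in>span (C g). \<exists>a b. x = z + a *\<^sub>R r0 + b *\<^sub>R r1"
    using chord_functional[OF dG nG[OF sSt(1)] nG[OF sSt(2)] n0] by blast
  \<comment> \<open>The part of the plane allowed by the two collar facets is the angle spanned by
    \<open>r0\<close> and \<open>r1\<close>.\<close>
  have comb: "\<exists>z\<in>span (C g). \<exists>a\<ge>0. \<exists>b\<ge>0. x = z + a *\<^sub>R r0 + b *\<^sub>R r1"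
    if x: "c0 \<bullet> x = 0" "?n0 \<bullet> x \<le> 0" "?n1 \<bullet> x \<le> 0" for x
  proof -
    obtain z a b where z: "z \<in> span (C g)" "x = z + a *\<^sub>R r0 + b *\<^sub>R r1" using c0(5)[OF x(1)] by blast
    have zz: "nrm t \<bullet> z = 0" if "t \<in> St" for t
    proof -
      have "span (C g) \<subseteq> {x. nrm t \<bullet> x = 0}" by (rule span_minimal) (use nG[OF that] in \<open>auto simp: subspace_hyperplane\<close>)
      then show ?thesis using z(1) by blast
    qed
    have "b * (?n0 \<bullet> r1) \<le> 0" "a * (?n1 \<bullet> r0) \<le> 0" using x(2,3) zz sSt n0 by (simp_all add: z(2) inner_add_right)
    then have "a \<ge> 0" "b \<ge> 0" using n0 by (simp_all add: mult_le_0_iff)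
    then show ?thesis using z by blast
  qed
  have comb_le: "m \<bullet> x \<le> 0" if x: "c0 \<bullet> x = 0" "?n0 \<bullet> x \<le> 0" "?n1 \<bullet> x \<le> 0"
    and m: "\<And>x. x \<in> C g \<Longrightarrow> m \<bullet> x = 0" "m \<bullet> r0 \<le> 0" "m \<bullet> r1 \<le> 0" for m x
  proof -
    obtain z a b where z: "z \<in> span (C g)" "a \<ge> 0" "b \<ge> 0" "x = z + a *\<^sub>R r0 + b *\<^sub>R r1" using comb[OF x] by blast
    have "span (C g) \<subseteq> {x. m \<bullet> x = 0}" by (rule span_minimal) (use m(1) in \<open>auto simp: subspace_hyperplane\<close>)
    then have "m \<bullet> z = 0" using z(1) by blast
    then show ?thesis using z m by (simp add: inner_add_right mult_nonneg_nonpos add_nonpos_nonpos)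
  qed
  have combs: "m \<bullet> x = 0 \<Longrightarrow> m' \<bullet> x = 0 \<Longrightarrow> x \<in> span (C g)" if x: "c0 \<bullet> x = 0" "?n0 \<bullet> x \<le> 0" "?n1 \<bullet> x \<le> 0"
    and m: "\<And>x. x \<in> C g \<Longrightarrow> m \<bullet> x = 0" "m \<bullet> r0 \<le> 0" "m \<bullet> r1 \<le> 0"
    and m': "\<And>x. x \<in> C g \<Longrightarrow> m' \<bullet> x = 0" "m' \<bullet> r0 \<le> 0" "m' \<bullet> r1 \<le> 0"
    and s: "m \<bullet> r0 < 0 \<or> m' \<bullet> r0 < 0" "m \<bullet> r1 < 0 \<or> m' \<bullet> r1 < 0" for m m' x
  proof -
    assume zero: "m \<bullet> x = 0" "m' \<bullet> x = 0"
    obtain z a b where z: "z \<in> span (C g)" "a \<ge> 0" "b \<ge> 0" "x = z + a *\<^sub>R r0 + b *\<^sub>R r1" using comb[OF x] by blast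
    have "span (C g) \<subseteq> {x. m \<bullet> x = 0}" "span (C g) \<subseteq> {x. m' \<bullet> x = 0}"
      by (rule span_minimal; use m(1) m'(1) in \<open>auto simp: subspace_hyperplane\<close>)+
    then have "m \<bullet> z = 0" "m' \<bullet> z = 0" using z(1) by blast+
    then have e: "a * (m \<bullet> r0) + b * (m \<bullet> r1) = 0" "a * (m' \<bullet> r0) + b * (m' \<bullet> r1) = 0"
      using zero z(4) by (simp_all add: inner_add_right)
    have l: "a * (m \<bullet> r0) \<le> 0" "b * (m \<bullet> r1) \<le> 0" "a * (m' \<bullet> r0) \<le> 0" "b * (m' \<bullet> r1) \<le> 0"
      using z m m' by (simp_all add: mult_nonneg_nonpos)
    have "a * (m \<bullet> r0) = 0" "b * (m \<bullet> r1) = 0" "a * (m' \<bullet> r0) = 0" "b * (m' \<bullet> r1) = 0" using e l by linarith+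
    then have "a = 0" "b = 0" using s by auto
    then show ?thesis using z by simp
  qed
  have cb: "c0 \<bullet> x = 0" if "x \<in> C b \<or> x \<in> C b'" for x
  proof -
    have "aff_dim (insert r (C g)) = aff_dim B" if "B \<in> {C b, C b'}" "r \<in> rel_interior B" for B r
    proof -
      have "C g facet_of B" using that pk_facet[OF g(1) bdK(1)] b g by auto
      moreover have "r \<notin> affine hull (C g)"
      proof
        assume "r \<in> affine hull (C g)"
        moreover have "convex B" "C g face_of B" using calculation that pcb pcone_convex \<open>C g facet_of B\<close> facet_of_imp_face_of by auto
        ultimately have "r \<in> C g" using face_of_imp_eq_affine_Int[of B "C g"] that rel_interior_subset by blast
        then show False using facet_disjoint_rel_interior[OF \<open>C g facet_of B\<close> that(2)] by blast
      qed
      ultimately show ?thesis by (simp add: aff_dim_insert facet_of_def)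
    qed
    then have hb: "affine hull (insert r (C g)) = affine hull B" if "B \<in> {C b, C b'}" "r \<in> rel_interior B" for B r
    proof (intro affine_dim_equal)
      show "affine hull insert r (C g) \<subseteq> affine hull B"
        using that rel_interior_subset Gsub by (intro hull_mono) blast
    qed (use that in \<open>auto simp: aff_dim_affine_hull\<close>)
    have "affine hull (insert r0 (C g)) \<subseteq> {x. c0 \<bullet> x = 0}" "affine hull (insert r1 (C g)) \<subseteq> {x. c0 \<bullet> x = 0}"
      by (rule hull_minimal; use c0 in \<open>auto simp: affine_hyperplane\<close>)+
    then have "affine hull (C b) \<subseteq> {x. c0 \<bullet> x = 0}" "affine hull (C b') \<subseteq> {x. c0 \<bullet> x = 0}"
      using hb[OF _ r0] hb[OF _ r1] by simp_all
    then show ?thesis using that hull_inc[of x "C b" affine] hull_inc[of x "C b'" affine] by fastforce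
  qed
  \<comment> \<open>Stated for both orientations of the plane, so that it can be used before the
    sign of \<open>c\<close> is fixed.\<close>
  have os: "y \<in> Y \<Longrightarrow> 0 \<le> k *\<^sub>R c0 \<bullet> y"
    if k: "k \<noteq> 0" and Y: "convex Y" "\<And>x. x \<in> Y \<Longrightarrow> m \<bullet> x = 0" "m \<bullet> r0 \<le> 0" "m \<bullet> r1 \<le> 0" "\<And>x. x \<in> C g \<Longrightarrow> m \<bullet> x = 0" "m \<noteq> 0"
      "\<And>x. x \<in> Y \<Longrightarrow> ?n0 \<bullet> x \<le> 0" "\<And>x. x \<in> Y \<Longrightarrow> ?n1 \<bullet> x \<le> 0"
      "C g face_of Y" "m \<bullet> r0 = 0 \<Longrightarrow> C b face_of Y" "m \<bullet> r1 = 0 \<Longrightarrow> C b' face_of Y"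
      and x: "x \<in> Y" "0 < k *\<^sub>R c0 \<bullet> x" for k Y m x y
    by (rule one_sided[of "k *\<^sub>R c0" "C g" r0 r1 ?n0 ?n1 "C b" "C b'" Y m x y])
      (use k c0 nG sSt n0 pcb dimG(3) rin Gsub cb Y x in auto)
  have t_face: "C g face_of C t" "nrm t \<bullet> r0 = 0 \<Longrightarrow> C b face_of C t" "nrm t \<bullet> r1 = 0 \<Longrightarrow> C b' face_of C t" if t: "t \<in> St" for t
  proof -
    have gt: "g \<subseteq> t" using t by (simp add: St_def)
    show "C g face_of C t" by (rule C_face[OF FacK[OF StF[OF t]] pkK[OF g(1)] gt])
    show "C b face_of C t" if "nrm t \<bullet> r0 = 0"
      using bt[OF t that] C_face[OF FacK[OF own(1)[OF b(1)]] bdK(2)[OF b(1)] own(2)[OF b(1)]] by simp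
    show "C b' face_of C t" if "nrm t \<bullet> r1 = 0"
      using bt'[OF t that] C_face[OF FacK[OF own(1)[OF b(2)]] bdK(2)[OF b(2)] own(2)[OF b(2)]] by simp
  qed
  have t_os: "0 \<le> k *\<^sub>R c0 \<bullet> y" if "k \<noteq> 0" "t \<in> St" "x \<in> C t" "0 < k *\<^sub>R c0 \<bullet> x" "y \<in> C t" for k t x y
    by (rule os[of k "C t" "nrm t" x y])
      (use that pcone_convex[OF pc[OF FacK[OF StF]]] nrm_perp[OF StF] tr nG nrm(1)[OF StF] supp_le[OF St_supp] sSt t_face in auto)
  \<comment> \<open>If the interior point \<open>q\<close> of a ridge lay in the plane, both
    functionals would vanish at a nonnegative combination of \<open>r0\<close> and \<open>r1\<close>
    modulo \<open>span (C g)\<close>; being jointly strict on each of the two rays, they would force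
    \<open>q\<close> into \<open>C g\<close>.\<close>
  have ridge_nz: "c0 \<bullet> q \<noteq> 0" if q: "q \<in> rel_interior f" "f \<subseteq> X" and f: "pcone f" "C g facet_of f"
     and m: "\<And>x. x \<in> f \<Longrightarrow> m \<bullet> x = 0" "m \<bullet> r0 \<le> 0" "m \<bullet> r1 \<le> 0"
     and m': "\<And>x. x \<in> f \<Longrightarrow> m' \<bullet> x = 0" "m' \<bullet> r0 \<le> 0" "m' \<bullet> r1 \<le> 0"
     and s: "m \<bullet> r0 < 0 \<or> m' \<bullet> r0 < 0" "m \<bullet> r1 < 0 \<or> m' \<bullet> r1 < 0"
     and X: "\<And>x. x \<in> X \<Longrightarrow> ?n0 \<bullet> x \<le> 0" "\<And>x. x \<in> X \<Longrightarrow> ?n1 \<bullet> x \<le> 0" for q f X m m'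
  proof
    assume "c0 \<bullet> q = 0"
    have qf: "q \<in> f" using q rel_interior_subset by blast
    have gf: "C g \<subseteq> f" using f(2) facet_of_imp_subset by blast
    have "q \<in> span (C g)"
      using combs[OF \<open>c0 \<bullet> q = 0\<close> _ _ _ m(2,3) _ m'(2,3) s] X qf q(2) gf m(1) m'(1) by blast
    then have "q \<in> C g"
      using face_of_imp_eq_affine_Int[OF pcone_convex[OF f(1)] facet_of_imp_face_of[OF f(2)]] pcone_affine_hull[OF dimG(3)] qf by blast
    then show False using facet_disjoint_rel_interior[OF f(2) q(1)] by blast
  qed
  have gSt: "g \<subseteq> t" if "t \<in> St" for t using that by (simp add: St_def)
  have t_ridge: "c0 \<bullet> q \<noteq> 0"
    if t: "t \<in> St" "t' \<in> St" "t \<noteq> t'" "t \<inter> t' \<in> rdg" and q: "q \<in> rel_interior (C (t \<inter> t'))" for t t' q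
  proof (rule ridge_nz[OF q, of "C t" "nrm t" "nrm t'"])
    have sub: "C (t \<inter> t') \<subseteq> C t" "C (t \<inter> t') \<subseteq> C t'" by (rule cn_mono; blast)+
    show "C (t \<inter> t') \<subseteq> C t" by fact
    show "pcone (C (t \<inter> t'))" by (rule pc[OF bdK(3)[OF t(4)]])
    show "C g facet_of C (t \<inter> t')" by (rule pk_facet[OF g(1) t(4)]) (use gSt t in blast)
    show "nrm t \<bullet> x = 0" "nrm t' \<bullet> x = 0" if "x \<in> C (t \<inter> t')" for x
      using nrm_perp[OF StF[OF t(1)]] nrm_perp[OF StF[OF t(2)]] sub that by blast+
    show "nrm t \<bullet> r0 \<le> 0" "nrm t \<bullet> r1 \<le> 0" "nrm t' \<bullet> r0 \<le> 0" "nrm t' \<bullet> r1 \<le> 0" using tr t(1,2) by blast+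
    show "nrm t \<bullet> r0 < 0 \<or> nrm t' \<bullet> r0 < 0" using bt[OF t(1)] bt[OF t(2)] tr(1)[OF t(1)] tr(1)[OF t(2)] t(3) by fastforce
    show "nrm t \<bullet> r1 < 0 \<or> nrm t' \<bullet> r1 < 0" using bt'[OF t(1)] bt'[OF t(2)] tr(2)[OF t(1)] tr(2)[OF t(2)] t(3) by fastforce
    show "nrm s0 \<bullet> x \<le> 0" "nrm s1 \<bullet> x \<le> 0" if "x \<in> C t" for x
      using supp_le[OF St_supp[OF sSt(1) t(1)] that] supp_le[OF St_supp[OF sSt(2) t(1)] that] by blast+
  qed
  obtain y0 where y0: "y0 \<in> Fac" "y0 \<noteq> s0" "g \<subseteq> y0" "s0 \<inter> y0 \<in> rdg" "s0 \<inter> y0 \<notin> bd"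
    by (rule nb_at[OF pkK[OF g(1)] StF[OF sSt(1)] StF[OF sSt(2)] gSt[OF sSt(1)] gSt[OF sSt(2)] False]) (rule that)
  have y0St: "y0 \<in> St" using y0 by (simp add: St_def)
  obtain q0 where q0: "q0 \<in> rel_interior (C (s0 \<inter> y0))" using pcone_rel_interior[OF pc[OF bdK(3)[OF y0(4)]]] by blast
  have q0s: "q0 \<in> C s0" using q0 rel_interior_subset cn_mono[of "s0 \<inter> y0" s0 h] by blast
  \<comment> \<open>The sign that puts the facets of the complex at \<open>g\<close> on the
    nonnegative side of the plane.\<close>
  define k where "k = sgn (c0 \<bullet> q0)"
  have q0nz: "c0 \<bullet> q0 \<noteq> 0" using t_ridge[OF sSt(1) y0St y0(2)[symmetric] y0(4) q0] .
  then have k: "k \<noteq> 0" by (simp add: k_def sgn_zero_iff)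
  define c where "c = k *\<^sub>R c0"
  have q0c: "0 < c \<bullet> q0" using q0nz by (simp add: c_def k_def sgn_real_def)
  have c_c0: "c \<bullet> x = 0 \<longleftrightarrow> c0 \<bullet> x = 0" for x using k by (simp add: c_def)
  \<comment> \<open>Positivity spreads through the ridges at \<open>g\<close>: the interior of a
    ridge between two facets avoids the plane and lies on the side of the facet already
    reached.\<close>
  have inSt: "\<exists>q\<in>C t. 0 < c \<bullet> q" if t: "t \<in> St" for t
  proof -
    have "(s0, t) \<in> {(a, b). a \<in> Fac \<and> b \<in> Fac \<and> g \<subseteq> a \<and> g \<subseteq> b \<and> aff_dim (cn h (a \<inter> b)) = int DIM('w) - 2}\<^sup>*"
      by (rule strong[OF pkK[OF g(1)] StF[OF sSt(1)] StF[OF t] gSt[OF sSt(1)] gSt[OF t]])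
    then show ?thesis
    proof (induction rule: rtrancl_induct)
      case base
      then show ?case using q0s q0c by blast
    next
      case (step a d)
      then have ad: "a \<in> St" "d \<in> St" "aff_dim (C (a \<inter> d)) = int DIM('w) - 2" by (auto simp: St_def)
      show ?case
      proof (cases "a = d")
        case True
        then show ?thesis using step.IH by simp
      next
        case False
        note rd = inter_cell[OF StF[OF ad(1)] StF[OF ad(2)] ad(3)]
        obtain q where q: "q \<in> rel_interior (C (a \<inter> d))" using pcone_rel_interior[OF pc[OF bdK(3)[OF rd]]] by blast
        have qq: "q \<in> C a" "q \<in> C d"
          using q rel_interior_subset cn_mono[of "a \<inter> d" a h] cn_mono[of "a \<inter> d" d h] by blast+
        obtain p where "p \<in> C a" "0 < c \<bullet> p" using step.IH by blast
        then have "0 \<le> c \<bullet> q" using t_os[OF k ad(1) _ _ qq(1), of p] by (simp add: c_def)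
        moreover have "c \<bullet> q \<noteq> 0" using t_ridge[OF ad(1,2) False rd q] c_c0 by simp
        ultimately show ?thesis using qq(2) by (intro bexI[of _ q]) auto
      qed
    qed
  qed
  have c_St: "0 \<le> c \<bullet> x" if t: "t \<in> St" "x \<in> C t" for t x
  proof -
    obtain p where "p \<in> C t" "0 < c \<bullet> p" using inSt[OF t(1)] by blast
    then show ?thesis using t_os[OF k t(1) _ _ t(2), of p] by (simp add: c_def)
  qed
  define inn where "inn F \<longleftrightarrow> (\<exists>q\<in>F. 0 < c \<bullet> q)" for F
  note Qpc = ff.P_pcone
  have Qle: "nrm s0 \<bullet> x \<le> 0" "nrm s1 \<bullet> x \<le> 0" if "x \<in> Q" for x using ff.P_le[OF _ that] s_collar by blast+
  have bface: "C b face_of Q" "C b' face_of Q" "C g face_of Q"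
  proof -
    have "C b face_of C s0" by (rule C_face[OF FacK[OF own(1)[OF b(1)]] bdK(2)[OF b(1)] own(2)[OF b(1)]])
    then show bQ: "C b face_of Q" using face_of_trans facet_of_imp_face_of[OF ff.P_facet[OF s_collar(1)]] by blast
    have "C b' face_of C s1" by (rule C_face[OF FacK[OF own(1)[OF b(2)]] bdK(2)[OF b(2)] own(2)[OF b(2)]])
    then show "C b' face_of Q" using face_of_trans facet_of_imp_face_of[OF ff.P_facet[OF s_collar(2)]] by blast
    have "C g face_of C b" by (rule C_face[OF bdK(2)[OF b(1)] pkK[OF g(1)] g(2)])
    then show "C g face_of Q" using bQ face_of_trans by blast
  qed
  have rQ: "r0 \<in> Q" "r1 \<in> Q" using rin bQ by blast+
  have Fr: "C b \<subseteq> F" if F: "F facet_of Q" "\<nu> i F \<bullet> r0 = 0" for F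
  proof
    fix x assume x: "x \<in> C b"
    have "\<nu> i F \<bullet> x = 0"
      by (rule rel_interior_zero[OF pcone_convex[OF pcb(1)] r0 _ F(2) x]) (use fnormal(2)[OF Qpc F(1)] bQ in blast)
    then show "x \<in> F" using fnormal(3)[OF Qpc F(1)] x bQ by blast
  qed
  have Fr': "C b' \<subseteq> F" if F: "F facet_of Q" "\<nu> i F \<bullet> r1 = 0" for F
  proof
    fix x assume x: "x \<in> C b'"
    have "\<nu> i F \<bullet> x = 0"
      by (rule rel_interior_zero[OF pcone_convex[OF pcb(2)] r1 _ F(2) x]) (use fnormal(2)[OF Qpc F(1)] bQ in blast)
    then show "x \<in> F" using fnormal(3)[OF Qpc F(1)] x bQ by blast
  qed
  have Fzero: "\<nu> i F \<bullet> x = 0" if "F facet_of Q" "x \<in> F" for F x using fnormal(3)[OF Qpc that(1)] that(2) by blast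
  have FQ: "x \<in> Q" if "F facet_of Q" "x \<in> F" for F x using facet_of_imp_subset[OF that(1)] that(2) by blast
  have F_os: "0 \<le> c \<bullet> y" if F: "F facet_of Q" "C g \<subseteq> F" "inn F" "y \<in> F" for F y
  proof -
    obtain p where p: "p \<in> F" "0 < c \<bullet> p" using F(3) by (auto simp: inn_def)
    have "0 \<le> k *\<^sub>R c0 \<bullet> y"
    proof (rule os[OF k, of F "\<nu> i F" p y])
      show "convex F" using pcone_convex[OF pcone_facet[OF Qpc F(1)]] .
      show "\<nu> i F \<bullet> r0 \<le> 0" "\<nu> i F \<bullet> r1 \<le> 0" using fnormal(2)[OF Qpc F(1)] rQ by blast+
      show "\<nu> i F \<bullet> x = 0" if "x \<in> C g" for x using Fzero[OF F(1)] F(2) that by blast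
      show "\<nu> i F \<noteq> 0" by (rule fnormal(4)[OF Qpc F(1)])
      show "C g face_of F" by (rule face_of_subset[OF bface(3) F(2) facet_of_imp_subset[OF F(1)]])
      show "C b face_of F" if "\<nu> i F \<bullet> r0 = 0" by (rule face_of_subset[OF bface(1) Fr[OF F(1) that] facet_of_imp_subset[OF F(1)]])
      show "C b' face_of F" if "\<nu> i F \<bullet> r1 = 0" by (rule face_of_subset[OF bface(2) Fr'[OF F(1) that] facet_of_imp_subset[OF F(1)]])
      show "nrm s0 \<bullet> x \<le> 0" "nrm s1 \<bullet> x \<le> 0" if "x \<in> F" for x using Qle[OF FQ[OF F(1) that]] by blast+
      show "0 < k *\<^sub>R c0 \<bullet> p" using p(2) by (simp only: c_def)
    qed (use Fzero[OF F(1)] p F(4) in auto)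
    then show ?thesis by (simp only: c_def)
  qed
  have outer_nonpos: "c \<bullet> y \<le> 0" if "\<not> inn F" "y \<in> F" for F y using that unfolding inn_def by (meson not_less)
  \<comment> \<open>A facet of \<open>Q\<close> inside the plane counts as outer; its outer normal
    is opposite to \<open>c\<close> because \<open>Q\<close> contains \<open>q0\<close>.\<close>
  have flat: "\<exists>l<0. c = l *\<^sub>R \<nu> i F" if F: "F facet_of Q" "\<And>y. y \<in> F \<Longrightarrow> c \<bullet> y = 0" for F
  proof -
    have dF: "aff_dim F = int DIM('w) - 1" using F(1) ff.P_dim by (simp add: facet_of_def)
    have sp: "span F = {x. \<nu> i F \<bullet> x = 0}"
      by (rule span_hyperplane_eq[OF pcone_facet[OF Qpc F(1)] dF fnormal(4)[OF Qpc F(1)] Fzero[OF F(1)]])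
    have "span F \<subseteq> {x. c \<bullet> x = 0}" by (rule span_minimal) (use F(2) in \<open>auto simp: subspace_hyperplane\<close>)
    then have "c \<in> span {\<nu> i F}" using sp by (intro perp_perp_singleton) blast
    then obtain l where l: "c = l *\<^sub>R \<nu> i F" by (auto simp: span_singleton)
    have "0 < l * (\<nu> i F \<bullet> q0)" using q0c l by simp
    moreover have "\<nu> i F \<bullet> q0 \<le> 0" using fnormal(2)[OF Qpc F(1)] ff.sub_P[OF s_collar(1)] q0s by blast
    ultimately have "l < 0" by (smt (verit) mult_nonneg_nonpos)
    then show ?thesis using l by blast
  qed
  have bal: "\<exists>M>0. c0 \<bullet> (x + M *\<^sub>R y) = 0" if "0 < c \<bullet> x" "c \<bullet> y < 0" for x y
  proof -
    have "c \<bullet> (x + ((c \<bullet> x) / (- (c \<bullet> y))) *\<^sub>R y) = 0" using that by (simp add: inner_diff_right)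
    then show ?thesis using that c_c0 by (intro exI[of _ "(c \<bullet> x) / (- (c \<bullet> y))"]) (auto simp: divide_pos_neg divide_neg_pos)
  qed
  have \<nu>r: "\<nu> i F \<bullet> r0 \<le> 0" "\<nu> i F \<bullet> r1 \<le> 0" if "F facet_of Q" for F using fnormal(2)[OF Qpc that] rQ by blast+
  have \<nu>g: "\<nu> i F \<bullet> x = 0" if "F facet_of Q" "C g \<subseteq> F" "x \<in> C g" for F x using Fzero[OF that(1)] that by blast
  have tle: "nrm s0 \<bullet> x \<le> 0" "nrm s1 \<bullet> x \<le> 0" if "t \<in> St" "x \<in> C t" for t x
    using supp_le[OF St_supp[OF sSt(1) that(1)] that(2)] supp_le[OF St_supp[OF sSt(2) that(1)] that(2)] by blast+
  have sum_le: "nrm s0 \<bullet> (x + M *\<^sub>R y) \<le> 0" "nrm s1 \<bullet> (x + M *\<^sub>R y) \<le> 0"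
    if "t \<in> St" "x \<in> C t" "y \<in> Q" "M \<ge> 0" for t x y M
    using tle[OF that(1,2)] Qle[OF that(3)] that(4) by (simp_all add: inner_add_right add_nonpos_nonpos mult_nonneg_nonpos)
  \<comment> \<open>A point \<open>x\<close> of the complex above the plane and a point
    \<open>y\<close> of the outer facet below it combine to a point of the plane. By
    \<open>sum_le\<close> it lies in the angle of \<open>r0\<close> and \<open>r1\<close>, where the
    functional of \<open>F\<close> is nonpositive; as this functional vanishes at \<open>y\<close>,
    it is nonpositive at \<open>x\<close>.\<close>
  have M1: "\<nu> i F \<bullet> x \<le> 0" if F: "F facet_of Q" "C g \<subseteq> F" "\<not> inn F" and t: "t \<in> St" "x \<in> C t" for F t x
  proof (rule ccontr)
    assume "\<not> ?thesis"
    then have pos: "0 < \<nu> i F \<bullet> x" by simp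
    show False
    proof (cases "\<exists>y\<in>F. c \<bullet> y < 0")
      case False
      then have "c \<bullet> y = 0" if "y \<in> F" for y using outer_nonpos[OF F(3) that] that by force
      then obtain l where l: "l < 0" "c = l *\<^sub>R \<nu> i F" using flat[OF F(1)] by blast
      then have "c \<bullet> x < 0" using pos by (simp add: mult_neg_pos)
      then show False using c_St[OF t] by simp
    next
      case True
      then obtain y where y: "y \<in> F" "c \<bullet> y < 0" by blast
      show False
      proof (cases "c \<bullet> x = 0")
        case True
        then show False using comb_le[of x "\<nu> i F"] tle[OF t] \<nu>g[OF F(1,2)] \<nu>r[OF F(1)] pos c_c0 by force
      next
        case False
        then have "0 < c \<bullet> x" using c_St[OF t] by simp
        then obtain M where M: "M > 0" "c0 \<bullet> (x + M *\<^sub>R y) = 0" using bal y(2) by blast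
        have "\<nu> i F \<bullet> (x + M *\<^sub>R y) \<le> 0"
          by (rule comb_le[OF M(2) sum_le[OF t FQ[OF F(1) y(1)]]])
            (use M(1) \<nu>g[OF F(1,2)] \<nu>r[OF F(1)] in auto)
        then show False using pos Fzero[OF F(1) y(1)] by (simp add: inner_add_right)
      qed
    qed
  qed
  have M2: "nrm t \<bullet> y \<le> 0" if F: "F facet_of Q" "C g \<subseteq> F" "\<not> inn F" and t: "t \<in> St" and y: "y \<in> F" for F t y
  proof (rule ccontr)
    assume "\<not> ?thesis"
    then have pos: "0 < nrm t \<bullet> y" by simp
    show False
    proof (cases "c \<bullet> y = 0")
      case True
      then show False using comb_le[of y "nrm t"] Qle[OF FQ[OF F(1) y]] nG[OF t] tr[OF t] pos c_c0 by force
    next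
      case False
      then have cy: "c \<bullet> y < 0" using outer_nonpos[OF F(3) y] by simp
      obtain x where x: "x \<in> C t" "0 < c \<bullet> x" using inSt[OF t] by blast
      obtain M where M: "M > 0" "c0 \<bullet> (x + M *\<^sub>R y) = 0" using bal[OF x(2) cy] by blast
      have "nrm t \<bullet> (x + M *\<^sub>R y) \<le> 0"
        by (rule comb_le[OF M(2) sum_le[OF t x(1) FQ[OF F(1) y]]]) (use M(1) nG[OF t] tr[OF t] in auto)
      then have "M * (nrm t \<bullet> y) \<le> 0" using nrm_perp[OF StF[OF t] x(1)] by (simp add: inner_add_right)
      then show False using M(1) pos by (simp add: mult_le_0_iff)
    qed
  qed
  \<comment> \<open>Opposite normals contradict \<open>M1\<close>. With equal directions,
    \<open>F\<close> would be the inner facet \<open>C t\<close> if \<open>t\<close> is in the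
    collar. Otherwise \<open>nrm t\<close> is strict on \<open>r0\<close> and \<open>r1\<close>, and
    for \<open>F\<close> not inside the plane the combined point falls into
    \<open>span (C g)\<close>, although \<open>nrm s0\<close> is negative inside the cone of
    \<open>t\<close>.\<close>
  have M3: "nrm t \<notin> span {\<nu> i F}" if F: "F facet_of Q" "C g \<subseteq> F" "\<not> inn F" and t: "t \<in> St" for F t
  proof
    assume "nrm t \<in> span {\<nu> i F}"
    then obtain l where l: "nrm t = l *\<^sub>R \<nu> i F" by (auto simp: span_singleton)
    have "l \<noteq> 0" using l nrm(1)[OF StF[OF t]] by auto
    show False
    proof (cases "l < 0")
      case True
      define t' where "t' = (if t = s0 then s1 else s0)"
      have t': "t' \<in> St" "t' \<noteq> t" using sSt False by (auto simp: t'_def)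
      obtain w where w: "w \<in> t'" "nrm t \<bullet> h w < 0" using supp_strict[OF St_supp[OF t t'(1)] StF[OF t] StF[OF t'(1)]] t'(2) by metis
      then have "0 < \<nu> i F \<bullet> h w" using True l by (simp add: mult_less_0_iff)
      then show False using M1[OF F t'(1) cn_base[OF w(1)]] by simp
    next
      case False
      then have l0: "l > 0" using \<open>l \<noteq> 0\<close> by simp
      show False
      proof (cases "t \<in> collar cl i")
        case True
        obtain a where a: "a > 0" "nrm t = a *\<^sub>R \<nu> i (C t)" using nrm_multiple[OF True] by blast
        have "a *\<^sub>R \<nu> i (C t) = l *\<^sub>R \<nu> i F" using a(2) l by simp
        then have "(1 / a) *\<^sub>R a *\<^sub>R \<nu> i (C t) = (1 / a) *\<^sub>R l *\<^sub>R \<nu> i F" by simp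
        then have "\<nu> i (C t) = (1 / a * l) *\<^sub>R \<nu> i F" using a(1) by simp
        then have "\<nu> i (C t) \<in> span {\<nu> i F}" by (metis span_base span_scale singletonI)
        then have "F = C t" using fnormal_indep[OF Qpc F(1) ff.P_facet[OF True]] by blast
        then show False using F(3) inSt[OF t] by (simp add: inn_def)
      next
        case False
        then have ts: "t \<noteq> s0" "t \<noteq> s1" using s_collar by blast+
        have neg: "nrm t \<bullet> r0 < 0" "nrm t \<bullet> r1 < 0" using bt[OF t] bt'[OF t] tr[OF t] ts by fastforce+
        obtain x where x: "x \<in> rel_interior (C t)" using pcone_rel_interior[OF pc[OF FacK[OF StF[OF t]]]] by blast
        have xt: "x \<in> C t" using x rel_interior_subset by blast
        have cx: "0 < c \<bullet> x"
        proof (rule ccontr)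
          assume "\<not> ?thesis"
          then have "c \<bullet> x = 0" using c_St[OF t xt] by simp
          then have "(- c) \<bullet> y = 0" if "y \<in> C t" for y
            using rel_interior_zero[OF pcone_convex[OF pc[OF FacK[OF StF[OF t]]]] x, of "- c" y] c_St[OF t] that by auto
          then show False using inSt[OF t] by force
        qed
        have sx: "nrm s0 \<bullet> x < 0"
        proof (rule ccontr)
          assume "\<not> ?thesis"
          then have "nrm s0 \<bullet> x = 0" using tle(1)[OF t xt] by simp
          then have z: "nrm s0 \<bullet> y = 0" if "y \<in> C t" for y
            using rel_interior_zero[OF pcone_convex[OF pc[OF FacK[OF StF[OF t]]]] x, of "nrm s0" y] tle(1)[OF t] that by blast
          obtain w where "w \<in> t" "nrm s0 \<bullet> h w < 0"
            using supp_strict[OF St_supp[OF sSt(1) t] StF[OF sSt(1)] StF[OF t]] ts by metis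
          then show False using z[OF cn_base] by force
        qed
        show False
        proof (cases "\<exists>y\<in>F. c \<bullet> y < 0")
          case False
          then have "c \<bullet> y = 0" if "y \<in> F" for y using outer_nonpos[OF F(3) that] that by force
          then obtain l' where l': "l' < 0" "c = l' *\<^sub>R \<nu> i F" using flat[OF F(1)] by blast
          have "\<nu> i F \<bullet> x = 0" using nrm_perp[OF StF[OF t] xt] l l0 by simp
          then show False using cx l' by simp
        next
          case True
          then obtain y where y: "y \<in> F" "c \<bullet> y < 0" by blast
          obtain M where M: "M > 0" "c0 \<bullet> (x + M *\<^sub>R y) = 0" using bal[OF cx y(2)] by blast
          note sl = sum_le[OF t xt FQ[OF F(1) y(1)], of M]
          have "nrm t \<bullet> (x + M *\<^sub>R y) = 0" using nrm_perp[OF StF[OF t] xt] Fzero[OF F(1) y(1)] l by (simp add: inner_add_right)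
          then have "x + M *\<^sub>R y \<in> span (C g)"
            using combs[OF M(2) _ _ nG[OF t] tr[OF t] nG[OF t] tr[OF t], of] sl M(1) neg by auto
          moreover have "span (C g) \<subseteq> {x. nrm s0 \<bullet> x = 0}" by (rule span_minimal) (use nG[OF sSt(1)] in \<open>auto simp: subspace_hyperplane\<close>)
          ultimately have "nrm s0 \<bullet> x + M * (nrm s0 \<bullet> y) = 0" by (auto simp: inner_add_right)
          moreover have "M * (nrm s0 \<bullet> y) \<le> 0" using M(1) Qle(1)[OF FQ[OF F(1) y(1)]] by (simp add: mult_nonneg_nonpos)
          ultimately show False using sx by linarith
        qed
      qed
    qed
  qed
  \<comment> \<open>Over a boundary ridge, \<open>c\<close> is a combination of the normals of the
    two facets of \<open>Q\<close> meeting there. If both were inner, both coefficients would be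
    negative, and \<open>c\<close> would be positive at the other ray \<open>r\<close>, which lies
    in the plane.\<close>
  have across: False if B: "B face_of Q" "aff_dim B = aff_dim Q - 2" "0 \<in> B" "\<And>x. x \<in> B \<Longrightarrow> c \<bullet> x = 0" "B \<subseteq> C s" "s \<in> collar cl i" "s \<in> St"
      and r: "r \<in> Q" "c \<bullet> r = 0" "nrm s \<bullet> r < 0" and F: "F facet_of Q" "B \<subseteq> F" "F \<noteq> C s" "inn F" for B s r F
  proof -
    note Cs = ff.P_facet[OF B(6)]
    obtain a d where ad: "\<And>x. x \<in> span Q \<Longrightarrow> c \<bullet> x = a * (\<nu> i (C s) \<bullet> x) + d * (\<nu> i F \<bullet> x)"
      using codim2_normal_span[OF Qpc Cs F(1) F(3)[symmetric] B(5) F(2) B(2,3), of c] B(4) by blast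
    have ad: "c \<bullet> x = a * (\<nu> i (C s) \<bullet> x) + d * (\<nu> i F \<bullet> x)" for x by (rule ad) (simp add: ff.P_span)
    obtain p where p: "p \<in> C s" "0 < c \<bullet> p" using inSt[OF B(7)] by blast
    obtain p' where p': "p' \<in> F" "0 < c \<bullet> p'" using F(4) by (auto simp: inn_def)
    have "0 < d * (\<nu> i F \<bullet> p)" using ad[of p] p Fzero[OF Cs p(1)] by simp
    moreover have "\<nu> i F \<bullet> p \<le> 0" using fnormal(2)[OF Qpc F(1) FQ[OF Cs p(1)]] .
    ultimately have d: "d < 0" by (smt (verit) mult_nonneg_nonpos)
    have "0 < a * (\<nu> i (C s) \<bullet> p')" using ad[of p'] p' Fzero[OF F(1) p'(1)] by simp
    moreover have "\<nu> i (C s) \<bullet> p' \<le> 0" using fnormal(2)[OF Qpc Cs FQ[OF F(1) p'(1)]] .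
    ultimately have a: "a < 0" by (smt (verit) mult_nonneg_nonpos)
    obtain e where e: "e > 0" "nrm s = e *\<^sub>R \<nu> i (C s)" using nrm_multiple[OF B(6)] by blast
    have "\<nu> i (C s) \<bullet> r < 0" using r(3) e by (simp add: mult_less_0_iff)
    then have "0 < a * (\<nu> i (C s) \<bullet> r)" using a by (simp add: mult_neg_neg)
    moreover have "0 \<le> d * (\<nu> i F \<bullet> r)" using d fnormal(2)[OF Qpc F(1) r(1)] by (simp add: mult_nonpos_nonpos)
    ultimately show False using ad[of r] r(2) by linarith
  qed
  have dimb: "aff_dim (C b) = aff_dim Q - 2" "aff_dim (C b') = aff_dim Q - 2"
    using bdK(1)[OF b(1)] bdK(1)[OF b(2)] ff.P_dim by (auto simp: rdg_def)
  \<comment> \<open>The interior of any other ridge through \<open>g\<close> misses the plane, so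
    both its facets have points on the same side.\<close>
  have same: "inn F \<longleftrightarrow> inn F'"
    if F: "F facet_of Q" "F' facet_of Q" "F \<noteq> F'" "f facet_of F" "f \<subseteq> F'" "C g \<subseteq> f" "f \<noteq> C b" "f \<noteq> C b'" for F F' f
  proof -
    note pcf = pcone_facet[OF pcone_facet[OF Qpc F(1)] F(4)]
    note cd = facet_facet_codim2[OF F(1,4)]
    have fF: "f \<subseteq> F" using F(4) facet_of_imp_subset by blast
    obtain e' where e': "e' facet_of Q" "e' \<noteq> F" "f facet_of e'" "f = F \<inter> e'" using codim2_other_facet[OF Qpc F(1,4)] by metis
    have "e' = F'" using other_facet_unique[OF F(1,2) e'(1) F(3,4,5) facet_of_imp_subset[OF e'(3)]] e'(2) by blast
    then have f: "f = F \<inter> F'" using e' by blast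
    have noB: "\<not> (B \<subseteq> F \<and> B \<subseteq> F')" if B: "B face_of Q" "aff_dim B = aff_dim Q - 2" "B \<noteq> f" for B
    proof
      assume "B \<subseteq> F \<and> B \<subseteq> F'"
      then have "B \<subseteq> f" using f by blast
      then have "B face_of f" using face_of_subset[OF B(1)] face_of_imp_subset[OF cd(1)] by blast
      then have "aff_dim B < aff_dim f" using face_of_aff_dim_lt[OF pcone_convex[OF pcf]] B(3) by blast
      then show False using B(2) cd(2) by simp
    qed
    obtain q where q: "q \<in> rel_interior f" using pcone_rel_interior[OF pcf] by blast
    have qF: "q \<in> F" "q \<in> F'" using q rel_interior_subset fF F(5) by blast+
    have gf: "C g facet_of f"
      using face_of_subset[OF bface(3) F(6) face_of_imp_subset[OF cd(1)]] dimG(2) cd(2) pcone_0[OF dimG(3)] by (auto simp: facet_of_def)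
    have "c0 \<bullet> q \<noteq> 0"
    proof (rule ridge_nz[OF q _ pcf gf, of Q "\<nu> i F" "\<nu> i F'"])
      show "f \<subseteq> Q" using face_of_imp_subset[OF cd(1)] .
      show "\<nu> i F \<bullet> x = 0" "\<nu> i F' \<bullet> x = 0" if "x \<in> f" for x using Fzero F(1,2) fF F(5) that by blast+
      show "\<nu> i F \<bullet> r0 < 0 \<or> \<nu> i F' \<bullet> r0 < 0"
        using noB[OF bface(1) dimb(1) F(7)[symmetric]] Fr[OF F(1)] Fr[OF F(2)] \<nu>r(1)[OF F(1)] \<nu>r(1)[OF F(2)] by fastforce
      show "\<nu> i F \<bullet> r1 < 0 \<or> \<nu> i F' \<bullet> r1 < 0"
        using noB[OF bface(2) dimb(2) F(8)[symmetric]] Fr'[OF F(1)] Fr'[OF F(2)] \<nu>r(2)[OF F(1)] \<nu>r(2)[OF F(2)] by fastforce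
    qed (use \<nu>r F(1,2) Qle in auto)
    then have qc: "c \<bullet> q \<noteq> 0" using c_c0 by simp
    have gF: "C g \<subseteq> F" "C g \<subseteq> F'" using F(5,6) fF by blast+
    have "inn F \<Longrightarrow> 0 < c \<bullet> q" "inn F' \<Longrightarrow> 0 < c \<bullet> q"
      using F_os[OF F(1) gF(1) _ qF(1)] F_os[OF F(2) gF(2) _ qF(2)] qc by fastforce+
    moreover have "0 < c \<bullet> q \<Longrightarrow> inn F \<and> inn F'" using qF by (auto simp: inn_def)
    ultimately show ?thesis by blast
  qed
  show ?thesis
  proof (rule that[of inn])
    show "inn (C s0)" "inn (C s1)" using inSt sSt by (simp_all add: inn_def)
    show "\<not> inn F" if F: "F facet_of Q" "C b \<subseteq> F" "F \<noteq> C s0" for F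
    proof
      assume "inn F"
      show False
        by (rule across[OF bface(1) dimb(1) pcone_0[OF pcb(1)] _ bsub(1) s_collar(1) sSt(1) rQ(2) _ n0(2) F \<open>inn F\<close>])
          (use cb c_c0 c0(4) in auto)
    qed
    show "\<not> inn F" if F: "F facet_of Q" "C b' \<subseteq> F" "F \<noteq> C s1" for F
    proof
      assume "inn F"
      show False
        by (rule across[OF bface(2) dimb(2) pcone_0[OF pcb(2)] _ bsub(2) s_collar(2) sSt(2) rQ(1) _ n0(4) F \<open>inn F\<close>])
          (use cb c_c0 c0(3) in auto)
    qed
    show "inn F \<longleftrightarrow> inn F'" if "F facet_of Q" "F' facet_of Q" "F \<noteq> F'" "f facet_of F" "f \<subseteq> F'" "C g \<subseteq> f" "f \<noteq> C b" "f \<noteq> C b'" for F F' f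
      by (rule same[OF that])
    show "\<nu> i F \<bullet> x \<le> 0" if "F facet_of Q" "C g \<subseteq> F" "\<not> inn F" "t \<in> St" "x \<in> C t" for F t x by (rule M1[OF that])
    show "nrm t \<bullet> x \<le> 0" if "F facet_of Q" "C g \<subseteq> F" "\<not> inn F" "t \<in> St" "x \<in> F" for F t x by (rule M2[OF that])
    show "nrm t \<notin> span {\<nu> i F}" if "F facet_of Q" "C g \<subseteq> F" "\<not> inn F" "t \<in> St" for F t by (rule M3[OF that])
  qed
qed

end

section \<open>Capping off the boundary\<close>

lemma orbit_subset:
  assumes "s \<in> B" "\<And>t f. t \<in> B \<Longrightarrow> f facet_of X t \<Longrightarrow> G \<subseteq> f \<Longrightarrow> nb t f \<in> B"
  shows "orbit X nb s G \<subseteq> B"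
proof
  fix t assume "t \<in> orbit X nb s G"
  then show "t \<in> B" by (induction rule: orbit.induct) (use assms in auto)
qed

lemma span_singleton_sym:
  assumes "v \<notin> span {w}" "v \<noteq> 0" "w \<noteq> 0" shows "w \<notin> span {v}"
proof
  assume "w \<in> span {v}"
  then obtain k where k: "w = k *\<^sub>R v" by (auto simp: span_singleton)
  then have "v = (1 / k) *\<^sub>R w" using assms(3) by auto
  then show False using assms(1) by (metis span_base span_scale singletonI)
qed

context nontrivial_manifold
begin

text \<open>
  The boundary component with index \<open>i\<close> is capped off by an infinite tower of copies of the boundary
  of \<open>PP i\<close>, each cut open along the boundary ridges.  Crossing a boundary ridge outwards leads from
  level \<open>k\<close> of the facet of the collar to level \<open>k + 1\<close> of the facet on the other side.  The result is
  a closed complex without knowing that the ridges separate the boundary of \<open>PP i\<close>.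
\<close>

definition "ot i F f = (THE F'. F' facet_of PP i \<and> F' \<noteq> F \<and> f \<subseteq> F')"
definition "isb i f \<longleftrightarrow> (\<exists>b\<in>bd. cl b = i \<and> C b = f)"
definition "bdof i f = (THE b. b \<in> bd \<and> cl b = i \<and> C b = f)"

definition NS :: "('p set + 'i \<times> nat \<times> 'w set) set" where
  "NS = Inl ` Fac \<union> {Inr (i, k, F) | i k F. i \<in> cl ` bd \<and> F facet_of PP i}"

definition XN :: "'p set + 'i \<times> nat \<times> 'w set \<Rightarrow> 'w set" where
  "XN = case_sum C (\<lambda>(i, k, F). F)"

definition nN :: "'p set + 'i \<times> nat \<times> 'w set \<Rightarrow> 'w" where
  "nN = case_sum nrm (\<lambda>(i, k, F). \<nu> i F)"

text \<open>The complex itself acts as the level below 0: crossing a boundary ridge inwards from the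
  facet on its outer side leads from level 0 to the facet of the complex, and from level
  \<open>Suc j\<close> to the copy of the collar facet at level \<open>j\<close>.\<close>

definition nbN :: "'p set + 'i \<times> nat \<times> 'w set \<Rightarrow> 'w set \<Rightarrow> 'p set + 'i \<times> nat \<times> 'w set" where
  "nbN x f = (case x of
     Inl s \<Rightarrow> (let b = pre s f in if b \<in> bd then Inr (cl b, 0, ot (cl b) (C s) f) else Inl (oth s b))
   | Inr (i, k, F) \<Rightarrow>
       if isb i f then
         (let s = own (bdof i f) in if F = C s then Inr (i, Suc k, ot i F f)
          else (case k of 0 \<Rightarrow> Inl s | Suc j \<Rightarrow> Inr (i, j, C s)))
       else Inr (i, k, ot i F f))"

lemma PP_facts:
  assumes "i \<in> cl ` bd"
  shows "pcone (PP i)" "aff_dim (PP i) = int DIM('w)" "s \<in> collar cl i \<Longrightarrow> C s facet_of PP i"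
    "s \<in> collar cl i \<Longrightarrow> x \<in> PP i \<Longrightarrow> nrm s \<bullet> x \<le> 0" "s \<in> collar cl i \<Longrightarrow> C s \<subseteq> PP i"
    "s \<in> collar cl i \<Longrightarrow> \<exists>a>0. nrm s = a *\<^sub>R \<nu> i (C s)"
proof -
  obtain b where b: "b \<in> bd" "i = cl b" using assms by blast
  interpret f: facet_family K h "collar cl i" nrm unfolding b(2) by (rule ff[OF b(1)])
  show "pcone (PP i)" by (rule f.P_pcone)
  show "aff_dim (PP i) = int DIM('w)" by (rule f.P_dim)
  show "s \<in> collar cl i \<Longrightarrow> C s facet_of PP i" by (rule f.P_facet)
  show "s \<in> collar cl i \<Longrightarrow> x \<in> PP i \<Longrightarrow> nrm s \<bullet> x \<le> 0" by (rule f.P_le)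
  show "s \<in> collar cl i \<Longrightarrow> C s \<subseteq> PP i" by (rule f.sub_P)
  show "s \<in> collar cl i \<Longrightarrow> \<exists>a>0. nrm s = a *\<^sub>R \<nu> i (C s)" using f.fnormal_\<nu> by metis
qed

lemma PP_facet_dim: "i \<in> cl ` bd \<Longrightarrow> F facet_of PP i \<Longrightarrow> aff_dim F = int DIM('w) - 1"
  using PP_facts(2) by (simp add: facet_of_def)

lemma ot:
  assumes i: "i \<in> cl ` bd" and F: "F facet_of PP i" and f: "f facet_of F"
  shows "ot i F f facet_of PP i" "ot i F f \<noteq> F" "f facet_of ot i F f" "f \<subseteq> ot i F f"
    "\<And>F'. F' facet_of PP i \<Longrightarrow> F' \<noteq> F \<Longrightarrow> f \<subseteq> F' \<Longrightarrow> F' = ot i F f"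
proof -
  note P = PP_facts(1)[OF i]
  obtain F' where F': "F' facet_of PP i" "F' \<noteq> F" "f facet_of F'" using codim2_other_facet[OF P F f] by metis
  have fF': "f \<subseteq> F'" using F'(3) facet_of_imp_subset by blast
  have u: "F'' = F'" if "F'' facet_of PP i" "F'' \<noteq> F" "f \<subseteq> F''" for F''
    using codim2_at_most_two_facets[OF P F F'(1) that(1) F'(2)[symmetric] facet_of_imp_subset[OF f] fF' that(3) facet_facet_codim2(2)[OF F f]]
      pcone_0[OF pcone_facet[OF pcone_facet[OF P F] f]] that(2) by blast
  have o: "ot i F f = F'" unfolding ot_def by (rule the_equality, intro conjI F' fF') (erule conjE, erule conjE, rule u)
  show "ot i F f facet_of PP i" "ot i F f \<noteq> F" "f facet_of ot i F f" "f \<subseteq> ot i F f" using F' fF' o by auto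
  show "\<And>F'. F' facet_of PP i \<Longrightarrow> F' \<noteq> F \<Longrightarrow> f \<subseteq> F' \<Longrightarrow> F' = ot i F f" using u o by simp
qed

lemma ot_ot:
  assumes "i \<in> cl ` bd" "F facet_of PP i" "f facet_of F"
  shows "ot i (ot i F f) f = F"
  using ot(5)[OF assms(1) ot(1,3)[OF assms] assms(2) ot(2)[OF assms, symmetric] facet_of_imp_subset[OF assms(3)]] by simp

text \<open>Boundary cells with the same label are told apart by their images, because convex
  position of the fattened component decides by a functional whether a vertex of it lies in
  \<open>own b0\<close>.\<close>

lemma bd_cell_subset:
  assumes b: "b \<in> bd" "b0 \<in> bd" "cl b0 = cl b" and g: "g \<in> K" "g \<subseteq> b" "C g \<subseteq> C b0"
  shows "g \<subseteq> b0"
proof (rule subset_by_vertices[OF g(1) bdK(2)[OF b(2)]])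
  fix w assume w: "w \<in> g" "w \<in> V"
  have hw: "h w \<in> C b0" using cn_base[OF w(1)] g(3) by blast
  then have "h w \<in> C (own b0)" using cn_mono[OF own(2)[OF b(2)]] by blast
  then have z: "nrm (own b0) \<bullet> h w = 0" by (rule nrm_perp[OF own(1)[OF b(2)]])
  have "supp (nrm (own b0)) (own b0) (own b)"
    using collar_supp[OF own_collar[OF b(2)]] own_collar[OF b(1)] b(3) by simp
  moreover have "w \<in> own b" using w g own(2)[OF b(1)] by blast
  ultimately have "w \<in> own b0" using z w(2) by (simp add: supp_def)
  then show "w \<in> b0" by (rule mem_cell[OF FacK[OF own(1)[OF b(2)]] bdK(2)[OF b(2)] own(2)[OF b(2)] _ hw])
qed

lemma bd_inj:
  assumes "b \<in> bd" "b' \<in> bd" "cl b = cl b'" "C b = C b'" shows "b = b'"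
  using bd_cell_subset[OF assms(1,2) assms(3)[symmetric] bdK(2)[OF assms(1)]]
    bd_cell_subset[OF assms(2,1) assms(3) bdK(2)[OF assms(2)]] assms(4) by blast

lemma bdof:
  assumes "b \<in> bd" shows "bdof (cl b) (C b) = b" "isb (cl b) (C b)"
  using assms bd_inj by (auto simp: bdof_def isb_def intro!: the_equality)

lemma own_pre: "b \<in> bd \<Longrightarrow> pre (own b) (C b) = b" "b \<in> bd \<Longrightarrow> C b facet_of C (own b)"
  using pre_C[OF FacK[OF own(1)] bdK(2) own(2)] ridge_facet[OF own(1) bdK(1) own(2)] by auto

section \<open>Crossing the ridges of the tower\<close>

lemma nb_cases:
  assumes x: "x \<in> NS" and fx: "f facet_of XN x"
  obtains (ca) s where "x = Inl s" "s \<in> Fac" "pre s f \<in> rdg" "pre s f \<subseteq> s" "C (pre s f) = f" "pre s f \<notin> bd" "nbN x f = Inl (oth s (pre s f))"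
  | (cb) b where "b \<in> bd" "x = Inl (own b)" "f = C b" "nbN x f = Inr (cl b, 0, ot (cl b) (C (own b)) f)"
  | (cc) i k F where "i \<in> cl ` bd" "F facet_of PP i" "x = Inr (i, k, F)" "\<not> isb i f" "nbN x f = Inr (i, k, ot i F f)"
  | (cd) b k where "b \<in> bd" "x = Inr (cl b, k, C (own b))" "f = C b" "nbN x f = Inr (cl b, Suc k, ot (cl b) (C (own b)) f)"
  | (ce) b F where "b \<in> bd" "F facet_of PP (cl b)" "x = Inr (cl b, 0, F)" "f = C b" "F \<noteq> C (own b)" "nbN x f = Inl (own b)"
  | (cf) b F j where "b \<in> bd" "F facet_of PP (cl b)" "x = Inr (cl b, Suc j, F)" "f = C b" "F \<noteq> C (own b)" "nbN x f = Inr (cl b, j, C (own b))"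
proof (cases x)
  case (Inl s)
  then have s: "s \<in> Fac" using x by (auto simp: NS_def)
  have fs: "f facet_of C s" using fx Inl by (simp add: XN_def)
  note p = facet_ridge[OF s fs]
  show ?thesis
  proof (cases "pre s f \<in> bd")
    case True
    have "s = own (pre s f)" by (rule own(3)[OF True s p(2)])
    then show ?thesis using cb[OF True] Inl True p(3) by (simp add: nbN_def Let_def)
  next
    case False
    then show ?thesis using ca[OF Inl s p False] Inl by (simp add: nbN_def Let_def)
  qed
next
  case (Inr y)
  then obtain i k F where y: "x = Inr (i, k, F)" by (metis prod_cases3)
  then have iF: "i \<in> cl ` bd" "F facet_of PP i" using x by (auto simp: NS_def)
  show ?thesis
  proof (cases "isb i f")
    case False
    then show ?thesis using cc[OF iF y False] y by (simp add: nbN_def)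
  next
    case True
    then obtain b where b': "b \<in> bd" "cl b = i" "C b = f" by (auto simp: isb_def)
    have bo: "bdof i f = b" using bdof(1)[OF b'(1)] b' by simp
    show ?thesis
    proof (cases "F = C (own b)")
      case True
      then show ?thesis using cd[OF b'(1), of k] b' y bo \<open>isb i f\<close> by (simp add: nbN_def Let_def)
    next
      case F: False
      show ?thesis
      proof (cases k)
        case 0
        then show ?thesis using ce[OF b'(1), of F] b' y bo \<open>isb i f\<close> F iF by (simp add: nbN_def Let_def)
      next
        case (Suc j)
        then show ?thesis using cf[OF b'(1), of F j] b' y bo \<open>isb i f\<close> F iF by (simp add: nbN_def Let_def)
      qed
    qed
  qed
qed

lemma St_indep:
  assumes "t \<in> Fac" "t' \<in> Fac" "t \<noteq> t'" "supp (nrm t) t t'"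
  shows "nrm t' \<notin> span {nrm t}"
proof
  assume "nrm t' \<in> span {nrm t}"
  then obtain k where k: "nrm t' = k *\<^sub>R nrm t" by (auto simp: span_singleton)
  obtain w where w: "w \<in> t'" "nrm t \<bullet> h w < 0" using supp_strict[OF assms(4,1,2,3)] by blast
  have "nrm t' \<bullet> h w = 0" using nrm_perp[OF assms(2) cn_base[OF w(1)]] .
  then have "k = 0" using k w(2) by simp
  then show False using k nrm(1)[OF assms(2)] by simp
qed

lemma own_supp: "b \<in> bd \<Longrightarrow> C (own b) facet_of PP (cl b)"
  using PP_facts(3)[OF _ own_collar] by blast

lemma nrm_\<nu>_indep:
  assumes b: "b \<in> bd" and F: "F facet_of PP (cl b)" "F \<noteq> C (own b)"
  shows "\<nu> (cl b) F \<notin> span {nrm (own b)}" "nrm (own b) \<notin> span {\<nu> (cl b) F}"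
proof -
  have i: "cl b \<in> cl ` bd" using b by blast
  obtain a where a: "a > 0" "nrm (own b) = a *\<^sub>R \<nu> (cl b) (C (own b))" using PP_facts(6)[OF i own_collar[OF b]] by blast
  show 1: "nrm (own b) \<notin> span {\<nu> (cl b) F}"
  proof
    assume "nrm (own b) \<in> span {\<nu> (cl b) F}"
    then have "(1 / a) *\<^sub>R nrm (own b) \<in> span {\<nu> (cl b) F}" by (rule span_scale)
    then show False using a fnormal_indep[OF PP_facts(1)[OF i] F(1) own_supp[OF b] F(2)] by simp
  qed
  show "\<nu> (cl b) F \<notin> span {nrm (own b)}"
    by (rule span_singleton_sym[OF 1 nrm(1)[OF own(1)[OF b]] fnormal(4)[OF PP_facts(1)[OF i] F(1)]])
qed

lemma ot_own:
  assumes b: "b \<in> bd"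
  shows "ot (cl b) (C (own b)) (C b) facet_of PP (cl b)" "ot (cl b) (C (own b)) (C b) \<noteq> C (own b)"
    "C b facet_of ot (cl b) (C (own b)) (C b)" "F facet_of PP (cl b) \<Longrightarrow> F \<noteq> C (own b) \<Longrightarrow> C b \<subseteq> F \<Longrightarrow> F = ot (cl b) (C (own b)) (C b)"
  using ot[OF _ own_supp[OF b] own_pre(2)[OF b]] b by blast+

lemma NS_simps:
  "XN (Inl s) = C s" "XN (Inr (i, k, F)) = F" "nN (Inl s) = nrm s" "nN (Inr (i, k, F)) = \<nu> i F"
  "Inl s \<in> NS \<longleftrightarrow> s \<in> Fac" "Inr (i, k, F) \<in> NS \<longleftrightarrow> i \<in> cl ` bd \<and> F facet_of PP i"
  by (auto simp: XN_def nN_def NS_def)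

lemma nb_basic:
  assumes x: "x \<in> NS" and f: "f facet_of XN x"
  shows "nbN x f \<in> NS" "f facet_of XN (nbN x f)" "nbN (nbN x f) f = x"
    "nN (nbN x f) \<notin> span {nN x}" "z \<in> XN x \<Longrightarrow> nN (nbN x f) \<bullet> z \<le> 0"
proof -
  have "nbN x f \<in> NS \<and> f facet_of XN (nbN x f) \<and> nbN (nbN x f) f = x \<and>
    nN (nbN x f) \<notin> span {nN x} \<and> (\<forall>z\<in>XN x. nN (nbN x f) \<bullet> z \<le> 0)"
    using x f
  proof (cases rule: nb_cases)
    case (ca s)
    note o = oth[OF ca(2-4,6)]
    obtain v where v: "v \<in> pre s f" "v \<in> V" using ex_vertex[OF bdK(3)[OF ca(3)]] by blast
    have vs: "v \<in> s" "v \<in> oth s (pre s f)" using v(1) ca(4) o(3) by (blast, blast)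
    have S: "supp (nrm (oth s (pre s f))) (oth s (pre s f)) s" "supp (nrm s) s (oth s (pre s f))"
      using nrm(2)[OF o(1) v(2) vs(2) ca(2) vs(1)] nrm(2)[OF ca(2) v(2) vs(1) o(1) vs(2)] by auto
    have fo: "f facet_of C (oth s (pre s f))" using ridge_facet[OF o(1) ca(3) o(3)] ca(5) by simp
    have "pre (oth s (pre s f)) f = pre s f"
      using pre_C[OF FacK[OF o(1)] bdK(3)[OF ca(3)] o(3)] ca(5) by simp
    then have "nbN (Inl (oth s (pre s f))) f = Inl s"
      using oth_oth[OF ca(2-4,6)] ca(6) by (simp add: nbN_def Let_def)
    moreover have "nrm (oth s (pre s f)) \<notin> span {nrm s}" using St_indep[OF ca(2) o(1) o(2)[symmetric] S(2)] .
    ultimately show ?thesis using o(1) fo supp_le[OF S(1)] ca(1,7) by (simp add: NS_simps)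
  next
    case (cb b)
    have i: "cl b \<in> cl ` bd" using cb(1) by blast
    note o = ot_own[OF cb(1)]
    let ?F = "ot (cl b) (C (own b)) (C b)"
    have "nbN (Inr (cl b, 0, ?F)) (C b) = Inl (own b)"
      using bdof[OF cb(1)] o(2) by (simp add: nbN_def Let_def)
    moreover have "\<nu> (cl b) ?F \<bullet> z \<le> 0" if "z \<in> C (own b)" for z
      using fnormal(2)[OF PP_facts(1)[OF i] o(1)] PP_facts(5)[OF i own_collar[OF cb(1)]] that by blast
    ultimately show ?thesis using cb(2-4) i o(1,3) nrm_\<nu>_indep(1)[OF cb(1) o(1,2)] by (simp add: NS_simps)
  next
    case (cc i k F)
    have fF: "f facet_of F" using f cc(3) by (simp add: NS_simps)
    note o = ot[OF cc(1,2) fF]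
    have "nbN (Inr (i, k, ot i F f)) f = Inr (i, k, F)" using cc(4) ot_ot[OF cc(1,2) fF] by (simp add: nbN_def)
    moreover have "\<nu> i (ot i F f) \<notin> span {\<nu> i F}" by (rule fnormal_indep[OF PP_facts(1)[OF cc(1)] cc(2) o(1) o(2)[symmetric]])
    moreover have "\<nu> i (ot i F f) \<bullet> z \<le> 0" if "z \<in> F" for z
      using fnormal(2)[OF PP_facts(1)[OF cc(1)] o(1)] facet_of_imp_subset[OF cc(2)] that by blast
    ultimately show ?thesis using cc(1,2,3,5) o(1,3) by (simp add: NS_simps)
  next
    case (cd b k)
    have i: "cl b \<in> cl ` bd" using cd(1) by blast
    note o = ot_own[OF cd(1)]
    let ?F = "ot (cl b) (C (own b)) (C b)"
    have "nbN (Inr (cl b, Suc k, ?F)) (C b) = Inr (cl b, k, C (own b))"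
      using bdof[OF cd(1)] o(2) by (simp add: nbN_def Let_def)
    moreover have "\<nu> (cl b) ?F \<notin> span {\<nu> (cl b) (C (own b))}"
      by (rule fnormal_indep[OF PP_facts(1)[OF i] own_supp[OF cd(1)] o(1) o(2)[symmetric]])
    moreover have "\<nu> (cl b) ?F \<bullet> z \<le> 0" if "z \<in> C (own b)" for z
      using fnormal(2)[OF PP_facts(1)[OF i] o(1)] PP_facts(5)[OF i own_collar[OF cd(1)]] that by blast
    ultimately show ?thesis using cd(2-4) i o(1,3) by (simp add: NS_simps)
  next
    case (ce b F)
    have i: "cl b \<in> cl ` bd" using ce(1) by blast
    have fF: "C b facet_of F" using f ce(3,4) by (simp add: NS_simps)
    have F: "F = ot (cl b) (C (own b)) (C b)" by (rule ot_own(4)[OF ce(1,2,5) facet_of_imp_subset[OF fF]])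
    have "nbN (Inl (own b)) (C b) = Inr (cl b, 0, F)" using own_pre(1)[OF ce(1)] ce(1) F by (simp add: nbN_def Let_def)
    moreover have "nrm (own b) \<bullet> z \<le> 0" if "z \<in> F" for z
      using PP_facts(4)[OF i own_collar[OF ce(1)]] facet_of_imp_subset[OF ce(2)] that by blast
    ultimately show ?thesis using ce(3,4,6) own(1)[OF ce(1)] own_pre(2)[OF ce(1)] nrm_\<nu>_indep(2)[OF ce(1,2,5)] by (simp add: NS_simps)
  next
    case (cf b F j)
    have i: "cl b \<in> cl ` bd" using cf(1) by blast
    have fF: "C b facet_of F" using assms(2) cf(3,4) by (simp add: NS_simps)
    have F: "F = ot (cl b) (C (own b)) (C b)" by (rule ot_own(4)[OF cf(1,2,5) facet_of_imp_subset[OF fF]])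
    have "nbN (Inr (cl b, j, C (own b))) (C b) = Inr (cl b, Suc j, F)"
      using bdof[OF cf(1)] F by (simp add: nbN_def Let_def)
    moreover have "\<nu> (cl b) (C (own b)) \<bullet> z \<le> 0" if "z \<in> F" for z
      using fnormal(2)[OF PP_facts(1)[OF i] own_supp[OF cf(1)]] facet_of_imp_subset[OF cf(2)] that by blast
    moreover have "\<nu> (cl b) (C (own b)) \<notin> span {\<nu> (cl b) F}"
      by (rule fnormal_indep[OF PP_facts(1)[OF i] cf(2) own_supp[OF cf(1)] cf(5)])
    ultimately show ?thesis using cf(3,4,6) i own_supp[OF cf(1)] own_pre(2)[OF cf(1)] by (simp add: NS_simps)
  qed
  then show "nbN x f \<in> NS" "f facet_of XN (nbN x f)" "nbN (nbN x f) f = x"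
    "nN (nbN x f) \<notin> span {nN x}" "z \<in> XN x \<Longrightarrow> nN (nbN x f) \<bullet> z \<le> 0" by blast+
qed

text \<open>A set closed under crossing the ridges through \<open>G\<close> contains the orbits of
  its members, so a set that is both \<open>nb_closed\<close> and \<open>mutual\<close> yields the
  condition \<open>orb\<close> for its members.\<close>

definition "mutual B \<longleftrightarrow> (\<forall>x\<in>B. \<forall>y\<in>B. y \<noteq> x \<longrightarrow> nN y \<notin> span {nN x} \<and> (\<forall>z\<in>XN x. nN y \<bullet> z \<le> 0))"
definition "nb_closed B G \<longleftrightarrow> (\<forall>x\<in>B. \<forall>f. f facet_of XN x \<longrightarrow> G \<subseteq> f \<longrightarrow> nbN x f \<in> B)"

end

context chord
begin

text \<open>Each block is one closed turn around \<open>g\<close>: an inner arc joined along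
  \<open>b\<close> and \<open>b'\<close> to an outer arc one level higher. The inner arc consists of
  the facets of the complex in block 0 and of the inner facets of level \<open>j\<close> in block
  \<open>Suc j\<close>.\<close>

lemma block:
  "\<exists>B :: nat \<Rightarrow> ('p set + 'i \<times> nat \<times> 'w set) set.
    (\<forall>k. mutual (B k)) \<and> (\<forall>k. nb_closed (B k) (C g)) \<and> (\<forall>t\<in>Fac. g \<subseteq> t \<longrightarrow> Inl t \<in> B 0) \<and>
    (\<forall>k F. F facet_of PP (cl b) \<longrightarrow> C g \<subseteq> F \<longrightarrow> Inr (cl b, k, F) \<in> B k \<or> Inr (cl b, k, F) \<in> B (Suc k))"
proof -
  obtain inn where S: "inn (C s0)" "inn (C s1)"
    "\<And>F F' f. \<lbrakk>F facet_of Q; F' facet_of Q; F \<noteq> F'; f facet_of F; f \<subseteq> F'; C g \<subseteq> f; f \<noteq> C b; f \<noteq> C b'\<rbrakk> \<Longrightarrow> inn F \<longleftrightarrow> inn F'"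
    "\<And>F. \<lbrakk>F facet_of Q; C b \<subseteq> F; F \<noteq> C s0\<rbrakk> \<Longrightarrow> \<not> inn F"
    "\<And>F. \<lbrakk>F facet_of Q; C b' \<subseteq> F; F \<noteq> C s1\<rbrakk> \<Longrightarrow> \<not> inn F"
    "\<And>F t x. \<lbrakk>F facet_of Q; C g \<subseteq> F; \<not> inn F; t \<in> St; x \<in> C t\<rbrakk> \<Longrightarrow> \<nu> i F \<bullet> x \<le> 0"
    "\<And>F t x. \<lbrakk>F facet_of Q; C g \<subseteq> F; \<not> inn F; t \<in> St; x \<in> F\<rbrakk> \<Longrightarrow> nrm t \<bullet> x \<le> 0"
    "\<And>F t. \<lbrakk>F facet_of Q; C g \<subseteq> F; \<not> inn F; t \<in> St\<rbrakk> \<Longrightarrow> nrm t \<notin> span {\<nu> i F}"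
    by (rule sides) blast
  have iI: "i \<in> cl ` bd" using b by blast
  note Ppc = PP_facts(1)[OF iI]
  define B :: "nat \<Rightarrow> ('p set + 'i \<times> nat \<times> 'w set) set" where
    "B k = (case k of 0 \<Rightarrow> Inl ` St | Suc j \<Rightarrow> {Inr (i, j, F) | F. F facet_of Q \<and> C g \<subseteq> F \<and> inn F}) \<union>
      {Inr (i, k, F) | F. F facet_of Q \<and> C g \<subseteq> F \<and> \<not> inn F}" for k
  have B0: "Inl t \<in> B k \<longleftrightarrow> k = 0 \<and> t \<in> St" for t k by (cases k) (auto simp: B_def)
  have Bi: "Inr (j, l, F) \<in> B k \<longleftrightarrow> j = i \<and> F facet_of Q \<and> C g \<subseteq> F \<and> (if inn F then k = Suc l else k = l)" for j l F k
    by (cases k) (auto simp: B_def)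
  have inSt: "\<exists>s. own x = s \<and> own x \<in> St \<and> inn (C (own x)) \<and> cl x = i \<and> (\<forall>F. F facet_of Q \<longrightarrow> C x \<subseteq> F \<longrightarrow> F \<noteq> C (own x) \<longrightarrow> \<not> inn F)"
    if "x = b \<or> x = b'" for x
    using that S(1,2,4,5) sSt cl_eq by auto
  have bdg: "x = b \<or> x = b'" if x: "x \<in> bd" "cl x = i" "C g \<subseteq> C x" for x
    using only[OF x(1)] bd_cell_subset[OF b(1) x(1,2) pkK[OF g(1)] g(2) x(3)] by blast
  show ?thesis
  proof (intro exI[of _ B] conjI allI ballI impI)
    show "Inl t \<in> B 0" if "t \<in> Fac" "g \<subseteq> t" for t using that B0 by (simp add: St_def)
    show "Inr (cl b, k, F) \<in> B k \<or> Inr (cl b, k, F) \<in> B (Suc k)" if "F facet_of PP (cl b)" "C g \<subseteq> F" for k F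
      using that Bi by auto
    show "mutual (B k)" for k
      unfolding mutual_def
    proof (intro ballI impI)
      fix x y assume xy: "x \<in> B k" "y \<in> B k" "y \<noteq> x"
      show "nN y \<notin> span {nN x} \<and> (\<forall>z\<in>XN x. nN y \<bullet> z \<le> 0)"
      proof (cases x)
        case x: (Inl t)
        then have t: "k = 0" "t \<in> St" using xy B0 by auto
        show ?thesis
        proof (cases y)
          case y: (Inl t')
          then have t': "t' \<in> St" "t' \<noteq> t" using xy B0 x by auto
          show ?thesis using St_indep[OF StF[OF t(2)] StF[OF t'(1)] t'(2)[symmetric] St_supp[OF t(2) t'(1)]]
              supp_le[OF St_supp[OF t'(1) t(2)]] by (simp add: x y NS_simps)
        next
          case (Inr p)
          then obtain j l F where y: "y = Inr (j, l, F)" by (metis prod_cases3)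
          then have F: "j = i" "F facet_of Q" "C g \<subseteq> F" "\<not> inn F" using xy(2) Bi t(1) by (auto split: if_splits)
          have "\<nu> i F \<notin> span {nrm t}"
            by (rule span_singleton_sym[OF S(8)[OF F(2-4) t(2)] nrm(1)[OF StF[OF t(2)]] fnormal(4)[OF Ppc F(2)]])
          then show ?thesis using S(6)[OF F(2-4) t(2)] by (simp add: x y F(1) NS_simps)
        qed
      next
        case (Inr p)
        then obtain j l F where x: "x = Inr (j, l, F)" by (metis prod_cases3)
        then have F: "j = i" "F facet_of Q" "C g \<subseteq> F" "if inn F then k = Suc l else k = l" using xy(1) Bi by auto
        show ?thesis
        proof (cases y)
          case y: (Inl t)
          then have t: "k = 0" "t \<in> St" using xy B0 by auto
          then have "\<not> inn F" using F(4) by (auto split: if_splits)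
          then show ?thesis using S(7)[OF F(2,3) _ t(2)] S(8)[OF F(2,3) _ t(2)] by (simp add: x y F(1) NS_simps)
        next
          case (Inr p')
          then obtain j' l' F' where y: "y = Inr (j', l', F')" by (metis prod_cases3)
          then have F': "j' = i" "F' facet_of Q" "C g \<subseteq> F'" "if inn F' then k = Suc l' else k = l'" using xy(2) Bi by auto
          have "F \<noteq> F'" using xy(3) x y F F' by (auto split: if_splits)
          then have "\<nu> i F' \<notin> span {\<nu> i F}" by (rule fnormal_indep[OF Ppc F(2) F'(2)])
          moreover have "\<nu> i F' \<bullet> z \<le> 0" if "z \<in> F" for z
            using fnormal(2)[OF Ppc F'(2)] facet_of_imp_subset[OF F(2)] that by blast
          ultimately show ?thesis by (simp add: x y F(1) F'(1) NS_simps)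
        qed
      qed
    qed
    show "nb_closed (B k) (C g)" for k
      unfolding nb_closed_def
    proof (intro ballI allI impI)
      fix x f assume x: "x \<in> B k" and f: "f facet_of XN x" "C g \<subseteq> f"
      have xNS: "x \<in> NS"
      proof (cases x)
        case (Inl t)
        then show ?thesis using x B0 StF by (simp add: NS_simps)
      next
        case (Inr p)
        then obtain j l F where "x = Inr (j, l, F)" by (metis prod_cases3)
        then show ?thesis using x Bi iI by (simp add: NS_simps)
      qed
      from xNS f(1) show "nbN x f \<in> B k"
      proof (cases rule: nb_cases)
        case (ca s)
        then have s: "k = 0" "s \<in> St" using x B0 by auto
        note o = oth[OF ca(2-4,6)]
        have "g \<subseteq> pre s f" using pre_sub[OF ca(2) pkK[OF g(1)] _ f(2)] s(2) by (simp add: St_def)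
        then have "oth s (pre s f) \<in> St" using o(1) order_trans[OF _ o(3)] by (simp add: St_def)
        then show ?thesis using ca(7) B0 s(1) by simp
      next
        case (cb x')
        have s: "k = 0" "own x' \<in> St" using x B0 cb(2) by auto
        have "g \<subseteq> pre (own x') f" using pre_sub[OF own(1)[OF cb(1)] pkK[OF g(1)] _ f(2)] s(2) by (simp add: St_def)
        then have "g \<subseteq> x'" using own_pre(1)[OF cb(1)] cb(3) by simp
        then have x': "x' = b \<or> x' = b'" by (rule only[OF cb(1)])
        note I = inSt[OF x'] and o = ot_own[OF cb(1)]
        have F: "ot (cl x') (C (own x')) (C x') facet_of Q" "C x' \<subseteq> ot (cl x') (C (own x')) (C x')" "ot (cl x') (C (own x')) (C x') \<noteq> C (own x')"
          using o(1-3) I facet_of_imp_subset by auto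
        then have "\<not> inn (ot (cl x') (C (own x')) (C x'))" using I by blast
        moreover have "C g \<subseteq> ot (cl x') (C (own x')) (C x')" using f(2) cb(3) F(2) by blast
        ultimately show ?thesis using cb(3,4) Bi F(1) s(1) I by simp
      next
        case (cc j l F)
        then have F: "j = i" "F facet_of Q" "C g \<subseteq> F" "if inn F then k = Suc l else k = l" using x Bi by auto
        have fF: "f facet_of F" using f(1) cc(3) by (simp add: NS_simps)
        note o = ot[OF iI F(2) fF]
        have nb: "f \<noteq> C b" "f \<noteq> C b'" using cc(4) F(1) bdof(2)[OF b(1)] bdof(2)[OF b(2)] cl_eq by auto
        have "inn F \<longleftrightarrow> inn (ot i F f)" by (rule S(3)[OF F(2) o(1) o(2)[symmetric] fF o(4) f(2) nb])
        moreover have "C g \<subseteq> ot i F f" using f(2) o(4) by blast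
        ultimately show ?thesis using cc(5) F(1,4) o(1) Bi by simp
      next
        case (cd x' l)
        then have F: "cl x' = i" "C (own x') facet_of Q" "if inn (C (own x')) then k = Suc l else k = l" using x Bi by auto
        have x': "x' = b \<or> x' = b'" using bdg[OF cd(1) F(1)] f(2) cd(3) by simp
        note I = inSt[OF x'] and o = ot_own[OF cd(1)]
        have G: "ot (cl x') (C (own x')) (C x') facet_of Q" "C x' \<subseteq> ot (cl x') (C (own x')) (C x')" "ot (cl x') (C (own x')) (C x') \<noteq> C (own x')"
          using o(1-3) I facet_of_imp_subset by auto
        then have "\<not> inn (ot (cl x') (C (own x')) (C x'))" using I by blast
        moreover have "C g \<subseteq> ot (cl x') (C (own x')) (C x')" using f(2) cd(3) G(2) by blast
        ultimately show ?thesis using cd(3,4) Bi G(1) F I by simp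
      next
        case (ce x' F)
        then have F: "cl x' = i" "F facet_of Q" "if inn F then k = Suc 0 else k = 0" using x Bi by auto
        have x': "x' = b \<or> x' = b'" using bdg[OF ce(1) F(1)] f(2) ce(4) by simp
        note I = inSt[OF x']
        have "C x' \<subseteq> F" using f(1) ce(3,4) facet_of_imp_subset by (simp add: NS_simps)
        then have "\<not> inn F" using I F(2) ce(5) by blast
        then show ?thesis using ce(6) B0 F(3) I by simp
      next
        case (cf x' F l)
        then have F: "cl x' = i" "F facet_of Q" "if inn F then k = Suc (Suc l) else k = Suc l" using x Bi by auto
        have x': "x' = b \<or> x' = b'" using bdg[OF cf(1) F(1)] \<open>C g \<subseteq> f\<close> cf(4) by simp
        note I = inSt[OF x']
        have "C x' \<subseteq> F" using \<open>f facet_of XN x\<close> cf(3,4) facet_of_imp_subset by (simp add: NS_simps)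
        then have "\<not> inn F" using I F(2) cf(5) by blast
        moreover have "C (own x') facet_of Q" using own_supp[OF cf(1)] F(1) by simp
        moreover have "C g \<subseteq> C (own x')" using Gsub(3) I by blast
        ultimately show ?thesis using cf(6) Bi F I by simp
      qed
    qed
  qed
qed

end

context nontrivial_manifold
begin

text \<open>Away from the boundary ridges the turn stays in the complex or on one level, and the
  facets through \<open>G\<close> there are themselves a block; otherwise \<open>block\<close>
  applies at the boundary cell \<open>g\<close> with cone \<open>G\<close>.\<close>

lemma orbit_block:
  assumes x: "x \<in> NS" and e: "e facet_of XN x" and G: "G facet_of e"
  obtains B where "mutual B" "nb_closed B G" "x \<in> B"
proof (cases x)
  case (Inl s)
  have s: "s \<in> Fac" "e facet_of C s" using x e Inl by (simp_all add: NS_simps)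
  note cd = facet_facet_codim2[OF s(2) G]
  have dG: "aff_dim G = int DIM('w) - 3" using cd(2) Fdim[OF s(1)] by simp
  have "G \<noteq> {0}"
  proof
    assume "G = {0}"
    then have "aff_dim G = 0" by simp
    then show False using dG dim4 by linarith
  qed
  note q = pre_cell[OF FacK[OF s(1)] cd(1,3) this]
  define g where "g = pre s G"
  have g: "g \<in> pk" "g \<subseteq> s" "C g = G" using q dG by (simp_all add: g_def pk_def)
  show ?thesis
  proof (cases "\<exists>b\<in>bd. g \<subseteq> b")
    case True
    then obtain b where b: "b \<in> bd" "g \<subseteq> b" by blast
    obtain b' where b': "b' \<in> bd" "b' \<noteq> b" "g \<subseteq> b'" "\<And>b''. b'' \<in> bd \<Longrightarrow> g \<subseteq> b'' \<Longrightarrow> b'' = b \<or> b'' = b'"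
      using boundary_arc[OF b(1) g(1) b(2)] by blast
    interpret ch: chord K h cl b b' g by unfold_locales (use b b' g in blast)+
    obtain B :: "nat \<Rightarrow> ('p set + 'i \<times> nat \<times> 'w set) set"
      where B: "\<forall>k. mutual (B k)" "\<forall>k. nb_closed (B k) (C g)" "\<forall>t\<in>Fac. g \<subseteq> t \<longrightarrow> Inl t \<in> B 0"
      using ch.block by (elim exE conjE)
    have "x \<in> B 0" using B(3) Inl s(1) g(2) by simp
    moreover have "nb_closed (B 0) G" using B(2) g(3) by simp
    ultimately show ?thesis using that[of "B 0"] B(1) by simp
  next
    case False
    define B :: "('p set + 'i \<times> nat \<times> 'w set) set" where "B = Inl ` {t \<in> Fac. g \<subseteq> t}"
    obtain v where v: "v \<in> g" "v \<in> V" using ex_vertex[OF pkK[OF g(1)]] by blast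
    show ?thesis
    proof (rule that[of B])
      show "x \<in> B" using Inl s(1) g(2) by (simp add: B_def)
      show "mutual B" unfolding mutual_def
      proof (intro ballI impI)
        fix x y assume "x \<in> B" "y \<in> B" "y \<noteq> x"
        then obtain t t' where t: "x = Inl t" "y = Inl t'" "t \<in> Fac" "t' \<in> Fac" "g \<subseteq> t" "g \<subseteq> t'" "t \<noteq> t'" unfolding B_def by blast
        have vt: "v \<in> t" "v \<in> t'" using v(1) t(5,6) by (blast, blast)
        have "supp (nrm t) t t'" "supp (nrm t') t' t" using nrm(2)[OF t(3) v(2) vt(1) t(4) vt(2)] nrm(2)[OF t(4) v(2) vt(2) t(3) vt(1)] by auto
        then show "nN y \<notin> span {nN x} \<and> (\<forall>z\<in>XN x. nN y \<bullet> z \<le> 0)"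
          using St_indep[OF t(3,4,7)] supp_le by (simp add: t(1,2) NS_simps)
      qed
      show "nb_closed B G" unfolding nb_closed_def
      proof (intro ballI allI impI)
        fix x f assume "x \<in> B" and f: "f facet_of XN x" "G \<subseteq> f"
        then obtain t where t: "x = Inl t" "t \<in> Fac" "g \<subseteq> t" unfolding B_def by blast
        have ft: "f facet_of C t" using f(1) t(1) by (simp add: NS_simps)
        note p = facet_ridge[OF t(2) ft]
        have gp: "g \<subseteq> pre t f" using pre_sub[OF t(2) pkK[OF g(1)] t(3)] f(2) g(3) by simp
        then have nb: "pre t f \<notin> bd" using False by blast
        note o = oth[OF t(2) p(1,2) nb]
        show "nbN x f \<in> B" using o(1) order_trans[OF gp o(3)] nb t(1) by (simp add: nbN_def Let_def B_def)
      qed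
    qed
  qed
next
  case (Inr p)
  then obtain i k F where y: "x = Inr (i, k, F)" by (metis prod_cases3)
  have iF: "i \<in> cl ` bd" "F facet_of PP i" and eF: "e facet_of F" using x e y by (simp_all add: NS_simps)
  note P = PP_facts(1)[OF iF(1)]
  have GF: "G \<subseteq> F" using facet_of_imp_subset[OF G] facet_of_imp_subset[OF eF] by blast
  have faceG: "G face_of PP i"
    using face_of_trans[OF face_of_trans[OF facet_of_imp_face_of[OF G] facet_of_imp_face_of[OF eF]] facet_of_imp_face_of[OF iF(2)]] .
  have Gne: "G \<noteq> {}" using G by (simp add: facet_of_def)
  have dG: "aff_dim G = int DIM('w) - 3" using G eF PP_facet_dim[OF iF] by (simp add: facet_of_def)
  show ?thesis
  proof (cases "\<exists>b\<in>bd. cl b = i \<and> G \<subseteq> C b")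
    case True
    then obtain b where b: "b \<in> bd" "cl b = i" "G \<subseteq> C b" by blast
    have "C b \<subseteq> PP i" using cn_mono[OF own(2)[OF b(1)]] PP_facts(5)[OF iF(1)] own_collar[OF b(1)] b(2) by blast
    then have Gb: "G face_of C b" using face_of_subset[OF faceG b(3)] by blast
    have "G \<noteq> {0}"
    proof
      assume "G = {0}"
      then have "aff_dim G = 0" by simp
      then show False using dG dim4 by linarith
    qed
    note q = pre_cell[OF bdK(2)[OF b(1)] Gb Gne this]
    define g where "g = pre b G"
    have g: "g \<in> pk" "g \<subseteq> b" "C g = G" using q dG by (simp_all add: g_def pk_def)
    obtain b' where b': "b' \<in> bd" "b' \<noteq> b" "g \<subseteq> b'" "\<And>b''. b'' \<in> bd \<Longrightarrow> g \<subseteq> b'' \<Longrightarrow> b'' = b \<or> b'' = b'"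
      using boundary_arc[OF b(1) g(1,2)] by blast
    interpret ch: chord K h cl b b' g by unfold_locales (use b b' g in blast)+
    obtain B where B: "\<forall>k. mutual (B k)" "\<forall>k. nb_closed (B k) (C g)"
      "\<forall>k F. F facet_of PP (cl b) \<longrightarrow> C g \<subseteq> F \<longrightarrow> Inr (cl b, k, F) \<in> B k \<or> Inr (cl b, k, F) \<in> B (Suc k)"
      using ch.block by (elim exE conjE)
    have "x \<in> B k \<or> x \<in> B (Suc k)" using B(3) iF(2) GF b(2) g(3) y by simp
    moreover have "mutual (B k)" "nb_closed (B k) G" for k using B(1,2) g(3) by simp_all
    ultimately show ?thesis using that[of "B k"] that[of "B (Suc k)"] by blast
  next
    case False
    define B :: "('p set + 'i \<times> nat \<times> 'w set) set"
      where "B = {Inr (i, k, F') | F'. F' facet_of PP i \<and> G \<subseteq> F'}"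
    show ?thesis
    proof (rule that[of B])
      show "x \<in> B" using y iF(2) GF by (simp add: B_def)
      show "mutual B" unfolding mutual_def
      proof (intro ballI impI)
        fix x y assume "x \<in> B" "y \<in> B" "y \<noteq> x"
        then obtain F F' where t: "x = Inr (i,k,F)" "y = Inr (i,k,F')" "F facet_of PP i" "F' facet_of PP i" "F \<noteq> F'" by (auto simp: B_def)
        show "nN y \<notin> span {nN x} \<and> (\<forall>z\<in>XN x. nN y \<bullet> z \<le> 0)"
          using fnormal_indep[OF P t(3,4,5)] fnormal(2)[OF P t(4)] facet_of_imp_subset[OF t(3)] unfolding t(1,2) NS_simps by blast
      qed
      show "nb_closed B G" unfolding nb_closed_def
      proof (intro ballI allI impI)
        fix x f assume "x \<in> B" and f: "f facet_of XN x" "G \<subseteq> f"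
        then obtain F' where t: "x = Inr (i,k,F')" "F' facet_of PP i" by (auto simp: B_def)
        have ft: "f facet_of F'" using f(1) t(1) by (simp add: NS_simps)
        have "\<not> isb i f" using False f(2) by (auto simp: isb_def)
        then have "nbN x f = Inr (i, k, ot i F' f)" using t(1) by (simp add: nbN_def)
        moreover have "G \<subseteq> ot i F' f" using f(2) ot(4)[OF iF(1) t(2) ft] by blast
        ultimately show "nbN x f \<in> B" using ot(1)[OF iF(1) t(2) ft] by (simp add: B_def)
      qed
    qed
  qed
qed

lemma finite_nN: "finite (nN ` NS)"
proof -
  have "finite bd" using finK by (simp add: bd_def rdg_def)
  have "nN ` NS \<subseteq> nrm ` Fac \<union> (\<Union>i\<in>cl ` bd. \<nu> i ` {F. F facet_of PP i})" by (auto simp: NS_def nN_def)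
  moreover have "finite Fac" using finK by (simp add: Fac_def)
  moreover have "finite {F. F facet_of PP i}" if "i \<in> cl ` bd" for i
    using finite_polyhedron_facets PP_facts(1)[OF that] by (auto simp: pcone_def)
  ultimately show ?thesis using \<open>finite bd\<close> by (meson finite_UN_I finite_UnI finite_imageI finite_subset)
qed

lemma NS_node:
  assumes "x \<in> NS"
  shows "pcone (XN x)" "aff_dim (XN x) = int DIM('w) - 1" "nN x \<noteq> 0" "z \<in> XN x \<Longrightarrow> nN x \<bullet> z = 0"
proof -
  have "pcone (XN x) \<and> aff_dim (XN x) = int DIM('w) - 1 \<and> nN x \<noteq> 0 \<and> (\<forall>z\<in>XN x. nN x \<bullet> z = 0)"
  proof (cases x)
    case (Inl s)
    then show ?thesis using assms pc[OF FacK] Fdim nrm(1) nrm_perp by (simp add: NS_simps)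
  next
    case (Inr p)
    then obtain i k F where y: "x = Inr (i, k, F)" by (metis prod_cases3)
    have iF: "i \<in> cl ` bd" "F facet_of PP i" using assms y by (simp_all add: NS_simps)
    show ?thesis using pcone_facet[OF PP_facts(1)[OF iF(1)] iF(2)] PP_facet_dim[OF iF]
        fnormal(3,4)[OF PP_facts(1)[OF iF(1)] iF(2)] unfolding y NS_simps by blast
  qed
  then show "pcone (XN x)" "aff_dim (XN x) = int DIM('w) - 1" "nN x \<noteq> 0" "z \<in> XN x \<Longrightarrow> nN x \<bullet> z = 0" by blast+
qed

sublocale tower: closed_complex NS XN nN nbN
proof
  fix s e G t assume a: "s \<in> NS" "e facet_of XN s" "G facet_of e" "t \<in> orbit XN nbN s G" "t \<noteq> s"
  obtain B where B: "mutual B" "nb_closed B G" "s \<in> B" by (rule orbit_block[OF a(1-3)])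
  have "orbit XN nbN s G \<subseteq> B" by (rule orbit_subset[OF B(3)]) (use B(2) in \<open>auto simp: nb_closed_def\<close>)
  then show "nN t \<notin> span {nN s} \<and> (\<forall>x\<in>XN s. nN t \<bullet> x \<le> 0)" using B(1,3) a(4,5) unfolding mutual_def by blast
qed (use finite_nN NS_node nb_basic in auto)

end

section \<open>Global support\<close>

context nontrivial_manifold
begin

abbreviation "reach x y \<equiv> (x, y) \<in> {(a, b). tower.E a b}\<^sup>*"

lemma E_Inl:
  assumes "a \<in> Fac" "b \<in> Fac" "a \<noteq> b" "a \<inter> b \<in> rdg"
  shows "tower.E (Inl a) (Inl b)"
proof -
  have sub: "a \<inter> b \<subseteq> a" "a \<inter> b \<subseteq> b" by auto
  have nbd: "a \<inter> b \<notin> bd" using own(3)[of "a \<inter> b" a] own(3)[of "a \<inter> b" b] assms by auto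
  have "oth a (a \<inter> b) = b" using oth(4)[OF assms(1,4) sub(1) nbd assms(2) assms(3)[symmetric] sub(2)] by simp
  moreover have "pre a (C (a \<inter> b)) = a \<inter> b" by (rule pre_C[OF FacK[OF assms(1)] bdK(3)[OF assms(4)] sub(1)])
  ultimately have "nbN (Inl a) (C (a \<inter> b)) = Inl b" using nbd by (simp add: nbN_def Let_def)
  moreover have "C (a \<inter> b) facet_of XN (Inl a)" using ridge_facet[OF assms(1,4) sub(1)] by (simp add: NS_simps)
  ultimately show ?thesis unfolding tower.E_def using assms(1) NS_simps(5) by metis
qed

lemma reach_sym: "reach x y \<Longrightarrow> reach y x"
proof -
  assume "reach x y"
  moreover have "sym {(a, b). tower.E a b}" by (auto intro!: symI tower.E_sym)
  ultimately show ?thesis by (rule symD[OF sym_rtrancl, rotated])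
qed

lemma reach_Inl:
  assumes "s \<in> Fac" "t \<in> Fac" shows "reach (Inl s) (Inl t)"
  using connF[OF assms]
proof (induction rule: rtrancl_induct)
  case (step a b)
  then have ab: "a \<in> Fac" "b \<in> Fac" "a \<inter> b \<noteq> {}" by auto
  have "a \<inter> b \<in> K" by (rule intK[OF FacK[OF ab(1)] FacK[OF ab(2)] ab(3)])
  from strong[OF this ab(1,2)] have "reach (Inl a) (Inl b)"
  proof (rule rtrancl_induct, goal_cases)
    case (4 y z)
    then have yz: "y \<in> Fac" "z \<in> Fac" "aff_dim (C (y \<inter> z)) = int DIM('w) - 2" by auto
    show ?case
    proof (cases "y = z")
      case False
      then have "tower.E (Inl y) (Inl z)" by (rule E_Inl[OF yz(1,2) _ inter_cell[OF yz]])
      then show ?thesis using 4(3) by (auto intro: rtrancl_into_rtrancl)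
    qed (use 4(3) in simp)
  qed auto
  then show ?case using step.IH by (rule rtrancl_trans[rotated])
qed simp

lemma two_facets_Inl:
  assumes "s \<in> Fac" obtains f1 f2 where "f1 facet_of XN (Inl s)" "f2 facet_of XN (Inl s)" "f1 \<noteq> f2"
proof -
  obtain u where u: "\<And>x. x \<in> C s \<Longrightarrow> x \<noteq> 0 \<Longrightarrow> 0 < u \<bullet> x" using C_pointed[OF FacK[OF assms]] by blast
  have "aff_dim (C s) \<ge> 2" using Fdim[OF assms] dim4 by simp
  from pointed_two_facets[OF pc[OF FacK[OF assms]] u this] show ?thesis using that by (simp add: NS_simps) blast
qed

lemma node_support:
  assumes s: "s \<in> Fac" and y: "reach (Inl s) y"
  shows "x \<in> C s \<Longrightarrow> nN y \<bullet> x \<le> 0" "c > 0 \<Longrightarrow> nN y = c *\<^sub>R nrm s \<Longrightarrow> y = Inl s"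
proof -
  obtain f1 f2 where f: "f1 facet_of XN (Inl s)" "f2 facet_of XN (Inl s)" "f1 \<noteq> f2" by (rule two_facets_Inl[OF s])
  have sN: "Inl s \<in> NS" using s by (simp add: NS_simps)
  show "nN y \<bullet> x \<le> 0" if "x \<in> C s"
  proof (cases "y = Inl s")
    case True
    then show ?thesis using nrm_perp[OF s that] by (simp add: NS_simps)
  next
    case False
    show ?thesis by (rule tower.support(1)[OF sN f y False]) (simp add: NS_simps that)
  qed
  show "y = Inl s" if "c > 0" "nN y = c *\<^sub>R nrm s"
  proof (rule ccontr)
    assume "y \<noteq> Inl s"
    from tower.support(2)[OF sN f y this that(1)] show False using that(2) by (simp add: NS_simps)
  qed
qed

lemma facet_support: "s \<in> Fac \<Longrightarrow> t \<in> Fac \<Longrightarrow> x \<in> C s \<Longrightarrow> nrm t \<bullet> x \<le> 0"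
  using node_support(1)[OF _ reach_Inl, of s t x] by (simp add: NS_simps)

text \<open>
  All facets of the closed complex are facets of one convex cone \<open>D\<close>.  Those through the ray of a
  vertex \<open>w\<close> are connected by ridges through that ray, and \<open>w\<close> can be followed along such a chain.
\<close>

lemma facet_support_strict:
  assumes s: "s \<in> Fac" "w \<in> s" "w \<in> V" and t: "t \<in> Fac" "nrm t \<bullet> h w = 0"
  shows "w \<in> t"
proof -
  define R where "R = {x \<in> NS. reach (Inl s) x}"
  define D where "D = {z. \<forall>x\<in>R. nN x \<bullet> z \<le> 0}"
  have RN: "x \<in> NS" if "x \<in> R" for x using that by (simp add: R_def)
  have InlR: "Inl r \<in> R" if "r \<in> Fac" for r using that reach_Inl[OF s(1) that] by (simp add: R_def NS_simps)
  have reachR: "reach (Inl r) x" if "r \<in> Fac" "x \<in> R" for r x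
    using rtrancl_trans[OF reach_sym[OF reach_Inl[OF s(1) that(1)]]] that(2) by (simp add: R_def)
  have CD: "C r \<subseteq> D" if "r \<in> Fac" for r using node_support(1)[OF that reachR[OF that]] by (auto simp: D_def)
  have XD: "XN x \<subseteq> D" if x: "x \<in> R" for x
  proof (cases x)
    case (Inl r)
    then show ?thesis using CD RN[OF x] by (simp add: NS_simps)
  next
    case (Inr p)
    then obtain i k F where y: "x = Inr (i, k, F)" by (metis prod_cases3)
    have F: "F facet_of PP i" "i \<in> cl ` bd" using RN[OF x] y by (simp_all add: NS_simps)
    have "PP i \<subseteq> D"
    proof
      fix z assume z: "z \<in> PP i"
      have "nN y \<bullet> z \<le> 0" if y: "y \<in> R" for y
      proof (rule convex_cone_hull_le)
        obtain b where b: "b \<in> bd" "i = cl b" using F(2) by blast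
        show "z \<in> convex_cone hull (h ` (\<Union>(collar cl i) \<inter> V))"
          using z facet_family.P_def[OF ff[OF b(1)]] b(2) by simp
        fix v assume "v \<in> h ` (\<Union>(collar cl i) \<inter> V)"
        then obtain r v' where "r \<in> collar cl i" "v' \<in> r" "v = h v'" by blast
        then show "nN y \<bullet> v \<le> 0" using CD[OF collar_Fac] cn_base[of v' r h] y by (auto simp: D_def)
      qed
      then show "z \<in> D" by (simp add: D_def)
    qed
    then show ?thesis using facet_of_imp_subset[OF F(1)] y by (auto simp: NS_simps)
  qed
  have finR: "finite (nN ` R)" using finite_nN by (rule finite_subset[rotated]) (auto simp: R_def)
  have pD: "pcone D"
  proof -
    have "D = \<Inter>((\<lambda>v. {z. v \<bullet> z \<le> 0}) ` nN ` R)" by (auto simp: D_def)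
    moreover have "polyhedron (\<Inter>((\<lambda>v. {z. v \<bullet> z \<le> 0}) ` nN ` R))"
      by (rule polyhedron_Inter) (use finR in \<open>auto simp: polyhedron_halfspace_le simp del: image_image\<close>)
    ultimately have "polyhedron D" by simp
    moreover have "conic D" by (auto simp: conic_def D_def mult_nonneg_nonpos)
    moreover have "0 \<in> D" by (simp add: D_def)
    ultimately show ?thesis by (auto simp: pcone_def)
  qed
  have nbR: "nbN x f \<in> R" if "x \<in> R" "f facet_of XN x" for x f
  proof -
    have "tower.E x (nbN x f)" unfolding tower.E_def using RN[OF that(1)] that(2) by blast
    then show ?thesis using that nb_basic(1)[OF RN[OF that(1)] that(2)] by (auto simp: R_def intro: rtrancl_into_rtrancl)
  qed
  \<comment> \<open>A point of \<open>D\<close> on the hyperplane of \<open>x\<close> satisfies the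
    facet inequalities of \<open>XN x\<close>, because these come from the normals of the
    neighbours, which also bound \<open>D\<close>.\<close>
  have XeqD: "z \<in> XN x" if x: "x \<in> R" and z: "z \<in> D" "nN x \<bullet> z = 0" for x z
  proof (rule pcone_memI[OF NS_node(1)[OF RN[OF x]]])
    show "z \<in> span (XN x)" using tower.span_X[OF RN[OF x]] z(2) by simp
    fix e assume e: "e facet_of XN x"
    obtain a where a: "a > 0" "\<And>y. nN x \<bullet> y = 0 \<Longrightarrow> nN (nbN x e) \<bullet> y = a * (fnormal (XN x) e \<bullet> y)"
      using tower.nb_normal[OF RN[OF x] e] by blast
    have "nN (nbN x e) \<bullet> z \<le> 0" using z(1) nbR[OF x e] by (simp add: D_def)
    then show "fnormal (XN x) e \<bullet> z \<le> 0" using a(1) a(2)[OF z(2)] by (simp add: mult_le_0_iff)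
  qed
  \<comment> \<open>If some normal vanished on \<open>D\<close>, all facets would lie in its
    hyperplane, yet \<open>t\<close> and a neighbour of \<open>t\<close> do not share one.\<close>
  have neg: "\<exists>z\<in>D. nN x \<bullet> z < 0" if x: "x \<in> R" for x
  proof (rule ccontr)
    assume "\<not> ?thesis"
    then have z: "nN x \<bullet> z = 0" if "z \<in> D" for z using that x by (force simp: D_def)
    have "nrm r' \<in> span {nN x}" if r': "r' \<in> Fac" for r'
    proof (rule perp_perp_singleton)
      have sp: "span (C r') = {z. nrm r' \<bullet> z = 0}"
        by (rule span_hyperplane_eq[OF pc[OF FacK[OF r']] Fdim[OF r'] nrm(1)[OF r'] nrm_perp[OF r']])
      have sp': "span (C r') = {y. nN x \<bullet> y = 0}"
        by (rule span_hyperplane_eq[OF pc[OF FacK[OF r']] Fdim[OF r'] NS_node(3)[OF RN[OF x]]]) (use CD[OF r'] z in blast)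
      show "nrm r' \<bullet> y = 0" if "nN x \<bullet> y = 0" for y using sp sp' that by blast
    qed
    then have "nrm t \<in> span {nN x}" using t(1) by blast
    then obtain l where l: "nrm t = l *\<^sub>R nN x" by (auto simp: span_singleton)
    obtain b where b: "b \<in> Fac" "b \<noteq> t" "t \<inter> b \<in> rdg" using has_nb[OF t(1)] by blast
    obtain v where v: "v \<in> t \<inter> b" "v \<in> V" using ex_vertex[OF bdK(3)[OF b(3)]] by blast
    have "supp (nrm t) t b" using nrm(2)[OF t(1) v(2) _ b(1)] v(1) by blast
    then obtain y where y: "y \<in> b" "nrm t \<bullet> h y < 0" using supp_strict t(1) b by metis
    then show False using z[of "h y"] CD[OF b(1)] cn_base[OF y(1), of h] l by auto
  qed
  have dimD: "aff_dim D = int DIM('w)"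
  proof -
    obtain z where z: "z \<in> D" "nrm t \<bullet> z < 0" using neg[OF InlR[OF t(1)]] by (auto simp: NS_simps)
    have "affine hull (C t) \<subseteq> {z. nrm t \<bullet> z = 0}"
      by (rule hull_minimal) (use nrm_perp[OF t(1)] in \<open>auto simp: affine_hyperplane\<close>)
    then have "z \<notin> affine hull (C t)" using z(2) by auto
    then have "aff_dim (insert z (C t)) = int DIM('w)" using Fdim[OF t(1)] by (simp add: aff_dim_insert)
    moreover have "aff_dim (insert z (C t)) \<le> aff_dim D" using z(1) CD[OF t(1)] by (intro aff_dim_subset) blast
    ultimately show ?thesis using aff_dim_le_DIM[of D] by linarith
  qed
  have Xfacet: "XN x facet_of D" if x: "x \<in> R" for x
  proof -
    have "XN x = D \<inter> {z. nN x \<bullet> z = 0}" using XD[OF x] XeqD[OF x] NS_node(4)[OF RN[OF x]] by blast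
    moreover have "nN x \<bullet> z \<le> 0" if "z \<in> D" for z using that x by (simp add: D_def)
    ultimately have "XN x face_of D"
      using face_of_Int_supporting_hyperplane_le[OF pcone_convex[OF pD], of "nN x" 0] by simp
    then show ?thesis using NS_node(2)[OF RN[OF x]] dimD pcone_0[OF NS_node(1)[OF RN[OF x]]] by (auto simp: facet_of_def)
  qed
  have spanD: "span D = UNIV" using dimD pcone_aff_dim[OF pD] by (simp add: dim_eq_full)
  obtain q where q: "q \<in> rel_interior D" using pcone_rel_interior[OF pD] by blast
  have hwD: "h w \<in> D" using CD[OF s(1)] cn_base[OF s(2)] by blast
  \<comment> \<open>Just beyond \<open>h w\<close>, away from the interior point \<open>q\<close>:
    from there the visible facets of \<open>D\<close> are exactly those through
    \<open>h w\<close>.\<close>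
  define u where "u \<epsilon> = h w - \<epsilon> *\<^sub>R q" for \<epsilon> :: real
  have "\<forall>\<^sub>F \<epsilon> in at_right 0. \<forall>\<Phi>\<in>{\<Phi>. \<Phi> facet_of D}. 0 < fnormal D \<Phi> \<bullet> u \<epsilon> \<longleftrightarrow> h w \<in> \<Phi>"
  proof (rule eventually_ball_finite)
    show "finite {\<Phi>. \<Phi> facet_of D}" using finite_polyhedron_facets pD by (auto simp: pcone_def)
    show "\<forall>\<Phi>\<in>{\<Phi>. \<Phi> facet_of D}. \<forall>\<^sub>F \<epsilon> in at_right 0. 0 < fnormal D \<Phi> \<bullet> u \<epsilon> \<longleftrightarrow> h w \<in> \<Phi>"
    proof
      fix \<Phi> assume "\<Phi> \<in> {\<Phi>. \<Phi> facet_of D}"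
      then have \<Phi>: "\<Phi> facet_of D" by simp
      have nq: "fnormal D \<Phi> \<bullet> q < 0" by (rule fnormal_rel_interior[OF pD \<Phi> q])
      show "\<forall>\<^sub>F \<epsilon> in at_right 0. 0 < fnormal D \<Phi> \<bullet> u \<epsilon> \<longleftrightarrow> h w \<in> \<Phi>"
      proof (cases "h w \<in> \<Phi>")
        case True
        then have "fnormal D \<Phi> \<bullet> h w = 0" using fnormal(3)[OF pD \<Phi>] by blast
        then have "0 < fnormal D \<Phi> \<bullet> u \<epsilon>" if "0 < \<epsilon>" for \<epsilon> using that nq by (simp add: u_def inner_diff_right mult_pos_neg)
        then show ?thesis using True eventually_at_right_less[of "0::real"] by (auto elim: eventually_mono)
      next
        case False
        have "((\<lambda>\<epsilon>. fnormal D \<Phi> \<bullet> u \<epsilon>) \<longlongrightarrow> fnormal D \<Phi> \<bullet> u 0) (at_right 0)"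
          unfolding u_def by (intro tendsto_intros)
        moreover have "fnormal D \<Phi> \<bullet> u 0 < 0" using fnormal_less[OF pD \<Phi> hwD False] by (simp add: u_def)
        ultimately have "\<forall>\<^sub>F \<epsilon> in at_right 0. fnormal D \<Phi> \<bullet> u \<epsilon> < 0" by (rule order_tendstoD(2))
        then show ?thesis using False by (auto elim!: eventually_mono)
      qed
    qed
  qed
  then obtain \<epsilon> where vis: "\<And>\<Phi>. \<Phi> facet_of D \<Longrightarrow> 0 < fnormal D \<Phi> \<bullet> u \<epsilon> \<longleftrightarrow> h w \<in> \<Phi>"
    using eventually_happens[of _ "at_right (0::real)"] by (auto simp: trivial_limit_at_right_real)
  have hwt: "h w \<in> C t" using XeqD[OF InlR[OF t(1)] hwD] t(2) by (simp add: NS_simps)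
  have fs: "C s facet_of D" "C t facet_of D" using Xfacet InlR s(1) t(1) by (force simp: NS_simps)+
  have "(C s, C t) \<in> (visible_adj D (u \<epsilon>))\<^sup>*"
    by (rule visible_facets_connected[OF pD]) (use spanD fs vis cn_base[OF s(2)] hwt in auto)
  \<comment> \<open>The predicate follows the vertex \<open>w\<close> itself along the chain: inside
    the tower it is remembered by some collar facet containing it, until a boundary ridge leads back
    to the complex.\<close>
  then have "\<exists>x\<in>R. XN x = C t \<and> (case x of Inl r \<Rightarrow> w \<in> r | Inr (i, k, F) \<Rightarrow> \<exists>r\<in>collar cl i. w \<in> r)"
  proof (induction rule: rtrancl_induct)
    case base
    show ?case using InlR[OF s(1)] s(2) by (intro bexI[of _ "Inl s"]) (simp_all add: NS_simps)
  next
    case (step \<Phi> \<Psi>)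
    then obtain x where x: "x \<in> R" "XN x = \<Phi>" "case x of Inl r \<Rightarrow> w \<in> r | Inr (i, k, F) \<Rightarrow> \<exists>r\<in>collar cl i. w \<in> r" by blast
    have P: "\<Phi> facet_of D" "\<Psi> facet_of D" "\<Phi> \<noteq> \<Psi>" "h w \<in> \<Phi>" "h w \<in> \<Psi>" "(\<Phi> \<inter> \<Psi>) facet_of \<Phi>"
      using step.hyps(2) vis by (auto simp: visible_adj_def)
    define f where "f = \<Phi> \<inter> \<Psi>"
    have f: "f facet_of XN x" "h w \<in> f" using P x(2) by (auto simp: f_def)
    note nb = nb_basic[OF RN[OF x(1)] f(1)]
    have nbR': "nbN x f \<in> R" by (rule nbR[OF x(1) f(1)])
    have "XN (nbN x f) \<noteq> \<Phi>"
    proof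
      assume "XN (nbN x f) = \<Phi>"
      then have "span (XN (nbN x f)) = span (XN x)" using x(2) by simp
      then have "{z. nN (nbN x f) \<bullet> z = 0} = {z. nN x \<bullet> z = 0}" using tower.span_X[OF nb(1)] tower.span_X[OF RN[OF x(1)]] by simp
      then have "nN (nbN x f) \<in> span {nN x}" by (intro perp_perp_singleton) blast
      then show False using nb(4) by blast
    qed
    moreover have "XN (nbN x f) = \<Phi> \<or> XN (nbN x f) = \<Psi>"
    proof (rule codim2_at_most_two_facets[OF pD P(1,2) Xfacet[OF nbR'] P(3), of f])
      show "f \<subseteq> \<Phi>" "f \<subseteq> \<Psi>" by (auto simp: f_def)
      show "f \<subseteq> XN (nbN x f)" using facet_of_imp_subset[OF nb(2)] .
      show "aff_dim f = aff_dim D - 2" using facet_facet_codim2(2)[OF P(1)] P(6) by (simp add: f_def)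
      show "0 \<in> f" using pcone_0[OF pcone_facet[OF NS_node(1)[OF RN[OF x(1)]] f(1)]] .
    qed
    ultimately have X': "XN (nbN x f) = \<Psi>" by blast
    have "case nbN x f of Inl r \<Rightarrow> w \<in> r | Inr (i, k, F) \<Rightarrow> \<exists>r\<in>collar cl i. w \<in> r"
      using RN[OF x(1)] f(1)
    proof (cases rule: nb_cases)
      case (ca r)
      have "w \<in> r" using x(3) ca(1) by simp
      then have "w \<in> pre r f" using f(2) by (simp add: pre_def)
      then show ?thesis using ca(7) oth(3)[OF ca(2-4,6)] by auto
    next
      case (cb b)
      then have "w \<in> own b" using x(3) by simp
      then show ?thesis using cb(4) own_collar[OF cb(1)] by auto
    next
      case (cc i k F)
      then show ?thesis using x(3) by simp
    next
      case (cd b k)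
      then show ?thesis using x(3) by simp
    next
      case (ce b F)
      then obtain r where r: "r \<in> collar cl (cl b)" "w \<in> r" using x(3) by auto
      have "h w \<in> C (own b)" using f(2) ce(4) cn_mono[OF own(2)[OF ce(1)]] by blast
      then have "nrm (own b) \<bullet> h w = 0" by (rule nrm_perp[OF own(1)[OF ce(1)]])
      then have "w \<in> own b" using collar_supp[OF own_collar[OF ce(1)] r(1)] r(2) s(3) by (simp add: supp_def)
      then show ?thesis using ce(6) by simp
    next
      case (cf b F j)
      then show ?thesis using x(3) by simp
    qed
    then show ?case using nbR' X' by blast
  qed
  then obtain x where x: "x \<in> R" "XN x = C t" "case x of Inl r \<Rightarrow> w \<in> r | Inr (i, k, F) \<Rightarrow> \<exists>r\<in>collar cl i. w \<in> r" by blast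
  \<comment> \<open>The node reached has the cone of \<open>t\<close> and hence a parallel normal; a
    point of \<open>D\<close> off the hyperplane makes the factor positive, and then
    \<open>node_support\<close> identifies the node with \<open>Inl t\<close>.\<close>
  have "{z. nN x \<bullet> z = 0} = {z. nrm t \<bullet> z = 0}"
    using tower.span_X[OF RN[OF x(1)]] tower.span_X[OF RN[OF InlR[OF t(1)]]] x(2) by (simp add: NS_simps)
  then have "nN x \<in> span {nrm t}" by (intro perp_perp_singleton) blast
  then obtain c where c: "nN x = c *\<^sub>R nrm t" by (auto simp: span_singleton)
  obtain z where z: "z \<in> D" "nN x \<bullet> z < 0" using neg[OF x(1)] by blast
  have "nrm t \<bullet> z \<le> 0" using z(1) InlR[OF t(1)] by (auto simp: D_def NS_simps dest!: bspec)
  moreover have "c * (nrm t \<bullet> z) < 0" using z(2) c by simp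
  ultimately have "c > 0" by (simp add: mult_less_0_iff)
  then have "x = Inl t" using node_support(2)[OF t(1) reachR[OF t(1) x(1)]] c by blast
  then show ?thesis using x(3) by simp
qed

end

theorem (in convex_manifold) global_support:
  assumes s: "s \<in> Fac"
  shows "\<exists>m. m \<noteq> 0 \<and> (\<forall>t\<in>Fac. supp m s t)"
proof (cases "\<exists>s\<in>Fac. \<exists>t\<in>Fac. s \<noteq> t")
  case True
  interpret nontrivial_manifold K h cl by unfold_locales (fact True)
  have "supp (nrm s) s t" if t: "t \<in> Fac" for t
    unfolding supp_def
  proof (intro conjI ballI)
    show "nrm s \<bullet> h x \<le> 0" if "x \<in> t" for x using facet_support[OF t s cn_base[OF that]] .
    show "nrm s \<bullet> h w = 0 \<longleftrightarrow> w \<in> s" if "w \<in> t \<inter> V" for w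
      using facet_support_strict[OF t _ _ s, of w] nrm_perp[OF s cn_base[of w s h]] that by blast
  qed
  then show ?thesis using nrm(1)[OF s] by blast
next
  case False
  \<comment> \<open>With a single facet, convexity at any of its vertices is already the
    claim.\<close>
  obtain v where v: "v \<in> s" "v \<in> V" using ex_vertex[OF FacK[OF s]] by blast
  obtain m where "m \<noteq> 0" "supp m s s" using star[OF v(2) s v(1)] s v(1) by blast
  moreover have "t = s" if "t \<in> Fac" for t using False s that by blast
  ultimately show ?thesis by metis
qed

section \<open>Lifting geometric polytopes to cones\<close>

text \<open>A linear combination vanishes exactly when its inner product with itself does, and that
  number is computed from the inner products of the points alone; so independence passes from
  \<open>k\<close> to \<open>f\<close>.\<close>

lemma dim_le_of_inner_eq:
  fixes f :: "'p \<Rightarrow> 'a::euclidean_space" and k :: "'p \<Rightarrow> 'e::euclidean_space"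
  assumes eq: "\<And>x y. x \<in> c \<Longrightarrow> y \<in> c \<Longrightarrow> f x \<bullet> f y = k x \<bullet> k y"
  shows "dim (k ` c) \<le> dim (f ` c)"
proof -
  obtain B' where B': "B' \<subseteq> k ` c" "independent B'" "card B' = dim (k ` c)"
    using basis_exists[of "k ` c"] by metis
  then obtain B where B: "B \<subseteq> c" "inj_on k B" "B' = k ` B" by (metis subset_image_inj)
  have finB: "finite B" using B B'(2) independent_imp_finite finite_imageD by blast
  have finj: "inj_on f B"
  proof (rule inj_onI)
    fix x y assume xy: "x \<in> B" "y \<in> B" "f x = f y"
    then have xyc: "x \<in> c" "y \<in> c" using B(1) by auto
    have "(k x - k y) \<bullet> (k x - k y) = (f x - f y) \<bullet> (f x - f y)"
      using eq xyc by (simp add: inner_diff_left inner_diff_right)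
    then have "k x = k y" using xy(3) by simp
    then show "x = y" using B(2) xy by (simp add: inj_on_def)
  qed
  have "independent (f ` B)"
  proof (rule independent_if_scalars_zero)
    show "finite (f ` B)" using finB by simp
    fix a y assume s: "(\<Sum>z\<in>f ` B. a z *\<^sub>R z) = 0" and y: "y \<in> f ` B"
    define b where "b x = a (f x)" for x
    have fs: "(\<Sum>x\<in>B. b x *\<^sub>R f x) = 0" using s by (simp add: sum.reindex[OF finj] b_def)
    have "(\<Sum>x\<in>B. b x *\<^sub>R k x) \<bullet> (\<Sum>x\<in>B. b x *\<^sub>R k x) = (\<Sum>x\<in>B. b x *\<^sub>R f x) \<bullet> (\<Sum>x\<in>B. b x *\<^sub>R f x)"
      unfolding inner_sum_left inner_sum_right using eq B(1) by (intro sum.cong refl) (auto simp: subset_iff)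
    then have ks: "(\<Sum>x\<in>B. b x *\<^sub>R k x) = 0" using fs by simp
    obtain x where x: "x \<in> B" "y = f x" using y by blast
    define a' where "a' z = b (inv_into B k z)" for z
    have "(\<Sum>z\<in>B'. a' z *\<^sub>R z) = 0"
      using ks by (simp add: B(3) sum.reindex[OF B(2)] a'_def inv_into_f_f[OF B(2)] cong: sum.cong)
    then have "a' (k x) = 0"
      using B'(2) independentD[of B' B' a' "k x"] finB B(3) x(1) by auto
    then show "a y = 0" using x by (simp add: a'_def b_def inv_into_f_f[OF B(2)])
  qed
  then have "card (f ` B) \<le> dim (f ` c)"
    using B(1) independent_card_le_dim[of "f ` B" "f ` c"] by blast
  then show ?thesis using card_image[OF finj] card_image[OF B(2)] B'(3) B(3) by simp
qed

lemma dim_eq_of_inner_eq: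
  fixes f :: "'p \<Rightarrow> 'a::euclidean_space" and k :: "'p \<Rightarrow> 'e::euclidean_space"
  assumes "\<And>x y. x \<in> c \<Longrightarrow> y \<in> c \<Longrightarrow> f x \<bullet> f y = k x \<bullet> k y"
  shows "dim (f ` c) = dim (k ` c)"
  using dim_le_of_inner_eq[of c f k] dim_le_of_inner_eq[of c k f] assms by fastforce

text \<open>Polarisation turns distances into inner products of differences from a base
  point.\<close>

lemma aff_dim_eq_of_dist_eq:
  fixes f :: "'p \<Rightarrow> 'a::euclidean_space" and k :: "'p \<Rightarrow> 'e::euclidean_space"
  assumes d: "\<And>x y. x \<in> c \<Longrightarrow> y \<in> c \<Longrightarrow> dist (f x) (f y) = dist (k x) (k y)"
  shows "aff_dim (f ` c) = aff_dim (k ` c)"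
proof (cases "c = {}")
  case False
  then obtain a where a: "a \<in> c" by blast
  have pol: "2 * ((u - w) \<bullet> (v - w)) = (dist u w)\<^sup>2 + (dist v w)\<^sup>2 - (dist u v)\<^sup>2" for u v w :: "'z::euclidean_space"
    by (simp add: dist_norm power2_norm_eq_inner algebra_simps inner_commute)
  have "(f x - f a) \<bullet> (f y - f a) = (k x - k a) \<bullet> (k y - k a)" if "x \<in> c" "y \<in> c" for x y
    using pol[of "f x" "f a" "f y"] pol[of "k x" "k a" "k y"] d that a by simp
  then have "dim ((\<lambda>x. f x - f a) ` c) = dim ((\<lambda>x. k x - k a) ` c)" by (rule dim_eq_of_inner_eq)
  moreover have "(+) (- f a) ` f ` c = (\<lambda>x. f x - f a) ` c" "(+) (- k a) ` k ` c = (\<lambda>x. k x - k a) ` c"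
    by (auto simp: image_image)
  ultimately show ?thesis
    using aff_dim_eq_dim[of "f a" "f ` c"] aff_dim_eq_dim[of "k a" "k ` c"] a by (simp add: hull_inc)
qed simp

section \<open>Points, distances and polytopes in both geometries\<close>

definition geo_point :: "geometry \<Rightarrow> 'a::euclidean_space \<Rightarrow> bool" where
  "geo_point G x \<longleftrightarrow> (G = Spherical \<longrightarrow> norm x = 1)"

text \<open>\<open>arccos\<close> is injective on the interval from -1 to 1, where the inner
  products of unit vectors lie; hence the condition \<open>geo_point\<close>.\<close>

lemma geo_dist_eq_iff:
  fixes x y :: "'a::euclidean_space" and x' y' :: "'e::euclidean_space"
  assumes "geo_point G x" "geo_point G y" "geo_point G x'" "geo_point G y'"
    and "geo_dist G x y = geo_dist G x' y'"
  shows "dist x y = dist x' y'" "G = Spherical \<Longrightarrow> x \<bullet> y = x' \<bullet> y'"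
proof -
  have ip: "x \<bullet> y = x' \<bullet> y'" if "G = Spherical"
  proof -
    have n: "norm x = 1" "norm y = 1" "norm x' = 1" "norm y' = 1" using assms that by (auto simp: geo_point_def)
    then have "\<bar>x \<bullet> y\<bar> \<le> 1" "\<bar>x' \<bullet> y'\<bar> \<le> 1" using Cauchy_Schwarz_ineq2[of x y] Cauchy_Schwarz_ineq2[of x' y'] by auto
    then show ?thesis using assms(5) that by (simp add: arccos_eq_iff)
  qed
  then show "G = Spherical \<Longrightarrow> x \<bullet> y = x' \<bullet> y'" .
  show "dist x y = dist x' y'"
  proof (cases G)
    case Spherical
    have "(dist x y)\<^sup>2 = (norm x)\<^sup>2 + (norm y)\<^sup>2 - 2 * (x \<bullet> y)" "(dist x' y')\<^sup>2 = (norm x')\<^sup>2 + (norm y')\<^sup>2 - 2 * (x' \<bullet> y')"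
      by (simp_all add: dist_norm power2_norm_eq_inner algebra_simps inner_commute)
    then have "(dist x y)\<^sup>2 = (dist x' y')\<^sup>2" using ip[OF Spherical] assms(1-4) Spherical by (simp add: geo_point_def)
    then show ?thesis using power2_eq_imp_eq[OF _ zero_le_dist zero_le_dist] by blast
  qed (use assms in simp)
qed

lemma geo_dim_isometry:
  fixes f :: "'p \<Rightarrow> 'a::euclidean_space" and k :: "'p \<Rightarrow> 'e::euclidean_space"
  assumes p: "\<And>x. x \<in> c \<Longrightarrow> geo_point G (f x) \<and> geo_point G (k x)"
    and d: "\<And>x y. x \<in> c \<Longrightarrow> y \<in> c \<Longrightarrow> geo_dist G (f x) (f y) = geo_dist G (k x) (k y)"
  shows "geo_dim G (f ` c) = geo_dim G (k ` c)"
proof (cases G)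
  case Euclidean
  then show ?thesis using aff_dim_eq_of_dist_eq[of c f k] d by simp
next
  case Spherical
  have "f x \<bullet> f y = k x \<bullet> k y" if "x \<in> c" "y \<in> c" for x y
    using geo_dist_eq_iff(2)[OF _ _ _ _ d[OF that] Spherical] p that by blast
  then show ?thesis using dim_eq_of_inner_eq[of c f k] Spherical by simp
qed

lemma spherical_hull_nz:
  assumes "\<forall>v\<in>V. 0 < u \<bullet> v" "x \<in> convex hull V" shows "0 < u \<bullet> x"
proof -
  have "convex hull V \<subseteq> {x. 0 < u \<bullet> x}"
    by (rule hull_minimal) (use assms(1) in \<open>auto simp: convex_halfspace_gt\<close>)
  then show ?thesis using assms(2) by blast
qed

lemma geo_polytope_point: "geo_polytope G P \<Longrightarrow> x \<in> P \<Longrightarrow> geo_point G x"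
  using spherical_hull_nz by (cases G) (fastforce simp: geo_point_def norm_sgn)+

lemma geo_polytope_compact_connected:
  fixes P :: "'a::euclidean_space set"
  assumes "geo_polytope G P" shows "compact P" "connected P"
proof -
  have "compact P \<and> connected P"
  proof (cases G)
    case Euclidean
    then show ?thesis using assms polytope_imp_compact polytope_imp_convex convex_connected by auto
  next
    case Spherical
    then obtain V u where V: "finite V" "\<forall>v\<in>V. 0 < u \<bullet> v" "P = sgn ` (convex hull V)" using assms by auto
    have "continuous_on (convex hull V) sgn"
      unfolding sgn_div_norm
    proof (intro continuous_intros ballI)
      fix x assume "x \<in> convex hull V"
      then have "x \<noteq> 0" using spherical_hull_nz[OF V(2)] by force
      then show "norm x \<noteq> 0" by simp
    qed
    then show ?thesis using V compact_continuous_image connected_continuous_image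
        finite_imp_compact_convex_hull[OF V(1)] convex_connected convex_convex_hull by blast
  qed
  then show "compact P" "connected P" by auto
qed

lemma conic_hull_dim:
  fixes B :: "'w::euclidean_space set"
  assumes "B \<noteq> {}" shows "aff_dim (conic hull B) = int (dim B)"
proof -
  have "0 \<in> conic hull B" using assms by simp
  then have "aff_dim (conic hull B) = int (dim (conic hull B))" by (simp add: aff_dim_zero hull_inc)
  moreover have "span (conic hull B) = span B"
  proof
    have "conic hull B \<subseteq> span B" by (rule hull_minimal) (auto simp: span_superset subspace_imp_conic)
    then show "span (conic hull B) \<subseteq> span B" by (simp add: span_minimal)
    show "span B \<subseteq> span (conic hull B)" by (intro span_mono hull_subset)
  qed
  ultimately show ?thesis by (metis dim_span)
qed

text \<open>
  The cone over a geometric polytope: \<open>l\<close> is the identity in the spherical case and places Euclidean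
  space at height one otherwise.
\<close>

locale geo_lift =
  fixes G :: geometry and l :: "'a::euclidean_space \<Rightarrow> 'w::euclidean_space"
  assumes lift_dim: "int (ambient_dim G TYPE('a)) = int DIM('w) - 1"
    and lift_half: "closed_half G H D \<Longrightarrow>
      \<exists>m. m \<noteq> 0 \<and> (\<forall>x. geo_point G x \<longrightarrow> (x \<in> H \<longleftrightarrow> m \<bullet> l x \<le> 0) \<and> (x \<in> D \<longleftrightarrow> m \<bullet> l x = 0))"
    and half_lift: "m \<noteq> 0 \<Longrightarrow> m \<bullet> l y = 0 \<Longrightarrow> \<exists>H D. closed_half G H D \<and>
      (\<forall>x. geo_point G x \<longrightarrow> (x \<in> H \<longleftrightarrow> m \<bullet> l x \<le> 0) \<and> (x \<in> D \<longleftrightarrow> m \<bullet> l x = 0))"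
    and lift_pcone: "geo_polytope G P \<Longrightarrow> P \<noteq> {} \<Longrightarrow> pcone (conic hull (l ` P)) \<and> (\<exists>u. \<forall>x\<in>P. 0 < u \<bullet> l x)"
    and lift_rays: "geo_point G x \<Longrightarrow> geo_point G y \<Longrightarrow> 0 < t \<Longrightarrow> l x = t *\<^sub>R l y \<Longrightarrow> x = y"
    and lift_face: "geo_polytope G P \<Longrightarrow> \<forall>x\<in>P. m \<bullet> l x \<le> 0 \<Longrightarrow> geo_face G {x \<in> P. m \<bullet> l x = 0} P"
    and face_lift: "geo_polytope G P \<Longrightarrow> geo_face G F P \<Longrightarrow> F \<noteq> {} \<Longrightarrow>
      \<exists>m. (\<forall>x\<in>P. m \<bullet> l x \<le> 0) \<and> F = {x \<in> P. m \<bullet> l x = 0}"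
    and lift_geo_dim: "P \<noteq> {} \<Longrightarrow> aff_dim (conic hull (l ` P)) = geo_dim G P + 1"
    and lift_cont: "continuous_on A l"

section \<open>The lifts of the two geometries\<close>

lemma geo_lift_spherical: "geo_lift Spherical (\<lambda>x::'a::euclidean_space. x)"
proof
  show "int (ambient_dim Spherical TYPE('a)) = int DIM('a) - 1" using DIM_positive[where 'a = 'a] by (simp add: of_nat_diff Suc_leI)
  fix H D :: "'a set" assume "closed_half Spherical H D"
  then show "\<exists>m. m \<noteq> 0 \<and> (\<forall>x::'a. geo_point Spherical x \<longrightarrow> (x \<in> H \<longleftrightarrow> m \<bullet> x \<le> 0) \<and> (x \<in> D \<longleftrightarrow> m \<bullet> x = 0))"
    by (auto simp: geo_point_def)
next
  fix m :: 'a assume "m \<noteq> 0"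
  then have "closed_half Spherical {x \<in> sphere 0 1. m \<bullet> x \<le> 0} {x \<in> sphere 0 1. m \<bullet> x = 0}" by auto
  moreover have "(x \<in> {x \<in> sphere 0 1. m \<bullet> x \<le> 0} \<longleftrightarrow> m \<bullet> x \<le> 0) \<and> (x \<in> {x \<in> sphere 0 1. m \<bullet> x = 0} \<longleftrightarrow> m \<bullet> x = 0)"
    if "geo_point Spherical x" for x using that by (auto simp: geo_point_def)
  ultimately show "\<exists>H D. closed_half Spherical H D \<and>
      (\<forall>x. geo_point Spherical x \<longrightarrow> (x \<in> H \<longleftrightarrow> m \<bullet> x \<le> 0) \<and> (x \<in> D \<longleftrightarrow> m \<bullet> x = 0))" by blast
next
  fix P :: "'a set" assume P: "geo_polytope Spherical P" "P \<noteq> {}"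
  then obtain V u where V: "finite V" "\<forall>v\<in>V. 0 < u \<bullet> v" "P = sgn ` (convex hull V)" by auto
  have pos: "0 < u \<bullet> x" if "x \<in> convex hull V" for x using spherical_hull_nz[OF V(2) that] .
  \<comment> \<open>Radial projection rescales each point by a positive factor, which does not
    change the conic hull.\<close>
  have "conic hull P = conic hull (convex hull V)"
  proof -
    have "P = (\<lambda>x. inverse (norm x) *\<^sub>R x) ` (convex hull V)" unfolding V(3) by (simp add: sgn_div_norm)
    then show ?thesis using conic_hull_image_scale[of "convex hull V" "\<lambda>x. inverse (norm x)"] pos by fastforce
  qed
  moreover have "polyhedron (conic hull (convex hull V))"
    using V(1) by (intro polyhedron_conic_hull_polytope) (auto simp: polytope_def)
  ultimately have "pcone (conic hull P)" using P(2) conic_conic_hull[of P] conic_hull_eq_empty[of P] by (auto simp: pcone_def)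
  moreover have "\<forall>x\<in>P. 0 < u \<bullet> x" unfolding V(3) using pos by (fastforce simp: sgn_div_norm zero_less_mult_iff)
  ultimately show "pcone (conic hull ((\<lambda>x. x) ` P)) \<and> (\<exists>u. \<forall>x\<in>P. 0 < u \<bullet> x)" by auto
next
  fix x y :: 'a and t :: real assume "geo_point Spherical x" "geo_point Spherical y" "0 < t" "x = t *\<^sub>R y"
  then show "x = y" by (auto simp: geo_point_def)
next
  fix P and m :: 'a assume "geo_polytope Spherical P" "\<forall>x\<in>P. m \<bullet> x \<le> 0"
  then show "geo_face Spherical {x \<in> P. m \<bullet> x = 0} P" by (auto intro!: exI[of _ "- m"])
next
  fix P F :: "'a set" assume "geo_face Spherical F P"
  then obtain u where "\<forall>x\<in>P. 0 \<le> u \<bullet> x" "F = {x \<in> P. u \<bullet> x = 0}" by auto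
  then show "\<exists>m. (\<forall>x\<in>P. m \<bullet> x \<le> 0) \<and> F = {x \<in> P. m \<bullet> x = 0}" by (intro exI[of _ "- u"]) auto
next
  fix P :: "'a set" assume "P \<noteq> {}"
  then show "aff_dim (conic hull ((\<lambda>x. x) ` P)) = geo_dim Spherical P + 1" by (simp add: conic_hull_dim)
qed (auto intro: continuous_on_id)

lemma geo_lift_euclidean: "geo_lift Euclidean (\<lambda>x::'a::euclidean_space. (x, 1::real))"
proof
  show "int (ambient_dim Euclidean TYPE('a)) = int DIM('a \<times> real) - 1" by simp
  fix H D :: "'a set" assume "closed_half Euclidean H D"
  then obtain a b where ab: "a \<noteq> 0" "H = {x. a \<bullet> x \<le> b}" "D = {x. a \<bullet> x = b}" by auto
  then show "\<exists>m. m \<noteq> 0 \<and> (\<forall>x::'a. geo_point Euclidean x \<longrightarrow> (x \<in> H \<longleftrightarrow> m \<bullet> (x, 1::real) \<le> 0) \<and> (x \<in> D \<longleftrightarrow> m \<bullet> (x, 1::real) = 0))"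
    by (intro exI[of _ "(a, - b)"]) (auto simp: inner_Pair zero_prod_def)
next
  \<comment> \<open>The point \<open>y\<close> excludes functionals \<open>(0, b)\<close> with
    \<open>b\<close> nonzero, whose hyperplanes do not meet height one and so bound no
    halfspace.\<close>
  fix m :: "'a \<times> real" and y assume m: "m \<noteq> 0" "m \<bullet> (y, 1) = 0"
  obtain a b where ab: "m = (a, b)" by (cases m)
  have "a \<noteq> 0" using m ab by (auto simp: inner_Pair zero_prod_def)
  then have "closed_half Euclidean {x. a \<bullet> x \<le> - b} {x. a \<bullet> x = - b}" by auto
  moreover have "(x \<in> {x. a \<bullet> x \<le> - b} \<longleftrightarrow> m \<bullet> (x, 1) \<le> 0) \<and> (x \<in> {x. a \<bullet> x = - b} \<longleftrightarrow> m \<bullet> (x, 1) = 0)" for x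
    by (auto simp: ab inner_Pair)
  ultimately show "\<exists>H D. closed_half Euclidean H D \<and>
      (\<forall>x. geo_point Euclidean x \<longrightarrow> (x \<in> H \<longleftrightarrow> m \<bullet> (x, 1) \<le> 0) \<and> (x \<in> D \<longleftrightarrow> m \<bullet> (x, 1) = 0))" by blast
next
  fix P :: "'a set" assume P: "geo_polytope Euclidean P" "P \<noteq> {}"
  have "polytope ((\<lambda>x. (x, 1::real)) ` P)"
  proof -
    obtain V where V: "finite V" "P = convex hull V" using P(1) by (auto simp: polytope_def)
    have "(\<lambda>x. (x, 1::real)) ` P = (+) (0, 1) ` ((\<lambda>x. (x, 0)) ` P)" by (auto simp: image_image)
    also have "(\<lambda>x. (x, 0::real)) ` P = convex hull ((\<lambda>x. (x, 0)) ` V)"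
      unfolding V(2) by (rule convex_hull_linear_image) (auto simp: linear_iff)
    finally show ?thesis using V(1) by (simp add: polytope_translation_eq polytope_convex_hull)
  qed
  then have "polyhedron (conic hull ((\<lambda>x. (x, 1::real)) ` P))" by (rule polyhedron_conic_hull_polytope)
  then have "pcone (conic hull ((\<lambda>x. (x, 1::real)) ` P))"
    using P(2) conic_conic_hull[of "(\<lambda>x. (x, 1::real)) ` P"] conic_hull_eq_empty[of "(\<lambda>x. (x, 1::real)) ` P"]
    by (auto simp: pcone_def)
  moreover have "\<forall>x\<in>P. 0 < (0, 1) \<bullet> (x, 1::real)" by (simp add: inner_Pair)
  ultimately show "pcone (conic hull ((\<lambda>x. (x, 1::real)) ` P)) \<and> (\<exists>u. \<forall>x\<in>P. 0 < u \<bullet> (x, 1::real))" by blast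
next
  fix x y :: 'a and t :: real assume "0 < t" "(x, 1::real) = t *\<^sub>R (y, 1)"
  then show "x = y" by auto
next
  fix P and m :: "'a \<times> real" assume P: "geo_polytope Euclidean P" and le: "\<forall>x\<in>P. m \<bullet> (x, 1) \<le> 0"
  obtain a b where ab: "m = (a, b)" by (cases m)
  have "{x \<in> P. m \<bullet> (x, 1) = 0} = P \<inter> {x. a \<bullet> x = - b}" using ab by (auto simp: inner_Pair)
  moreover have "a \<bullet> x \<le> - b" if "x \<in> P" for x using le that ab by (force simp: inner_Pair)
  ultimately show "geo_face Euclidean {x \<in> P. m \<bullet> (x, 1) = 0} P"
    using face_of_Int_supporting_hyperplane_le[OF polytope_imp_convex, of P a "-b"] P by simp
next
  fix P F :: "'a set" assume "geo_polytope Euclidean P" "geo_face Euclidean F P"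
  then have "F exposed_face_of P" using exposed_face_of_polyhedron polytope_imp_polyhedron by auto
  then obtain a b where "P \<subseteq> {x. a \<bullet> x \<le> b}" "F = P \<inter> {x. a \<bullet> x = b}" unfolding exposed_face_of_def by blast
  then show "\<exists>m. (\<forall>x\<in>P. m \<bullet> (x, 1::real) \<le> 0) \<and> F = {x \<in> P. m \<bullet> (x, 1::real) = 0}"
    by (intro exI[of _ "(a, - b)"]) (auto simp: inner_Pair)
next
  fix P :: "'a set" assume P: "P \<noteq> {}"
  define B where "B = (\<lambda>x. (x, 1::real)) ` P"
  have B: "B \<noteq> {}" using P by (simp add: B_def)
  have "affine hull B \<subseteq> {z. (0, 1) \<bullet> z = 1}"
    by (rule hull_minimal) (auto simp: B_def affine_hyperplane inner_Pair)
  then have "0 \<notin> affine hull B" by (auto simp: zero_prod_def inner_Pair)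
  then have "aff_dim (insert 0 B) = aff_dim B + 1" by (simp add: aff_dim_insert)
  moreover have "aff_dim (insert 0 B) = int (dim B)" by (subst aff_dim_zero) (auto simp: hull_inc dim_insert span_0)
  moreover have "aff_dim B = aff_dim P"
    using aff_dim_eq_of_dist_eq[of P "\<lambda>x. (x, 1::real)" "\<lambda>x. x"] by (simp add: B_def dist_Pair_Pair)
  ultimately show "aff_dim (conic hull ((\<lambda>x. (x, 1::real)) ` P)) = geo_dim Euclidean P + 1"
    using conic_hull_dim[OF B] by (simp add: B_def)
qed (auto intro!: continuous_intros)

text \<open>Combinatorial equivalence provides some isomorphism \<open>g\<close>, which may differ
  from \<open>\<phi>\<close>. But \<open>\<phi>\<close> is then a bijection that maps inclusions to
  inclusions, and the two finite sets of inclusions have the same size, so \<open>\<phi>\<close>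
  creates no new one.\<close>

lemma order_iso_image:
  fixes \<phi> :: "'p set \<Rightarrow> 'q set"
  assumes fin: "finite \<A>" and mono: "\<And>A B. A \<subseteq> B \<Longrightarrow> \<phi> A \<subseteq> \<phi> B"
    and ce: "combinatorially_equivalent \<A> (\<phi> ` \<A>)"
    and AB: "A \<in> \<A>" "B \<in> \<A>" "\<phi> A \<subseteq> \<phi> B"
  shows "A \<subseteq> B"
proof -
  obtain g where g: "bij_betw g \<A> (\<phi> ` \<A>)" "\<And>c c'. c \<in> \<A> \<Longrightarrow> c' \<in> \<A> \<Longrightarrow> c \<subseteq> c' \<longleftrightarrow> g c \<subseteq> g c'"
    using ce by (auto simp: combinatorially_equivalent_def)
  have inj: "inj_on \<phi> \<A>" using bij_betw_same_card[OF g(1)] eq_card_imp_inj_on[OF fin, of \<phi>] by simp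
  define L where "L = {(A, B) \<in> \<A> \<times> \<A>. A \<subseteq> B}"
  define L' where "L' = {(A, B) \<in> \<phi> ` \<A> \<times> \<phi> ` \<A>. A \<subseteq> B}"
  have finL: "finite L" "finite L'" using fin by (auto simp: L_def L'_def intro: finite_subset[of _ "\<A> \<times> \<A>"] finite_subset[of _ "\<phi> ` \<A> \<times> \<phi> ` \<A>"])
  have "bij_betw (map_prod g g) L L'"
  proof (rule bij_betw_imageI)
    show "inj_on (map_prod g g) L" using g(1) by (auto simp: inj_on_def bij_betw_def L_def)
    show "map_prod g g ` L = L'"
    proof
      show "map_prod g g ` L \<subseteq> L'"
      proof
        fix p assume "p \<in> map_prod g g ` L"
        then obtain A B where "A \<in> \<A>" "B \<in> \<A>" "A \<subseteq> B" "p = (g A, g B)" by (auto simp: L_def)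
        then show "p \<in> L'" using g(2) bij_betwE[OF g(1)] by (simp add: L'_def)
      qed
      show "L' \<subseteq> map_prod g g ` L"
      proof
        fix p assume "p \<in> L'"
        then obtain A' B' where p: "p = (A', B')" "A' \<in> \<phi> ` \<A>" "B' \<in> \<phi> ` \<A>" "A' \<subseteq> B'" by (auto simp: L'_def)
        obtain A B where "A \<in> \<A>" "g A = A'" "B \<in> \<A>" "g B = B'"
          using p(2,3) g(1) unfolding bij_betw_def by (metis imageE)
        then show "p \<in> map_prod g g ` L" using p(1,4) g(2) by (force simp: L_def)
      qed
    qed
  qed
  then have "card L = card L'" by (rule bij_betw_same_card)
  moreover have "map_prod \<phi> \<phi> ` L \<subseteq> L'" using mono by (auto simp: L_def L'_def)
  moreover have "inj_on (map_prod \<phi> \<phi>) L" using inj by (auto simp: inj_on_def L_def)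
  ultimately have "map_prod \<phi> \<phi> ` L = L'" using card_subset_eq[OF finL(2)] card_image by metis
  moreover have "(\<phi> A, \<phi> B) \<in> L'" using AB by (auto simp: L'_def)
  ultimately obtain A1 B1 where "(A1, B1) \<in> L" "\<phi> A1 = \<phi> A" "\<phi> B1 = \<phi> B" by auto
  moreover from this have "A1 = A" "B1 = B" using inj_onD[OF inj] AB(1,2) by (simp_all add: L_def)
  ultimately show ?thesis by (simp add: L_def)
qed

text \<open>Both rank functions give the length of a longest chain below a cell, so they depend on
  the order alone. Dimension is thereby an invariant of combinatorial equivalence.\<close>

lemma rank_unique:
  fixes d :: "'p set \<Rightarrow> int" and d' :: "'q set \<Rightarrow> int"
  assumes bij: "bij_betw g \<A> \<B>" and ord: "\<And>c c'. c \<in> \<A> \<Longrightarrow> c' \<in> \<A> \<Longrightarrow> c \<subseteq> c' \<longleftrightarrow> g c \<subseteq> g c'"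
    and d: "\<And>c. c \<in> \<A> \<Longrightarrow> 0 \<le> d c" "\<And>b c. b \<in> \<A> \<Longrightarrow> c \<in> \<A> \<Longrightarrow> b \<subset> c \<Longrightarrow> d b < d c"
      "\<And>c. c \<in> \<A> \<Longrightarrow> 0 < d c \<Longrightarrow> \<exists>b\<in>\<A>. b \<subset> c \<and> d b = d c - 1"
    and d': "\<And>c. c \<in> \<B> \<Longrightarrow> 0 \<le> d' c" "\<And>b c. b \<in> \<B> \<Longrightarrow> c \<in> \<B> \<Longrightarrow> b \<subset> c \<Longrightarrow> d' b < d' c"
      "\<And>c. c \<in> \<B> \<Longrightarrow> 0 < d' c \<Longrightarrow> \<exists>b\<in>\<B>. b \<subset> c \<and> d' b = d' c - 1"
    and c: "c \<in> \<A>"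
  shows "d' (g c) = d c"
proof -
  have ord': "c \<subset> c' \<longleftrightarrow> g c \<subset> g c'" if "c \<in> \<A>" "c' \<in> \<A>" for c c'
    using ord[OF that] ord[OF that(2,1)] by blast
  have gin: "g c \<in> \<B>" if "c \<in> \<A>" for c using bij that by (auto simp: bij_betw_def)
  have le: "int n \<le> d' (g c)" if "c \<in> \<A>" "d c = int n" for n c using that
  proof (induction n arbitrary: c)
    case 0
    then show ?case using d'(1)[OF gin] by simp
  next
    case (Suc n)
    then obtain b where b: "b \<in> \<A>" "b \<subset> c" "d b = int n" using d(3)[of c] by auto
    have "d' (g b) < d' (g c)" using d'(2)[OF gin[OF b(1)] gin[OF Suc.prems(1)]] ord'[OF b(1) Suc.prems(1)] b(2) by blast
    then show ?case using Suc.IH[OF b(1,3)] by simp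
  qed
  have ge: "int n \<le> d c" if "c \<in> \<A>" "d' (g c) = int n" for n c using that
  proof (induction n arbitrary: c)
    case 0
    then show ?case using d(1) by simp
  next
    case (Suc n)
    then obtain b' where b': "b' \<in> \<B>" "b' \<subset> g c" "d' b' = int n" using d'(3)[OF gin[OF Suc.prems(1)]] by auto
    then obtain b where b: "b \<in> \<A>" "b' = g b" using bij by (auto simp: bij_betw_def)
    have "d b < d c" using d(2)[OF b(1) Suc.prems(1)] ord'[OF b(1) Suc.prems(1)] b'(2) b(2) by blast
    then show ?case using Suc.IH[OF b(1)] b'(3) b(2) by simp
  qed
  show ?thesis using le[OF c, of "nat (d c)"] ge[OF c, of "nat (d' (g c))"] d(1)[OF c] d'(1)[OF gin[OF c]] by simp
qed

section \<open>Polytopal complexes\<close>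

context geo_lift
begin

lemma face_cone:
  assumes le: "\<forall>x\<in>P. m \<bullet> l x \<le> 0" and F: "F = {x \<in> P. m \<bullet> l x = 0}" "F \<noteq> {}"
  shows "cn l F = cn l P \<inter> {y. m \<bullet> y = 0}"
proof
  show "cn l F \<subseteq> cn l P \<inter> {y. m \<bullet> y = 0}" using F(1) by (force simp: cn_iff)
  show "cn l P \<inter> {y. m \<bullet> y = 0} \<subseteq> cn l F"
  proof
    fix y assume y: "y \<in> cn l P \<inter> {y. m \<bullet> y = 0}"
    then obtain t x where t: "0 \<le> t" "x \<in> P" "y = t *\<^sub>R l x" by (auto simp: cn_iff)
    obtain x0 where x0: "x0 \<in> F" using F(2) by blast
    show "y \<in> cn l F"
    proof (cases "t = 0")
      case True
      then show ?thesis using t(3) x0 unfolding cn_iff by auto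
    next
      case False
      then have "x \<in> F" using y t F(1) by auto
      then show ?thesis using t unfolding cn_iff by blast
    qed
  qed
qed

lemma face_dim_less:
  fixes P :: "'a set"
  assumes P: "geo_polytope G P" and F: "geo_face G F P" "F \<noteq> {}" "F \<subseteq> P" "F \<noteq> P"
  shows "geo_dim G F < geo_dim G P"
proof -
  have Pne: "P \<noteq> {}" using F by blast
  obtain m where m: "\<forall>x\<in>P. m \<bullet> l x \<le> 0" "F = {x \<in> P. m \<bullet> l x = 0}" using face_lift[OF P F(1,2)] by blast
  have eq: "cn l F = cn l P \<inter> {y. m \<bullet> y = 0}" by (rule face_cone[OF m F(2)])
  have conv: "convex (cn l P)" using lift_pcone[OF P Pne] pcone_convex unfolding cn_def by blast
  have le: "m \<bullet> y \<le> 0" if "y \<in> cn l P" for y using that m(1) by (auto simp: cn_iff mult_nonneg_nonpos)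
  have face: "cn l F face_of cn l P" unfolding eq
    by (rule face_of_Int_supporting_hyperplane_le[OF conv]) (rule le)
  obtain x where x: "x \<in> P" "x \<notin> F" using F by blast
  then have "l x \<in> cn l P" "l x \<notin> cn l F" using cn_base[of x P l] m(2) eq by auto
  then have "cn l F \<noteq> cn l P" by blast
  then have "aff_dim (cn l F) < aff_dim (cn l P)" using face_of_aff_dim_lt[OF conv face] by blast
  then show ?thesis using lift_geo_dim[OF F(2)] lift_geo_dim[OF Pne] by (simp add: cn_def)
qed

lemma polytope_dim_nonneg:
  fixes P :: "'a set"
  assumes P: "geo_polytope G P" "P \<noteq> {}"
  shows "0 \<le> geo_dim G P"
proof -
  obtain x where x: "x \<in> P" using P(2) by blast
  obtain u where "\<forall>x\<in>P. 0 < u \<bullet> l x" using lift_pcone[OF P] by blast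
  then have "l x \<noteq> 0" using x by force
  then have "\<not> l ` P \<subseteq> {0}" using x by blast
  then have "dim (l ` P) \<noteq> 0" unfolding dim_eq_0 .
  moreover have "int (dim (l ` P)) = geo_dim G P + 1" using lift_geo_dim[OF P(2)] conic_hull_dim[of "l ` P"] P(2) by simp
  ultimately show ?thesis by linarith
qed

lemma polytope_facet:
  fixes P :: "'a set"
  assumes P: "geo_polytope G P" "P \<noteq> {}" and d: "0 < geo_dim G P"
  shows "\<exists>F. geo_face G F P \<and> F \<noteq> {} \<and> F \<subseteq> P \<and> F \<noteq> P \<and> geo_dim G F = geo_dim G P - 1"
proof -
  obtain u where u: "\<forall>x\<in>P. 0 < u \<bullet> l x" and pcP: "pcone (cn l P)" using lift_pcone[OF P] by (auto simp: cn_def)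
  have dc: "aff_dim (cn l P) = geo_dim G P + 1" using lift_geo_dim[OF P(2)] by (simp add: cn_def)
  have upos: "0 < u \<bullet> y" if y: "y \<in> cn l P" "y \<noteq> 0" for y
  proof -
    obtain t x where t: "0 \<le> t" "x \<in> P" "y = t *\<^sub>R l x" using y(1) by (auto simp: cn_iff)
    then have "0 < t" using y(2) by (cases "t = 0") auto
    then show ?thesis using t u by simp
  qed
  obtain e where e: "e facet_of cn l P"
    using pointed_two_facets[OF pcP upos] d dc by (metis add.commute add_le_cancel_left int_one_le_iff_zero_less one_add_one)
  have ef: "e face_of cn l P" "e \<noteq> {}" "aff_dim e = aff_dim (cn l P) - 1" using e by (auto simp: facet_of_def)
  obtain m where m: "\<And>x. x \<in> cn l P \<Longrightarrow> m \<bullet> x \<le> 0" "e = {x \<in> cn l P. m \<bullet> x = 0}"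
    using pcone_face_normal[OF pcP ef(1,2)] by metis
  define F where "F = {x \<in> P. m \<bullet> l x = 0}"
  have le: "\<forall>x\<in>P. m \<bullet> l x \<le> 0" using m(1) cn_base[of _ P l] by blast
  have "e \<noteq> {0}" using ef(3) dc d by auto
  then obtain y where y: "y \<in> e" "y \<noteq> 0" using ef(2) by blast
  then obtain t x where t: "0 \<le> t" "x \<in> P" "y = t *\<^sub>R l x" using m(2) by (auto simp: cn_iff)
  then have "x \<in> F" using y m(2) by (auto simp: F_def)
  then have Fne: "F \<noteq> {}" by blast
  have "cn l F = e" using face_cone[OF le F_def Fne] m(2) by blast
  then have "geo_dim G F = geo_dim G P - 1" using ef(3) dc lift_geo_dim[OF Fne] by (simp add: cn_def)
  moreover from this have "F \<noteq> P" by auto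
  moreover have "geo_face G F P" unfolding F_def by (rule lift_face[OF P(1) le])
  ultimately show ?thesis using Fne by (intro exI[of _ F]) (auto simp: F_def)
qed

end

text \<open>Stated outside the locale, because charts take values in a space different from that of
  \<open>f\<close> and call for a lift of their own.\<close>

lemma geo_face_dim_less:
  assumes "geo_polytope G P" "geo_face G F P" "F \<noteq> {}" "F \<subseteq> P" "F \<noteq> P"
  shows "geo_dim G F < geo_dim G P"
  using geo_lift.face_dim_less[OF geo_lift_spherical, of P F] geo_lift.face_dim_less[OF geo_lift_euclidean, of P F] assms
  by (cases G) simp_all

lemma geo_polytope_dim_nonneg:
  assumes "geo_polytope G P" "P \<noteq> {}"
  shows "0 \<le> geo_dim G P"
  using geo_lift.polytope_dim_nonneg[OF geo_lift_spherical, of P] geo_lift.polytope_dim_nonneg[OF geo_lift_euclidean, of P] assms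
  by (cases G) simp_all

lemma geo_polytope_facet:
  assumes "geo_polytope G P" "P \<noteq> {}" "0 < geo_dim G P"
  shows "\<exists>F. geo_face G F P \<and> F \<noteq> {} \<and> F \<subseteq> P \<and> F \<noteq> P \<and> geo_dim G F = geo_dim G P - 1"
proof (cases G)
  case Spherical
  show ?thesis using geo_lift.polytope_facet[OF geo_lift_spherical, of P] assms unfolding Spherical by blast
next
  case Euclidean
  show ?thesis using geo_lift.polytope_facet[OF geo_lift_euclidean, of P] assms unfolding Euclidean by blast
qed

section \<open>Abstract complexes and the dimensions of their cells\<close>

locale polytopal =
  fixes G :: geometry and K :: "('p, 'e::euclidean_space) pcomplex"
  assumes complex: "polytopal_complex G K"
begin

lemma fin_cells: "finite (cells K)"
  using complex by (simp add: polytopal_complex_def)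

lemma cell_ne: "c \<in> cells K \<Longrightarrow> c \<noteq> {}"
  and chart_inj: "c \<in> cells K \<Longrightarrow> inj_on (chart K c) c"
  and chart_polytope: "c \<in> cells K \<Longrightarrow> geo_polytope G (chart K c ` c)"
  using complex by (simp_all add: polytopal_complex_def)

lemma face_in_cells: "c \<in> cells K \<Longrightarrow> cell_face G K F c \<Longrightarrow> F \<in> cells K"
  using complex unfolding polytopal_complex_def by blast

lemma chart_point: "c \<in> cells K \<Longrightarrow> x \<in> c \<Longrightarrow> geo_point G (chart K c x)"
  using geo_polytope_point[OF chart_polytope] by blast

lemma face_chart:
  "\<lbrakk>c \<in> cells K; cell_face G K F c; x \<in> F; y \<in> F\<rbrakk> \<Longrightarrow>
   geo_dist G (chart K F x) (chart K F y) = geo_dist G (chart K c x) (chart K c y)"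
  using complex unfolding polytopal_complex_def by blast

lemma inter_face: "\<lbrakk>c \<in> cells K; c' \<in> cells K; c \<inter> c' \<noteq> {}\<rbrakk> \<Longrightarrow> cell_face G K (c \<inter> c') c"
  using complex unfolding polytopal_complex_def by blast

lemma inter_cell: "\<lbrakk>c \<in> cells K; c' \<in> cells K; c \<inter> c' \<noteq> {}\<rbrakk> \<Longrightarrow> c \<inter> c' \<in> cells K"
  using inter_face face_in_cells by metis

lemma sub_face:
  assumes "b \<in> cells K" "c \<in> cells K" "b \<subseteq> c" shows "cell_face G K b c"
  using inter_face[OF assms(2,1)] assms cell_ne[OF assms(1)] by (simp add: Int_absorb1)

lemma sub_dim:
  assumes "b \<in> cells K" "c \<in> cells K" "b \<subseteq> c" shows "cell_dim G K b = geo_dim G (chart K c ` b)"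
  unfolding cell_dim_def
  by (rule geo_dim_isometry)
    (use chart_point assms face_chart[OF assms(2) sub_face[OF assms]] in blast)+

lemma cell_dim_nonneg: "c \<in> cells K \<Longrightarrow> 0 \<le> cell_dim G K c"
  unfolding cell_dim_def by (rule geo_polytope_dim_nonneg[OF chart_polytope]) (simp_all add: cell_ne)

lemma cell_dim_less:
  assumes "b \<in> cells K" "c \<in> cells K" "b \<subset> c" shows "cell_dim G K b < cell_dim G K c"
proof -
  have bc: "b \<subseteq> c" using assms(3) by blast
  have "chart K c ` b \<noteq> chart K c ` c" using inj_on_image_eq_iff[OF chart_inj[OF assms(2)] bc order_refl] assms(3) by blast
  then have "geo_dim G (chart K c ` b) < geo_dim G (chart K c ` c)"
    using sub_face[OF assms(1,2) bc] bc cell_ne[OF assms(1)]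
    by (intro geo_face_dim_less chart_polytope assms(2)) (auto simp: cell_face_def)
  then show ?thesis using sub_dim[OF assms(1,2) bc] by (simp add: cell_dim_def)
qed

lemma cell_dim_pred:
  assumes c: "c \<in> cells K" and d: "0 < cell_dim G K c"
  shows "\<exists>b\<in>cells K. b \<subset> c \<and> cell_dim G K b = cell_dim G K c - 1"
proof -
  obtain F where F: "geo_face G F (chart K c ` c)" "F \<noteq> {}" "F \<subseteq> chart K c ` c" "F \<noteq> chart K c ` c"
    "geo_dim G F = geo_dim G (chart K c ` c) - 1"
    using geo_polytope_facet[OF chart_polytope[OF c]] d cell_ne[OF c] by (auto simp: cell_dim_def)
  define b where "b = {x \<in> c. chart K c x \<in> F}"
  have img: "chart K c ` b = F" using F(3) by (auto simp: b_def)
  have bc: "b \<subseteq> c" by (simp add: b_def)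
  have "cell_face G K b c" unfolding cell_face_def using img bc F(1,2) by auto
  then have b: "b \<in> cells K" by (rule face_in_cells[OF c])
  have "b \<noteq> c" using img F(4) by blast
  then show ?thesis using b bc sub_dim[OF b c bc] img F(5) by (auto simp: cell_dim_def)
qed

end

section \<open>The weak topology\<close>

lemma topspace_complex_topology: "topspace (complex_topology K) = polyhedron_of K"
proof
  show "topspace (complex_topology K) \<subseteq> polyhedron_of K"
    using openin_topspace[of "complex_topology K"] unfolding openin_complex_topology by blast
  have "openin (complex_topology K) (polyhedron_of K)"
    unfolding openin_complex_topology
  proof (intro conjI ballI)
    fix b assume "b \<in> cells K"
    then have "polyhedron_of K \<inter> b = {x \<in> b. chart K b x \<in> UNIV}" by (auto simp: polyhedron_of_def)
    then show "\<exists>W. open W \<and> polyhedron_of K \<inter> b = {x \<in> b. chart K b x \<in> W}" by blast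
  qed simp
  then show "polyhedron_of K \<subseteq> topspace (complex_topology K)" by (rule openin_subset)
qed

lemma cell_connectedin:
  assumes c: "c \<in> cells K" and P: "geo_polytope G (chart K c ` c)"
  shows "connectedin (complex_topology K) c"
  unfolding connectedin
proof (intro conjI notI)
  show "c \<subseteq> topspace (complex_topology K)" using c by (auto simp: topspace_complex_topology polyhedron_of_def)
  assume "\<exists>E1 E2. openin (complex_topology K) E1 \<and> openin (complex_topology K) E2 \<and>
      c \<subseteq> E1 \<union> E2 \<and> E1 \<inter> E2 \<inter> c = {} \<and> E1 \<inter> c \<noteq> {} \<and> E2 \<inter> c \<noteq> {}"
  then obtain E1 E2 where E: "openin (complex_topology K) E1" "openin (complex_topology K) E2"
    "c \<subseteq> E1 \<union> E2" "E1 \<inter> E2 \<inter> c = {}" "E1 \<inter> c \<noteq> {}" "E2 \<inter> c \<noteq> {}" by metis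
  obtain W1 where W1: "open W1" "E1 \<inter> c = {x \<in> c. chart K c x \<in> W1}"
    using E(1) c unfolding openin_complex_topology by blast
  obtain W2 where W2: "open W2" "E2 \<inter> c = {x \<in> c. chart K c x \<in> W2}"
    using E(2) c unfolding openin_complex_topology by blast
  have "connected (chart K c ` c)" by (rule geo_polytope_compact_connected(2)[OF P])
  moreover have "chart K c ` c \<subseteq> W1 \<union> W2" using E(3) W1(2) W2(2) by blast
  moreover have "W1 \<inter> W2 \<inter> chart K c ` c = {}" using E(4) W1(2) W2(2) by blast
  moreover have "W1 \<inter> chart K c ` c \<noteq> {}" "W2 \<inter> chart K c ` c \<noteq> {}" using E(5,6) W1(2) W2(2) by blast+
  ultimately show False using W1(1) W2(1) unfolding connected_def by blast
qed

lemma openin_cell_saturated: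
  assumes "U \<subseteq> polyhedron_of K" "\<And>c. c \<in> cells K \<Longrightarrow> U \<inter> c = {} \<or> c \<subseteq> U"
  shows "openin (complex_topology K) U"
  unfolding openin_complex_topology
proof (intro conjI ballI assms(1))
  fix c assume "c \<in> cells K"
  then consider "U \<inter> c = {x \<in> c. chart K c x \<in> {}}" | "U \<inter> c = {x \<in> c. chart K c x \<in> UNIV}" using assms(2) by blast
  then show "\<exists>W. open W \<and> U \<inter> c = {x \<in> c. chart K c x \<in> W}" by cases blast+
qed

section \<open>Subdivisions of a simplex\<close>

lemma convex_of_isometry:
  fixes k :: "'a::euclidean_space \<Rightarrow> 'e::euclidean_space"
  assumes k: "convex (k ` c)" and d: "\<And>x y. x \<in> c \<Longrightarrow> y \<in> c \<Longrightarrow> dist (k x) (k y) = dist x y"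
  shows "convex c"
proof (rule convexI)
  fix x y and u v :: real assume xy: "x \<in> c" "y \<in> c" and uv: "0 \<le> u" "0 \<le> v" "u + v = 1"
  have "u *\<^sub>R k x + v *\<^sub>R k y \<in> k ` c" using convexD[OF k _ _ uv] xy by blast
  \<comment> \<open>The candidate is the point whose chart is the convex combination of the charts;
    its distances to \<open>x\<close> and \<open>y\<close> already determine it.\<close>
  then obtain w where w: "w \<in> c" "k w = u *\<^sub>R k x + v *\<^sub>R k y" by (metis imageE)
  have u: "u = 1 - v" using uv by simp
  have "k w - k x = v *\<^sub>R (k y - k x)" "k w - k y = u *\<^sub>R (k x - k y)"
    unfolding w(2) using uv(3) by (simp_all add: u algebra_simps)
  then have "dist (k w) (k x) = v * dist (k x) (k y)" "dist (k w) (k y) = u * dist (k x) (k y)"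
    using uv by (simp_all add: dist_norm norm_minus_commute)
  then have dw: "dist w x = v * dist x y" "dist w y = u * dist x y" using d xy w(1) by simp_all
  \<comment> \<open>Stewart's identity\<close>
  have "(norm (w - (u *\<^sub>R x + v *\<^sub>R y)))\<^sup>2 = u * (dist w x)\<^sup>2 + v * (dist w y)\<^sup>2 - u * v * (dist x y)\<^sup>2"
    unfolding dist_norm power2_norm_eq_inner u by (simp add: inner_diff_left inner_diff_right inner_add_left inner_add_right inner_commute algebra_simps)
  also have "\<dots> = 0" unfolding dw u by (simp add: power2_eq_square algebra_simps)
  finally show "u *\<^sub>R x + v *\<^sub>R y \<in> c" using w(1) by simp
qed

lemma compact_of_isometry:
  fixes k :: "'p \<Rightarrow> 'e::euclidean_space" and f :: "'p \<Rightarrow> 'a::euclidean_space"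
  assumes k: "compact (k ` c)" and d: "\<And>x y. x \<in> c \<Longrightarrow> y \<in> c \<Longrightarrow> dist (f x) (f y) = dist (k x) (k y)"
  shows "compact (f ` c)"
proof -
  define j where "j = inv_into c k"
  have j: "j p \<in> c" "k (j p) = p" if "p \<in> k ` c" for p
    using that by (simp_all add: j_def inv_into_into f_inv_into_f)
  have "dist (f (j p)) (f (j q)) = dist p q" if "p \<in> k ` c" "q \<in> k ` c" for p q
    using d[OF j(1)[OF that(1)] j(1)[OF that(2)]] j(2)[OF that(1)] j(2)[OF that(2)] by simp
  then have "continuous_on (k ` c) (\<lambda>p. f (j p))" unfolding continuous_on_iff by metis
  then have "compact ((\<lambda>p. f (j p)) ` k ` c)" using k by (rule compact_continuous_image)
  moreover have "f (j (k x)) = f x" if "x \<in> c" for x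
    using d[OF j(1) that, of "k x"] j(2)[of "k x"] that by simp
  then have "(\<lambda>p. f (j p)) ` k ` c = f ` c" by (simp add: image_image)
  ultimately show ?thesis by simp
qed

text \<open>A cell of \<open>L\<close> is a subset of \<open>S\<close> whose polytope is given by an
  isometric chart; its convexity, closedness and dimension as a subset of \<open>S\<close> are
  recovered through that isometry.\<close>

locale simplex_subdivision =
  fixes S :: "'e::euclidean_space set" and m :: nat and L :: "('e, 'e) pcomplex"
  assumes simplex: "(int m) simplex S"
    and sub: "subdivision Euclidean L (geo_complex {F. F face_of S \<and> F \<noteq> {}})"
begin

sublocale polytopal Euclidean L
  by standard (use sub in \<open>simp add: subdivision_def\<close>)

lemma S_dim: "aff_dim S = int m" by (rule aff_dim_simplex[OF simplex])

lemma S_convex: "convex S" by (rule convex_simplex[OF simplex])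

lemma cells_union: "\<Union>(cells L) = S"
proof -
  have "S \<noteq> {}" using S_dim by auto
  then have "S \<in> {F. F face_of S \<and> F \<noteq> {}}" using S_convex by (simp add: face_of_refl)
  moreover have "F \<subseteq> S" if "F \<in> {F. F face_of S \<and> F \<noteq> {}}" for F using that face_of_imp_subset by blast
  ultimately have "\<Union>{F. F face_of S \<and> F \<noteq> {}} = S" by blast
  then show ?thesis using sub by (simp add: subdivision_def polyhedron_of_def geo_complex_def)
qed

lemma cell_isometry:
  assumes "c \<in> cells L" "x \<in> c" "y \<in> c" shows "dist (chart L c x) (chart L c y) = dist x y"
  using assms sub by (auto simp: subdivision_def geo_complex_def)

lemma cell_convex: "c \<in> cells L \<Longrightarrow> convex c"
  using convex_of_isometry[OF polytope_imp_convex cell_isometry] chart_polytope[of c] by simp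

lemma cell_closed:
  assumes c: "c \<in> cells L" shows "closed c"
proof -
  have "compact (chart L c ` c)" using chart_polytope[OF c] polytope_imp_compact by simp
  then have "compact ((\<lambda>x. x) ` c)" by (rule compact_of_isometry) (simp add: cell_isometry[OF c])
  then show ?thesis by (simp add: compact_imp_closed)
qed

lemma cell_aff_dim: "c \<in> cells L \<Longrightarrow> cell_dim Euclidean L c = aff_dim c"
  using aff_dim_eq_of_dist_eq[where f = "chart L c" and k = "\<lambda>x. x"] cell_isometry by (simp add: cell_dim_def)

lemma cell_dim_le: "c \<in> cells L \<Longrightarrow> cell_dim Euclidean L c \<le> int m"
  using cell_aff_dim[of c] aff_dim_subset[of c S] cells_union S_dim by auto

text \<open>A point missed by the closed union of the full cells would have a neighbourhood in
  \<open>S\<close> covered by finitely many cells of smaller dimension, which general position rules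
  out.\<close>

lemma full_cell:
  assumes z: "z \<in> S" obtains c where "c \<in> cells L" "z \<in> c" "cell_dim Euclidean L c = int m"
proof -
  define Q where "Q = \<Union>{c \<in> cells L. cell_dim Euclidean L c = int m}"
  have "closed Q" unfolding Q_def using fin_cells cell_closed by (intro closed_Union) auto
  have "z \<in> Q"
  proof (rule ccontr)
    assume "z \<notin> Q"
    then have "open (- Q)" "z \<in> - Q" using \<open>closed Q\<close> by auto
    then have ne: "S \<inter> - Q \<noteq> {}" using z by blast
    obtain \<delta> where \<delta>: "0 < \<delta>" "ball z \<delta> \<subseteq> - Q" using \<open>open (- Q)\<close> \<open>z \<in> - Q\<close> openE by blast
    have ad: "aff_dim (S \<inter> ball z \<delta>) = int m"
      using aff_dim_convex_Int_open[OF S_convex open_ball, of z \<delta>] z \<delta>(1) S_dim by (metis IntI centre_in_ball empty_iff)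
    have "\<exists>y\<in>S \<inter> ball z \<delta>. \<forall>M\<in>{c \<in> cells L. cell_dim Euclidean L c < int m}. y \<notin> affine hull M"
    proof (rule convex_not_covered_dim)
      show "finite {c \<in> cells L. cell_dim Euclidean L c < int m}" using fin_cells by simp
      show "convex (S \<inter> ball z \<delta>)" using S_convex by (simp add: convex_Int)
      show "S \<inter> ball z \<delta> \<noteq> {}" using z \<delta>(1) by (metis IntI centre_in_ball empty_iff)
      show "aff_dim M < aff_dim (S \<inter> ball z \<delta>)" if "M \<in> {c \<in> cells L. cell_dim Euclidean L c < int m}" for M
        using that cell_aff_dim[of M] ad by simp
    qed
    then obtain y where y: "y \<in> S" "y \<in> ball z \<delta>" "\<And>M. M \<in> cells L \<Longrightarrow> cell_dim Euclidean L M < int m \<Longrightarrow> y \<notin> affine hull M"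
      by auto
    obtain c where c: "c \<in> cells L" "y \<in> c" using y(1) cells_union by blast
    then have "cell_dim Euclidean L c = int m" using y(3)[OF c(1)] cell_dim_le[OF c(1)] hull_inc[OF c(2)] by fastforce
    then have "y \<in> Q" using c by (auto simp: Q_def)
    then show False using y(2) \<delta>(2) by blast
  qed
  then show ?thesis using that by (auto simp: Q_def)
qed

text \<open>Near a point \<open>y\<close> of \<open>g\<close> that lies in no proper face of
  \<open>g\<close>, the full cells containing \<open>g\<close> cover a convex neighbourhood
  \<open>U\<close> of \<open>y\<close> in \<open>S\<close>, and
  \<open>convex_cover_connected\<close> applies there.\<close>

lemma full_cells_connected:
  assumes g: "g \<in> cells L" and a: "a \<in> cells L" "cell_dim Euclidean L a = int m" "g \<subseteq> a"
    and b: "b \<in> cells L" "cell_dim Euclidean L b = int m" "g \<subseteq> b"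
  shows "(a, b) \<in> {(a, b). (a \<in> cells L \<and> cell_dim Euclidean L a = int m \<and> g \<subseteq> a) \<and>
    (b \<in> cells L \<and> cell_dim Euclidean L b = int m \<and> g \<subseteq> b) \<and>
    (\<exists>e\<in>cells L. e \<subseteq> a \<and> e \<subseteq> b \<and> int m - 1 \<le> cell_dim Euclidean L e)}\<^sup>*" (is "_ \<in> ?R\<^sup>*")
proof -
  have "\<exists>y\<in>g. \<forall>M\<in>{c \<in> cells L. c \<subset> g}. y \<notin> affine hull M"
  proof (rule convex_not_covered_dim)
    show "aff_dim M < aff_dim g" if "M \<in> {c \<in> cells L. c \<subset> g}" for M
      using that cell_dim_less[of M g] g cell_aff_dim by simp
  qed (use fin_cells cell_convex[OF g] cell_ne[OF g] in auto)
  then obtain y where y: "y \<in> g" "\<And>M. M \<in> cells L \<Longrightarrow> M \<subset> g \<Longrightarrow> y \<notin> affine hull M" by auto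
  have gc: "g \<subseteq> c" if c: "c \<in> cells L" "y \<in> c" for c
  proof (rule ccontr)
    assume "\<not> g \<subseteq> c"
    then have "g \<inter> c \<subset> g" by blast
    moreover have "g \<inter> c \<in> cells L" using inter_cell[OF g c(1)] y(1) c(2) by blast
    ultimately show False using y hull_inc[of y "g \<inter> c" affine] c(2) by blast
  qed
  define Q where "Q = \<Union>{c \<in> cells L. y \<notin> c}"
  have "closed Q" unfolding Q_def using fin_cells cell_closed by (intro closed_Union) auto
  moreover have "y \<notin> Q" by (auto simp: Q_def)
  ultimately obtain \<epsilon> where \<epsilon>: "0 < \<epsilon>" "ball y \<epsilon> \<subseteq> - Q" using openE[of "- Q" y] by (auto simp: open_Compl)
  define U where "U = S \<inter> ball y \<epsilon>"
  define I where "I = {c \<in> cells L. cell_dim Euclidean L c = int m \<and> y \<in> c}"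
  have yS: "y \<in> S" using y(1) g cells_union by blast
  have dU: "aff_dim U = int m" unfolding U_def
    using aff_dim_convex_Int_open[OF S_convex open_ball, of y \<epsilon>] yS \<epsilon>(1) S_dim by (metis IntI centre_in_ball empty_iff)
  have "(a, b) \<in> {(a, b). a \<in> I \<and> b \<in> I \<and> aff_dim U - 1 \<le> aff_dim (a \<inter> b \<inter> U)}\<^sup>*"
  proof (rule convex_cover_connected)
    show "finite I" using fin_cells by (simp add: I_def)
    show "convex U" using S_convex by (simp add: U_def convex_Int)
    show "closed i" "convex i" if "i \<in> I" for i using that cell_closed cell_convex by (auto simp: I_def)
    show "U \<subseteq> (\<Union>i\<in>I. i)"
    proof
      fix z assume z: "z \<in> U"
      then obtain c where c: "c \<in> cells L" "z \<in> c" "cell_dim Euclidean L c = int m" using full_cell by (auto simp: U_def)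
      have "y \<in> c"
      proof (rule ccontr)
        assume "y \<notin> c"
        then have "z \<in> Q" using c by (auto simp: Q_def)
        then show False using z \<epsilon>(2) by (auto simp: U_def)
      qed
      then show "z \<in> (\<Union>i\<in>I. i)" using c by (auto simp: I_def)
    qed
    show "aff_dim (i \<inter> U) = aff_dim U" if i: "i \<in> I" for i
    proof -
      have iL: "i \<in> cells L" "y \<in> i" "aff_dim i = int m" using i cell_aff_dim by (auto simp: I_def)
      have "i \<inter> U = i \<inter> ball y \<epsilon>" using iL(1) cells_union by (auto simp: U_def)
      moreover have "i \<inter> ball y \<epsilon> \<noteq> {}" using iL(2) \<epsilon>(1) by (metis IntI centre_in_ball empty_iff)
      ultimately show ?thesis using aff_dim_convex_Int_open[OF cell_convex[OF iL(1)] open_ball, of y \<epsilon>] iL(3) dU by simp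
    qed
    show "a \<in> I" "b \<in> I" using a b y(1) by (auto simp: I_def)
  qed
  moreover have "{(a, b). a \<in> I \<and> b \<in> I \<and> aff_dim U - 1 \<le> aff_dim (a \<inter> b \<inter> U)} \<subseteq> ?R"
  proof clarify
    fix a b assume a: "a \<in> I" and b: "b \<in> I" and ad: "aff_dim U - 1 \<le> aff_dim (a \<inter> b \<inter> U)"
    have aL: "a \<in> cells L" "cell_dim Euclidean L a = int m" "y \<in> a" and bL: "b \<in> cells L" "cell_dim Euclidean L b = int m" "y \<in> b"
      using a b by (auto simp: I_def)
    have ab: "a \<inter> b \<in> cells L" using inter_cell[OF aL(1) bL(1)] aL(3) bL(3) by blast
    have "int m - 1 \<le> cell_dim Euclidean L (a \<inter> b)"
      using ad dU aff_dim_subset[OF Int_lower1[of "a \<inter> b" U]] cell_aff_dim[OF ab] by simp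
    then show "(a \<in> cells L \<and> cell_dim Euclidean L a = int m \<and> g \<subseteq> a) \<and>
      (b \<in> cells L \<and> cell_dim Euclidean L b = int m \<and> g \<subseteq> b) \<and>
      (\<exists>e\<in>cells L. e \<subseteq> a \<and> e \<subseteq> b \<and> int m - 1 \<le> cell_dim Euclidean L e)"
      using aL bL ab gc by blast
  qed
  ultimately show ?thesis by (rule set_mp[OF rtrancl_mono, rotated])
qed

end

text \<open>The conclusions mention only the order of the cells and their dimensions, and
  \<open>rank_unique\<close> carries the latter along the combinatorial equivalence.\<close>

lemma PL_ball_subdivision:
  assumes S: "(int m) simplex S"
    and PL: "PL_homeomorphic G X Euclidean (geo_complex {F. F face_of S \<and> F \<noteq> {}})"
  obtains K' where "subdivision G K' X" "\<And>c. c \<in> cells K' \<Longrightarrow> cell_dim G K' c \<le> int m"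
    "\<exists>c\<in>cells K'. cell_dim G K' c = int m"
    "\<And>g a b. \<lbrakk>g \<in> cells K'; a \<in> cells K'; cell_dim G K' a = int m; g \<subseteq> a; b \<in> cells K'; cell_dim G K' b = int m; g \<subseteq> b\<rbrakk> \<Longrightarrow>
      (a, b) \<in> {(a, b). (a \<in> cells K' \<and> cell_dim G K' a = int m \<and> g \<subseteq> a) \<and>
        (b \<in> cells K' \<and> cell_dim G K' b = int m \<and> g \<subseteq> b) \<and>
        (\<exists>e\<in>cells K'. e \<subseteq> a \<and> e \<subseteq> b \<and> int m - 1 \<le> cell_dim G K' e)}\<^sup>*"
proof -
  obtain K' L where KL: "subdivision G K' X" "subdivision Euclidean L (geo_complex {F. F face_of S \<and> F \<noteq> {}})"
    "combinatorially_equivalent (cells K') (cells L)" using PL unfolding PL_homeomorphic_def by metis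
  interpret L: simplex_subdivision S m L by standard (rule S, rule KL(2))
  interpret K': polytopal G K' by standard (use KL(1) in \<open>simp add: subdivision_def\<close>)
  obtain \<phi> where \<phi>: "bij_betw \<phi> (cells K') (cells L)"
    and ord: "\<And>c c'. c \<in> cells K' \<Longrightarrow> c' \<in> cells K' \<Longrightarrow> c \<subseteq> c' \<longleftrightarrow> \<phi> c \<subseteq> \<phi> c'"
    using KL(3) by (auto simp: combinatorially_equivalent_def)
  have dim\<phi>: "cell_dim Euclidean L (\<phi> c) = cell_dim G K' c" if "c \<in> cells K'" for c
    by (rule rank_unique[OF \<phi> ord, where d = "cell_dim G K'" and d' = "cell_dim Euclidean L"])
      (simp_all add: that K'.cell_dim_nonneg K'.cell_dim_less K'.cell_dim_pred L.cell_dim_nonneg L.cell_dim_less L.cell_dim_pred)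
  define \<psi> where "\<psi> = inv_into (cells K') \<phi>"
  have \<phi>L: "\<phi> c \<in> cells L" "\<psi> (\<phi> c) = c" if "c \<in> cells K'" for c
    using that bij_betw_inv_into_left[OF \<phi>] bij_betwE[OF \<phi>] by (simp_all add: \<psi>_def)
  have \<psi>K: "\<psi> c \<in> cells K'" "\<phi> (\<psi> c) = c" if "c \<in> cells L" for c
    using that bij_betw_inv_into_right[OF \<phi>] bij_betwE[OF bij_betw_inv_into[OF \<phi>]] by (simp_all add: \<psi>_def)
  show ?thesis
  proof (rule that[OF KL(1)])
    show "cell_dim G K' c \<le> int m" if "c \<in> cells K'" for c
      using dim\<phi>[OF that] L.cell_dim_le[OF \<phi>L(1)[OF that]] by simp
    have "S \<noteq> {}" using L.S_dim by auto
    then obtain c where "c \<in> cells L" "cell_dim Euclidean L c = int m" using L.full_cell by blast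
    then show "\<exists>c\<in>cells K'. cell_dim G K' c = int m" using \<psi>K dim\<phi> by metis
    fix g a b assume g: "g \<in> cells K'" and a: "a \<in> cells K'" "cell_dim G K' a = int m" "g \<subseteq> a"
      and b: "b \<in> cells K'" "cell_dim G K' b = int m" "g \<subseteq> b"
    let ?R = "{(a, b). (a \<in> cells L \<and> cell_dim Euclidean L a = int m \<and> \<phi> g \<subseteq> a) \<and>
      (b \<in> cells L \<and> cell_dim Euclidean L b = int m \<and> \<phi> g \<subseteq> b) \<and>
      (\<exists>e\<in>cells L. e \<subseteq> a \<and> e \<subseteq> b \<and> int m - 1 \<le> cell_dim Euclidean L e)}"
    let ?R' = "{(a, b). (a \<in> cells K' \<and> cell_dim G K' a = int m \<and> g \<subseteq> a) \<and>
        (b \<in> cells K' \<and> cell_dim G K' b = int m \<and> g \<subseteq> b) \<and>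
        (\<exists>e\<in>cells K'. e \<subseteq> a \<and> e \<subseteq> b \<and> int m - 1 \<le> cell_dim G K' e)}"
    have step: "(\<psi> x, \<psi> y) \<in> ?R'" if xy: "(x, y) \<in> ?R" for x y
    proof -
      have x: "x \<in> cells L" "cell_dim Euclidean L x = int m" "\<phi> g \<subseteq> x"
        and y: "y \<in> cells L" "cell_dim Euclidean L y = int m" "\<phi> g \<subseteq> y" using xy by auto
      obtain e where e: "e \<in> cells L" "e \<subseteq> x" "e \<subseteq> y" "int m - 1 \<le> cell_dim Euclidean L e" using xy by auto
      have sub: "\<psi> p \<subseteq> \<psi> q" if "p \<in> cells L" "q \<in> cells L" "p \<subseteq> q" for p q
        using ord[OF \<psi>K(1)[OF that(1)] \<psi>K(1)[OF that(2)]] \<psi>K(2)[OF that(1)] \<psi>K(2)[OF that(2)] that(3) by simp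
      have dim\<psi>: "cell_dim G K' (\<psi> p) = cell_dim Euclidean L p" if "p \<in> cells L" for p
        using dim\<phi>[OF \<psi>K(1)[OF that]] \<psi>K(2)[OF that] by simp
      have "g \<subseteq> \<psi> x" "g \<subseteq> \<psi> y" using sub[OF \<phi>L(1)[OF g]] x y \<phi>L(2)[OF g] by simp_all
      moreover have "\<exists>e\<in>cells K'. e \<subseteq> \<psi> x \<and> e \<subseteq> \<psi> y \<and> int m - 1 \<le> cell_dim G K' e"
        using sub[OF e(1) x(1) e(2)] sub[OF e(1) y(1) e(3)] \<psi>K(1)[OF e(1)] dim\<psi>[OF e(1)] e(4) by (intro bexI[of _ "\<psi> e"]) auto
      ultimately show ?thesis using \<psi>K(1)[OF x(1)] \<psi>K(1)[OF y(1)] dim\<psi>[OF x(1)] dim\<psi>[OF y(1)] x(2) y(2) by simp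
    qed
    have "(\<phi> a, \<phi> b) \<in> ?R\<^sup>*"
      using L.full_cells_connected[OF \<phi>L(1)[OF g] \<phi>L(1)[OF a(1)] _ _ \<phi>L(1)[OF b(1)]] dim\<phi>[OF a(1)] dim\<phi>[OF b(1)]
        ord[OF g a(1)] ord[OF g b(1)] a b by simp
    then have "(\<psi> (\<phi> a), \<psi> (\<phi> b)) \<in> ?R'\<^sup>*"
    proof (induction rule: rtrancl_induct)
      case (step y z)
      then show ?case using \<open>\<And>x y. (x, y) \<in> ?R \<Longrightarrow> (\<psi> x, \<psi> y) \<in> ?R'\<close>[OF step(2)] by (rule_tac rtrancl_into_rtrancl)
    qed simp
    then show "(a, b) \<in> ?R'\<^sup>*" using \<phi>L(2)[OF a(1)] \<phi>L(2)[OF b(1)] by simp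
  qed
qed

section \<open>Immersed complexes\<close>

locale immersed = geo_lift G l for G and l :: "'a::euclidean_space \<Rightarrow> 'w::euclidean_space" +
  fixes K :: "('p, 'e::euclidean_space) pcomplex" and f :: "'p \<Rightarrow> 'a"
  assumes precomplex: "precomplex G K f"
begin

sublocale polytopal G K
  by standard (use precomplex in \<open>simp add: precomplex_def\<close>)

definition "h p = l (f p)"

lemma star_cells: "c \<in> cells (star K \<sigma>) \<longleftrightarrow> c \<in> cells K \<and> (\<exists>c'\<in>cells K. \<sigma> \<subseteq> c' \<and> c \<subseteq> c')"
  by (auto simp: star_def generated_subcomplex_def)

lemma chart_star [simp]: "chart (star K \<sigma>) = chart K"
  by (simp add: star_def generated_subcomplex_def)

lemma f_isometry:
  "\<lbrakk>c \<in> cells K; x \<in> c; y \<in> c\<rbrakk> \<Longrightarrow> geo_dist G (f x) (f y) = geo_dist G (chart K c x) (chart K c y)"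
  using precomplex unfolding precomplex_def by blast

lemma image_polytopal:
  assumes "c \<in> cells K" shows "polytopal G (geo_complex ((`) f ` cells (star K c)))"
  using assms precomplex by unfold_locales (simp add: precomplex_def geometric_polytopal_complex_def)

lemma image_polytope:
  assumes c: "c \<in> cells K" shows "geo_polytope G (f ` c)"
proof -
  have "c \<in> cells (star K c)" using c by (auto simp: star_cells)
  then have "f ` c \<in> cells (geo_complex ((`) f ` cells (star K c)))" by (simp add: geo_complex_def)
  from polytopal.chart_polytope[OF image_polytopal[OF c] this] show ?thesis by (simp add: geo_complex_def)
qed

lemma f_point: "c \<in> cells K \<Longrightarrow> x \<in> c \<Longrightarrow> geo_point G (f x)"
  using geo_polytope_point[OF image_polytope] by blast

lemma f_dist:
  assumes "c \<in> cells K" "x \<in> c" "y \<in> c" shows "dist (f x) (f y) = dist (chart K c x) (chart K c y)"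
  by (rule geo_dist_eq_iff(1)[OF _ _ _ _ f_isometry[OF assms]]) (use f_point chart_point assms in blast)+

lemma f_inj:
  assumes c: "c \<in> cells K" shows "inj_on f c"
proof (rule inj_onI)
  fix x y assume xy: "x \<in> c" "y \<in> c" "f x = f y"
  then have "chart K c x = chart K c y" using f_dist[OF c xy(1,2)] by simp
  then show "x = y" using inj_onD[OF chart_inj[OF c]] xy by blast
qed

lemma image_subset:
  assumes "\<sigma> \<in> cells K" "b \<in> cells (star K \<sigma>)" "c \<in> cells (star K \<sigma>)" "f ` b \<subseteq> f ` c"
  shows "b \<subseteq> c"
proof (rule order_iso_image[of "cells (star K \<sigma>)" "(`) f", OF _ image_mono _ assms(2-4)])
  show "finite (cells (star K \<sigma>))" using fin_cells by (rule rev_finite_subset) (auto simp: star_cells)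
  show "combinatorially_equivalent (cells (star K \<sigma>)) ((`) f ` cells (star K \<sigma>))"
    using precomplex assms(1) unfolding precomplex_def by blast
qed

text \<open>The image of the star of \<open>c\<close> is a complex and so contains the face as the
  image of some cell; \<open>image_subset\<close> shows that this cell lies in
  \<open>c\<close>.\<close>

lemma image_face:
  assumes c: "c \<in> cells K" and F: "geo_face G F (f ` c)" "F \<noteq> {}" "F \<subseteq> f ` c"
  shows "{x \<in> c. f x \<in> F} \<in> cells K"
proof -
  have cs: "c \<in> cells (star K c)" using c by (auto simp: star_cells)
  have "f ` c \<in> cells (geo_complex ((`) f ` cells (star K c)))" using cs by (auto simp: geo_complex_def)
  then have "F \<in> cells (geo_complex ((`) f ` cells (star K c)))"
    by (rule polytopal.face_in_cells[OF image_polytopal[OF c]]) (use F in \<open>auto simp: cell_face_def geo_complex_def\<close>)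
  then obtain b where b: "b \<in> cells (star K c)" "F = f ` b" by (auto simp: geo_complex_def)
  then have bc: "b \<subseteq> c" using image_subset[OF c b(1) cs] F(3) by blast
  have "x \<in> b" if "x \<in> c" "f x \<in> f ` b" for x
    using inj_on_image_mem_iff[OF f_inj[OF c] that(1) bc] that(2) by simp
  then have "{x \<in> c. f x \<in> F} = b" using bc b(2) by blast
  then show ?thesis using b(1) by (simp add: star_cells)
qed

lemma sub_image_face:
  assumes "b \<in> cells K" "c \<in> cells K" "b \<subseteq> c" shows "geo_face G (f ` b) (f ` c)"
proof -
  have "b \<in> cells (star K c)" "c \<in> cells (star K c)" using assms by (auto simp: star_cells)
  then have "f ` b \<in> cells (geo_complex ((`) f ` cells (star K c)))" "f ` c \<in> cells (geo_complex ((`) f ` cells (star K c)))"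
    by (simp_all add: geo_complex_def)
  from polytopal.sub_face[OF image_polytopal[OF assms(2)] this image_mono[OF assms(3)]]
  show ?thesis by (simp add: cell_face_def geo_complex_def)
qed

lemma cn_h: "cn h c = conic hull (l ` f ` c)"
  by (simp add: cn_def h_def image_image)

sublocale cell_cones "cells K" h
proof
  show "finite (cells K)" by (rule fin_cells)
  show "c \<noteq> {}" if "c \<in> cells K" for c using that by (rule cell_ne)
  show "pcone (cn h c)" "\<exists>u. \<forall>x\<in>c. 0 < u \<bullet> h x" if "c \<in> cells K" for c
    using lift_pcone[OF image_polytope[OF that]] cell_ne[OF that] by (auto simp: cn_h h_def)
  show "x = y" if "c \<in> cells K" "x \<in> c" "y \<in> c" "0 < t" "h x = t *\<^sub>R h y" for c x y t
    using lift_rays[OF f_point[OF that(1,2)] f_point[OF that(1,3)] that(4)] that(5) inj_onD[OF f_inj[OF that(1)]] that(2,3)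
    by (simp add: h_def)
  show "{x \<in> c. m \<bullet> h x = 0} \<in> cells K"
    if c: "c \<in> cells K" and m: "\<forall>x\<in>c. m \<bullet> h x \<le> 0" "\<exists>x\<in>c. m \<bullet> h x = 0" for c m
  proof -
    have "geo_face G {p \<in> f ` c. m \<bullet> l p = 0} (f ` c)"
      by (rule lift_face[OF image_polytope[OF c]]) (use m(1) in \<open>simp add: h_def\<close>)
    then have "{x \<in> c. f x \<in> {p \<in> f ` c. m \<bullet> l p = 0}} \<in> cells K"
      by (rule image_face[OF c]) (use m(2) in \<open>auto simp: h_def\<close>)
    moreover have "{x \<in> c. f x \<in> {p \<in> f ` c. m \<bullet> l p = 0}} = {x \<in> c. m \<bullet> h x = 0}" by (auto simp: h_def)
    ultimately show ?thesis by simp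
  qed
  show "\<exists>m. (\<forall>x\<in>c. m \<bullet> h x \<le> 0) \<and> b = {x \<in> c. m \<bullet> h x = 0}"
    if c: "c \<in> cells K" and b: "b \<in> cells K" "b \<subseteq> c" for b c
  proof -
    obtain m where m: "\<forall>p\<in>f ` c. m \<bullet> l p \<le> 0" "f ` b = {p \<in> f ` c. m \<bullet> l p = 0}"
      using face_lift[OF image_polytope[OF c] sub_image_face[OF b(1) c b(2)]] cell_ne[OF b(1)] by blast
    have "x \<in> b \<longleftrightarrow> m \<bullet> h x = 0" if x: "x \<in> c" for x
    proof -
      have "x \<in> b \<longleftrightarrow> f x \<in> f ` b" using inj_on_image_mem_iff[OF f_inj[OF c] x b(2)] by simp
      then show ?thesis unfolding m(2) using x by (simp add: h_def)
    qed
    then have "b = {x \<in> c. m \<bullet> h x = 0}" using b(2) by blast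
    then show ?thesis using m(1) by (intro exI[of _ m]) (simp add: h_def)
  qed
  show "c \<inter> c' \<in> cells K" if "c \<in> cells K" "c' \<in> cells K" "c \<inter> c' \<noteq> {}" for c c'
    using that by (rule inter_cell)
qed

lemma V_eq: "V = vertices K" and Fac_eq: "Fac = facets K"
  by (simp_all add: V_def vertices_def Fac_def facets_def)

lemma dim_C: "c \<in> cells K \<Longrightarrow> aff_dim (C c) = cell_dim G K c + 1"
  using lift_geo_dim[of "f ` c"] cell_ne[of c] geo_dim_isometry[of c G f "chart K c"] f_point chart_point f_isometry
  by (simp add: cn_h cell_dim_def)

text \<open>Stars and fattened boundary components are both generated subcomplexes, so one
  translation to functionals serves local convexity and the hypothesis on the boundary.\<close>

lemma generated_support:
  assumes cp: "convex_position G (generated_subcomplex K A) f" and s: "s \<in> A" "s \<in> Fac"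
  shows "\<exists>m. m \<noteq> 0 \<and> (\<forall>t\<in>A. t \<in> cells K \<longrightarrow> supp m s t)"
proof -
  let ?A = "generated_subcomplex K A"
  have cells: "c \<in> cells ?A \<longleftrightarrow> c \<in> cells K \<and> (\<exists>c'\<in>A. c \<subseteq> c')" for c by (simp add: generated_subcomplex_def)
  have "s \<in> facets ?A" using s FacK[OF s(2)] cells by (auto simp: facets_def Fac_def)
  then obtain H D where H: "closed_half G H D" "f ` polyhedron_of ?A \<subseteq> H" "\<And>v. v \<in> vertices ?A \<Longrightarrow> f v \<in> D \<longleftrightarrow> v \<in> s"
    using cp unfolding convex_position_def by metis
  obtain m where m: "m \<noteq> 0" "\<And>x. geo_point G x \<Longrightarrow> (x \<in> H \<longleftrightarrow> m \<bullet> l x \<le> 0) \<and> (x \<in> D \<longleftrightarrow> m \<bullet> l x = 0)"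
    using lift_half[OF H(1)] by blast
  have "supp m s t" if t: "t \<in> A" "t \<in> cells K" for t
    unfolding supp_def
  proof (intro conjI ballI)
    fix x assume x: "x \<in> t"
    then have "x \<in> polyhedron_of ?A" using t cells by (auto simp: polyhedron_of_def)
    then have "f x \<in> H" using H(2) by blast
    then show "m \<bullet> h x \<le> 0" using m(2)[OF f_point[OF t(2) x]] by (simp add: h_def)
  next
    fix w assume w: "w \<in> t \<inter> V"
    then have "w \<in> vertices ?A" using t cells by (auto simp: vertices_def V_def)
    then show "m \<bullet> h w = 0 \<longleftrightarrow> w \<in> s" using H(3) m(2)[OF f_point[OF t(2)]] w by (auto simp: h_def)
  qed
  then show ?thesis using m(1) by blast
qed

lemma generic_point:
  assumes g: "g \<in> cells K"
  obtains x where "x \<in> g" "\<And>c. c \<in> cells K \<Longrightarrow> x \<in> c \<Longrightarrow> g \<subseteq> c"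
proof -
  let ?M = "insert {0} (C ` {b \<in> cells K. b \<subset> g})"
  have "\<exists>y\<in>C g. \<forall>M\<in>?M. y \<notin> affine hull M"
  proof (rule convex_not_covered_dim)
    show "finite ?M" using fin_cells by simp
    show "convex (C g)" "C g \<noteq> {}" using pc[OF g] pcone_convex by (auto simp: pcone_def)
    fix M assume "M \<in> ?M"
    then show "aff_dim M < aff_dim (C g)" using C_dim_pos[OF g] C_dim_less[OF g] by auto
  qed
  then obtain y where y: "y \<in> C g" "y \<notin> affine hull {0}" "\<And>b. b \<in> cells K \<Longrightarrow> b \<subset> g \<Longrightarrow> y \<notin> affine hull (C b)" by auto
  obtain t x where t: "0 \<le> t" "x \<in> g" "y = t *\<^sub>R h x" using y(1) by (auto simp: cn_iff)
  have "g \<subseteq> c" if c: "c \<in> cells K" "x \<in> c" for c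
  proof (rule ccontr)
    assume "\<not> g \<subseteq> c"
    then have "g \<inter> c \<subset> g" by blast
    moreover have "g \<inter> c \<in> cells K" using inter_cell[OF g c(1)] c(2) t(2) by blast
    moreover have "y \<in> C (g \<inter> c)" using t c(2) unfolding cn_iff by blast
    ultimately show False using y(3)[of "g \<inter> c"] hull_inc[of y "C (g \<inter> c)" affine] by blast
  qed
  then show ?thesis using that t(2) by blast
qed

end

section \<open>Subdivided stars\<close>

locale star_subdivision = immersed G l K f
  for G and l :: "'a::euclidean_space \<Rightarrow> 'w::euclidean_space"
    and K :: "('p, 'e::euclidean_space) pcomplex" and f +
  fixes v :: 'p and K' :: "('p, 'e) pcomplex"
  assumes v: "v \<in> vertices K" and subd: "subdivision G K' (star K {v})"
begin

sublocale sub: polytopal G K'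
  by standard (use subd in \<open>simp add: subdivision_def\<close>)

lemma sub_cell:
  assumes "c' \<in> cells K'"
  obtains c where "c \<in> cells (star K {v})" "c' \<subseteq> c"
    "\<And>x y. x \<in> c' \<Longrightarrow> y \<in> c' \<Longrightarrow> geo_dist G (f x) (f y) = geo_dist G (chart K' c' x) (chart K' c' y)"
proof -
  obtain c where c: "c \<in> cells (star K {v})" "c' \<subseteq> c"
    "\<forall>x\<in>c'. \<forall>y\<in>c'. geo_dist G (chart K' c' x) (chart K' c' y) = geo_dist G (chart K c x) (chart K c y)"
    using subd assms unfolding subdivision_def by auto
  have cK: "c \<in> cells K" using c(1) by (simp add: star_cells)
  have "geo_dist G (f x) (f y) = geo_dist G (chart K' c' x) (chart K' c' y)" if "x \<in> c'" "y \<in> c'" for x y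
    using f_isometry[OF cK, of x y] c(2,3) that by auto
  then show ?thesis using that[OF c(1,2)] by blast
qed

lemma sub_in_facet:
  assumes "c' \<in> cells K'" obtains t where "t \<in> Fac" "v \<in> t" "c' \<subseteq> t"
proof -
  obtain c where c: "c \<in> cells (star K {v})" "c' \<subseteq> c" by (rule sub_cell[OF assms])
  then obtain c1 where c1: "c1 \<in> cells K" "v \<in> c1" "c \<subseteq> c1" by (auto simp: star_cells)
  obtain t where "t \<in> Fac" "c1 \<subseteq> t" by (rule Fac_exists[OF c1(1)])
  then show ?thesis using that[of t] c(2) c1(2,3) by blast
qed

lemma sub_f_point: "c' \<in> cells K' \<Longrightarrow> x \<in> c' \<Longrightarrow> geo_point G (f x)"
  using sub_in_facet f_point FacK by (metis subsetD)

lemma sub_dim_C: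
  assumes c': "c' \<in> cells K'" shows "aff_dim (C c') = cell_dim G K' c' + 1"
proof -
  have "geo_dim G (f ` c') = geo_dim G (chart K' c' ` c')"
  proof (rule geo_dim_isometry)
    show "geo_point G (f x) \<and> geo_point G (chart K' c' x)" if "x \<in> c'" for x
      using sub_f_point[OF c' that] sub.chart_point[OF c' that] by blast
    show "geo_dist G (f x) (f y) = geo_dist G (chart K' c' x) (chart K' c' y)" if "x \<in> c'" "y \<in> c'" for x y
      using sub_cell[OF c'] that by metis
  qed
  then show ?thesis using lift_geo_dim[of "f ` c'"] sub.cell_ne[OF c'] by (simp add: cn_h cell_dim_def)
qed

lemma sub_closed:
  assumes c': "c' \<in> cells K'" shows "closed (C c')"
proof -
  have "compact (f ` c')"
  proof (rule compact_of_isometry)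
    show "compact (chart K' c' ` c')" by (rule geo_polytope_compact_connected(1)[OF sub.chart_polytope[OF c']])
    show "dist (f x) (f y) = dist (chart K' c' x) (chart K' c' y)" if xy: "x \<in> c'" "y \<in> c'" for x y
    proof (rule geo_dist_eq_iff(1)[of G])
      show "geo_dist G (f x) (f y) = geo_dist G (chart K' c' x) (chart K' c' y)" using sub_cell[OF c'] xy by metis
    qed (use sub_f_point[OF c'] sub.chart_point[OF c'] xy in blast)+
  qed
  then have "compact (l ` f ` c')" by (rule compact_continuous_image[OF lift_cont])
  moreover have "0 \<notin> l ` f ` c'"
  proof
    assume "0 \<in> l ` f ` c'"
    then obtain x where x: "x \<in> c'" "h x = 0" by (auto simp: h_def)
    obtain t where "t \<in> Fac" "c' \<subseteq> t" by (rule sub_in_facet[OF c'])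
    then show False using h_nz[OF FacK, of t x] x by blast
  qed
  ultimately show ?thesis unfolding cn_h by (intro closed_conic_hull) blast
qed

text \<open>A point of \<open>C t\<close> near \<open>h x\<close>, in general position to the proper
  faces of \<open>t\<close> and to the subdivision cells of smaller dimension, lies in the cone of a
  subdivision cell of full dimension inside \<open>t\<close>. If the point is close enough, this
  closed cone contains \<open>h x\<close> too.\<close>

lemma full_sub_cell:
  assumes t: "t \<in> Fac" "v \<in> t" and x: "x \<in> t"
  obtains c' where "c' \<in> cells K'" "x \<in> c'" "c' \<subseteq> t" "cell_dim G K' c' = cell_dim G K t"
proof -
  have tK: "t \<in> cells K" by (rule FacK[OF t(1)])
  define Q where "Q = \<Union>(C ` {c' \<in> cells K'. h x \<notin> C c'})"
  have "closed Q" unfolding Q_def using sub.fin_cells sub_closed by (intro closed_Union) auto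
  moreover have "h x \<notin> Q" by (auto simp: Q_def)
  ultimately obtain \<epsilon> where \<epsilon>: "0 < \<epsilon>" "ball (h x) \<epsilon> \<subseteq> - Q" using openE[of "- Q" "h x"] by (auto simp: open_Compl)
  define N where "N = C t \<inter> ball (h x) \<epsilon>"
  have Nne: "N \<noteq> {}" using cn_base[OF x, of h] \<epsilon>(1) by (auto simp: N_def)
  have dN: "aff_dim N = aff_dim (C t)"
    unfolding N_def by (rule aff_dim_convex_Int_open[OF pcone_convex[OF pc[OF tK]] open_ball]) (use Nne in \<open>simp add: N_def\<close>)
  let ?M = "insert {0} (C ` {b \<in> cells K. b \<subset> t} \<union> C ` {c' \<in> cells K'. cell_dim G K' c' < cell_dim G K t})"
  have "\<exists>y\<in>N. \<forall>M\<in>?M. y \<notin> affine hull M"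
  proof (rule convex_not_covered_dim)
    show "finite ?M" using fin_cells sub.fin_cells by simp
    show "convex N" using pcone_convex[OF pc[OF tK]] by (simp add: N_def convex_Int)
    show "N \<noteq> {}" by (rule Nne)
    fix M assume "M \<in> ?M"
    then consider "M = {0}" | b where "b \<in> cells K" "b \<subset> t" "M = C b"
      | c' where "c' \<in> cells K'" "cell_dim G K' c' < cell_dim G K t" "M = C c'" by blast
    then show "aff_dim M < aff_dim N"
    proof cases
      case 1
      then show ?thesis using C_dim_pos[OF tK] dN by simp
    next
      case 2
      then show ?thesis using C_dim_less[OF tK, of b] dN by auto
    next
      case 3
      then show ?thesis using sub_dim_C[of c'] dim_C[OF tK] dN by simp
    qed
  qed
  then obtain y where y: "y \<in> N" "y \<notin> affine hull {0}" "\<And>b. b \<in> cells K \<Longrightarrow> b \<subset> t \<Longrightarrow> y \<notin> affine hull (C b)"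
    "\<And>c'. c' \<in> cells K' \<Longrightarrow> cell_dim G K' c' < cell_dim G K t \<Longrightarrow> y \<notin> affine hull (C c')" by auto
  obtain s z where s: "0 \<le> s" "z \<in> t" "y = s *\<^sub>R h z" using y(1) by (auto simp: cn_iff N_def)
  have "t \<in> cells (star K {v})" using tK t(2) by (auto simp: star_cells)
  then have "z \<in> polyhedron_of K'" using s(2) subd by (auto simp: subdivision_def polyhedron_of_def)
  then obtain c' where c': "c' \<in> cells K'" "z \<in> c'" by (auto simp: polyhedron_of_def)
  obtain c where c: "c \<in> cells (star K {v})" "c' \<subseteq> c" by (rule sub_cell[OF c'(1)])
  have cK: "c \<in> cells K" using c(1) by (simp add: star_cells)
  have zc: "z \<in> t \<inter> c" using s(2) c'(2) c(2) by blast
  have tc: "t \<inter> c \<in> cells K" using inter_cell[OF tK cK] zc by blast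
  have "y \<in> C (t \<inter> c)" unfolding cn_iff using s zc by blast
  then have "\<not> t \<inter> c \<subset> t" using y(3)[OF tc] hull_inc[of y "C (t \<inter> c)" affine] by blast
  then have "c = t" using t(1) cK by (auto simp: Fac_def)
  then have c't: "c' \<subseteq> t" using c(2) by simp
  have yc: "y \<in> C c'" unfolding cn_iff using s c'(2) by blast
  then have "\<not> cell_dim G K' c' < cell_dim G K t" using y(4)[OF c'(1)] hull_inc[of y "C c'" affine] by blast
  moreover have "cell_dim G K' c' \<le> cell_dim G K t"
    using aff_dim_subset[OF cn_mono[OF c't, of h]] sub_dim_C[OF c'(1)] dim_C[OF tK] by simp
  ultimately have dims: "cell_dim G K' c' = cell_dim G K t" by simp
  have "h x \<in> C c'"
  proof (rule ccontr)
    assume "h x \<notin> C c'"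
    then have "y \<in> Q" using c'(1) yc by (auto simp: Q_def)
    then show False using y(1) \<epsilon>(2) by (auto simp: N_def)
  qed
  then obtain r w where r: "0 \<le> r" "w \<in> c'" "h x = r *\<^sub>R h w" by (auto simp: cn_iff)
  have "r \<noteq> 0" using r(3) h_nz[OF tK x] by auto
  then have "x = w" using rays[OF tK x _ _ r(3)] r(1,2) c't by auto
  then show ?thesis using that[OF c'(1) _ c't dims] r(2) by simp
qed

text \<open>Purity of the star makes all its facets equal in dimension, and the subdivision has a
  cell of dimension \<open>m\<close> but none of larger dimension.\<close>

lemma facet_dim:
  assumes pure: "pure G (star K {v})" and le: "\<And>c. c \<in> cells K' \<Longrightarrow> cell_dim G K' c \<le> int m"
    and ex: "\<exists>c\<in>cells K'. cell_dim G K' c = int m" and t: "t \<in> Fac" "v \<in> t"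
  shows "cell_dim G K t = int m"
proof -
  have sf: "s \<in> facets (star K {v})" if "s \<in> Fac" "v \<in> s" for s
    using that by (auto simp: facets_def Fac_def star_cells)
  have cd: "cell_dim G (star K {v}) = cell_dim G K" by (simp add: cell_dim_def fun_eq_iff)
  obtain c' where c': "c' \<in> cells K'" "cell_dim G K' c' = int m" using ex by blast
  obtain s where s: "s \<in> Fac" "v \<in> s" "c' \<subseteq> s" by (rule sub_in_facet[OF c'(1)])
  have "int m \<le> cell_dim G K s"
    using aff_dim_subset[OF cn_mono[OF s(3), of h]] sub_dim_C[OF c'(1)] c'(2) dim_C[OF FacK[OF s(1)]] by simp
  moreover have "cell_dim G K s = cell_dim G K t" using pure sf[OF s(1,2)] sf[OF t] unfolding pure_def cd by metis
  moreover have "cell_dim G K t \<le> int m" using full_sub_cell[OF t t(2)] le by metis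
  ultimately show ?thesis by simp
qed

text \<open>A point \<open>x\<close> of \<open>g\<close> in no proper face of \<open>g\<close> lies
  in full subdivision cells inside \<open>s\<close> and inside \<open>t\<close>. All subdivision
  cells in the chain between them contain \<open>x\<close>, so the facets around them contain
  \<open>g\<close>, and consecutive facets are equal or share a ridge.\<close>

lemma star_strongly_connected:
  assumes Fd: "\<And>t. t \<in> Fac \<Longrightarrow> cell_dim G K t = int m"
    and conn: "\<And>g a b. \<lbrakk>g \<in> cells K'; a \<in> cells K'; cell_dim G K' a = int m; g \<subseteq> a; b \<in> cells K'; cell_dim G K' b = int m; g \<subseteq> b\<rbrakk> \<Longrightarrow>
      (a, b) \<in> {(a, b). (a \<in> cells K' \<and> cell_dim G K' a = int m \<and> g \<subseteq> a) \<and>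
        (b \<in> cells K' \<and> cell_dim G K' b = int m \<and> g \<subseteq> b) \<and>
        (\<exists>e\<in>cells K'. e \<subseteq> a \<and> e \<subseteq> b \<and> int m - 1 \<le> cell_dim G K' e)}\<^sup>*"
    and g: "g \<in> cells K" "v \<in> g" and s: "s \<in> Fac" "g \<subseteq> s" and t: "t \<in> Fac" "g \<subseteq> t"
  shows "(s, t) \<in> {(a, b). a \<in> Fac \<and> b \<in> Fac \<and> g \<subseteq> a \<and> g \<subseteq> b \<and> aff_dim (cn h (a \<inter> b)) = int m}\<^sup>*" (is "_ \<in> ?R\<^sup>*")
proof -
  have uniq: "a = b" if ab: "a \<in> Fac" "b \<in> Fac" and c: "c \<in> cells K'" "cell_dim G K' c = int m" "c \<subseteq> a" "c \<subseteq> b" for a b c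
  proof (rule ccontr)
    assume ne: "a \<noteq> b"
    have "a \<inter> b \<in> cells K" using inter_cell[OF FacK[OF ab(1)] FacK[OF ab(2)]] c(3,4) sub.cell_ne[OF c(1)] by blast
    moreover have "a \<inter> b \<noteq> a" using ab ne by (auto simp: Fac_def)
    ultimately have "aff_dim (C (a \<inter> b)) < int m + 1"
      using C_dim_less[OF FacK[OF ab(1)], of "a \<inter> b"] dim_C[OF FacK[OF ab(1)]] Fd[OF ab(1)] by simp
    moreover have "aff_dim (C c) \<le> aff_dim (C (a \<inter> b))" using c(3,4) by (intro aff_dim_subset cn_mono) blast
    ultimately show False using sub_dim_C[OF c(1)] c(2) by simp
  qed
  obtain x where x: "x \<in> g" "\<And>c. c \<in> cells K \<Longrightarrow> x \<in> c \<Longrightarrow> g \<subseteq> c" using generic_point[OF g(1)] by blast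
  obtain s' where s': "s' \<in> cells K'" "x \<in> s'" "s' \<subseteq> s" "cell_dim G K' s' = cell_dim G K s"
    using full_sub_cell[OF s(1), of x] s(2) g(2) x(1) by blast
  obtain t' where t': "t' \<in> cells K'" "x \<in> t'" "t' \<subseteq> t" "cell_dim G K' t' = cell_dim G K t"
    using full_sub_cell[OF t(1), of x] t(2) g(2) x(1) by blast
  define g' where "g' = s' \<inter> t'"
  have g': "g' \<in> cells K'" "x \<in> g'" using sub.inter_cell[OF s'(1) t'(1)] s'(2) t'(2) by (auto simp: g'_def)
  let ?R' = "{(a, b). (a \<in> cells K' \<and> cell_dim G K' a = int m \<and> g' \<subseteq> a) \<and>
        (b \<in> cells K' \<and> cell_dim G K' b = int m \<and> g' \<subseteq> b) \<and>
        (\<exists>e\<in>cells K'. e \<subseteq> a \<and> e \<subseteq> b \<and> int m - 1 \<le> cell_dim G K' e)}"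
  have "(s', t') \<in> ?R'\<^sup>*"
    by (rule conn[OF g'(1)]) (use s' t' s t Fd in \<open>auto simp: g'_def\<close>)
  then have "\<exists>b\<in>Fac. t' \<subseteq> b \<and> g \<subseteq> b \<and> (s, b) \<in> ?R\<^sup>*"
  proof (induction rule: rtrancl_induct)
    case base
    show ?case using s s'(3) by blast
  next
    case (step y z)
    obtain b where b: "b \<in> Fac" "y \<subseteq> b" "g \<subseteq> b" "(s, b) \<in> ?R\<^sup>*" using step.IH by blast
    have z: "z \<in> cells K'" "cell_dim G K' z = int m" "g' \<subseteq> z" using step.hyps(2) by auto
    obtain e where e: "e \<in> cells K'" "e \<subseteq> y" "e \<subseteq> z" "int m - 1 \<le> cell_dim G K' e" using step.hyps(2) by auto
    obtain a where a: "a \<in> Fac" "z \<subseteq> a" by (rule sub_in_facet[OF z(1)])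
    have ga: "g \<subseteq> a" using x(2)[OF FacK[OF a(1)]] g'(2) z(3) a(2) by blast
    show ?case
    proof (cases "a = b")
      case True
      then show ?thesis using b a(2) by blast
    next
      case False
      have eab: "e \<subseteq> b \<inter> a" using e(2,3) b(2) a(2) by blast
      have "b \<inter> a \<in> cells K" using inter_cell[OF FacK[OF b(1)] FacK[OF a(1)]] eab sub.cell_ne[OF e(1)] by blast
      moreover have "b \<inter> a \<noteq> b" using a(1) b(1) False by (auto simp: Fac_def)
      ultimately have "aff_dim (C (b \<inter> a)) < int m + 1"
        using C_dim_less[OF FacK[OF b(1)], of "b \<inter> a"] dim_C[OF FacK[OF b(1)]] Fd[OF b(1)] by simp
      moreover have "int m \<le> aff_dim (C (b \<inter> a))"
        using aff_dim_subset[OF cn_mono[OF eab, of h]] sub_dim_C[OF e(1)] e(4) by simp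
      ultimately have "(b, a) \<in> ?R" using a(1) b(1,3) ga by simp
      then have "(s, a) \<in> ?R\<^sup>*" using b(4) by (rule_tac rtrancl_into_rtrancl)
      then show ?thesis using a ga by blast
    qed
  qed
  then obtain b where b: "b \<in> Fac" "t' \<subseteq> b" "(s, b) \<in> ?R\<^sup>*" by blast
  have "b = t" by (rule uniq[OF b(1) t(1) t'(1) _ b(2) t'(3)]) (use t'(4) Fd[OF t(1)] in simp)
  then show ?thesis using b(3) by simp
qed

end

section \<open>From the complex to the cones\<close>

context immersed
begin

text \<open>The union of the facets reachable from \<open>s\<close> contains every cell that it
  meets, so it is open and closed in the weak topology.\<close>

lemma facets_connected:
  assumes conn: "connected_space (complex_topology K)" and s: "s \<in> Fac" and t: "t \<in> Fac"
  shows "(s, t) \<in> {(a, b). a \<in> Fac \<and> b \<in> Fac \<and> a \<inter> b \<noteq> {}}\<^sup>*" (is "_ \<in> ?R\<^sup>*")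
proof -
  define U where "U = \<Union>{a \<in> Fac. (s, a) \<in> ?R\<^sup>*}"
  have step: "b \<subseteq> U" if b: "b \<in> Fac" "b \<inter> U \<noteq> {}" for b
  proof -
    obtain a where a: "a \<in> Fac" "(s, a) \<in> ?R\<^sup>*" "a \<inter> b \<noteq> {}" using b(2) by (auto simp: U_def)
    then have "(s, b) \<in> ?R\<^sup>*" using b(1) by (auto intro: rtrancl_into_rtrancl)
    then show ?thesis using b(1) by (auto simp: U_def)
  qed
  have sat: "U \<inter> c = {} \<or> c \<subseteq> U" if c: "c \<in> cells K" for c
  proof -
    obtain b where b: "b \<in> Fac" "c \<subseteq> b" by (rule Fac_exists[OF c])
    then show ?thesis using step[OF b(1)] by blast
  qed
  have UK: "U \<subseteq> polyhedron_of K" using FacK by (auto simp: U_def polyhedron_of_def)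
  have "openin (complex_topology K) U" by (rule openin_cell_saturated[OF UK sat])
  moreover have "openin (complex_topology K) (polyhedron_of K - U)"
  proof (rule openin_cell_saturated)
    show "(polyhedron_of K - U) \<inter> c = {} \<or> c \<subseteq> polyhedron_of K - U" if "c \<in> cells K" for c
      using sat[OF that] that by (auto simp: polyhedron_of_def)
  qed blast
  then have "closedin (complex_topology K) U" using UK by (simp add: closedin_def topspace_complex_topology)
  moreover have "U \<noteq> {}" using s ne[OF FacK[OF s]] by (auto simp: U_def)
  ultimately have "U = polyhedron_of K" using conn unfolding connected_space_clopen_in topspace_complex_topology by blast
  moreover obtain x where "x \<in> t" using ne[OF FacK[OF t]] by blast
  ultimately have "x \<in> U" "x \<in> t" using FacK[OF t] by (auto simp: polyhedron_of_def)
  then obtain a where a: "a \<in> Fac" "(s, a) \<in> ?R\<^sup>*" "x \<in> a" by (auto simp: U_def)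
  then have "(a, t) \<in> ?R" using t \<open>x \<in> t\<close> by blast
  then show ?thesis using a(2) by (rule_tac rtrancl_into_rtrancl)
qed

lemma convex_position_global:
  assumes d: "ambient_dim G TYPE('a) = d" "d \<ge> 3" and man: "polytopal_manifold G (d - 1) K"
    and conn: "connected_space (complex_topology K)" and loc: "locally_convex_position G K f"
    and fatB: "\<And>B. B \<in> boundary_components G (d - 1) K \<Longrightarrow> convex_position G (fat G (d - 1) B K) f"
  shows "convex_position G K f"
proof -
  define m where "m = d - 1"
  \<comment> \<open>The lift adds one dimension to \<open>d\<close>, and the manifold has one less
    than \<open>d\<close>.\<close>
  have m: "int DIM('w) = int m + 2" "m \<ge> 2" using lift_dim d by (auto simp: m_def)
  have starcp: "convex_position G (star K {v}) f" if "v \<in> V" for v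
    using loc that by (simp add: locally_convex_position_def V_eq)
  have subdiv: "\<exists>K'. star_subdivision G l K f v K' \<and> (\<forall>c\<in>cells K'. cell_dim G K' c \<le> int m) \<and>
      (\<exists>c\<in>cells K'. cell_dim G K' c = int m) \<and>
      (\<forall>g a b. g \<in> cells K' \<longrightarrow> a \<in> cells K' \<longrightarrow> cell_dim G K' a = int m \<longrightarrow> g \<subseteq> a \<longrightarrow>
        b \<in> cells K' \<longrightarrow> cell_dim G K' b = int m \<longrightarrow> g \<subseteq> b \<longrightarrow>
      (a, b) \<in> {(a, b). (a \<in> cells K' \<and> cell_dim G K' a = int m \<and> g \<subseteq> a) \<and>
        (b \<in> cells K' \<and> cell_dim G K' b = int m \<and> g \<subseteq> b) \<and>
        (\<exists>e\<in>cells K'. e \<subseteq> a \<and> e \<subseteq> b \<and> int m - 1 \<le> cell_dim G K' e)}\<^sup>*)" if v: "v \<in> V" for v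
  proof -
    obtain S :: "'e set" where S: "(int m) simplex S"
      "PL_homeomorphic G (star K {v}) Euclidean (geo_complex {F. F face_of S \<and> F \<noteq> {}})"
      using man v unfolding polytopal_manifold_def V_eq m_def by blast
    show ?thesis
    proof (rule PL_ball_subdivision[OF S], goal_cases)
      case (1 K')
      have "star_subdivision G l K f v K'" by unfold_locales (use v 1(1) in \<open>simp_all add: V_eq\<close>)
      then show ?case using 1(2-4) by (intro exI[of _ K']) simp
    qed
  qed
  have Fd: "cell_dim G K t = int m" if t: "t \<in> Fac" for t
  proof -
    obtain v where v: "v \<in> t" "v \<in> V" by (rule ex_vertex[OF FacK[OF t]])
    obtain K' where K': "star_subdivision G l K f v K'" "\<forall>c\<in>cells K'. cell_dim G K' c \<le> int m"
      "\<exists>c\<in>cells K'. cell_dim G K' c = int m" using subdiv[OF v(2)] by blast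
    show ?thesis
      by (rule star_subdivision.facet_dim[OF K'(1) _ _ K'(3) t v(1)])
        (use starcp[OF v(2)] K'(2) in \<open>simp_all add: convex_position_def\<close>)
  qed
  have bd_iff: "e \<in> bd \<longleftrightarrow> e \<in> cells K \<and> cell_dim G K e = int m - 1 \<and> (\<exists>!c. c \<in> facets K \<and> e \<subseteq> c)" for e
    using dim_C[of e] m(1) by (auto simp: bd_def rdg_def Fac_eq)
  then have bd_eq: "bd = {e \<in> cells K. cell_dim G K e = int m - 1 \<and> (\<exists>!c. c \<in> facets K \<and> e \<subseteq> c)}"
    by (intro set_eqI) simp
  define Bd where "Bd = boundary_complex G m K"
  have cells_Bd: "c \<in> cells Bd \<longleftrightarrow> c \<in> cells K \<and> (\<exists>e\<in>bd. c \<subseteq> e)" for c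
    unfolding Bd_def boundary_complex_def generated_subcomplex_def bd_eq by simp
  have chart_Bd: "chart Bd = chart K" by (simp add: Bd_def boundary_complex_def generated_subcomplex_def)
  define X where "X = complex_topology Bd"
  have bdBd: "b \<in> cells Bd" if "b \<in> bd" for b using that cells_Bd bd_iff by blast
  have bd_conn: "connectedin X b" if b: "b \<in> bd" for b
    unfolding X_def by (rule cell_connectedin[OF bdBd[OF b], of G]) (use b bd_iff chart_polytope chart_Bd in simp)
  \<comment> \<open>A boundary ridge is connected, so any of its points determines the same
    component of the boundary.\<close>
  define cl where "cl b = connected_component_of_set X (SOME x. x \<in> b)" for b
  have cl_sub: "b \<subseteq> cl b" "x \<in> topspace X" "cl b = connected_component_of_set X x" if b: "b \<in> bd" "x \<in> b" for b x
  proof -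
    have y: "(SOME x. x \<in> b) \<in> b" using b(2) by (rule someI)
    show "b \<subseteq> cl b" unfolding cl_def by (rule connected_component_of_maximal[OF bd_conn[OF b(1)] y])
    then have "connected_component_of X (SOME x. x \<in> b) x" using b(2) by (auto simp: cl_def)
    then have "x \<in> topspace X \<and> connected_component_of X (SOME x. x \<in> b) = connected_component_of X x"
      using connected_component_of_equiv[of X "SOME x. x \<in> b" x] by blast
    then show "x \<in> topspace X" "cl b = connected_component_of_set X x" by (simp_all add: cl_def)
  qed
  interpret convex_manifold "cells K" h cl
  proof
    show "DIM('w) \<ge> 4" using m by linarith
    show "aff_dim (cn h s) = int DIM('w) - 1" if "s \<in> Fac" for s using dim_C[OF FacK[OF that]] Fd[OF that] m(1) by simp
    show "\<exists>m. m \<noteq> 0 \<and> (\<forall>t\<in>Fac. v \<in> t \<longrightarrow> supp m s t)" if v: "v \<in> V" "s \<in> Fac" "v \<in> s" for v s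
    proof -
      have "\<exists>m. m \<noteq> 0 \<and> (\<forall>t\<in>{c \<in> cells K. {v} \<subseteq> c}. t \<in> cells K \<longrightarrow> supp m s t)"
        by (rule generated_support) (use starcp[OF v(1)] v FacK[OF v(2)] in \<open>simp_all add: star_def\<close>)
      then show ?thesis using FacK by auto
    qed
    show "(s, t) \<in> {(a, b). a \<in> Fac \<and> b \<in> Fac \<and> g \<subseteq> a \<and> g \<subseteq> b \<and> aff_dim (cn h (a \<inter> b)) = int DIM('w) - 2}\<^sup>*"
      if g: "g \<in> cells K" and st: "s \<in> Fac" "t \<in> Fac" "g \<subseteq> s" "g \<subseteq> t" for g s t
    proof -
      obtain v where v: "v \<in> g" "v \<in> V" by (rule ex_vertex[OF g])
      obtain K' where K': "star_subdivision G l K f v K'"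
        "\<And>g a b. \<lbrakk>g \<in> cells K'; a \<in> cells K'; cell_dim G K' a = int m; g \<subseteq> a; b \<in> cells K'; cell_dim G K' b = int m; g \<subseteq> b\<rbrakk> \<Longrightarrow>
        (a, b) \<in> {(a, b). (a \<in> cells K' \<and> cell_dim G K' a = int m \<and> g \<subseteq> a) \<and>
        (b \<in> cells K' \<and> cell_dim G K' b = int m \<and> g \<subseteq> b) \<and>
        (\<exists>e\<in>cells K'. e \<subseteq> a \<and> e \<subseteq> b \<and> int m - 1 \<le> cell_dim G K' e)}\<^sup>*"
        using subdiv[OF v(2)] by blast
      have eq: "int DIM('w) - 2 = int m" using m(1) by simp
      show ?thesis unfolding eq
        by (rule star_subdivision.star_strongly_connected[OF K'(1) Fd K'(2) g v(1) st(1,3,2,4)])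
    qed
    show "(s, t) \<in> {(a, b). a \<in> Fac \<and> b \<in> Fac \<and> a \<inter> b \<noteq> {}}\<^sup>*" if "s \<in> Fac" "t \<in> Fac" for s t
      by (rule facets_connected[OF conn that])
    show "cl b = cl b'" if b: "b \<in> bd" "b' \<in> bd" "b \<inter> b' \<noteq> {}" for b b'
    proof -
      obtain x where "x \<in> b" "x \<in> b'" using b(3) by blast
      then show ?thesis using cl_sub(3)[OF b(1)] cl_sub(3)[OF b(2)] by metis
    qed
    show "\<exists>m. m \<noteq> 0 \<and> (\<forall>t\<in>collar cl i. supp m s t)" if s: "s \<in> collar cl i" for i s
    proof -
      obtain b where b: "b \<in> bd" "cl b = i" "b \<subseteq> s" using s by (auto simp: collar_def)
      obtain x where x: "x \<in> b" using b(1) bd_iff ne by blast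
      have "i \<in> connected_components_of X"
        unfolding connected_components_of_def using cl_sub(2,3)[OF b(1) x] b(2) by blast
      then have "K\<lparr>cells := {c \<in> cells Bd. c \<subseteq> i}\<rparr> \<in> boundary_components G (d - 1) K" (is "?B \<in> _")
        unfolding boundary_components_def X_def Bd_def m_def by blast
      then have cp: "convex_position G (fat G m ?B K) f" using fatB by (simp add: m_def)
      let ?A = "{c \<in> facets K. \<exists>e\<in>cells ?B. cell_dim G K e = int m - 1 \<and> e \<subseteq> c}"
      \<comment> \<open>Every facet of the collar contains a ridge of the component and therefore
        belongs to its fattening.\<close>
      have sub: "collar cl i \<subseteq> ?A"
      proof
        fix t assume "t \<in> collar cl i"
        then obtain e where e: "t \<in> Fac" "e \<in> bd" "cl e = i" "e \<subseteq> t" by (auto simp: collar_def)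
        have "e \<noteq> {}" using e(2) bd_iff ne by blast
        then have "e \<subseteq> i" using cl_sub(1)[OF e(2)] e(3) by blast
        then have "e \<in> cells ?B" using bdBd[OF e(2)] by simp
        moreover have "cell_dim G K e = int m - 1" using e(2) bd_iff by blast
        ultimately show "t \<in> ?A" using e(1,4) unfolding Fac_eq by blast
      qed
      have "\<exists>m. m \<noteq> 0 \<and> (\<forall>t\<in>?A. t \<in> cells K \<longrightarrow> supp m s t)"
        by (rule generated_support) (use cp sub s in \<open>auto simp: fat_def collar_def\<close>)
      then obtain n where n: "n \<noteq> 0" "\<And>t. t \<in> ?A \<Longrightarrow> t \<in> cells K \<Longrightarrow> supp n s t" by blast
      have "supp n s t" if "t \<in> collar cl i" for t
        using n(2)[OF set_mp[OF sub that]] that FacK by (auto simp: collar_def)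
      then show ?thesis using n(1) by blast
    qed
  qed
  show ?thesis
    unfolding convex_position_def
  proof (intro conjI ballI)
    show "pure G K" unfolding pure_def using Fd Fac_eq by blast
    fix s assume "s \<in> facets K"
    then have s: "s \<in> Fac" by (simp add: Fac_eq)
    obtain n where n: "n \<noteq> 0" "\<And>t. t \<in> Fac \<Longrightarrow> supp n s t" using global_support[OF s] by blast
    obtain v where v: "v \<in> s" "v \<in> V" by (rule ex_vertex[OF FacK[OF s]])
    have "n \<bullet> l (f v) = 0" using n(2)[OF s] v by (auto simp: supp_def h_def)
    then obtain H D where H: "closed_half G H D"
      "\<And>x. geo_point G x \<Longrightarrow> (x \<in> H \<longleftrightarrow> n \<bullet> l x \<le> 0) \<and> (x \<in> D \<longleftrightarrow> n \<bullet> l x = 0)" using half_lift[OF n(1)] by blast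
    have "f ` polyhedron_of K \<subseteq> H"
    proof clarify
      fix x assume "x \<in> polyhedron_of K"
      then obtain c where c: "c \<in> cells K" "x \<in> c" by (auto simp: polyhedron_of_def)
      obtain t where t: "t \<in> Fac" "c \<subseteq> t" by (rule Fac_exists[OF c(1)])
      then have "n \<bullet> l (f x) \<le> 0" using n(2)[OF t(1)] c(2) by (auto simp: supp_def h_def)
      then show "f x \<in> H" using H(2)[OF f_point[OF c]] by simp
    qed
    moreover have "f w \<in> D \<longleftrightarrow> w \<in> s" if w: "w \<in> vertices K" for w
    proof -
      have wc: "{w} \<in> cells K" using w by (simp add: vertices_def)
      obtain t where t: "t \<in> Fac" "{w} \<subseteq> t" by (rule Fac_exists[OF wc])
      then have "n \<bullet> l (f w) = 0 \<longleftrightarrow> w \<in> s" using n(2)[OF t(1)] w by (auto simp: supp_def h_def V_eq)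
      then show ?thesis using H(2)[OF f_point[OF wc]] by simp
    qed
    ultimately show "\<exists>H D. closed_half G H D \<and> f ` polyhedron_of K \<subseteq> H \<and> (\<forall>w\<in>vertices K. f w \<in> D \<longleftrightarrow> w \<in> s)"
      using H(1) by blast
  qed
qed

end

theorem theoremA9:
  fixes G :: geometry and d :: nat
    and K :: "('p, 'e::euclidean_space) pcomplex"
    and f :: "'p \<Rightarrow> 'a::euclidean_space"
  assumes "ambient_dim G TYPE('a) = d"
    and "d \<ge> 3"
    and "premanifold G (d - 1) K f"
    and "connected_space (complex_topology K)"
    and "locally_convex_position G K f"
    and "\<And>B. B \<in> boundary_components G (d - 1) K \<Longrightarrow> convex_position G (fat G (d - 1) B K) f"
  shows "convex_position G K f"
proof -
  have man: "polytopal_manifold G (d - 1) K" and pre: "precomplex G K f"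
    using assms(3) by (simp_all add: premanifold_def)
  show ?thesis
  proof (cases G)
    case Euclidean
    have "immersed G (\<lambda>x::'a. (x, 1::real)) K f"
      unfolding immersed_def immersed_axioms_def using pre geo_lift_euclidean Euclidean by blast
    then show ?thesis by (rule immersed.convex_position_global[OF _ assms(1,2) man assms(4-6)])
  next
    case Spherical
    have "immersed G (\<lambda>x::'a. x) K f"
      unfolding immersed_def immersed_axioms_def using pre geo_lift_spherical Spherical by blast
    then show ?thesis by (rule immersed.convex_position_global[OF _ assms(1,2) man assms(4-6)])
  qed
qed

end
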